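(* Let $d, I, J$ be positive integers and let $\delta$ be an $I$-by-$J$ matrix whose entries are non-commutative polynomials in $d$ variables. Let $\phi : B_\delta \to \mathbb{M}^1$ be a function. Then $\phi$ belongs to $H_1^\infty(B_\delta)$ (that is, $\phi$ is an nc-function on $B_\delta$ with $\|\phi(x)\| \le 1$ for every $x \in B_\delta$) if and only if $\phi$ has a free realization, i.e. there exist a Hilbert space $\mathcal{M}$ and an isometry $$\begin{bmatrix} A & B \\ C & D \end{bmatrix} : \mathbb{C} \oplus (\mathcal{M} \otimes \mathbb{C}^I) \to \mathbb{C} \oplus (\mathcal{M} \otimes \mathbb{C}^J)$$ such that for every $n \ge 1$ and every $x \in B_\delta \cap \mathbb{M}_n^d$, $$\phi(x) = A \otimes \mathrm{id}_{\mathbb{C}^n} + (B \otimes \mathrm{id}_{\mathbb{C}^n})(\mathrm{id}_{\mathcal{M}} \otimes \delta(x)) \left[ \mathrm{id}_{\mathcal{M} \otimes \mathbb{C}^J \otimes \mathbb{C}^n} - (D \otimes \mathrm{id}_{\mathbb{C}^n})(\mathrm{id}_{\mathcal{M}} \otimes \delta(x)) \right]^{-1} (C \otimes \mathrm{id}_{\mathbb{C}^n}).$$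
   Context: $\mathbb{M}_n$ denotes the $n \times n$ complex matrices, $\mathbb{M}_n^d$ the $d$-tuples $x = (x^1, \dots, x^d)$ of such matrices, and $\mathbb{M}^d = \bigcup_{n=1}^\infty \mathbb{M}_n^d$. In particular $\mathbb{M}^1 = \bigcup_n \mathbb{M}_n$. An nc-function on a set $E \subseteq \mathbb{M}^d$ is a function $\phi : E \to \mathbb{M}^1$ such that (i) $\phi$ is graded: if $x \in E \cap \mathbb{M}_n^d$ then $\phi(x) \in \mathbb{M}_n$; and (ii) $\phi$ is intertwining preserving: if $x \in E \cap \mathbb{M}_n^d$, $y \in E \cap \mathbb{M}_m^d$ and $S : \mathbb{C}^n \to \mathbb{C}^m$ is a linear operator with $Sx = yS$ (meaning $S x^r = y^r S$ for each $1 \le r \le d$), then $S\phi(x) = \phi(y) S$. For an $I \times J$ matrix $\delta$ of non-commutative polynomials (complex coefficients) in $d$ variables and $x \in \mathbb{M}_n^d$, evaluating each entry at $x$ gives $\delta(x)$, regarded as an operator from $\mathbb{C}^J \otimes \mathbb{C}^n$ to $\mathbb{C}^I \otimes \mathbb{C}^n$. All norms are operator norms. The polynomial polyhedron is $B_\delta := \{ x \in \mathbb{M}^d : \|\delta(x)\| < 1 \}$. $H_1^\infty(B_\delta)$ is the set of nc-functions on $B_\delta$ bounded by $1$ in norm at every $x \in B_\delta$. In the realization formula $\mathbb{C} \otimes \mathbb{C}^n$ is identified with $\mathbb{C}^n$, and $A \in \mathbb{C}$, $B : \mathcal{M}\otimes\mathbb{C}^I \to \mathbb{C}$, $C : \mathbb{C}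 \to \mathcal{M} \otimes \mathbb{C}^J$, $D : \mathcal{M}\otimes\mathbb{C}^I \to \mathcal{M}\otimes\mathbb{C}^J$ are the block entries of the isometry. *)

theory Defs
  imports
    "HOL-Analysis.L2_Norm"
    "HOL-Library.Poly_Mapping"
    "Jordan_Normal_Form.VS_Connect"
begin

section \<open>Matrix tuples and operator norm\<close>

definition nc_level :: "nat \<Rightarrow> nat \<Rightarrow> complex mat list set" where
  "nc_level d n = {x. length x = d \<and> set x \<subseteq> carrier_mat n n}"

text \<open>The space \<open>\<bbbM>\<^sup>1\<close> in which nc-functions take their values, without the one-element lists.\<close>

definition nc_matrices :: "complex mat set" where
  "nc_matrices = (\<Union>n\<in>{1..}. carrier_mat n n)"

definition vnorm :: "complex vec \<Rightarrow> real" where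
  "vnorm v = L2_set (\<lambda>i. cmod (v $ i)) {..<dim_vec v}"

definition op_norm :: "complex mat \<Rightarrow> real" where
  "op_norm A = (SUP v \<in> {v \<in> carrier_vec (dim_col A). vnorm v \<le> 1}. vnorm (A *\<^sub>v v))"


section \<open>Non-commutative polynomials and polynomial polyhedra\<close>

text \<open>A non-commutative polynomial is a finitely supported complex combination of words; the letter
  \<open>k\<close> of a word stands for the \<open>k\<close>-th variable (counted from \<open>0\<close>), the empty word for \<open>1\<close>.\<close>

type_synonym nc_poly = "nat list \<Rightarrow>\<^sub>0 complex"

definition nc_polys :: "nat \<Rightarrow> nc_poly set" where
  "nc_polys d = {p. \<forall>w \<in> Poly_Mapping.keys p. set w \<subseteq> {..<d}}"

definition word_eval :: "nat \<Rightarrow> complex mat list \<Rightarrow> nat list \<Rightarrow> complex mat" where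
  "word_eval n x w = foldr (\<lambda>k N. x ! k * N) w (1\<^sub>m n)"

definition poly_eval :: "nat \<Rightarrow> complex mat list \<Rightarrow> nc_poly \<Rightarrow> complex mat" where
  "poly_eval n x p =
     mat n n (\<lambda>ab. \<Sum>w \<in> Poly_Mapping.keys p. Poly_Mapping.lookup p w * word_eval n x w $$ ab)"

text \<open>The operator \<open>\<delta>(x) : \<complex>\<^sup>J \<otimes> \<complex>\<^sup>n \<rightarrow> \<complex>\<^sup>I \<otimes> \<complex>\<^sup>n\<close> as a block matrix: the basis vector
  \<open>e\<^sub>i \<otimes> e\<^sub>a\<close> has number \<open>i * n + a\<close>, and the block \<open>(i, j)\<close> is the value of the entry \<open>(i, j)\<close> of
  \<open>\<delta>\<close> at \<open>x\<close>.\<close>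

definition delta_eval :: "nat \<Rightarrow> complex mat list \<Rightarrow> nc_poly mat \<Rightarrow> complex mat" where
  "delta_eval n x \<delta> = mat (dim_row \<delta> * n) (dim_col \<delta> * n)
     (\<lambda>(r, c). poly_eval n x (\<delta> $$ (r div n, c div n)) $$ (r mod n, c mod n))"

definition nc_polyhedron :: "nat \<Rightarrow> nc_poly mat \<Rightarrow> complex mat list set" where
  "nc_polyhedron d \<delta> = (\<Union>n\<in>{1..}. {x \<in> nc_level d n. op_norm (delta_eval n x \<delta>) < 1})"


section \<open>Non-commutative functions\<close>

definition nc_function :: "nat \<Rightarrow> complex mat list set \<Rightarrow> (complex mat list \<Rightarrow> complex mat) \<Rightarrow> bool" where
  "nc_function d E \<phi> \<longleftrightarrow>
     (\<forall>n\<ge>1. \<forall>x \<in> E \<inter> nc_level d n. \<phi> x \<in> carrier_mat n n) \<and>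
     (\<forall>n\<ge>1. \<forall>m\<ge>1. \<forall>x \<in> E \<inter> nc_level d n. \<forall>y \<in> E \<inter> nc_level d m. \<forall>S \<in> carrier_mat m n.
        (\<forall>r<d. S * (x ! r) = (y ! r) * S) \<longrightarrow> S * \<phi> x = \<phi> y * S)"

definition H_inf_1 :: "nat \<Rightarrow> nc_poly mat \<Rightarrow> (complex mat list \<Rightarrow> complex mat) set" where
  "H_inf_1 d \<delta> = {\<phi>. nc_function d (nc_polyhedron d \<delta>) \<phi> \<and> (\<forall>x \<in> nc_polyhedron d \<delta>. op_norm (\<phi> x) \<le> 1)}"


section \<open>Hilbert spaces\<close>

text \<open>Complex Hilbert spaces with an explicit carrier, so that the existence of a Hilbert space can
  be asserted inside a formula. The inner product is linear in its first argument.\<close>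

record 'h hspace = "(complex, 'h) module" +
  hinner :: "'h \<Rightarrow> 'h \<Rightarrow> complex"

abbreviation scalar_field :: "complex ring" where
  "scalar_field \<equiv> class_ring"

definition hnorm :: "'h hspace \<Rightarrow> 'h \<Rightarrow> real" where
  "hnorm H u = sqrt (Re (hinner H u u))"

locale hilbert_space = vectorspace scalar_field H for H :: "'h hspace" (structure) +
  assumes inner_add: "\<lbrakk>u \<in> carrier H; v \<in> carrier H; w \<in> carrier H\<rbrakk> \<Longrightarrow>
      hinner H (u \<oplus> v) w = hinner H u w + hinner H v w"
    and inner_smult: "\<lbrakk>u \<in> carrier H; v \<in> carrier H\<rbrakk> \<Longrightarrow> hinner H (c \<odot>\<^bsub>H\<^esub> u) v = c * hinner H u v"
    and inner_commute: "\<lbrakk>u \<in> carrier H; v \<in> carrier H\<rbrakk> \<Longrightarrow> hinner H u v = cnj (hinner H v u)"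
    and inner_nonneg: "u \<in> carrier H \<Longrightarrow> 0 \<le> Re (hinner H u u)"
    and inner_definite: "\<lbrakk>u \<in> carrier H; hinner H u u = 0\<rbrakk> \<Longrightarrow> u = \<zero>"
    and complete: "\<lbrakk>\<And>k. s k \<in> carrier H;
        \<And>e. 0 < e \<Longrightarrow> \<exists>N. \<forall>k\<ge>N. \<forall>l\<ge>N. hnorm H (s k \<ominus> s l) < e\<rbrakk> \<Longrightarrow>
      \<exists>u \<in> carrier H. (\<lambda>k. hnorm H (s k \<ominus> u)) \<longlonglongrightarrow> 0"

definition scalars :: "complex hspace" where
  "scalars = \<lparr>carrier = UNIV, mult = (*), one = 1, zero = 0, add = (+), smult = (*),
     hinner = (\<lambda>z w. z * cnj w)\<rparr>"

definition hsum :: "'h hspace \<Rightarrow> 'k hspace \<Rightarrow> ('h \<times> 'k) hspace" where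
  "hsum H K = module.extend (direct_sum H K)
     (hspace.fields (\<lambda>u v. hinner H (fst u) (fst v) + hinner K (snd u) (snd v)))"

text \<open>The tensor product \<open>H \<otimes> \<complex>\<^sup>k\<close>, realised as \<open>k\<close>-tuples in \<open>H\<close>: the elementary tensor \<open>h \<otimes> v\<close> is
  the tuple with entries \<open>v\<^sub>i h\<close>. In particular \<open>tensor scalars n\<close> is \<open>\<complex> \<otimes> \<complex>\<^sup>n = \<complex>\<^sup>n\<close>.
  The fields \<open>mult\<close> and \<open>one\<close> play no role in a module.\<close>

definition tensor :: "'h hspace \<Rightarrow> nat \<Rightarrow> (nat \<Rightarrow> 'h) hspace" where
  "tensor H k = \<lparr>carrier = (\<Pi>\<^sub>E i\<in>{..<k}. carrier H), mult = undefined, one = undefined,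
     zero = (\<lambda>i\<in>{..<k}. \<zero>\<^bsub>H\<^esub>),
     add = (\<lambda>f g. \<lambda>i\<in>{..<k}. f i \<oplus>\<^bsub>H\<^esub> g i),
     smult = (\<lambda>c f. \<lambda>i\<in>{..<k}. c \<odot>\<^bsub>H\<^esub> f i),
     hinner = (\<lambda>f g. \<Sum>i<k. hinner H (f i) (g i))\<rparr>"

definition isometry :: "'h hspace \<Rightarrow> 'k hspace \<Rightarrow> ('h \<Rightarrow> 'k) \<Rightarrow> bool" where
  "isometry H K V \<longleftrightarrow> V \<in> module_hom scalar_field H K \<and> (\<forall>u \<in> carrier H. hnorm K (V u) = hnorm H u)"


section \<open>Free realizations\<close>

text \<open>\<open>T \<otimes> id\<close> on \<open>H \<otimes> \<complex>\<^sup>n\<close>.\<close>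

definition tensor_id :: "nat \<Rightarrow> ('h \<Rightarrow> 'k) \<Rightarrow> (nat \<Rightarrow> 'h) \<Rightarrow> nat \<Rightarrow> 'k" where
  "tensor_id n T h = (\<lambda>a\<in>{..<n}. T (h a))"

text \<open>\<open>id \<otimes> G : (M \<otimes> \<complex>\<^sup>J) \<otimes> \<complex>\<^sup>n \<rightarrow> (M \<otimes> \<complex>\<^sup>I) \<otimes> \<complex>\<^sup>n\<close> for \<open>G : \<complex>\<^sup>J \<otimes> \<complex>\<^sup>n \<rightarrow> \<complex>\<^sup>I \<otimes> \<complex>\<^sup>n\<close> given by an
  \<open>I n \<times> J n\<close> matrix, numbered as in \<open>delta_eval\<close>. For \<open>h\<close> in \<open>(M \<otimes> \<complex>\<^sup>J) \<otimes> \<complex>\<^sup>n\<close>, the coefficient of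
  \<open>e\<^sub>j \<otimes> e\<^sub>b\<close> is \<open>h b j\<close>.\<close>

definition id_tensor ::
  "'m hspace \<Rightarrow> nat \<Rightarrow> nat \<Rightarrow> nat \<Rightarrow> complex mat \<Rightarrow> (nat \<Rightarrow> nat \<Rightarrow> 'm) \<Rightarrow> nat \<Rightarrow> nat \<Rightarrow> 'm" where
  "id_tensor M I J n G h = (\<lambda>a\<in>{..<n}. \<lambda>i\<in>{..<I}.
     (\<Oplus>\<^bsub>M\<^esub>b\<in>{..<n}. (\<Oplus>\<^bsub>M\<^esub>j\<in>{..<J}. G $$ (i * n + a, j * n + b) \<odot>\<^bsub>M\<^esub> h b j)))"

definition block_op ::
  "complex \<Rightarrow> ('u \<Rightarrow> complex) \<Rightarrow> (complex \<Rightarrow> 'v) \<Rightarrow> ('u \<Rightarrow> 'v) \<Rightarrow> 'v hspace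
     \<Rightarrow> complex \<times> 'u \<Rightarrow> complex \<times> 'v" where
  "block_op A B C D K = (\<lambda>(z, u). (A * z + B u, C z \<oplus>\<^bsub>K\<^esub> D u))"

text \<open>For an \<open>I \<times> J\<close> matrix \<open>\<delta>\<close>, \<open>K\<close> below is \<open>M \<otimes> \<complex>\<^sup>J \<otimes> \<complex>\<^sup>n\<close> and \<open>R\<close> is the operator
  \<open>id - (D \<otimes> id) (id \<otimes> \<delta>(x))\<close> on it. That \<open>R\<close> is invertible is part of the meaning of the formula.
  The last equation is the formula for \<open>\<phi>(x)\<close> applied to an arbitrary vector.\<close>

definition free_realization ::
  "nat \<Rightarrow> nc_poly mat \<Rightarrow> (complex mat list \<Rightarrow> complex mat) \<Rightarrow> 'm hspace \<Rightarrow> complex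
     \<Rightarrow> ((nat \<Rightarrow> 'm) \<Rightarrow> complex) \<Rightarrow> (complex \<Rightarrow> nat \<Rightarrow> 'm) \<Rightarrow> ((nat \<Rightarrow> 'm) \<Rightarrow> nat \<Rightarrow> 'm) \<Rightarrow> bool" where
  "free_realization d \<delta> \<phi> M A B C D \<longleftrightarrow>
     (let I = dim_row \<delta>; J = dim_col \<delta> in
      hilbert_space M \<and>
      B \<in> module_hom scalar_field (tensor M I) scalars \<and>
      C \<in> module_hom scalar_field scalars (tensor M J) \<and>
      D \<in> module_hom scalar_field (tensor M I) (tensor M J) \<and>
      isometry (hsum scalars (tensor M I)) (hsum scalars (tensor M J))
        (block_op A B C D (tensor M J)) \<and>
      (\<forall>n\<ge>1. \<forall>x \<in> nc_polyhedron d \<delta> \<inter> nc_level d n.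
         let K = tensor (tensor M J) n;
             \<Delta> = id_tensor M I J n (delta_eval n x \<delta>);
             R = (\<lambda>h. h \<ominus>\<^bsub>K\<^esub> tensor_id n D (\<Delta> h))
         in bij_betw R (carrier K) (carrier K) \<and>
            \<phi> x \<in> carrier_mat n n \<and>
            (\<forall>v \<in> carrier (tensor scalars n).
               \<phi> x *\<^sub>v vec n v =
               vec n (tensor_id n (\<lambda>z. A * z) v
                 \<oplus>\<^bsub>tensor scalars n\<^esub>
                 tensor_id n B (\<Delta> (inv_into (carrier K) R (tensor_id n C v)))))))"

text \<open>A formula cannot quantify over types, so the Hilbert space is taken with its carrier inside a given
  type \<open>'m\<close>. The type \<open>nat \<Rightarrow> complex\<close> has the cardinality of the continuum, as every Hilbert space
  of dimension between \<open>1\<close> and the continuum; up to isomorphism it accommodates them all.\<close>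

definition has_free_realization ::
  "'m itself \<Rightarrow> nat \<Rightarrow> nc_poly mat \<Rightarrow> (complex mat list \<Rightarrow> complex mat) \<Rightarrow> bool" where
  "has_free_realization _ d \<delta> \<phi> \<longleftrightarrow>
     (\<exists>(M :: 'm hspace) A B C D. free_realization d \<delta> \<phi> M A B C D)"

end

theory Submission
  imports Defs "HOL-Analysis.Function_Topology" "HOL-Analysis.Infinite_Sum"
begin

text \<open>That a realized function is nc and contractive is read off from the isometry: the state
  \<open>h = [id - (D \<otimes> id)(id \<otimes> \<delta>(x))]\<^sup>-\<^sup>1 (C \<otimes> id) v\<close> satisfies \<open>\<parallel>\<phi>(x) v\<parallel>\<^sup>2 + \<parallel>h\<parallel>\<^sup>2 = \<parallel>v\<parallel>\<^sup>2 + \<parallel>\<delta>(x) h\<parallel>\<^sup>2\<close>, and it is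
  unique, hence transported by intertwiners.

  For the converse one looks for a positive kernel \<open>K\<close> with
  \<open>1 - \<phi>(y)\<^sup>* \<phi>(x) = K(y, x) - \<delta>(y)\<^sup>* K(y, x) \<delta>(x)\<close>. On finitely many points a kernel minimising the distance
  between the two sides exists by compactness; if the distance were positive, the residual would yield a positive
  definite form in which \<open>\<delta>\<close> is a strict contraction and \<open>\<phi>\<close> is not a contraction. An nc-function excludes this:
  after a change of basis which makes the form the standard one, the direct sum of the points is again a
  point of the polyhedron. By compactness one \<open>K\<close> serves all points.

  Factoring \<open>K\<close> over a sequence of points dense for \<open>(\<delta>, \<phi>)\<close>, the equation says that two families of finitely
  supported vectors have the same Gram matrix, so a linear isometry carries one to the other. It extends to an
  isometry of \<open>\<complex> \<oplus> (\<ell>\<^sup>2 \<otimes> \<complex>\<^sup>I)\<close> into \<open>\<complex> \<oplus> (\<ell>\<^sup>2 \<otimes> \<complex>\<^sup>J)\<close> as half of the coordinates of \<open>\<ell>\<^sup>2\<close> are left free.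
  The resulting formula for \<open>\<phi>\<close> holds at the points of the sequence, and elsewhere because its value
  depends continuously on \<open>\<delta>(x)\<close>.\<close>

section \<open>Positive semidefinite kernels\<close>

text \<open>In the converse, intertwining is used once, for the direct sum; the kernel is indexed by
  single vector components and has no structure beyond positivity. Three obstacles shape the rest.
  Boundedness: both compactness arguments need it and get it from the strictness of
  \<open>\<parallel>\<delta>(x)\<parallel> < 1\<close>; for the passage to all points the bound
  \<open>1 / (1 - \<parallel>\<delta>(x)\<parallel>\<^sup>2)\<close> depends on one point at a time.
  Invertibility: the residual form is only semidefinite, and even this has to be derived, by
  iterating a contraction inequality. Adding a small multiple of the identity makes the change of
  basis invertible, and it makes the contraction strict as well, because \<open>\<delta>\<close> is
  a strict contraction for the standard form. Separability: Gram vectors for all points at once form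
  an uncountable family, while the coordinates of the state space are numbered by
  \<open>nat\<close>. Elimination (Cholesky factorisation) yields finitely supported Gram vectors;
  the isometry between the two families is then an explicit infinite matrix, and its extension comes
  from factoring the defect of that matrix, without closed subspaces or orthogonal
  complements.\<close>

definition qform :: "'a set \<Rightarrow> ('a \<Rightarrow> 'a \<Rightarrow> complex) \<Rightarrow> ('a \<Rightarrow> complex) \<Rightarrow> complex" where
  "qform A K c = (\<Sum>a\<in>A. \<Sum>b\<in>A. c a * cnj (c b) * K a b)"

text \<open>Nonnegativity of the real part alone does not force Hermitian symmetry (for
  \<open>\<i>\<close> times the identity the real part is 0), so symmetry is a separate clause. Test
  sets are finite because the index type is arbitrary.\<close>

definition psd :: "('a \<Rightarrow> 'a \<Rightarrow> complex) \<Rightarrow> bool" where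
  "psd K \<longleftrightarrow> (\<forall>a b. K b a = cnj (K a b)) \<and> (\<forall>A c. finite A \<longrightarrow> 0 \<le> Re (qform A K c))"

lemma psdI:
  assumes "\<And>a b. K b a = cnj (K a b)" and "\<And>A c. finite A \<Longrightarrow> 0 \<le> Re (qform A K c)"
  shows "psd K"
  using assms unfolding psd_def by blast

lemma psd_herm: "psd K \<Longrightarrow> K b a = cnj (K a b)"
  unfolding psd_def by blast

lemma psd_nonneg: "psd K \<Longrightarrow> finite A \<Longrightarrow> 0 \<le> Re (qform A K c)"
  unfolding psd_def by blast

lemma qform_add: "qform A (\<lambda>a b. K a b + K' a b) c = qform A K c + qform A K' c"
  by (simp add: qform_def sum.distrib algebra_simps)

lemma qform_diff: "qform A (\<lambda>a b. K a b - K' a b) c = qform A K c - qform A K' c"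
  by (simp add: qform_def sum_subtractf algebra_simps)

lemma qform_scale: "qform A (\<lambda>a b. t * K a b) c = t * qform A K c"
  by (simp add: qform_def sum_distrib_left algebra_simps)

lemma qform_sum: "qform A (\<lambda>a b. \<Sum>i\<in>I. K i a b) c = (\<Sum>i\<in>I. qform A (K i) c)"
proof -
  have "qform A (\<lambda>a b. \<Sum>i\<in>I. K i a b) c = (\<Sum>a\<in>A. \<Sum>i\<in>I. \<Sum>b\<in>A. c a * cnj (c b) * K i a b)"
    unfolding qform_def
    by (rule sum.cong[OF refl]) (simp add: sum_distrib_left sum.swap[of _ I A])
  also have "\<dots> = (\<Sum>i\<in>I. qform A (K i) c)"
    unfolding qform_def by (rule sum.swap)
  finally show ?thesis .
qed

lemma qform_rank_one:
  "qform A (\<lambda>a b. f a * cnj (f b)) c = complex_of_real ((cmod (\<Sum>a\<in>A. c a * f a))\<^sup>2)"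
proof -
  have "qform A (\<lambda>a b. f a * cnj (f b)) c = (\<Sum>a\<in>A. c a * f a) * cnj (\<Sum>a\<in>A. c a * f a)"
    by (simp add: qform_def cnj_sum sum_product algebra_simps)
  thus ?thesis by (simp only: complex_norm_square)
qed

lemma qform_cong:
  "(\<And>a. a \<in> A \<Longrightarrow> c a = c' a) \<Longrightarrow> (\<And>a b. a \<in> A \<Longrightarrow> b \<in> A \<Longrightarrow> K a b = K' a b) \<Longrightarrow> qform A K c = qform A K' c'"
  unfolding qform_def by (intro sum.cong refl) auto

lemma qform_superset:
  assumes "finite B" "A \<subseteq> B" "\<And>a. a \<in> B - A \<Longrightarrow> c a = 0"
  shows "qform B K c = qform A K c"
proof -
  have "qform B K c = (\<Sum>a\<in>A. \<Sum>b\<in>B. c a * cnj (c b) * K a b)"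
    unfolding qform_def by (rule sum.mono_neutral_right) (use assms in auto)
  also have "\<dots> = qform A K c"
    unfolding qform_def
    by (intro sum.cong refl sum.mono_neutral_right) (use assms in auto)
  finally show ?thesis .
qed

lemma psd_add:
  assumes "psd K" "psd K'"
  shows "psd (\<lambda>a b. K a b + K' a b)"
proof (rule psdI)
  show "K b a + K' b a = cnj (K a b + K' a b)" for a b
    by (simp add: psd_herm[OF assms(1), of a b] psd_herm[OF assms(2), of a b])
qed (use assms in \<open>simp add: qform_add psd_nonneg\<close>)

lemma psd_scale:
  assumes "psd K" "0 \<le> t"
  shows "psd (\<lambda>a b. complex_of_real t * K a b)"
proof (rule psdI)
  show "complex_of_real t * K b a = cnj (complex_of_real t * K a b)" for a b
    by (simp add: psd_herm[OF assms(1), of b a])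
qed (use assms in \<open>simp add: qform_scale psd_nonneg\<close>)

lemma psd_rank_one: "psd (\<lambda>a b. f a * cnj (f b))"
  by (rule psdI) (simp_all add: qform_rank_one)

lemma psd_zero: "psd (\<lambda>a b. 0)"
  by (rule psdI) (simp_all add: qform_def)

lemma psd_sum: "(\<And>i. i \<in> I \<Longrightarrow> psd (K i)) \<Longrightarrow> psd (\<lambda>a b. \<Sum>i\<in>I. K i a b)"
proof (induction I rule: infinite_finite_induct)
  case (insert x F)
  have "psd (\<lambda>a b. K x a b + (\<Sum>i\<in>F. K i a b))"
    by (rule psd_add) (use insert in auto)
  thus ?case using insert.hyps by simp
qed (simp_all add: psd_zero)

lemma psd_pullback:
  assumes "psd K"
  shows "psd (\<lambda>a b. K (f a) (f b))"
proof (rule psdI)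
  fix A :: "'b set" and c :: "'b \<Rightarrow> complex" assume A: "finite A"
  \<comment> \<open>\<open>f\<close> may identify indices, so the coefficients are added up over
    each fibre; the form on \<open>A\<close> becomes the form of \<open>K\<close> on the image with
    these sums.\<close>
  define d where "d = (\<lambda>u. \<Sum>a | a \<in> A \<and> f a = u. c a)"
  have 1: "(\<Sum>a\<in>A. c a * g (f a)) = (\<Sum>u\<in>f ` A. d u * g u)" for g :: "'a \<Rightarrow> complex"
  proof -
    have "(\<Sum>a\<in>A. c a * g (f a)) = (\<Sum>u\<in>f ` A. \<Sum>a | a \<in> A \<and> f a = u. c a * g (f a))"
      by (rule sum.image_gen[OF A])
    also have "\<dots> = (\<Sum>u\<in>f ` A. d u * g u)"
      unfolding d_def sum_distrib_right by (intro sum.cong) auto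
    finally show ?thesis .
  qed
  have 2: "(\<Sum>a\<in>A. cnj (c a) * g (f a)) = (\<Sum>u\<in>f ` A. cnj (d u) * g u)" for g
    using arg_cong[OF 1[of "\<lambda>u. cnj (g u)"], of cnj] by (simp add: cnj_sum)
  have "qform A (\<lambda>a b. K (f a) (f b)) c = (\<Sum>a\<in>A. c a * (\<Sum>b\<in>A. cnj (c b) * K (f a) (f b)))"
    by (simp add: qform_def sum_distrib_left algebra_simps)
  also have "\<dots> = (\<Sum>a\<in>A. c a * (\<Sum>u\<in>f ` A. cnj (d u) * K (f a) u))"
    by (simp add: 2[of "K (f _)"])
  also have "\<dots> = qform (f ` A) K d"
    unfolding 1[of "\<lambda>v. \<Sum>u\<in>f ` A. cnj (d u) * K v u"]
    by (simp add: qform_def sum_distrib_left algebra_simps)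
  finally show "0 \<le> Re (qform A (\<lambda>a b. K (f a) (f b)) c)"
    using psd_nonneg[OF assms] A by simp
qed (rule psd_herm[OF assms])

lemma psd_diag:
  assumes "psd K"
  shows "0 \<le> Re (K a a)" and "K a a = complex_of_real (Re (K a a))"
proof -
  show "0 \<le> Re (K a a)" using psd_nonneg[OF assms, of "{a}" "\<lambda>_. 1"] by (simp add: qform_def)
  show "K a a = complex_of_real (Re (K a a))"
    using psd_herm[OF assms, of a a] by (metis complex_cnj_cancel_iff Reals_cnj_iff complex_is_Real_iff of_real_Re)
qed

text \<open>On the pair \<open>a\<close>, \<open>p\<close>, with coefficients 1 and
  \<open>- t * K a p\<close>, the form is affine in \<open>t\<close>, because its quadratic term
  carries the factor \<open>K p p = 0\<close>; the slope is negative unless \<open>K a p\<close>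
  vanishes.\<close>

lemma psd_zero_row:
  assumes K: "psd K" and z: "K p p = 0"
  shows "K a p = 0" "K p a = 0"
proof -
  show "K a p = 0"
  proof (rule ccontr)
    assume nz: "K a p \<noteq> 0"
    hence ap: "a \<noteq> p" using z by auto
    have h: "K p a = cnj (K a p)" by (rule psd_herm[OF K])
    have "0 \<le> Re (K a a) - 2 * t * (cmod (K a p))\<^sup>2" for t :: real
    proof -
      define c where "c = (\<lambda>u. if u = p then - (of_real t * K a p) else (1::complex))"
      have "qform {a, p} K c = K a a + cnj (c p) * K a p + c p * K p a"
        using ap z by (simp add: qform_def c_def)
      also have "\<dots> = K a a - of_real (2 * t) * (K a p * cnj (K a p))"
        by (simp add: c_def h algebra_simps)
      also have "\<dots> = K a a - of_real (2 * t * (cmod (K a p))\<^sup>2)"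
        by (simp only: complex_norm_square[symmetric] of_real_mult)
      finally show ?thesis using psd_nonneg[OF K, of "{a, p}" c] by simp
    qed
    \<comment> \<open>For this \<open>t\<close> the lower bound 0 would be claimed of -1.\<close>
    from this[of "(Re (K a a) + 1) / (2 * (cmod (K a p))\<^sup>2)"] nz show False by simp
  qed
  thus "K p a = 0" using psd_herm[OF K, of a p] by simp
qed

section \<open>Schur complements and triangular factorisation of kernels\<close>

definition eliminate :: "'a \<Rightarrow> ('a \<Rightarrow> 'a \<Rightarrow> complex) \<Rightarrow> 'a \<Rightarrow> 'a \<Rightarrow> complex" where
  "eliminate p K a b = K a b - K a p * K p b / K p p"

text \<open>\<open>eliminate p K\<close> is the Schur complement of \<open>K p p\<close>: its form
  at \<open>c\<close> is the form of \<open>K\<close> after the coefficient at \<open>p\<close> has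
  been shifted by the minimising amount \<open>w\<close>. If \<open>K p p = 0\<close>, division by
  zero makes both \<open>w\<close> and the correction 0, and \<open>K\<close> itself is
  left.\<close>

lemma psd_eliminate:
  assumes K: "psd K"
  shows "psd (eliminate p K)"
proof (rule psdI)
  have "cnj (K u v) = K v u" for u v
    by (rule psd_herm[OF K, symmetric])
  thus "eliminate p K b a = cnj (eliminate p K a b)" for a b
    by (simp add: eliminate_def mult.commute)
next
  fix A :: "'a set" and c0 :: "'a \<Rightarrow> complex" assume A0: "finite A"
  \<comment> \<open>Shifting the coefficient at \<open>p\<close> requires \<open>p\<close> among the
    indices; \<open>c0\<close> is extended by 0.\<close>
  define A' where "A' = insert p A"
  define c where "c = (\<lambda>a. if a \<in> A then c0 a else 0)"
  have A: "finite A'" "p \<in> A'" using A0 by (auto simp: A'_def)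
  define S where "S = (\<Sum>a\<in>A'. c a * K a p)"
  define w where "w = S / K p p"
  have S': "(\<Sum>b\<in>A'. cnj (c b) * K p b) = cnj S"
    unfolding S_def cnj_sum by (simp add: psd_herm[OF K, symmetric])
  have kr: "cnj (K p p) = K p p" using psd_herm[OF K] by metis
  have e: "qform A (eliminate p K) c0 = qform A' (eliminate p K) c"
    by (subst qform_superset[of A' A]) (use A in \<open>auto simp: A'_def c_def intro!: qform_cong\<close>)
  have 1: "qform A' (eliminate p K) c = qform A' K c - S * cnj S / K p p"
  proof -
    have "qform A' (\<lambda>a b. K a p * K p b / K p p) c = S * (\<Sum>b\<in>A'. cnj (c b) * K p b) / K p p"
      by (simp add: qform_def S_def sum_product sum_divide_distrib algebra_simps)
    thus ?thesis unfolding eliminate_def qform_diff S' by simp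
  qed
  have 2: "qform A' K (\<lambda>a. c a - (if a = p then w else 0)) = qform A' K c - cnj w * S - w * cnj S + w * cnj w * K p p"
  proof -
    have "qform A' K (\<lambda>a. c a - (if a = p then w else 0)) = 
      (\<Sum>a\<in>A'. \<Sum>b\<in>A'. c a * cnj (c b) * K a b - (if b = p then cnj w * (c a * K a p) else 0)
         - (if a = p then w * (cnj (c b) * K p b) else 0) + (if a = p then if b = p then w * cnj w * K p p else 0 else 0))"
      unfolding qform_def by (intro sum.cong refl) (auto simp: algebra_simps)
    also have "\<dots> = qform A' K c - cnj w * S - w * cnj S + w * cnj w * K p p"
    proof -
      have 3: "(\<Sum>a\<in>A'. \<Sum>b\<in>A'. if a = p then w * (cnj (c b) * K p b) else 0) = w * cnj S"
        using A by (subst sum.swap) (simp add: sum_distrib_left[symmetric] S')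
      have 4: "(\<Sum>a\<in>A'. \<Sum>b\<in>A'. if a = p then if b = p then w * cnj w * K p p else 0 else 0) = w * cnj w * K p p"
        using A by (subst sum.swap) simp
      show ?thesis
        using A by (simp add: sum.distrib sum_subtractf 3 4 sum_distrib_left[symmetric] S_def[symmetric] qform_def)
    qed
    finally show ?thesis .
  qed
  have "qform A' (eliminate p K) c = (if K p p = 0 then qform A' K c else qform A' K (\<lambda>a. c a - (if a = p then w else 0)))"
    unfolding 1 2 by (auto simp: w_def kr field_simps)
  thus "0 \<le> Re (qform A (eliminate p K) c0)"
    unfolding e using psd_nonneg[OF K A(1)] by simp
qed

text \<open>The diagonal entry at \<open>a\<close> of the Schur complement at \<open>b\<close> is
  nonnegative, which is the inequality divided by \<open>K b b\<close>.\<close>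

lemma psd_cauchy_schwarz:
  assumes K: "psd K"
  shows "(cmod (K a b))\<^sup>2 \<le> Re (K a a) * Re (K b b)"
proof (cases "K b b = 0")
  case True
  thus ?thesis using psd_zero_row[OF K True, of a] by simp
next
  case False
  define k where "k = Re (K b b)"
  have k: "K b b = of_real k" "k > 0"
    using psd_diag[OF K, of b] False by (auto simp: k_def less_le)
  have "K a b * K b a / K b b = of_real ((cmod (K a b))\<^sup>2 / k)"
    unfolding psd_herm[OF K, of b a] by (simp only: k complex_norm_square of_real_divide complex_mod_cnj complex_cnj_cnj mult.commute)
  hence "0 \<le> Re (K a a) - (cmod (K a b))\<^sup>2 / k"
    using psd_diag(1)[OF psd_eliminate[OF K, of b], of a] by (simp add: eliminate_def)
  thus ?thesis using k by (simp add: field_simps)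
qed

primrec elim_seq :: "('a \<Rightarrow> 'a \<Rightarrow> complex) \<Rightarrow> (nat \<Rightarrow> 'a) \<Rightarrow> nat \<Rightarrow> 'a \<Rightarrow> 'a \<Rightarrow> complex" where
  "elim_seq K p 0 = K"
| "elim_seq K p (Suc l) = eliminate (p l) (elim_seq K p l)"

text \<open>The column that step \<open>l\<close> contributes to the Cholesky factor; in
  Gram-Schmidt terms, the coefficient of the vector at \<open>a\<close> along the
  \<open>l\<close>-th orthonormal vector. A zero pivot gives the zero column through division by
  zero, in accordance with \<open>psd_zero_row\<close>.\<close>

definition elim_coeff :: "('a \<Rightarrow> 'a \<Rightarrow> complex) \<Rightarrow> (nat \<Rightarrow> 'a) \<Rightarrow> nat \<Rightarrow> 'a \<Rightarrow> complex" where
  "elim_coeff K p l a = elim_seq K p l a (p l) / of_real (sqrt (Re (elim_seq K p l (p l) (p l))))"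

lemma psd_elim_seq: "psd K \<Longrightarrow> psd (elim_seq K p l)"
  by (induction l) (simp_all add: psd_eliminate)

text \<open>Step \<open>k\<close> clears the row of \<open>p k\<close> (for a zero pivot it is clear
  already), and the corrections of all later steps have a factor from that row.\<close>

lemma elim_seq_pivot:
  assumes K: "psd K" and "k < l"
  shows "elim_seq K p l (p k) b = 0" "elim_seq K p l b (p k) = 0"
proof -
  have "elim_seq K p l (p k) b = 0" for b
    using \<open>k < l\<close>
  proof (induction l arbitrary: b)
    case (Suc l)
    show ?case
    proof (cases "k = l")
      case True
      then show ?thesis
        using psd_zero_row[OF psd_elim_seq[OF K, of p l], of "p l" b] by (auto simp: eliminate_def)
    next
      case False
      then show ?thesis using Suc by (simp add: eliminate_def)
    qed
  qed simp
  thus "elim_seq K p l (p k) b = 0" "elim_seq K p l b (p k) = 0"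
    using psd_herm[OF psd_elim_seq[OF K, of p l]] by (metis, metis complex_cnj_zero)
qed

lemma elim_coeff_pivot: "psd K \<Longrightarrow> k < l \<Longrightarrow> elim_coeff K p l (p k) = 0"
  by (simp add: elim_coeff_def elim_seq_pivot)

lemma elim_coeff_product:
  assumes K: "psd K"
  shows "elim_coeff K p l a * cnj (elim_coeff K p l b)
    = elim_seq K p l a (p l) * elim_seq K p l (p l) b / elim_seq K p l (p l) (p l)"
proof -
  note P = psd_elim_seq[OF K, of p l]
  let ?k = "Re (elim_seq K p l (p l) (p l))"
  have "of_real (sqrt ?k) * of_real (sqrt ?k) = elim_seq K p l (p l) (p l)"
    by (metis of_real_mult psd_diag[OF P] real_sqrt_mult_self abs_of_nonneg)
  moreover have "cnj (elim_seq K p l b (p l)) = elim_seq K p l (p l) b"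
    using psd_herm[OF P] by metis
  ultimately show ?thesis by (simp add: elim_coeff_def)
qed

text \<open>Each step subtracts exactly the rank-one kernel of its column, so the sum telescopes.
  The remainder stays explicit; it is again positive, which gives \<open>psd_bessel\<close>.\<close>

lemma elim_seq_decomp:
  assumes K: "psd K"
  shows "K a b = (\<Sum>l<L. elim_coeff K p l a * cnj (elim_coeff K p l b)) + elim_seq K p L a b"
proof (induction L)
  case (Suc L)
  show ?case
    by (subst Suc) (simp add: elim_coeff_product[OF K] eliminate_def)
qed simp

lemma psd_bessel:
  assumes "psd K"
  shows "(\<Sum>l<L. (cmod (elim_coeff K p l a))\<^sup>2) \<le> Re (K a a)"
proof -
  have "K a a = of_real (\<Sum>l<L. (cmod (elim_coeff K p l a))\<^sup>2) + elim_seq K p L a a"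
    by (subst elim_seq_decomp[OF assms, of a a p L]) (simp add: complex_norm_square del: of_real_power)
  thus ?thesis using psd_diag(1)[OF psd_elim_seq[OF assms, of p L], of a] by simp
qed

text \<open>Pivoting once on every element of \<open>A\<close> leaves a remainder whose rows over
  \<open>A\<close> vanish; \<open>b\<close> may therefore be arbitrary.\<close>

lemma psd_finite_decomp:
  assumes K: "psd K" and A: "finite A" and e: "bij_betw e {..<N} A"
  obtains R :: "nat \<Rightarrow> 'a \<Rightarrow> complex" where
    "\<And>a b. a \<in> A \<Longrightarrow> K a b = (\<Sum>l<N. R l a * cnj (R l b))"
proof
  fix a b assume "a \<in> A"
  then obtain k where "k < N" "a = e k" using e by (auto simp: bij_betw_def)
  thus "K a b = (\<Sum>l<N. elim_coeff K e l a * cnj (elim_coeff K e l b))"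
    by (subst elim_seq_decomp[OF K, of a b e N]) (simp add: elim_seq_pivot[OF K])
qed

text \<open>With pivots \<open>from_nat 0\<close>, \<open>from_nat 1\<close>, and so on, the factor
  is triangular: the row of \<open>a\<close> is exhausted after step \<open>to_nat a\<close>. A
  positive kernel on a countable type thus has finitely supported Gram vectors, and its entries are
  finite sums.\<close>

lemma psd_countable_decomp:
  fixes K :: "'a::countable \<Rightarrow> 'a \<Rightarrow> complex"
  assumes K: "psd K"
  obtains U :: "'a \<Rightarrow> nat \<Rightarrow> complex" where
    "\<And>a l. to_nat a < l \<Longrightarrow> U a l = 0"
    "\<And>a b L. to_nat a < L \<Longrightarrow> K a b = (\<Sum>l<L. U a l * cnj (U b l))"
proof
  let ?U = "\<lambda>a l. elim_coeff K from_nat l a"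
  show "?U a l = 0" if "to_nat a < l" for a l
    using elim_coeff_pivot[OF K that, of from_nat] by simp
  show "K a b = (\<Sum>l<L. ?U a l * cnj (?U b l))" if "to_nat a < L" for a b L
    by (subst elim_seq_decomp[OF K, of a b from_nat L])
       (use elim_seq_pivot[OF K that, of from_nat b] in simp)
qed

text \<open>Since \<open>K\<close> is a sum of rank-one kernels, a matrix acts on its Gram vectors with the norm it has on \<open>\<complex>\<^sup>A\<close>.\<close>

lemma psd_contraction:
  assumes K: "psd K" and A: "finite A"
    and G: "\<And>\<alpha>. (\<Sum>r\<in>B. (cmod (\<Sum>c\<in>A. G r c * \<alpha> c))\<^sup>2) \<le> \<rho> * (\<Sum>c\<in>A. (cmod (\<alpha> c))\<^sup>2)"
  shows "(\<Sum>r\<in>B. Re (qform A K (G r))) \<le> \<rho> * (\<Sum>c\<in>A. Re (K c c))"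
proof -
  obtain e where e: "bij_betw e {..<card A} A"
    using ex_bij_betw_nat_finite[OF A] by (auto simp: atLeast0LessThan)
  obtain R where R: "\<And>a b. a \<in> A \<Longrightarrow> K a b = (\<Sum>l<card A. R l a * cnj (R l b))"
    using psd_finite_decomp[OF K A e] by blast
  have 1: "Re (qform A K (G r)) = (\<Sum>l<card A. (cmod (\<Sum>c\<in>A. G r c * R l c))\<^sup>2)" for r
  proof -
    have "qform A K (G r) = qform A (\<lambda>a b. \<Sum>l<card A. R l a * cnj (R l b)) (G r)"
      by (rule qform_cong) (auto simp: R)
    thus ?thesis by (simp add: qform_sum qform_rank_one)
  qed
  have 2: "Re (K c c) = (\<Sum>l<card A. (cmod (R l c))\<^sup>2)" if "c \<in> A" for c
    unfolding R[OF that] by (simp add: complex_norm_square[symmetric] del: of_real_power)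
  have "(\<Sum>r\<in>B. Re (qform A K (G r))) = (\<Sum>l<card A. \<Sum>r\<in>B. (cmod (\<Sum>c\<in>A. G r c * R l c))\<^sup>2)"
    unfolding 1 by (rule sum.swap)
  also have "\<dots> \<le> (\<Sum>l<card A. \<rho> * (\<Sum>c\<in>A. (cmod (R l c))\<^sup>2))"
    by (intro sum_mono G)
  also have "\<dots> = \<rho> * (\<Sum>c\<in>A. Re (K c c))"
    by (simp add: 2 sum_distrib_left[symmetric] sum.swap[of _ A])
  finally show ?thesis .
qed

section \<open>Solving a kernel equation by duality\<close>

lemma compact_complex_disc: "compact {z. cmod z \<le> r}"
proof -
  let ?B = "(\<lambda>(a, b). Complex a b) ` ({-r..r} \<times> {-r..r})"
  have "continuous_on ({-r..r} \<times> {-r..r}) (\<lambda>(a, b). Complex a b)"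
    unfolding Complex_eq case_prod_beta by (intro continuous_intros)
  hence "compact ?B"
    by (intro compact_continuous_image compact_Times compact_Icc)
  moreover have "closed {z. cmod z \<le> r}"
    by (intro closed_Collect_le continuous_intros)
  moreover have "{z. cmod z \<le> r} \<subseteq> ?B"
  proof
    fix z assume "z \<in> {z. cmod z \<le> r}"
    hence "Re z \<in> {-r..r}" "Im z \<in> {-r..r}"
      using abs_Re_le_cmod[of z] abs_Im_le_cmod[of z] by auto
    thus "z \<in> ?B" by (intro image_eqI[of _ _ "(Re z, Im z)"]) auto
  qed
  ultimately show ?thesis
    using closed_Int_compact[of "{z. cmod z \<le> r}" ?B] by (simp add: Int_absorb2)
qed

text \<open>Tychonoff for a product of discs. In the topology of pointwise convergence the
  conditions imposed on finitely many entries of a kernel are closed, which is what both compactness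
  arguments rely on.\<close>

lemma compact_bounded_functions:
  "compact {\<kappa> :: 'p \<Rightarrow> complex. \<forall>p. cmod (\<kappa> p) \<le> r p}"
proof -
  have "compactin (product_topology (\<lambda>_. euclidean) UNIV) (\<Pi>\<^sub>E p\<in>UNIV. {z. cmod z \<le> r p})"
    unfolding compactin_PiE by (simp add: compact_complex_disc)
  moreover have "(\<Pi>\<^sub>E p\<in>UNIV. {z. cmod z \<le> r p}) = {\<kappa>. \<forall>p. cmod (\<kappa> p) \<le> r p}"
    by (auto simp: PiE_def)
  ultimately show ?thesis
    by (simp add: euclidean_product_topology)
qed

lemma closed_psd: "closed {\<kappa> :: 'a \<times> 'a \<Rightarrow> complex. psd (\<lambda>a b. \<kappa> (a, b))}"
proof -
  have "{\<kappa> :: 'a \<times> 'a \<Rightarrow> complex. psd (\<lambda>a b. \<kappa> (a, b))} =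
    (\<Inter>a. \<Inter>b. {\<kappa>. \<kappa> (b, a) = cnj (\<kappa> (a, b))}) \<inter>
    (\<Inter>A\<in>Collect finite. \<Inter>c. {\<kappa>. 0 \<le> Re (qform A (\<lambda>a b. \<kappa> (a, b)) c)})"
    unfolding psd_def by blast
  moreover have "closed {\<kappa> :: 'a \<times> 'a \<Rightarrow> complex. \<kappa> (b, a) = cnj (\<kappa> (a, b))}" for a b
    by (intro closed_Collect_eq continuous_intros continuous_on_product_coordinates)
  moreover have "closed {\<kappa> :: 'a \<times> 'a \<Rightarrow> complex. 0 \<le> Re (qform A (\<lambda>a b. \<kappa> (a, b)) c)}" for A c
    unfolding qform_def by (intro closed_Collect_le continuous_intros continuous_on_product_coordinates)
  ultimately show ?thesis by (simp add: closed_INT closed_Int)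
qed

lemma nonneg_slope:
  fixes p q t0 :: real
  assumes "0 < t0" and "\<And>t. 0 < t \<Longrightarrow> t \<le> t0 \<Longrightarrow> 0 \<le> 2 * t * p + t\<^sup>2 * q"
  shows "0 \<le> p"
proof (rule ccontr)
  assume "\<not> 0 \<le> p"
  \<comment> \<open>The second bound gives \<open>t * (1 + \<bar>q\<bar>) \<le> - p\<close>, so the
    quadratic term cannot compensate the linear one.\<close>
  define t where "t = min t0 (- p / (1 + \<bar>q\<bar>))"
  have t: "0 < t" "t \<le> t0" "t \<le> - p / (1 + \<bar>q\<bar>)"
    using assms(1) \<open>\<not> 0 \<le> p\<close> by (auto simp: t_def field_simps)
  have "t * q \<le> t * (1 + \<bar>q\<bar>)" using t by (intro mult_left_mono) auto
  also have "\<dots> \<le> - p" using t(3) by (simp add: field_simps)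
  finally have "2 * p + t * q < 0" using \<open>\<not> 0 \<le> p\<close> by simp
  hence "t * (2 * p + t * q) < 0" using t(1) by (simp add: mult_pos_neg)
  thus False using assms(2)[OF t(1,2)] by (simp add: algebra_simps power2_eq_square)
qed

text \<open>The kernel problem on finitely many points, in coordinates: \<open>\<Gamma> i\<close> is
  the \<open>i\<close>-th row of \<open>\<delta>\<close> as a linear map from functions on
  \<open>\<Omega> \<times> {..<J}\<close> to functions on \<open>\<Omega>\<close>, \<open>e1\<close>
  stands for the identity and \<open>e2\<close> for \<open>\<phi>\<close>. As \<open>contr\<close>
  compares squares, \<open>\<rho>\<close> bounds the square of a norm.\<close>

locale kernel_equation =
  fixes \<Omega> :: "'w set" and I J :: nat and \<Gamma> :: "nat \<Rightarrow> 'w \<Rightarrow> 'w \<times> nat \<Rightarrow> complex"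
    and e1 e2 :: "'w \<Rightarrow> complex" and \<rho> :: real
  assumes fin: "finite \<Omega>" and J: "1 \<le> J" and \<rho>: "0 \<le> \<rho>" "\<rho> < 1"
    and contr: "\<And>\<alpha>. (\<Sum>i<I. \<Sum>\<omega>\<in>\<Omega>. (cmod (\<Sum>z\<in>\<Omega> \<times> {..<J}. \<Gamma> i \<omega> z * \<alpha> z))\<^sup>2)
        \<le> \<rho> * (\<Sum>z\<in>\<Omega> \<times> {..<J}. (cmod (\<alpha> z))\<^sup>2)"
begin

abbreviation "Z \<equiv> \<Omega> \<times> {..<J}"

text \<open>The operator of the kernel equation, linear in \<open>K\<close>: the trace over
  \<open>j\<close> minus the transform of \<open>K\<close> by the rows of
  \<open>\<Gamma>\<close>.\<close>

definition \<Psi> :: "('w \<times> nat \<Rightarrow> 'w \<times> nat \<Rightarrow> complex) \<Rightarrow> 'w \<Rightarrow> 'w \<Rightarrow> complex" where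
  "\<Psi> K \<omega> \<omega>' = (\<Sum>j<J. K (\<omega>, j) (\<omega>', j))
     - (\<Sum>i<I. \<Sum>z\<in>Z. \<Sum>z'\<in>Z. \<Gamma> i \<omega> z * cnj (\<Gamma> i \<omega>' z') * K z z')"

definition target :: "'w \<Rightarrow> 'w \<Rightarrow> complex" where
  "target \<omega> \<omega>' = e1 \<omega> * cnj (e1 \<omega>') - e2 \<omega> * cnj (e2 \<omega>')"

definition energy :: "('w \<times> nat \<Rightarrow> 'w \<times> nat \<Rightarrow> complex) \<Rightarrow> real" where
  "energy K = (\<Sum>\<omega>\<in>\<Omega>. \<Sum>\<omega>'\<in>\<Omega>. (cmod (\<Psi> K \<omega> \<omega>' - target \<omega> \<omega>'))\<^sup>2)"

lemma finZ: "finite Z"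
  using fin by simp

lemma \<Psi>_add_scale: "\<Psi> (\<lambda>z z'. K z z' + t * K' z z') \<omega> \<omega>' = \<Psi> K \<omega> \<omega>' + t * \<Psi> K' \<omega> \<omega>'"
  by (simp add: \<Psi>_def sum.distrib sum_distrib_left algebra_simps)

lemma \<Psi>_herm:
  assumes "psd K"
  shows "\<Psi> K \<omega>' \<omega> = cnj (\<Psi> K \<omega> \<omega>')"
proof -
  have h: "cnj (K u v) = K v u" for u v
    by (rule psd_herm[OF assms, symmetric])
  have "(\<Sum>z\<in>Z. \<Sum>z'\<in>Z. \<Gamma> i \<omega>' z * cnj (\<Gamma> i \<omega> z') * K z z')
      = (\<Sum>z\<in>Z. \<Sum>z'\<in>Z. cnj (\<Gamma> i \<omega> z) * \<Gamma> i \<omega>' z' * K z' z)" for i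
    by (subst sum.swap) (simp add: mult.commute)
  thus ?thesis by (simp add: \<Psi>_def h)
qed

text \<open>By \<open>psd_contraction\<close> the subtracted terms take away at most the fraction
  \<open>\<rho>\<close> of the trace of \<open>K\<close>. This coercivity keeps positive kernels
  with small energy bounded.\<close>

lemma trace_bound:
  assumes K: "psd K"
  shows "(1 - \<rho>) * (\<Sum>z\<in>Z. Re (K z z)) \<le> (\<Sum>\<omega>\<in>\<Omega>. Re (\<Psi> K \<omega> \<omega>))"
proof -
  have "(\<Sum>r\<in>{..<I} \<times> \<Omega>. Re (qform Z K (\<Gamma> (fst r) (snd r)))) \<le> \<rho> * (\<Sum>z\<in>Z. Re (K z z))"
    by (rule psd_contraction[OF K finZ])
       (use contr in \<open>simp add: sum.cartesian_product[of _ \<Omega> "{..<I}", symmetric] sum.cartesian_product' case_prod_beta\<close>)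
  moreover have "(\<Sum>r\<in>{..<I} \<times> \<Omega>. Re (qform Z K (\<Gamma> (fst r) (snd r))))
      = (\<Sum>\<omega>\<in>\<Omega>. \<Sum>i<I. Re (qform Z K (\<Gamma> i \<omega>)))"
    by (simp add: sum.cartesian_product' case_prod_beta sum.swap[of _ "{..<I}"])
  moreover have "(\<Sum>z\<in>Z. Re (K z z)) = (\<Sum>\<omega>\<in>\<Omega>. \<Sum>j<J. Re (K (\<omega>, j) (\<omega>, j)))"
    by (simp add: sum.cartesian_product')
  moreover have "(\<Sum>\<omega>\<in>\<Omega>. Re (\<Psi> K \<omega> \<omega>))
      = (\<Sum>\<omega>\<in>\<Omega>. \<Sum>j<J. Re (K (\<omega>, j) (\<omega>, j))) - (\<Sum>\<omega>\<in>\<Omega>. \<Sum>i<I. Re (qform Z K (\<Gamma> i \<omega>)))"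
    by (simp add: \<Psi>_def qform_def sum_subtractf Re_sum)
  ultimately show ?thesis by (simp add: algebra_simps)
qed

lemma energy_bound:
  obtains c where "0 \<le> c"
    "\<And>K z z'. psd K \<Longrightarrow> energy K \<le> energy (\<lambda>_ _. 0) \<Longrightarrow> z \<in> Z \<Longrightarrow> z' \<in> Z \<Longrightarrow> cmod (K z z') \<le> c"
proof -
  define e0 where "e0 = energy (\<lambda>_ _. 0)"
  have e0: "0 \<le> e0" unfolding e0_def energy_def by (intro sum_nonneg) auto
  \<comment> \<open>\<open>1 + e0\<close> dominates the square root of \<open>e0\<close>, which
    bounds the deviation of \<open>\<Psi> K\<close> from the target at a diagonal entry.\<close>
  define s where "s = (\<Sum>\<omega>\<in>\<Omega>. cmod (target \<omega> \<omega>) + (1 + e0))"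
  define c where "c = s / (1 - \<rho>)"
  have s: "0 \<le> s" unfolding s_def using e0 by (intro sum_nonneg) auto
  show ?thesis
  proof (rule that)
    show c: "0 \<le> c" using s \<rho> by (simp add: c_def)
    fix K z z' assume K: "psd K" and En: "energy K \<le> energy (\<lambda>_ _. 0)" and z: "z \<in> Z" "z' \<in> Z"
    have "Re (\<Psi> K \<omega> \<omega>) \<le> cmod (target \<omega> \<omega>) + (1 + e0)" if "\<omega> \<in> \<Omega>" for \<omega>
    proof -
      have "(cmod (\<Psi> K \<omega> \<omega> - target \<omega> \<omega>))\<^sup>2 \<le> (\<Sum>\<omega>'\<in>\<Omega>. (cmod (\<Psi> K \<omega> \<omega>' - target \<omega> \<omega>'))\<^sup>2)"
        by (rule member_le_sum) (use that fin in auto)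
      also have "\<dots> \<le> energy K"
        unfolding energy_def
        by (rule member_le_sum[where f = "\<lambda>\<omega>. \<Sum>\<omega>'\<in>\<Omega>. (cmod (\<Psi> K \<omega> \<omega>' - target \<omega> \<omega>'))\<^sup>2"])
           (use that fin in \<open>auto intro: sum_nonneg\<close>)
      also have "\<dots> \<le> e0" using En by (simp add: e0_def)
      also have "e0 \<le> (1 + e0)\<^sup>2" using e0 by (simp add: power2_eq_square algebra_simps)
      finally have "cmod (\<Psi> K \<omega> \<omega> - target \<omega> \<omega>) \<le> 1 + e0"
        using e0 by (simp add: power2_le_iff_abs_le)
      moreover have "Re (\<Psi> K \<omega> \<omega>) \<le> cmod (target \<omega> \<omega>) + cmod (\<Psi> K \<omega> \<omega> - target \<omega> \<omega>)"
        using norm_triangle_sub[of "\<Psi> K \<omega> \<omega>" "target \<omega> \<omega>"] complex_Re_le_cmod[of "\<Psi> K \<omega> \<omega>"] by linarith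
      ultimately show ?thesis by simp
    qed
    hence "(1 - \<rho>) * (\<Sum>z\<in>Z. Re (K z z)) \<le> s"
      unfolding s_def by (intro order_trans[OF trace_bound[OF K]] sum_mono) auto
    hence tr: "(\<Sum>z\<in>Z. Re (K z z)) \<le> c" using \<rho> by (simp add: c_def field_simps)
    have d: "Re (K z z) \<le> c" if "z \<in> Z" for z
      by (rule order_trans[OF member_le_sum[where f = "\<lambda>z. Re (K z z)"] tr])
         (use that finZ psd_diag[OF K] in auto)
    have "(cmod (K z z'))\<^sup>2 \<le> Re (K z z) * Re (K z' z')" by (rule psd_cauchy_schwarz[OF K])
    also have "\<dots> \<le> c * c" by (intro mult_mono d z c psd_diag[OF K])
    finally show "cmod (K z z') \<le> c" using c by (simp add: power2_eq_square[symmetric] power2_le_iff_abs_le)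
  qed
qed

text \<open>First-order conditions for least squares over a convex cone. From the minimiser one may
  move towards every positive kernel supported on \<open>Z\<close>, which gives the inequality for
  \<open>K1\<close>, and back towards 0 along the minimiser itself, which gives the one for
  \<open>K\<close>.\<close>

lemma energy_minimizer:
  obtains K where "psd K" 
    "\<And>K1. psd K1 \<Longrightarrow> (\<And>z z'. z \<notin> Z \<or> z' \<notin> Z \<Longrightarrow> K1 z z' = 0) \<Longrightarrow>
        0 \<le> Re (\<Sum>\<omega>\<in>\<Omega>. \<Sum>\<omega>'\<in>\<Omega>. cnj (\<Psi> K \<omega> \<omega>' - target \<omega> \<omega>') * \<Psi> K1 \<omega> \<omega>')"
    "Re (\<Sum>\<omega>\<in>\<Omega>. \<Sum>\<omega>'\<in>\<Omega>. cnj (\<Psi> K \<omega> \<omega>' - target \<omega> \<omega>') * \<Psi> K \<omega> \<omega>') \<le> 0"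
proof -
  obtain c where c: "0 \<le> c"
    "\<And>K z z'. psd K \<Longrightarrow> energy K \<le> energy (\<lambda>_ _. 0) \<Longrightarrow> z \<in> Z \<Longrightarrow> z' \<in> Z \<Longrightarrow> cmod (K z z') \<le> c"
    using energy_bound by blast
  \<comment> \<open>A kernel with energy no larger than that of 0 has entries at most
    \<open>c\<close>; the extra 1 leaves room to vary the minimiser inside the compact set.\<close>
  define r where "r = (\<lambda>p. if p \<in> Z \<times> Z then c + 1 else 0)"
  define S where "S = {\<kappa>. psd (\<lambda>a b. \<kappa> (a, b))} \<inter> {\<kappa>. \<forall>p. cmod (\<kappa> p) \<le> r p}"
  have "compact S"
    unfolding S_def by (intro closed_Int_compact closed_psd compact_bounded_functions)
  moreover have S0: "(\<lambda>_. 0) \<in> S" using c(1) by (auto simp: S_def psd_zero r_def)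
  moreover have "continuous_on S (\<lambda>\<kappa>. energy (\<lambda>a b. \<kappa> (a, b)))"
    unfolding energy_def \<Psi>_def
    by (intro continuous_intros continuous_on_product_coordinates 
        continuous_on_subset[OF continuous_on_product_coordinates]) auto
  ultimately obtain \<kappa> where \<kappa>: "\<kappa> \<in> S" and min: "\<And>\<kappa>'. \<kappa>' \<in> S \<Longrightarrow> energy (\<lambda>a b. \<kappa> (a, b)) \<le> energy (\<lambda>a b. \<kappa>' (a, b))"
    using continuous_attains_inf[of S "\<lambda>\<kappa>. energy (\<lambda>a b. \<kappa> (a, b))"] by blast
  define K where "K = (\<lambda>a b. \<kappa> (a, b))"
  define D where "D = (\<lambda>\<omega> \<omega>'. \<Psi> K \<omega> \<omega>' - target \<omega> \<omega>')"
  have K: "psd K" using \<kappa> by (simp add: S_def K_def)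
  have Kb: "cmod (K z z') \<le> (if z \<in> Z \<and> z' \<in> Z then c else 0)" for z z'
  proof (cases "z \<in> Z \<and> z' \<in> Z")
    case True
    thus ?thesis using c(2)[OF K min[OF S0, folded K_def]] by simp
  next
    case False
    have "cmod (\<kappa> (z, z')) \<le> r (z, z')" using \<kappa> unfolding S_def by blast
    thus ?thesis using False by (auto simp: r_def K_def split: if_splits)
  qed
  have var: "0 \<le> 2 * t * Re (\<Sum>\<omega>\<in>\<Omega>. \<Sum>\<omega>'\<in>\<Omega>. cnj (D \<omega> \<omega>') * \<Psi> K1 \<omega> \<omega>')
      + t\<^sup>2 * (\<Sum>\<omega>\<in>\<Omega>. \<Sum>\<omega>'\<in>\<Omega>. (cmod (\<Psi> K1 \<omega> \<omega>'))\<^sup>2)"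
    if P: "psd (\<lambda>z z'. K z z' + of_real t * K1 z z')"
      and b: "\<And>z z'. cmod (K z z' + of_real t * K1 z z') \<le> (if z \<in> Z \<and> z' \<in> Z then c + 1 else 0)" for t K1
  proof -
    have "(\<lambda>p. K (fst p) (snd p) + of_real t * K1 (fst p) (snd p)) \<in> S"
      unfolding S_def
    proof (intro IntI CollectI allI)
      fix p
      show "cmod (K (fst p) (snd p) + of_real t * K1 (fst p) (snd p)) \<le> r p"
        using b[of "fst p" "snd p"] by (simp add: r_def mem_Times_iff)
    qed (use P in simp)
    from min[OF this] have "energy K \<le> energy (\<lambda>z z'. K z z' + of_real t * K1 z z')"
      by (simp add: K_def)
    moreover have expand: "(cmod (d + of_real t * p))\<^sup>2 = (cmod d)\<^sup>2 + 2 * t * Re (cnj d * p) + t\<^sup>2 * (cmod p)\<^sup>2" for d p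
      unfolding cmod_power2 by (simp add: power2_eq_square algebra_simps)
    have "(cmod (\<Psi> (\<lambda>z z'. K z z' + of_real t * K1 z z') \<omega> \<omega>' - target \<omega> \<omega>'))\<^sup>2
      = (cmod (D \<omega> \<omega>'))\<^sup>2 + 2 * t * Re (cnj (D \<omega> \<omega>') * \<Psi> K1 \<omega> \<omega>') + t\<^sup>2 * (cmod (\<Psi> K1 \<omega> \<omega>'))\<^sup>2" for \<omega> \<omega>'
      unfolding \<Psi>_add_scale D_def expand[symmetric] by (simp add: diff_add_eq)
    hence "energy (\<lambda>z z'. K z z' + of_real t * K1 z z') = energy K
      + 2 * t * Re (\<Sum>\<omega>\<in>\<Omega>. \<Sum>\<omega>'\<in>\<Omega>. cnj (D \<omega> \<omega>') * \<Psi> K1 \<omega> \<omega>')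
      + t\<^sup>2 * (\<Sum>\<omega>\<in>\<Omega>. \<Sum>\<omega>'\<in>\<Omega>. (cmod (\<Psi> K1 \<omega> \<omega>'))\<^sup>2)"
      using D_def unfolding energy_def
      by (simp add: sum.distrib sum_distrib_left Re_sum del: times_complex.sel)
    ultimately show ?thesis by simp
  qed
  have A: "0 \<le> Re (\<Sum>\<omega>\<in>\<Omega>. \<Sum>\<omega>'\<in>\<Omega>. cnj (D \<omega> \<omega>') * \<Psi> K1 \<omega> \<omega>')"
    if K1: "psd K1" and sup: "\<And>z z'. z \<notin> Z \<or> z' \<notin> Z \<Longrightarrow> K1 z z' = 0" for K1
  proof -
    define b where "b = 1 + (\<Sum>z\<in>Z. \<Sum>z'\<in>Z. cmod (K1 z z'))"
    have b1: "b \<ge> 1" unfolding b_def by (simp add: sum_nonneg)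
    have b: "cmod (K1 z z') \<le> b" if "z \<in> Z" "z' \<in> Z" for z z'
    proof -
      have "cmod (K1 z z') \<le> (\<Sum>z'\<in>Z. cmod (K1 z z'))"
        by (rule member_le_sum) (use that finZ in auto)
      also have "\<dots> \<le> (\<Sum>z\<in>Z. \<Sum>z'\<in>Z. cmod (K1 z z'))"
        by (rule member_le_sum[where f = "\<lambda>z. \<Sum>z'\<in>Z. cmod (K1 z z')"]) (use that finZ in \<open>auto intro: sum_nonneg\<close>)
      finally show ?thesis by (simp add: b_def)
    qed
    show "0 \<le> Re (\<Sum>\<omega>\<in>\<Omega>. \<Sum>\<omega>'\<in>\<Omega>. cnj (D \<omega> \<omega>') * \<Psi> K1 \<omega> \<omega>')"
    proof (rule nonneg_slope[of "1 / b"])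
      show "0 < 1 / b" using b1 by simp
      fix t assume t: "0 < t" "t \<le> 1 / b"
      have 1: "psd (\<lambda>z z'. K z z' + of_real t * K1 z z')"
        using t by (intro psd_add psd_scale K K1) auto
      have 2: "cmod (K z z' + of_real t * K1 z z') \<le> (if z \<in> Z \<and> z' \<in> Z then c + 1 else 0)" for z z'
      proof (cases "z \<in> Z \<and> z' \<in> Z")
        case True
        have "cmod (K z z' + of_real t * K1 z z') \<le> cmod (K z z') + t * cmod (K1 z z')"
          using norm_triangle_ineq[of "K z z'" "of_real t * K1 z z'"] t by (simp add: norm_mult)
        also have "t * cmod (K1 z z') \<le> 1 / b * b" using t b True b1 by (intro mult_mono) auto
        finally show ?thesis using Kb[of z z'] True b1 by simp
      next
        case False
        thus ?thesis using sup Kb[of z z'] by auto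
      qed
      show "0 \<le> 2 * t * Re (\<Sum>\<omega>\<in>\<Omega>. \<Sum>\<omega>'\<in>\<Omega>. cnj (D \<omega> \<omega>') * \<Psi> K1 \<omega> \<omega>')
          + t\<^sup>2 * (\<Sum>\<omega>\<in>\<Omega>. \<Sum>\<omega>'\<in>\<Omega>. (cmod (\<Psi> K1 \<omega> \<omega>'))\<^sup>2)"
        by (rule var[OF 1 2])
    qed
  qed
  have B: "Re (\<Sum>\<omega>\<in>\<Omega>. \<Sum>\<omega>'\<in>\<Omega>. cnj (D \<omega> \<omega>') * \<Psi> K \<omega> \<omega>') \<le> 0"
  proof -
    have "0 \<le> - Re (\<Sum>\<omega>\<in>\<Omega>. \<Sum>\<omega>'\<in>\<Omega>. cnj (D \<omega> \<omega>') * \<Psi> K \<omega> \<omega>')"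
    proof (rule nonneg_slope[of 1])
      fix t :: real assume t: "0 < t" "t \<le> 1"
      have e: "K z z' + of_real (- t) * K z z' = of_real (1 - t) * K z z'" for z z'
        by (simp add: algebra_simps)
      have "cmod (of_real (1 - t) * K z z') \<le> (if z \<in> Z \<and> z' \<in> Z then c + 1 else 0)" for z z'
      proof -
        have "cmod (of_real (1 - t) * K z z') \<le> 1 * cmod (K z z')"
          unfolding norm_mult norm_of_real using t by (intro mult_right_mono) auto
        thus ?thesis using Kb[of z z'] by (auto split: if_splits)
      qed
      hence "0 \<le> 2 * (- t) * Re (\<Sum>\<omega>\<in>\<Omega>. \<Sum>\<omega>'\<in>\<Omega>. cnj (D \<omega> \<omega>') * \<Psi> K \<omega> \<omega>')
          + (- t)\<^sup>2 * (\<Sum>\<omega>\<in>\<Omega>. \<Sum>\<omega>'\<in>\<Omega>. (cmod (\<Psi> K \<omega> \<omega>'))\<^sup>2)"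
        using t by (intro var) (simp_all only: e psd_scale[OF K] diff_ge_0_iff_ge)
      thus "0 \<le> 2 * t * - Re (\<Sum>\<omega>\<in>\<Omega>. \<Sum>\<omega>'\<in>\<Omega>. cnj (D \<omega> \<omega>') * \<Psi> K \<omega> \<omega>')
          + t\<^sup>2 * (\<Sum>\<omega>\<in>\<Omega>. \<Sum>\<omega>'\<in>\<Omega>. (cmod (\<Psi> K \<omega> \<omega>'))\<^sup>2)"
        by (simp only: mult_minus_left mult_minus_right power2_minus)
    qed simp
    thus ?thesis by simp
  qed
  show ?thesis
    by (rule that[OF K]) (use A B in \<open>simp_all add: D_def\<close>)
qed

text \<open>A separation argument in which the residual \<open>D\<close> of the minimiser is the
  separating functional. Rank-one directions turn the first-order conditions into a contraction
  inequality for the form \<open>L\<close>; after a perturbation by a multiple of the identity,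
  \<open>dual\<close> applies and in the limit \<open>L\<close> is at \<open>e2\<close> at most what
  it is at \<open>e1\<close>. The remaining first-order condition says the opposite, with a gap of
  the squared size of \<open>D\<close>.\<close>

theorem solvable:
  assumes dual: "\<And>L \<rho>' \<epsilon>. psd L \<Longrightarrow> 0 < \<epsilon> \<Longrightarrow> \<rho>' < 1 \<Longrightarrow>
      (\<And>\<alpha>. \<epsilon> * (\<Sum>\<omega>\<in>\<Omega>. (cmod (\<alpha> \<omega>))\<^sup>2) \<le> Re (qform \<Omega> L \<alpha>)) \<Longrightarrow>
      (\<And>\<alpha>. (\<Sum>i<I. Re (qform \<Omega> L (\<lambda>\<omega>. \<Sum>z\<in>Z. \<Gamma> i \<omega> z * \<alpha> z)))
         \<le> \<rho>' * (\<Sum>j<J. Re (qform \<Omega> L (\<lambda>\<omega>. \<alpha> (\<omega>, j))))) \<Longrightarrow>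
      Re (qform \<Omega> L e2) \<le> Re (qform \<Omega> L e1)"
  shows "\<exists>K. psd K \<and> (\<forall>\<omega>\<in>\<Omega>. \<forall>\<omega>'\<in>\<Omega>. \<Psi> K \<omega> \<omega>' = target \<omega> \<omega>')"
proof -
  obtain K where K: "psd K" 
    and K1: "\<And>K1. psd K1 \<Longrightarrow> (\<And>z z'. z \<notin> Z \<or> z' \<notin> Z \<Longrightarrow> K1 z z' = 0) \<Longrightarrow>
        0 \<le> Re (\<Sum>\<omega>\<in>\<Omega>. \<Sum>\<omega>'\<in>\<Omega>. cnj (\<Psi> K \<omega> \<omega>' - target \<omega> \<omega>') * \<Psi> K1 \<omega> \<omega>')"
    and K2: "Re (\<Sum>\<omega>\<in>\<Omega>. \<Sum>\<omega>'\<in>\<Omega>. cnj (\<Psi> K \<omega> \<omega>' - target \<omega> \<omega>') * \<Psi> K \<omega> \<omega>') \<le> 0"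
    using energy_minimizer by blast
  define D where "D \<omega> \<omega>' = \<Psi> K \<omega> \<omega>' - target \<omega> \<omega>'" for \<omega> \<omega>'
  note K1 = K1[folded D_def] and K2 = K2[folded D_def]
  \<comment> \<open>Conjugated, so that pairing \<open>D\<close> with a rank-one kernel is a value
    of \<open>qform\<close>; cut off, so that positivity can be stated on the whole type.\<close>
  define L where "L \<omega> \<omega>' = (if \<omega> \<in> \<Omega> \<and> \<omega>' \<in> \<Omega> then cnj (D \<omega> \<omega>') else 0)" for \<omega> \<omega>'
  define sq where "sq \<alpha> = (\<Sum>\<omega>\<in>\<Omega>. (cmod (\<alpha> \<omega>))\<^sup>2)" for \<alpha> :: "'w \<Rightarrow> complex"
  have sq0: "0 \<le> sq \<alpha>" for \<alpha> unfolding sq_def by (intro sum_nonneg) auto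
  have Dherm: "D \<omega>' \<omega> = cnj (D \<omega> \<omega>')" for \<omega> \<omega>'
    unfolding D_def by (simp add: target_def \<Psi>_herm[OF K, of \<omega> \<omega>'] mult.commute)
  have Lherm: "L \<omega>' \<omega> = cnj (L \<omega> \<omega>')" for \<omega> \<omega>'
    by (simp add: L_def Dherm[of \<omega> \<omega>'])
  have pair: "(\<Sum>\<omega>\<in>\<Omega>. \<Sum>\<omega>'\<in>\<Omega>. cnj (D \<omega> \<omega>') * (a \<omega> * cnj (a \<omega>'))) = qform \<Omega> L a" for a
    unfolding qform_def by (intro sum.cong refl) (simp add: L_def)
  define act where "act i \<alpha> \<omega> = (\<Sum>z\<in>Z. \<Gamma> i \<omega> z * \<alpha> z)" for i \<alpha> \<omega>
  have ineq: "(\<Sum>i<I. Re (qform \<Omega> L (act i \<alpha>))) \<le> (\<Sum>j<J. Re (qform \<Omega> L (\<lambda>\<omega>. \<alpha> (\<omega>, j))))" for \<alpha>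
  proof -
    \<comment> \<open>Admissible directions are supported on \<open>Z\<close>; cutting
      \<open>\<alpha>\<close> off changes none of the sums.\<close>
    define \<beta> where "\<beta> z = (if z \<in> Z then \<alpha> z else 0)" for z
    have act: "act i \<alpha> \<omega> = (\<Sum>z\<in>Z. \<Gamma> i \<omega> z * \<beta> z)" for i \<omega>
      unfolding act_def by (intro sum.cong refl) (simp only: \<beta>_def if_True)
    have \<beta>j: "\<beta> (\<omega>, j) = \<alpha> (\<omega>, j)" if "\<omega> \<in> \<Omega>" "j < J" for \<omega> j
      using that by (simp add: \<beta>_def)
    have "(\<Sum>z\<in>Z. \<Sum>z'\<in>Z. \<Gamma> i \<omega> z * cnj (\<Gamma> i \<omega>' z') * (\<beta> z * cnj (\<beta> z'))) = act i \<alpha> \<omega> * cnj (act i \<alpha> \<omega>')" for i \<omega> \<omega>'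
      unfolding act cnj_sum sum_product by (intro sum.cong refl) simp
    hence "\<Psi> (\<lambda>z z'. \<beta> z * cnj (\<beta> z')) \<omega> \<omega>' = (\<Sum>j<J. \<alpha> (\<omega>, j) * cnj (\<alpha> (\<omega>', j)))
        - (\<Sum>i<I. act i \<alpha> \<omega> * cnj (act i \<alpha> \<omega>'))" if "\<omega> \<in> \<Omega>" "\<omega>' \<in> \<Omega>" for \<omega> \<omega>'
      using that by (simp add: \<Psi>_def \<beta>j)
    hence "(\<Sum>\<omega>\<in>\<Omega>. \<Sum>\<omega>'\<in>\<Omega>. cnj (D \<omega> \<omega>') * \<Psi> (\<lambda>z z'. \<beta> z * cnj (\<beta> z')) \<omega> \<omega>')
      = (\<Sum>\<omega>\<in>\<Omega>. \<Sum>\<omega>'\<in>\<Omega>. (\<Sum>j<J. cnj (D \<omega> \<omega>') * (\<alpha> (\<omega>, j) * cnj (\<alpha> (\<omega>', j))))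
        - (\<Sum>i<I. cnj (D \<omega> \<omega>') * (act i \<alpha> \<omega> * cnj (act i \<alpha> \<omega>'))))"
      by (intro sum.cong refl) (simp add: right_diff_distrib sum_distrib_left)
    also have "\<dots> = (\<Sum>j<J. qform \<Omega> L (\<lambda>\<omega>. \<alpha> (\<omega>, j))) - (\<Sum>i<I. qform \<Omega> L (act i \<alpha>))"
      unfolding sum_subtractf pair[symmetric]
      by (simp only: sum.swap[of _ "{..<J}" \<Omega>] sum.swap[of _ "{..<I}" \<Omega>])
    finally have "0 \<le> Re ((\<Sum>j<J. qform \<Omega> L (\<lambda>\<omega>. \<alpha> (\<omega>, j))) - (\<Sum>i<I. qform \<Omega> L (act i \<alpha>)))"
      using K1[OF psd_rank_one, of \<beta>] by (simp only: \<beta>_def if_False mult_zero_left mult_zero_right simp_thms complex_cnj_zero split: if_splits) auto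
    thus ?thesis by simp
  qed
  define C where "C = (\<Sum>\<omega>\<in>\<Omega>. \<Sum>\<omega>'\<in>\<Omega>. cmod (L \<omega> \<omega>'))"
  have C0: "0 \<le> C" unfolding C_def by (intro sum_nonneg) auto
  have Cb: "\<bar>Re (qform \<Omega> L a)\<bar> \<le> C * sq a" for a
  proof -
    have m: "(cmod (a \<omega>))\<^sup>2 \<le> sq a" if "\<omega> \<in> \<Omega>" for \<omega>
      unfolding sq_def by (rule member_le_sum) (use that fin in auto)
    have "cmod (a \<omega>) * cmod (a \<omega>') \<le> sq a" if "\<omega> \<in> \<Omega>" "\<omega>' \<in> \<Omega>" for \<omega> \<omega>'
      using m[OF that(1)] m[OF that(2)] sum_squares_bound[of "cmod (a \<omega>)" "cmod (a \<omega>')"] by linarith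
    hence "cmod (qform \<Omega> L a) \<le> (\<Sum>\<omega>\<in>\<Omega>. \<Sum>\<omega>'\<in>\<Omega>. sq a * cmod (L \<omega> \<omega>'))"
      unfolding qform_def
      by (intro order_trans[OF norm_sum] sum_mono) (auto simp: norm_mult intro!: mult_right_mono)
    also have "\<dots> = C * sq a" by (simp add: C_def sum_distrib_left mult.commute)
    finally show ?thesis using abs_Re_le_cmod order_trans by blast
  qed
  \<comment> \<open>Feed \<open>a\<close> into the component \<open>j = 0\<close>, available as
    \<open>1 \<le> J\<close>, and iterate \<open>ineq\<close>: each round multiplies the total
    squared norm by at most \<open>\<rho>\<close>, and \<open>L\<close> is bounded by
    \<open>C\<close> times squared norms. So the form at \<open>a\<close> is at least
    \<open>- (C * \<rho> ^ k * sq a)\<close> for every \<open>k\<close>.\<close>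
  have Lnonneg: "0 \<le> Re (qform \<Omega> L a)" for a
  proof -
    define e0 where "e0 a z = (if snd z = 0 then a (fst z) else 0)" for a :: "'w \<Rightarrow> complex" and z :: "'w \<times> nat"
    have bound: "- (C * \<rho> ^ k * sq a) \<le> Re (qform \<Omega> L a)" for k a
    proof (induction k arbitrary: a)
      case 0
      show ?case using Cb[of a] by simp
    next
      case (Suc k)
      have "(\<Sum>j<J. Re (qform \<Omega> L (\<lambda>\<omega>. e0 a (\<omega>, j)))) = (\<Sum>j\<in>{0}. Re (qform \<Omega> L (\<lambda>\<omega>. e0 a (\<omega>, j))))"
        using J by (intro sum.mono_neutral_right) (auto simp: e0_def qform_def)
      hence 1: "(\<Sum>i<I. Re (qform \<Omega> L (act i (e0 a)))) \<le> Re (qform \<Omega> L a)"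
        using ineq[of "e0 a"] by (simp add: e0_def)
      have "(\<Sum>z\<in>Z. (cmod (e0 a z))\<^sup>2) = (\<Sum>\<omega>\<in>\<Omega>. \<Sum>j<J. (cmod (e0 a (\<omega>, j)))\<^sup>2)"
        by (simp add: sum.cartesian_product')
      also have "\<dots> = (\<Sum>\<omega>\<in>\<Omega>. \<Sum>j\<in>{0}. (cmod (e0 a (\<omega>, j)))\<^sup>2)"
        using J by (intro sum.cong refl sum.mono_neutral_right) (auto simp: e0_def)
      finally have "(\<Sum>z\<in>Z. (cmod (e0 a z))\<^sup>2) = sq a" by (simp add: e0_def sq_def)
      hence 2: "(\<Sum>i<I. sq (act i (e0 a))) \<le> \<rho> * sq a"
        using contr[of "e0 a"] by (simp add: sq_def act_def)
      have "- (C * \<rho> ^ Suc k * sq a) \<le> - (C * \<rho> ^ k * (\<Sum>i<I. sq (act i (e0 a))))"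
        using mult_left_mono[OF 2, of "C * \<rho> ^ k"] C0 \<rho> by (simp add: algebra_simps)
      also have "\<dots> = (\<Sum>i<I. - (C * \<rho> ^ k * sq (act i (e0 a))))"
        by (simp add: sum_distrib_left sum_negf)
      also have "\<dots> \<le> (\<Sum>i<I. Re (qform \<Omega> L (act i (e0 a))))"
        by (intro sum_mono Suc)
      finally show ?case using 1 by linarith
    qed
    have "(\<lambda>k. - (C * \<rho> ^ k * sq a)) \<longlonglongrightarrow> - (C * 0 * sq a)"
      using \<rho> by (intro tendsto_intros LIMSEQ_realpow_zero)
    thus ?thesis using LIMSEQ_le_const2[of _ _ "Re (qform \<Omega> L a)"] bound by (auto intro: LIMSEQ_le_const2)
  qed
  have key: "Re (qform \<Omega> L e2) + \<epsilon> * sq e2 \<le> Re (qform \<Omega> L e1) + \<epsilon> * sq e1" if \<epsilon>: "0 < \<epsilon>" for \<epsilon>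
  proof -
    define L' where "L' \<omega> \<omega>' = L \<omega> \<omega>' + of_real \<epsilon> * (if \<omega> = \<omega>' \<and> \<omega> \<in> \<Omega> then 1 else 0)" for \<omega> \<omega>'
    have one: "qform \<Omega> (\<lambda>\<omega> \<omega>'. if \<omega> = \<omega>' \<and> \<omega> \<in> \<Omega> then 1 else 0) a = of_real (sq a)" for a
    proof -
      have "qform \<Omega> (\<lambda>\<omega> \<omega>'. if \<omega> = \<omega>' \<and> \<omega> \<in> \<Omega> then 1 else 0) a 
        = (\<Sum>\<omega>\<in>\<Omega>. \<Sum>\<omega>'\<in>\<Omega>. if \<omega> = \<omega>' then a \<omega> * cnj (a \<omega>) else 0)"
        unfolding qform_def by (intro sum.cong refl) auto
      thus ?thesis using fin by (simp add: sq_def complex_norm_square del: of_real_power)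
    qed
    have q': "Re (qform \<Omega> L' a) = Re (qform \<Omega> L a) + \<epsilon> * sq a" for a
      unfolding L'_def qform_add qform_scale one by simp
    \<comment> \<open>For \<open>l = Re (qform \<Omega> L a)\<close> and \<open>s = sq a\<close>,
      the quotient of \<open>l + \<epsilon> * \<rho> * s\<close> by
      \<open>l + \<epsilon> * s\<close> grows with \<open>l\<close>, and
      \<open>l \<le> C * s\<close>; this is its value at \<open>l = C * s\<close>.\<close>
    define \<rho>' where "\<rho>' = (C + \<epsilon> * \<rho>) / (C + \<epsilon>)"
    have C\<epsilon>: "0 < C + \<epsilon>" using C0 \<epsilon> by simp
    have "Re (qform \<Omega> L' e2) \<le> Re (qform \<Omega> L' e1)"
    proof (rule dual[of L' \<epsilon> \<rho>'])
      show "psd L'"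
      proof (rule psdI)
        show "L' b a = cnj (L' a b)" for a b
          by (auto simp: L'_def Lherm[of a b])
        fix A c assume A: "finite (A :: 'w set)"
        have "qform A L' c = qform (A \<union> \<Omega>) L' (\<lambda>w. if w \<in> A then c w else 0)"
          by (subst qform_superset[of "A \<union> \<Omega>" A]) (use A fin in \<open>auto intro: qform_cong\<close>)
        also have "\<dots> = (\<Sum>a\<in>A \<union> \<Omega>. \<Sum>b\<in>\<Omega>. (if a \<in> A then c a else 0) * cnj (if b \<in> A then c b else 0) * L' a b)"
          unfolding qform_def
          by (intro sum.cong refl sum.mono_neutral_right) (use A fin in \<open>auto simp: L'_def L_def\<close>)
        also have "\<dots> = qform \<Omega> L' (\<lambda>w. if w \<in> A then c w else 0)"
          unfolding qform_def
          by (rule sum.mono_neutral_right) (use A fin in \<open>auto simp: L'_def L_def\<close>)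
        finally show "0 \<le> Re (qform A L' c)"
          using Lnonneg \<epsilon> sq0 by (simp add: q')
      qed
      show "\<rho>' < 1" using C\<epsilon> \<epsilon> \<rho> by (simp add: \<rho>'_def)
      show "\<epsilon> * (\<Sum>\<omega>\<in>\<Omega>. (cmod (a \<omega>))\<^sup>2) \<le> Re (qform \<Omega> L' a)" for a
        using Lnonneg[of a] by (simp add: q' sq_def)
      fix \<alpha> :: "'w \<times> nat \<Rightarrow> complex"
      have "(\<Sum>i<I. sq (act i \<alpha>)) \<le> \<rho> * (\<Sum>z\<in>Z. (cmod (\<alpha> z))\<^sup>2)"
        using contr[of \<alpha>] by (simp add: sq_def act_def)
      also have "(\<Sum>z\<in>Z. (cmod (\<alpha> z))\<^sup>2) = (\<Sum>j<J. sq (\<lambda>\<omega>. \<alpha> (\<omega>, j)))"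
        by (simp add: sq_def sum.cartesian_product' sum.swap[of _ "{..<J}"])
      finally have 1: "(\<Sum>i<I. sq (act i \<alpha>)) \<le> \<rho> * (\<Sum>j<J. sq (\<lambda>\<omega>. \<alpha> (\<omega>, j)))" .
      have 2: "Re (qform \<Omega> L a) + \<epsilon> * \<rho> * sq a \<le> \<rho>' * (Re (qform \<Omega> L a) + \<epsilon> * sq a)" for a
      proof -
        have "Re (qform \<Omega> L a) \<le> C * sq a" using Cb[of a] by simp
        hence "\<epsilon> * (1 - \<rho>) * Re (qform \<Omega> L a) \<le> \<epsilon> * (1 - \<rho>) * (C * sq a)"
          using \<epsilon> \<rho> by (intro mult_left_mono) auto
        hence "(C + \<epsilon>) * (Re (qform \<Omega> L a) + \<epsilon> * \<rho> * sq a) \<le> (C + \<epsilon> * \<rho>) * (Re (qform \<Omega> L a) + \<epsilon> * sq a)"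
          by (simp add: algebra_simps)
        thus ?thesis using C\<epsilon> by (simp add: \<rho>'_def field_simps)
      qed
      have "(\<Sum>i<I. Re (qform \<Omega> L' (act i \<alpha>))) = (\<Sum>i<I. Re (qform \<Omega> L (act i \<alpha>))) + \<epsilon> * (\<Sum>i<I. sq (act i \<alpha>))"
        by (simp add: q' sum.distrib sum_distrib_left)
      also have "\<dots> \<le> (\<Sum>j<J. Re (qform \<Omega> L (\<lambda>\<omega>. \<alpha> (\<omega>, j)))) + \<epsilon> * (\<rho> * (\<Sum>j<J. sq (\<lambda>\<omega>. \<alpha> (\<omega>, j))))"
        by (intro add_mono ineq mult_left_mono 1) (use \<epsilon> in auto)
      also have "\<dots> = (\<Sum>j<J. Re (qform \<Omega> L (\<lambda>\<omega>. \<alpha> (\<omega>, j))) + \<epsilon> * \<rho> * sq (\<lambda>\<omega>. \<alpha> (\<omega>, j)))"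
        by (simp add: sum.distrib sum_distrib_left mult.assoc)
      also have "\<dots> \<le> (\<Sum>j<J. \<rho>' * (Re (qform \<Omega> L (\<lambda>\<omega>. \<alpha> (\<omega>, j))) + \<epsilon> * sq (\<lambda>\<omega>. \<alpha> (\<omega>, j))))"
        by (intro sum_mono 2)
      finally show "(\<Sum>i<I. Re (qform \<Omega> L' (\<lambda>\<omega>. \<Sum>z\<in>Z. \<Gamma> i \<omega> z * \<alpha> z)))
         \<le> \<rho>' * (\<Sum>j<J. Re (qform \<Omega> L' (\<lambda>\<omega>. \<alpha> (\<omega>, j))))"
        by (simp only: q' sum_distrib_left act_def[abs_def])
    qed (use \<epsilon> in simp)
    thus ?thesis by (simp add: q')
  qed
  have "Re (qform \<Omega> L e2) \<le> Re (qform \<Omega> L e1)"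
  proof (rule field_le_epsilon)
    fix e :: real assume e: "0 < e"
    \<comment> \<open>The perturbation is chosen so small that its contribution at \<open>e1\<close>
      is at most \<open>e\<close>.\<close>
    have "e / (1 + sq e1) * sq e1 \<le> e" using e sq0[of e1] by (simp add: field_simps)
    moreover have "0 \<le> e / (1 + sq e1) * sq e2" using e sq0[of e1] sq0[of e2] by simp
    ultimately show "Re (qform \<Omega> L e2) \<le> Re (qform \<Omega> L e1) + e"
      using key[of "e / (1 + sq e1)"] e sq0[of e1] by fastforce
  qed
  \<comment> \<open>The target equals \<open>\<Psi> K - D\<close>, so pairing it with
    \<open>D\<close> gives the pairing of \<open>D\<close> with \<open>\<Psi> K\<close>, nonpositive
    by \<open>K2\<close>, minus the squared size of \<open>D\<close>.\<close>
  moreover have "Re (qform \<Omega> L e1) - Re (qform \<Omega> L e2) \<le> - (\<Sum>\<omega>\<in>\<Omega>. \<Sum>\<omega>'\<in>\<Omega>. (cmod (D \<omega> \<omega>'))\<^sup>2)"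
  proof -
    have "qform \<Omega> L e1 - qform \<Omega> L e2 = (\<Sum>\<omega>\<in>\<Omega>. \<Sum>\<omega>'\<in>\<Omega>. cnj (D \<omega> \<omega>') * (\<Psi> K \<omega> \<omega>' - D \<omega> \<omega>'))"
      unfolding pair[symmetric] sum_subtractf[symmetric]
      by (intro sum.cong refl) (simp add: D_def target_def algebra_simps)
    also have "\<dots> = (\<Sum>\<omega>\<in>\<Omega>. \<Sum>\<omega>'\<in>\<Omega>. cnj (D \<omega> \<omega>') * \<Psi> K \<omega> \<omega>') 
        - of_real (\<Sum>\<omega>\<in>\<Omega>. \<Sum>\<omega>'\<in>\<Omega>. (cmod (D \<omega> \<omega>'))\<^sup>2)"
      by (simp add: right_diff_distrib sum_subtractf complex_norm_square mult.commute[of "cnj _"] del: of_real_power)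
    finally show ?thesis using K2 by (simp only: minus_complex.sel(1)[symmetric]) (simp only: minus_complex.sel(1) Re_complex_of_real)
  qed
  ultimately have "(\<Sum>\<omega>\<in>\<Omega>. \<Sum>\<omega>'\<in>\<Omega>. (cmod (D \<omega> \<omega>'))\<^sup>2) \<le> 0" by linarith
  hence "(\<Sum>\<omega>\<in>\<Omega>. \<Sum>\<omega>'\<in>\<Omega>. (cmod (D \<omega> \<omega>'))\<^sup>2) = 0"
    by (intro antisym sum_nonneg) auto
  hence "D \<omega> \<omega>' = 0" if "\<omega> \<in> \<Omega>" "\<omega>' \<in> \<Omega>" for \<omega> \<omega>'
    using fin that by (simp add: sum_nonneg_eq_0_iff sum_nonneg)
  thus ?thesis using K by (auto simp: D_def)
qed

end

section \<open>Operator norms and evaluation of noncommutative polynomials\<close>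

lemma sum_blocks: "(\<Sum>r<k * n. f r) = (\<Sum>i<k. \<Sum>b<n. f (i * n + b :: nat))"
proof (induction k)
  case (Suc k)
  have "(\<Sum>r<Suc k * n. f r) = (\<Sum>r<k * n. f r) + (\<Sum>r\<in>{k * n..<k * n + n}. f r)"
    by (subst sum.union_disjoint[symmetric]) (auto intro!: sum.cong)
  also have "(\<Sum>r\<in>{k * n..<k * n + n}. f r) = (\<Sum>b<n. f (k * n + b))"
    using sum.shift_bounds_nat_ivl[of f 0 "k * n" n] by (simp add: atLeast0LessThan add.commute)
  finally show ?case using Suc by simp
qed simp

lemma block_index_less: "i < k \<Longrightarrow> b < n \<Longrightarrow> i * n + b < k * (n :: nat)"
proof -
  assume "i < k" "b < n"
  hence "i * n + b < Suc i * n" by simp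
  also have "\<dots> \<le> k * n" using \<open>i < k\<close> by (intro mult_le_mono1) simp
  finally show ?thesis .
qed

lemma vnorm_sq: "(vnorm v)\<^sup>2 = (\<Sum>i<dim_vec v. (cmod (v $ i))\<^sup>2)"
  unfolding vnorm_def L2_set_def by (simp add: sum_nonneg)

lemma vnorm_nonneg: "0 \<le> vnorm v"
  unfolding vnorm_def by simp

lemma vnorm_smult: "vnorm (c \<cdot>\<^sub>v v) = cmod c * vnorm v"
proof -
  have "(vnorm (c \<cdot>\<^sub>v v))\<^sup>2 = (cmod c * vnorm v)\<^sup>2"
    by (simp add: vnorm_sq power_mult_distrib norm_mult sum_distrib_left)
  thus ?thesis by (simp add: vnorm_nonneg power2_eq_iff_nonneg)
qed

lemma mult_mat_vec_index: "A \<in> carrier_mat nr nc \<Longrightarrow> v \<in> carrier_vec nc \<Longrightarrow> i < nr \<Longrightarrow>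
    (A *\<^sub>v v) $ i = (\<Sum>j<nc. A $$ (i, j) * v $ j)"
  by (auto simp: scalar_prod_def atLeast0LessThan intro!: sum.cong)

lemma mult_mat_index: "A \<in> carrier_mat nr k \<Longrightarrow> B \<in> carrier_mat k nc \<Longrightarrow> i < nr \<Longrightarrow> j < nc \<Longrightarrow>
    (A * B) $$ (i, j) = (\<Sum>l<k. A $$ (i, l) * B $$ (l, j))"
  by (auto simp: scalar_prod_def atLeast0LessThan intro!: sum.cong)

text \<open>A crude bound by the entries; it makes the supremum in \<open>op_norm\<close> that of a
  bounded set.\<close>

lemma mult_mat_vec_bounded:
  obtains C where "0 \<le> C" "\<And>v :: complex vec. v \<in> carrier_vec (dim_col A) \<Longrightarrow> vnorm (A *\<^sub>v v) \<le> C * vnorm v"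
proof
  let ?C = "\<Sum>i<dim_row A. \<Sum>j<dim_col A. cmod (A $$ (i, j))"
  show "0 \<le> ?C" by (intro sum_nonneg) auto
  fix v :: "complex vec" assume v: "v \<in> carrier_vec (dim_col A)"
  have c: "cmod (v $ j) \<le> vnorm v" if "j < dim_col A" for j
    unfolding vnorm_def using that v by (intro member_le_L2_set) auto
  have "vnorm (A *\<^sub>v v) \<le> (\<Sum>i<dim_row A. cmod ((A *\<^sub>v v) $ i))"
    unfolding vnorm_def dim_mult_mat_vec by (rule L2_set_le_sum) simp
  also have "\<dots> \<le> (\<Sum>i<dim_row A. \<Sum>j<dim_col A. cmod (A $$ (i, j)) * vnorm v)"
  proof (rule sum_mono)
    fix i assume "i \<in> {..<dim_row A}"
    hence "(A *\<^sub>v v) $ i = (\<Sum>j<dim_col A. A $$ (i, j) * v $ j)"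
      using v by (intro mult_mat_vec_index) auto
    also have "cmod \<dots> \<le> (\<Sum>j<dim_col A. cmod (A $$ (i, j)) * vnorm v)"
      by (intro order_trans[OF norm_sum] sum_mono) (auto simp: norm_mult intro!: mult_left_mono c)
    finally show "cmod ((A *\<^sub>v v) $ i) \<le> (\<Sum>j<dim_col A. cmod (A $$ (i, j)) * vnorm v)" .
  qed
  also have "\<dots> = ?C * vnorm v" by (simp add: sum_distrib_right)
  finally show "vnorm (A *\<^sub>v v) \<le> ?C * vnorm v" .
qed

lemma op_norm_bound:
  assumes v: "v \<in> carrier_vec (dim_col A)"
  shows "vnorm (A *\<^sub>v v) \<le> op_norm A * vnorm v"
proof -
  obtain C where C: "0 \<le> C" "\<And>v. v \<in> carrier_vec (dim_col A) \<Longrightarrow> vnorm (A *\<^sub>v v) \<le> C * vnorm v"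
    using mult_mat_vec_bounded by blast
  show ?thesis
  proof (cases "vnorm v = 0")
    case True
    thus ?thesis using C(2)[OF v] by simp
  next
    case False
    define u where "u = complex_of_real (1 / vnorm v) \<cdot>\<^sub>v v"
    have u: "u \<in> {v \<in> carrier_vec (dim_col A). vnorm v \<le> 1}"
      using v False vnorm_nonneg[of v] by (simp add: u_def vnorm_smult norm_divide)
    have "bdd_above ((\<lambda>v. vnorm (A *\<^sub>v v)) ` {v \<in> carrier_vec (dim_col A). vnorm v \<le> 1})"
    proof (rule bdd_aboveI2)
      fix w assume "w \<in> {v \<in> carrier_vec (dim_col A). vnorm v \<le> 1}"
      thus "vnorm (A *\<^sub>v w) \<le> C"
        using C(2)[of w] mult_left_mono[of "vnorm w" 1 C] C(1) by simp
    qed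
    hence "vnorm (A *\<^sub>v u) \<le> op_norm A"
      unfolding op_norm_def by (rule cSUP_upper[OF u])
    moreover have "A *\<^sub>v u = complex_of_real (1 / vnorm v) \<cdot>\<^sub>v (A *\<^sub>v v)"
      unfolding u_def using v by (intro mult_mat_vec[of _ "dim_row A" "dim_col A"]) auto
    ultimately show ?thesis
      using False vnorm_nonneg[of v] by (simp add: vnorm_smult norm_divide field_simps)
  qed
qed

lemma op_norm_le:
  assumes "\<And>v. v \<in> carrier_vec (dim_col A) \<Longrightarrow> vnorm (A *\<^sub>v v) \<le> r * vnorm v" and "0 \<le> r"
  shows "op_norm A \<le> r"
  unfolding op_norm_def
proof (rule cSUP_least)
  have "0\<^sub>v (dim_col A) \<in> {v \<in> carrier_vec (dim_col A). vnorm v \<le> 1}"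
    by (simp add: vnorm_def L2_set_def)
  thus "{v \<in> carrier_vec (dim_col A). vnorm v \<le> 1} \<noteq> {}" by blast
  fix v assume v: "v \<in> {v \<in> carrier_vec (dim_col A). vnorm v \<le> 1}"
  hence "r * vnorm v \<le> r * 1" using \<open>0 \<le> r\<close> by (intro mult_left_mono) auto
  thus "vnorm (A *\<^sub>v v) \<le> r" using assms(1)[of v] v by simp
qed

lemma op_norm_nonneg: "0 \<le> op_norm A"
proof -
  obtain C where C: "0 \<le> C" "\<And>v. v \<in> carrier_vec (dim_col A) \<Longrightarrow> vnorm (A *\<^sub>v v) \<le> C * vnorm v"
    using mult_mat_vec_bounded by blast
  have "bdd_above ((\<lambda>v. vnorm (A *\<^sub>v v)) ` {v \<in> carrier_vec (dim_col A). vnorm v \<le> 1})"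
  proof (rule bdd_aboveI2)
    fix w assume "w \<in> {v \<in> carrier_vec (dim_col A). vnorm v \<le> 1}"
    thus "vnorm (A *\<^sub>v w) \<le> C"
      using C(2)[of w] mult_left_mono[of "vnorm w" 1 C] C(1) by simp
  qed
  moreover have "0\<^sub>v (dim_col A) \<in> {v \<in> carrier_vec (dim_col A). vnorm v \<le> 1}"
    by (simp add: vnorm_def L2_set_def)
  ultimately have "vnorm (A *\<^sub>v 0\<^sub>v (dim_col A)) \<le> op_norm A"
    unfolding op_norm_def by (intro cSUP_upper)
  thus ?thesis using vnorm_nonneg order_trans by blast
qed

section \<open>Evaluation of words, polynomials and matrices of polynomials\<close>

lemma word_eval_carrier:
  assumes "x \<in> nc_level d n" "set w \<subseteq> {..<d}"
  shows "word_eval n x w \<in> carrier_mat n n"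
  using assms(2)
proof (induction w)
  case (Cons k w)
  have "x ! k \<in> carrier_mat n n"
    using assms(1) Cons.prems nth_mem[of k x] by (auto simp: nc_level_def)
  thus ?case using Cons by (simp add: word_eval_def)
qed (simp add: word_eval_def)

lemma word_eval_intertwine:
  assumes x: "x \<in> nc_level d n" and y: "y \<in> nc_level d m" and S: "S \<in> carrier_mat m n"
    and int: "\<And>r. r < d \<Longrightarrow> S * (x ! r) = (y ! r) * S"
    and w: "set w \<subseteq> {..<d}"
  shows "S * word_eval n x w = word_eval m y w * S"
  using w
proof (induction w)
  case (Cons k w)
  have k: "k < d" and w: "set w \<subseteq> {..<d}" using Cons.prems by auto
  have xk: "x ! k \<in> carrier_mat n n" and yk: "y ! k \<in> carrier_mat m m"
    using x y k by (auto simp: nc_level_def)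
  note wx = word_eval_carrier[OF x w] and wy = word_eval_carrier[OF y w]
  have "S * word_eval n x (k # w) = S * (x ! k * word_eval n x w)" by (simp add: word_eval_def)
  also have "\<dots> = (S * x ! k) * word_eval n x w" by (rule assoc_mult_mat[symmetric, OF S xk wx])
  also have "\<dots> = y ! k * S * word_eval n x w" by (simp add: int[OF k])
  also have "\<dots> = y ! k * (S * word_eval n x w)" by (rule assoc_mult_mat[OF yk S wx])
  also have "\<dots> = y ! k * (word_eval m y w * S)" by (simp add: Cons.IH[OF w])
  also have "\<dots> = y ! k * word_eval m y w * S" by (rule assoc_mult_mat[symmetric, OF yk wy S])
  finally show ?case by (simp add: word_eval_def)
qed (use S in \<open>simp add: word_eval_def\<close>)

lemma poly_eval_carrier: "poly_eval n x p \<in> carrier_mat n n"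
  by (simp add: poly_eval_def)

lemma poly_eval_intertwine:
  assumes x: "x \<in> nc_level d n" and y: "y \<in> nc_level d m" and S: "S \<in> carrier_mat m n"
    and int: "\<And>r. r < d \<Longrightarrow> S * (x ! r) = (y ! r) * S"
    and p: "p \<in> nc_polys d"
  shows "S * poly_eval n x p = poly_eval m y p * S"
proof (rule eq_matI)
  fix a b assume "a < dim_row (poly_eval m y p * S)" "b < dim_col (poly_eval m y p * S)"
  hence ab: "a < m" "b < n" using S by (auto simp: poly_eval_def)
  let ?K = "Poly_Mapping.keys p"
  have w: "set w \<subseteq> {..<d}" if "w \<in> ?K" for w using p that by (auto simp: nc_polys_def)
  have "(S * poly_eval n x p) $$ (a, b)
      = (\<Sum>c<n. S $$ (a, c) * (\<Sum>w\<in>?K. Poly_Mapping.lookup p w * word_eval n x w $$ (c, b)))"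
    using ab by (subst mult_mat_index[OF S poly_eval_carrier]) (auto simp: poly_eval_def)
  also have "\<dots> = (\<Sum>w\<in>?K. Poly_Mapping.lookup p w * (\<Sum>c<n. S $$ (a, c) * word_eval n x w $$ (c, b)))"
    by (simp add: sum_distrib_left sum.swap[of _ ?K] algebra_simps)
  also have "\<dots> = (\<Sum>w\<in>?K. Poly_Mapping.lookup p w * (\<Sum>c<m. word_eval m y w $$ (a, c) * S $$ (c, b)))"
  proof (rule sum.cong[OF refl])
    fix w assume "w \<in> ?K"
    note w = w[OF this]
    have "(\<Sum>c<n. S $$ (a, c) * word_eval n x w $$ (c, b)) = (\<Sum>c<m. word_eval m y w $$ (a, c) * S $$ (c, b))"
      using word_eval_intertwine[OF x y S int w] ab
        mult_mat_index[OF S word_eval_carrier[OF x w], of a b] mult_mat_index[OF word_eval_carrier[OF y w] S, of a b]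
      by simp
    thus "Poly_Mapping.lookup p w * (\<Sum>c<n. S $$ (a, c) * word_eval n x w $$ (c, b))
        = Poly_Mapping.lookup p w * (\<Sum>c<m. word_eval m y w $$ (a, c) * S $$ (c, b))" by simp
  qed
  also have "\<dots> = (\<Sum>c<m. (\<Sum>w\<in>?K. Poly_Mapping.lookup p w * word_eval m y w $$ (a, c)) * S $$ (c, b))"
    by (simp add: sum_distrib_left sum_distrib_right sum.swap[of _ ?K] algebra_simps)
  also have "\<dots> = (poly_eval m y p * S) $$ (a, b)"
    using ab by (subst mult_mat_index[OF poly_eval_carrier S]) (auto simp: poly_eval_def)
  finally show "(S * poly_eval n x p) $$ (a, b) = (poly_eval m y p * S) $$ (a, b)" .
qed (use S in \<open>auto simp: poly_eval_def\<close>)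

lemma delta_eval_carrier:
  "\<delta> \<in> carrier_mat I J \<Longrightarrow> delta_eval n x \<delta> \<in> carrier_mat (I * n) (J * n)"
  by (auto simp: delta_eval_def)

lemma delta_eval_index:
  assumes "\<delta> \<in> carrier_mat I J" "i < I" "j < J" "b < n" "c < n"
  shows "delta_eval n x \<delta> $$ (i * n + b, j * n + c) = poly_eval n x (\<delta> $$ (i, j)) $$ (b, c)"
  using assms block_index_less[of i I b n] block_index_less[of j J c n]
  by (auto simp: delta_eval_def)

text \<open>The norm bound in block coordinates, the form in which \<open>psd_contraction\<close>
  can carry it over to Gram vectors.\<close>

lemma delta_eval_contraction:
  assumes \<delta>: "\<delta> \<in> carrier_mat I J"
  shows "(\<Sum>i<I. \<Sum>b<n. (cmod (\<Sum>j<J. \<Sum>c<n. delta_eval n x \<delta> $$ (i * n + b, j * n + c) * \<alpha> j c))\<^sup>2)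
    \<le> (op_norm (delta_eval n x \<delta>))\<^sup>2 * (\<Sum>j<J. \<Sum>c<n. (cmod (\<alpha> j c))\<^sup>2)"
proof -
  let ?G = "delta_eval n x \<delta>"
  note G = delta_eval_carrier[OF \<delta>, of n x]
  define v where "v = vec (J * n) (\<lambda>r. \<alpha> (r div n) (r mod n))"
  have v: "v \<in> carrier_vec (J * n)" by (simp add: v_def)
  have vi: "v $ (j * n + c) = \<alpha> j c" if "j < J" "c < n" for j c
    using that block_index_less[OF that] by (simp add: v_def)
  have "(vnorm (?G *\<^sub>v v))\<^sup>2 \<le> (op_norm ?G * vnorm v)\<^sup>2"
    using G v by (intro power_mono op_norm_bound vnorm_nonneg) auto
  moreover have "(vnorm v)\<^sup>2 = (\<Sum>j<J. \<Sum>c<n. (cmod (\<alpha> j c))\<^sup>2)"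
    using v by (simp add: vnorm_sq sum_blocks vi)
  moreover have "(?G *\<^sub>v v) $ (i * n + b) = (\<Sum>j<J. \<Sum>c<n. ?G $$ (i * n + b, j * n + c) * \<alpha> j c)"
    if "i < I" "b < n" for i b
    by (subst mult_mat_vec_index[OF G v block_index_less[OF that]]) (simp add: sum_blocks vi)
  hence "(vnorm (?G *\<^sub>v v))\<^sup>2 = (\<Sum>i<I. \<Sum>b<n. (cmod (\<Sum>j<J. \<Sum>c<n. ?G $$ (i * n + b, j * n + c) * \<alpha> j c))\<^sup>2)"
    using G by (simp add: vnorm_sq sum_blocks del: index_mult_mat_vec)
  ultimately show ?thesis by (simp add: power_mult_distrib)
qed

lemma injective_mat_inverse:
  fixes A :: "complex mat"
  assumes A: "A \<in> carrier_mat n n" and inj: "\<And>v. v \<in> carrier_vec n \<Longrightarrow> A *\<^sub>v v = 0\<^sub>v n \<Longrightarrow> v = 0\<^sub>v n"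
  obtains B where "B \<in> carrier_mat n n" "A * B = 1\<^sub>m n" "B * A = 1\<^sub>m n"
proof -
  have "det A \<noteq> 0"
    using det_0_iff_vec_prod_zero_field[OF A] inj by blast
  from det_non_zero_imp_unit[OF A this, unfolded Units_def, of "()"] show ?thesis
    using that by (auto simp: ring_mat_def)
qed

text \<open>As \<open>1 \<le> d\<close>, the first matrix of a tuple determines its level, so the
  level hidden in the union that defines the polyhedron is the given \<open>n\<close>.\<close>

lemma nc_polyhedron_level:
  assumes "1 \<le> d" "x \<in> nc_polyhedron d \<delta>" "x \<in> nc_level d n"
  shows "1 \<le> n" "op_norm (delta_eval n x \<delta>) < 1"
proof -
  obtain k where k: "1 \<le> k" "x \<in> nc_level d k" "op_norm (delta_eval k x \<delta>) < 1"
    using assms(2) by (auto simp: nc_polyhedron_def)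
  have "x ! 0 \<in> set x"
    using assms(1,3) by (intro nth_mem) (simp add: nc_level_def)
  hence "x ! 0 \<in> carrier_mat n n" "x ! 0 \<in> carrier_mat k k"
    using assms(3) k(2) by (auto simp: nc_level_def)
  hence "n = k" by (metis carrier_matD(1))
  thus "1 \<le> n" "op_norm (delta_eval n x \<delta>) < 1" using k by auto
qed

lemma vnorm_sq_le_imp: "(vnorm v)\<^sup>2 \<le> r * (vnorm w)\<^sup>2 \<Longrightarrow> vnorm v \<le> sqrt r * vnorm w"
  using real_sqrt_le_mono[of "(vnorm v)\<^sup>2" "r * (vnorm w)\<^sup>2"] by (simp add: real_sqrt_mult vnorm_nonneg)

text \<open>Writing \<open>L = R\<^sup>* R\<close>, the point \<open>y = R (\<Oplus>\<^sub>s x\<^sub>s) R\<^sup>-\<^sup>1\<close> belongs to the polyhedron, and \<open>R\<close> intertwines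
  each \<open>x\<^sub>s\<close> with \<open>y\<close>; so the bound on \<open>\<phi>(y)\<close> is a bound on \<open>\<Oplus>\<^sub>s \<phi>(x\<^sub>s)\<close> in the norm given by \<open>L\<close>.\<close>

lemma nc_function_contractive_for_form:
  fixes pt :: "'s \<Rightarrow> complex mat list" and lv :: "'s \<Rightarrow> nat"
  assumes d: "1 \<le> d" and \<delta>: "\<delta> \<in> carrier_mat I J" and polys: "elements_mat \<delta> \<subseteq> nc_polys d"
    and \<phi>: "\<phi> \<in> H_inf_1 d \<delta>" and T: "finite T"
    and pt: "\<And>s. s \<in> T \<Longrightarrow> pt s \<in> nc_polyhedron d \<delta> \<inter> nc_level d (lv s)"
    and L: "psd L" and \<epsilon>: "0 < \<epsilon>" and \<rho>: "\<rho> < 1"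
    and pos: "\<And>a. \<epsilon> * (\<Sum>\<omega>\<in>Sigma T (\<lambda>s. {..<lv s}). (cmod (a \<omega>))\<^sup>2) \<le> Re (qform (Sigma T (\<lambda>s. {..<lv s})) L a)"
    and contr: "\<And>\<alpha>. (\<Sum>i<I. Re (qform (Sigma T (\<lambda>s. {..<lv s})) L (\<lambda>(s, b).
          \<Sum>j<J. \<Sum>c<lv s. delta_eval (lv s) (pt s) \<delta> $$ (i * lv s + b, j * lv s + c) * \<alpha> ((s, c), j))))
        \<le> \<rho> * (\<Sum>j<J. Re (qform (Sigma T (\<lambda>s. {..<lv s})) L (\<lambda>\<omega>. \<alpha> (\<omega>, j))))"
  shows "Re (qform (Sigma T (\<lambda>s. {..<lv s})) L (\<lambda>(s, b). \<Sum>c<lv s. \<phi> (pt s) $$ (b, c) * a (s, c)))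
    \<le> Re (qform (Sigma T (\<lambda>s. {..<lv s})) L a)"
\<comment> \<open>The polyhedron has no points of level 0, so an empty direct sum is treated
  apart.\<close>
proof (cases "Sigma T (\<lambda>s. {..<lv s}) = {}")
  case True
  show ?thesis unfolding True qform_def by simp
next
  case False
  define \<Omega> where "\<Omega> = Sigma T (\<lambda>s. {..<lv s})"
  note pos = pos[folded \<Omega>_def] and contr = contr[folded \<Omega>_def]
  define N where "N = card \<Omega>"
  have fin: "finite \<Omega>" unfolding \<Omega>_def using T by auto
  have N: "1 \<le> N" using False fin unfolding N_def \<Omega>_def by (simp add: Suc_le_eq card_gt_0_iff)
  obtain e where e: "bij_betw e {..<N} \<Omega>"
    using ex_bij_betw_nat_finite[OF fin] by (auto simp: atLeast0LessThan N_def)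
  define ix where "ix = inv_into {..<N} e"
  have ix: "ix \<omega> < N" "e (ix \<omega>) = \<omega>" if "\<omega> \<in> \<Omega>" for \<omega>
    using that e bij_betw_inv_into[OF e] unfolding ix_def
    by (auto simp: bij_betw_def f_inv_into_f)
  have ix2: "ix (e k) = k" if "k < N" for k
    using e that unfolding ix_def by (auto simp: bij_betw_def)
  have e\<Omega>: "e k \<in> \<Omega>" if "k < N" for k
    using e that by (auto simp: bij_betw_def)
  have sumN: "(\<Sum>k<N. f (e k)) = (\<Sum>\<omega>\<in>\<Omega>. f \<omega>)" for f :: "_ \<Rightarrow> complex"
    by (rule sum.reindex_bij_betw[OF e])
  obtain R where R: "\<And>a b. a \<in> \<Omega> \<Longrightarrow> L a b = (\<Sum>l<N. R l a * cnj (R l b))"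
    using psd_finite_decomp[OF L fin e] by blast
  define Rm where "Rm = mat N N (\<lambda>(l, k). R l (e k))"
  have Rm: "Rm \<in> carrier_mat N N" by (simp add: Rm_def)
  define vc where "vc a = vec N (\<lambda>k. a (e k))" for a :: "'s \<times> nat \<Rightarrow> complex"
  have vc: "vc a \<in> carrier_vec N" for a by (simp add: vc_def)
  have Rvc: "(Rm *\<^sub>v vc a) $ l = (\<Sum>\<omega>\<in>\<Omega>. a \<omega> * R l \<omega>)" if "l < N" for a l
    using that sumN[of "\<lambda>\<omega>. a \<omega> * R l \<omega>"]
    by (subst mult_mat_vec_index[OF Rm vc that]) (simp add: Rm_def vc_def mult.commute)
  have form: "Re (qform \<Omega> L a) = (vnorm (Rm *\<^sub>v vc a))\<^sup>2" for a
  proof -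
    have "qform \<Omega> L a = qform \<Omega> (\<lambda>\<omega> \<omega>'. \<Sum>l<N. R l \<omega> * cnj (R l \<omega>')) a"
      by (rule qform_cong) (auto simp: R)
    also have "\<dots> = of_real (\<Sum>l<N. (cmod (\<Sum>\<omega>\<in>\<Omega>. a \<omega> * R l \<omega>))\<^sup>2)"
      by (simp add: qform_sum qform_rank_one)
    finally show ?thesis
      using Rm Rvc by (simp add: vnorm_sq del: index_mult_mat_vec)
  qed
  have vc_surj: "vc (\<lambda>\<omega>. v $ ix \<omega>) = v" if "v \<in> carrier_vec N" for v
    using that by (intro eq_vecI) (auto simp: vc_def ix2)
  have inj: "v = 0\<^sub>v N" if v: "v \<in> carrier_vec N" "Rm *\<^sub>v v = 0\<^sub>v N" for v
  proof (rule eq_vecI)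
    define a where "a \<omega> = v $ ix \<omega>" for \<omega>
    have "vc a = v" unfolding a_def[abs_def] by (rule vc_surj[OF v(1)])
    hence "Re (qform \<Omega> L a) = 0" using v(2) by (simp add: form vnorm_sq)
    hence "\<epsilon> * (\<Sum>\<omega>\<in>\<Omega>. (cmod (a \<omega>))\<^sup>2) \<le> 0" using pos[of a] by simp
    hence "(\<Sum>\<omega>\<in>\<Omega>. (cmod (a \<omega>))\<^sup>2) \<le> 0" using \<epsilon> by (simp add: mult_le_0_iff)
    hence "(\<Sum>\<omega>\<in>\<Omega>. (cmod (a \<omega>))\<^sup>2) = 0" by (intro antisym sum_nonneg) auto
    hence a0: "a \<omega> = 0" if "\<omega> \<in> \<Omega>" for \<omega> using fin that by (simp add: sum_nonneg_eq_0_iff)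
    fix k assume "k < dim_vec (0\<^sub>v N :: complex vec)"
    thus "v $ k = 0\<^sub>v N $ k" using a0[OF e\<Omega>, of k] by (simp add: a_def ix2)
  qed (use v in simp)
  obtain Ri where Ri: "Ri \<in> carrier_mat N N" "Rm * Ri = 1\<^sub>m N" "Ri * Rm = 1\<^sub>m N"
    by (rule injective_mat_inverse[OF Rm inj])
  \<comment> \<open>\<open>BD f\<close> is the direct sum of the matrices \<open>f s\<close> in the
    basis numbered by \<open>e\<close>, and \<open>E s\<close> is the inclusion of the summand
    \<open>s\<close>.\<close>
  define BD where "BD f = mat N N (\<lambda>(k, k'). if fst (e k) = fst (e k')
      then f (fst (e k)) $$ (snd (e k), snd (e k')) else 0)" for f :: "'s \<Rightarrow> complex mat"
  define E where "E s = mat N (lv s) (\<lambda>(k, b). if e k = (s, b) then 1 else (0 :: complex))" for s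
  have BD: "BD f \<in> carrier_mat N N" for f by (simp add: BD_def)
  have E: "E s \<in> carrier_mat N (lv s)" for s by (simp add: E_def)
  have in\<Omega>: "fst (e k) \<in> T" "snd (e k) < lv (fst (e k))" if "k < N" for k
    using e\<Omega>[OF that] by (auto simp: \<Omega>_def)
  have BDE: "BD f * E s = E s * f s" if "s \<in> T" and f: "f s \<in> carrier_mat (lv s) (lv s)" for f s
  proof (rule eq_matI)
    fix k b assume "k < dim_row (E s * f s)" "b < dim_col (E s * f s)"
    hence kb: "k < N" "b < lv s" using E[of s] f by auto
    have sb: "(s, b) \<in> \<Omega>" using that kb by (simp add: \<Omega>_def)
    have "(BD f * E s) $$ (k, b) = (\<Sum>k'<N. BD f $$ (k, k') * E s $$ (k', b))"
      using kb by (intro mult_mat_index[OF BD E])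
    also have "\<dots> = (\<Sum>k'<N. if k' = ix (s, b) then BD f $$ (k, k') else 0)"
    proof (intro sum.cong refl)
      fix k' assume k': "k' \<in> {..<N}"
      hence "e k' = (s, b) \<longleftrightarrow> k' = ix (s, b)" using ix(2)[OF sb] ix2[of k'] by auto
      thus "BD f $$ (k, k') * E s $$ (k', b) = (if k' = ix (s, b) then BD f $$ (k, k') else 0)"
        using k' kb by (simp add: E_def)
    qed
    also have "\<dots> = BD f $$ (k, ix (s, b))" using ix(1)[OF sb] by simp
    also have "\<dots> = (if fst (e k) = s then f s $$ (snd (e k), b) else 0)"
      using kb ix[OF sb] by (auto simp: BD_def)
    also have "\<dots> = (\<Sum>c<lv s. if c = snd (e k) then if fst (e k) = s then f s $$ (c, b) else 0 else 0)"
      using in\<Omega>[OF kb(1)] by auto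
    also have "\<dots> = (\<Sum>c<lv s. E s $$ (k, c) * f s $$ (c, b))"
      using kb by (intro sum.cong refl) (auto simp: E_def prod_eq_iff)
    also have "\<dots> = (E s * f s) $$ (k, b)"
      using kb by (intro mult_mat_index[OF E f, symmetric])
    finally show "(BD f * E s) $$ (k, b) = (E s * f s) $$ (k, b)" .
  qed (use BD[of f] E[of s] f in auto)
  \<comment> \<open>Every basis vector is a column of some \<open>E s\<close>, so intertwining along
    all the maps \<open>Rm * E s\<close> amounts to one matrix identity.\<close>
  have lift: "F * Rm = Rm * BD f"
    if F: "F \<in> carrier_mat N N" and f: "\<And>s. s \<in> T \<Longrightarrow> f s \<in> carrier_mat (lv s) (lv s)"
      and int: "\<And>s. s \<in> T \<Longrightarrow> F * (Rm * E s) = (Rm * E s) * f s" for F f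
  proof (rule eq_matI)
    fix l k assume "l < dim_row (Rm * BD f)" "k < dim_col (Rm * BD f)"
    hence lk: "l < N" "k < N" using Rm BD[of f] by auto
    obtain s b where ek: "e k = (s, b)" by force
    have sb: "s \<in> T" "b < lv s" using in\<Omega>[OF lk(2)] ek by auto
    have col: "(M * E s) $$ (r, b) = M $$ (r, k)" if "r < N" and M: "M \<in> carrier_mat N N" for M r
    proof -
      have "(M * E s) $$ (r, b) = (\<Sum>k'<N. M $$ (r, k') * E s $$ (k', b))"
        using that sb by (intro mult_mat_index[OF _ E])
      also have "\<dots> = (\<Sum>k'<N. if k' = k then M $$ (r, k') else 0)"
      proof (intro sum.cong refl)
        fix k' assume k': "k' \<in> {..<N}"
        hence "e k' = (s, b) \<longleftrightarrow> k' = k" using ix2[of k'] ix2[OF lk(2)] ek by auto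
        thus "M $$ (r, k') * E s $$ (k', b) = (if k' = k then M $$ (r, k') else 0)"
          using k' sb by (simp add: E_def)
      qed
      finally show ?thesis using lk by simp
    qed
    have "(F * Rm) $$ (l, k) = (F * Rm * E s) $$ (l, b)"
      using col[OF lk(1), of "F * Rm"] F Rm by simp
    also have "F * Rm * E s = F * (Rm * E s)" using F Rm E by (intro assoc_mult_mat)
    also have "\<dots> = Rm * E s * f s" by (rule int[OF sb(1)])
    also have "\<dots> = Rm * (E s * f s)" using Rm E f[OF sb(1)] by (intro assoc_mult_mat)
    also have "\<dots> = Rm * (BD f * E s)" by (simp add: BDE[of s f] sb(1) f)
    also have "\<dots> = Rm * BD f * E s" using Rm BD E by (intro assoc_mult_mat[symmetric])
    also have "\<dots> $$ (l, b) = (Rm * BD f) $$ (l, k)"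
      using col[OF lk(1), of "Rm * BD f"] Rm BD[of f] by simp
    finally show "(F * Rm) $$ (l, k) = (Rm * BD f) $$ (l, k)" .
  qed (use F Rm BD[of f] in auto)
  have BDvc: "BD f *\<^sub>v vc a = vc (\<lambda>(s, b). \<Sum>c<lv s. f s $$ (b, c) * a (s, c))" for f a
  proof (rule eq_vecI)
    fix k assume "k < dim_vec (vc (\<lambda>(s, b). \<Sum>c<lv s. f s $$ (b, c) * a (s, c)))"
    hence k: "k < N" by (simp add: vc_def)
    obtain s b where ek: "e k = (s, b)" by force
    have sb: "s \<in> T" "b < lv s" using in\<Omega>[OF k] ek by auto
    have "(BD f *\<^sub>v vc a) $ k = (\<Sum>k'<N. BD f $$ (k, k') * vc a $ k')"
      by (rule mult_mat_vec_index[OF BD vc k])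
    also have "\<dots> = (\<Sum>k'<N. (\<lambda>\<omega>. if fst \<omega> = s then f s $$ (b, snd \<omega>) * a \<omega> else 0) (e k'))"
      using k ek by (intro sum.cong refl) (auto simp: BD_def vc_def)
    also have "\<dots> = (\<Sum>\<omega>\<in>\<Omega>. if fst \<omega> = s then f s $$ (b, snd \<omega>) * a \<omega> else 0)"
      by (rule sumN)
    also have "\<dots> = (\<Sum>s'\<in>T. \<Sum>c<lv s'. if s' = s then f s $$ (b, c) * a (s', c) else 0)"
      unfolding \<Omega>_def using T by (subst sum.Sigma) (auto intro!: sum.cong)
    also have "\<dots> = (\<Sum>s'\<in>T. if s' = s then \<Sum>c<lv s. f s $$ (b, c) * a (s, c) else 0)"
      by (intro sum.cong refl) auto
    also have "\<dots> = (\<Sum>c<lv s. f s $$ (b, c) * a (s, c))" using T sb by simp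
    finally show "(BD f *\<^sub>v vc a) $ k = vc (\<lambda>(s, b). \<Sum>c<lv s. f s $$ (b, c) * a (s, c)) $ k"
      using k ek by (simp add: vc_def)
  qed (simp add: BD_def vc_def)
  have act: "F *\<^sub>v (Rm *\<^sub>v vc a) = Rm *\<^sub>v vc (\<lambda>(s, b). \<Sum>c<lv s. f s $$ (b, c) * a (s, c))"
    if "F \<in> carrier_mat N N" "\<And>s. s \<in> T \<Longrightarrow> f s \<in> carrier_mat (lv s) (lv s)"
      "\<And>s. s \<in> T \<Longrightarrow> F * (Rm * E s) = (Rm * E s) * f s" for F f a
    using lift[OF that] assoc_mult_mat_vec[OF that(1) Rm vc, of a] assoc_mult_mat_vec[OF Rm BD vc, of f a]
    by (simp add: BDvc)
  have ptc: "pt s ! r \<in> carrier_mat (lv s) (lv s)" if "s \<in> T" "r < d" for s r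
    using pt[OF that(1)] that(2) by (auto simp: nc_level_def)
  define y where "y = map (\<lambda>r. Rm * BD (\<lambda>s. pt s ! r) * Ri) [0..<d]"
  have y: "y \<in> nc_level d N"
    using Rm Ri(1) BD by (auto simp: y_def nc_level_def)
  have int: "(Rm * E s) * (pt s ! r) = (y ! r) * (Rm * E s)" if s: "s \<in> T" and r: "r < d" for s r
  proof -
    let ?B = "BD (\<lambda>s. pt s ! r)"
    have "(y ! r) * (Rm * E s) = Rm * ?B * Ri * (Rm * E s)" using r by (simp add: y_def)
    also have "\<dots> = Rm * ?B * (Ri * (Rm * E s))"
      using Rm BD[of "\<lambda>s. pt s ! r"] Ri(1) E[of s] by (intro assoc_mult_mat[of _ N N _ N _ "lv s"]) auto
    also have "Ri * (Rm * E s) = Ri * Rm * E s" using Ri(1) Rm E by (intro assoc_mult_mat[symmetric])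
    also have "\<dots> = E s" using Ri(3) E[of s] by simp
    also have "Rm * ?B * E s = Rm * (?B * E s)" using Rm BD E by (intro assoc_mult_mat)
    also have "\<dots> = Rm * (E s * (pt s ! r))" by (simp add: BDE[of s "\<lambda>s. pt s ! r"] s ptc[OF s r])
    also have "\<dots> = Rm * E s * (pt s ! r)" using Rm E ptc[OF s r] by (intro assoc_mult_mat[symmetric])
    finally show ?thesis by simp
  qed
  have RE: "Rm * E s \<in> carrier_mat N (lv s)" for s using Rm E[of s] by simp
  \<comment> \<open>\<open>\<rho>\<close> is not assumed nonnegative; the maximum with 0 gives a
    meaningful norm bound below 1.\<close>
  have "op_norm (delta_eval N y \<delta>) \<le> sqrt (max \<rho> 0)"
  proof (rule op_norm_le)
    note G = delta_eval_carrier[OF \<delta>, of N y]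
    fix v :: "complex vec" assume "v \<in> carrier_vec (dim_col (delta_eval N y \<delta>))"
    hence v: "v \<in> carrier_vec (J * N)" using G by auto
    define vj where "vj j = vec N (\<lambda>k. v $ (j * N + k))" for j
    \<comment> \<open>The blocks of \<open>v\<close> pulled back through \<open>Rm\<close>, as
      coefficients over the original points; there \<open>contr\<close> applies.\<close>
    define \<alpha> where "\<alpha> z = (Ri *\<^sub>v vj (snd z)) $ ix (fst z)" for z :: "('s \<times> nat) \<times> nat"
    have vj: "vj j = Rm *\<^sub>v vc (\<lambda>\<omega>. \<alpha> (\<omega>, j))" for j
    proof -
      have c: "vj j \<in> carrier_vec N" by (simp add: vj_def)
      have "vc (\<lambda>\<omega>. \<alpha> (\<omega>, j)) = Ri *\<^sub>v vj j"
        using vc_surj[of "Ri *\<^sub>v vj j"] Ri(1) c by (simp add: \<alpha>_def mult_mat_vec_carrier)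
      moreover have "Rm *\<^sub>v (Ri *\<^sub>v vj j) = vj j"
        using assoc_mult_mat_vec[OF Rm Ri(1) c] Ri(2) c by simp
      ultimately show ?thesis by simp
    qed
    define g where "g i j s = poly_eval (lv s) (pt s) (\<delta> $$ (i, j))" for i j s
    have comp: "(delta_eval N y \<delta> *\<^sub>v v) $ (i * N + l) = (Rm *\<^sub>v vc (\<lambda>(s, b).
          \<Sum>j<J. \<Sum>c<lv s. delta_eval (lv s) (pt s) \<delta> $$ (i * lv s + b, j * lv s + c) * \<alpha> ((s, c), j))) $ l"
      if i: "i < I" and l: "l < N" for i l
    proof -
      have p: "\<delta> $$ (i, j) \<in> nc_polys d" if "j < J" for j
        using polys elements_matI[OF \<delta> i that refl] by blast
      have "(delta_eval N y \<delta> *\<^sub>v v) $ (i * N + l)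
          = (\<Sum>j<J. \<Sum>k<N. poly_eval N y (\<delta> $$ (i, j)) $$ (l, k) * vj j $ k)"
        using G v block_index_less[OF i l]
        by (subst mult_mat_vec_index[OF G v]) (auto simp: sum_blocks delta_eval_index[OF \<delta> i _ l] vj_def)
      also have "\<dots> = (\<Sum>j<J. (poly_eval N y (\<delta> $$ (i, j)) *\<^sub>v vj j) $ l)"
        using l by (intro sum.cong refl mult_mat_vec_index[OF poly_eval_carrier, symmetric]) (auto simp: vj_def)
      also have "\<dots> = (\<Sum>j<J. (Rm *\<^sub>v vc (\<lambda>(s, b). \<Sum>c<lv s. g i j s $$ (b, c) * \<alpha> ((s, c), j))) $ l)"
      proof (intro sum.cong refl)
        fix j assume "j \<in> {..<J}"
        hence "poly_eval N y (\<delta> $$ (i, j)) *\<^sub>v (Rm *\<^sub>v vc (\<lambda>\<omega>. \<alpha> (\<omega>, j)))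
            = Rm *\<^sub>v vc (\<lambda>(s, b). \<Sum>c<lv s. g i j s $$ (b, c) * \<alpha> ((s, c), j))"
          unfolding g_def
          by (intro act poly_eval_carrier poly_eval_intertwine[OF _ y RE int p, symmetric]) (use pt in auto)
        thus "(poly_eval N y (\<delta> $$ (i, j)) *\<^sub>v vj j) $ l
            = (Rm *\<^sub>v vc (\<lambda>(s, b). \<Sum>c<lv s. g i j s $$ (b, c) * \<alpha> ((s, c), j))) $ l"
          by (simp only: vj)
      qed
      also have "\<dots> = (\<Sum>\<omega>\<in>\<Omega>. (\<Sum>j<J. (case \<omega> of (s, b) \<Rightarrow> \<Sum>c<lv s. g i j s $$ (b, c) * \<alpha> ((s, c), j))) * R l \<omega>)"
        unfolding Rvc[OF l] by (subst sum.swap) (simp add: sum_distrib_right)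
      also have "\<dots> = (\<Sum>\<omega>\<in>\<Omega>. (case \<omega> of (s, b) \<Rightarrow> \<Sum>j<J. \<Sum>c<lv s. 
          delta_eval (lv s) (pt s) \<delta> $$ (i * lv s + b, j * lv s + c) * \<alpha> ((s, c), j)) * R l \<omega>)"
        by (intro sum.cong refl) (auto simp: \<Omega>_def g_def delta_eval_index[OF \<delta> i])
      also have "\<dots> = (Rm *\<^sub>v vc (\<lambda>(s, b).
          \<Sum>j<J. \<Sum>c<lv s. delta_eval (lv s) (pt s) \<delta> $$ (i * lv s + b, j * lv s + c) * \<alpha> ((s, c), j))) $ l"
        unfolding Rvc[OF l] ..
      finally show ?thesis .
    qed
    have "(vnorm (delta_eval N y \<delta> *\<^sub>v v))\<^sup>2 = (\<Sum>i<I. Re (qform \<Omega> L (\<lambda>(s, b).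
          \<Sum>j<J. \<Sum>c<lv s. delta_eval (lv s) (pt s) \<delta> $$ (i * lv s + b, j * lv s + c) * \<alpha> ((s, c), j))))"
      using G Rm by (simp add: form vnorm_sq sum_blocks comp del: index_mult_mat_vec)
    also have "\<dots> \<le> \<rho> * (\<Sum>j<J. Re (qform \<Omega> L (\<lambda>\<omega>. \<alpha> (\<omega>, j))))" by (rule contr)
    also have "\<dots> = \<rho> * (\<Sum>j<J. (vnorm (vj j))\<^sup>2)" by (simp only: form vj)
    also have "\<dots> = \<rho> * (vnorm v)\<^sup>2" using v by (simp add: vnorm_sq sum_blocks vj_def)
    also have "\<dots> \<le> max \<rho> 0 * (vnorm v)\<^sup>2" by (intro mult_right_mono) auto
    finally show "vnorm (delta_eval N y \<delta> *\<^sub>v v) \<le> sqrt (max \<rho> 0) * vnorm v"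
      by (rule vnorm_sq_le_imp)
  qed simp
  also have "\<dots> < 1" using \<rho> by simp
  finally have yB: "y \<in> nc_polyhedron d \<delta>"
    using y N by (auto simp: nc_polyhedron_def)
  have nc: "nc_function d (nc_polyhedron d \<delta>) \<phi>" and bd: "op_norm (\<phi> y) \<le> 1"
    using \<phi> yB by (auto simp: H_inf_1_def)
  have lv1: "1 \<le> lv s" if "s \<in> T" for s
    using nc_polyhedron_level(1)[OF d, of "pt s" \<delta> "lv s"] pt[OF that] by blast
  have \<phi>y: "\<phi> y \<in> carrier_mat N N" using nc yB y N unfolding nc_function_def by blast
  have \<phi>s: "\<phi> (pt s) \<in> carrier_mat (lv s) (lv s)" if "s \<in> T" for s
    using nc pt[OF that] lv1[OF that] unfolding nc_function_def by blast
  have \<phi>int: "\<phi> y * (Rm * E s) = (Rm * E s) * \<phi> (pt s)" if s: "s \<in> T" for s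
    using nc yB y N pt[OF s] lv1[OF s] RE[of s] int[OF s] unfolding nc_function_def by (metis IntI)
  have "\<phi> y *\<^sub>v (Rm *\<^sub>v vc a) = Rm *\<^sub>v vc (\<lambda>(s, b). \<Sum>c<lv s. \<phi> (pt s) $$ (b, c) * a (s, c))"
    by (rule act[OF \<phi>y \<phi>s \<phi>int])
  moreover have "vnorm (\<phi> y *\<^sub>v (Rm *\<^sub>v vc a)) \<le> 1 * vnorm (Rm *\<^sub>v vc a)"
    by (rule order_trans[OF op_norm_bound mult_right_mono[OF bd vnorm_nonneg]]) (use \<phi>y mult_mat_vec_carrier[OF Rm vc] in auto)
  ultimately show ?thesis
    unfolding \<Omega>_def[symmetric] form by (intro power_mono vnorm_nonneg) simp
qed

section \<open>A positive kernel modelling a bounded nc-function\<close>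

text \<open>For a point \<open>x\<close> of level \<open>n\<close>, the index \<open>((x, a), b)\<close> with \<open>a, b < n\<close> stands for the component along
  \<open>e\<^sub>b\<close> of a quantity evaluated at the vector \<open>e\<^sub>a\<close>.\<close>

type_synonym nc_index = "(complex mat list \<times> nat) \<times> nat"

definition lvl :: "complex mat list \<Rightarrow> nat" where
  "lvl x = dim_row (x ! 0)"

definition indices :: "complex mat list set \<Rightarrow> nc_index set" where
  "indices F = Sigma (Sigma F (\<lambda>x. {..<lvl x})) (\<lambda>s. {..<lvl (fst s)})"

definition dcoef :: "nc_poly mat \<Rightarrow> nat \<Rightarrow> nc_index \<Rightarrow> nat \<Rightarrow> nat \<Rightarrow> complex" where
  "dcoef \<delta> i \<omega> j c = (let n = lvl (fst (fst \<omega>)) in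
     delta_eval n (fst (fst \<omega>)) \<delta> $$ (i * n + snd \<omega>, j * n + c))"

definition unit_at :: "nc_index \<Rightarrow> complex" where
  "unit_at \<omega> = (if snd (fst \<omega>) = snd \<omega> then 1 else 0)"

definition value_at :: "(complex mat list \<Rightarrow> complex mat) \<Rightarrow> nc_index \<Rightarrow> complex" where
  "value_at \<phi> \<omega> = \<phi> (fst (fst \<omega>)) $$ (snd \<omega>, snd (fst \<omega>))"

text \<open>The negative terms are moved across, so that for positive \<open>K\<close> both sides
  are Gram matrices: on the left of the unit component together with \<open>\<delta>\<close> applied
  to the Gram vectors of \<open>K\<close>, on the right of the value of \<open>\<phi>\<close>
  together with these Gram vectors. The isometry of the realization will carry the first family to
  the second.\<close>

definition model_equation ::
  "nc_poly mat \<Rightarrow> (complex mat list \<Rightarrow> complex mat) \<Rightarrow> (nc_index \<times> nat \<Rightarrow> nc_index \<times> nat \<Rightarrow> complex)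
    \<Rightarrow> nc_index \<Rightarrow> nc_index \<Rightarrow> bool" where
  "model_equation \<delta> \<phi> K \<omega> \<omega>' \<longleftrightarrow>
     unit_at \<omega> * cnj (unit_at \<omega>') + (\<Sum>i<dim_row \<delta>.
       \<Sum>j<dim_col \<delta>. \<Sum>c<lvl (fst (fst \<omega>)). \<Sum>j'<dim_col \<delta>. \<Sum>c'<lvl (fst (fst \<omega>')).
         dcoef \<delta> i \<omega> j c * cnj (dcoef \<delta> i \<omega>' j' c') * K ((fst \<omega>, c), j) ((fst \<omega>', c'), j'))
     = value_at \<phi> \<omega> * cnj (value_at \<phi> \<omega>') + (\<Sum>j<dim_col \<delta>. K (\<omega>, j) (\<omega>', j))"

lemma nc_polyhedron_lvl:
  assumes "1 \<le> d" "x \<in> nc_polyhedron d \<delta>"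
  shows "x \<in> nc_level d (lvl x)" "1 \<le> lvl x" "op_norm (delta_eval (lvl x) x \<delta>) < 1"
proof -
  obtain n where n: "1 \<le> n" "x \<in> nc_level d n" "op_norm (delta_eval n x \<delta>) < 1"
    using assms(2) by (auto simp: nc_polyhedron_def)
  have "x ! 0 \<in> set x"
    using assms(1) n(2) by (intro nth_mem) (simp add: nc_level_def)
  hence "lvl x = n" using n(2) by (auto simp: nc_level_def lvl_def)
  thus "x \<in> nc_level d (lvl x)" "1 \<le> lvl x" "op_norm (delta_eval (lvl x) x \<delta>) < 1"
    using n by simp_all
qed

lemma nc_level_lvl: "1 \<le> d \<Longrightarrow> x \<in> nc_level d n \<Longrightarrow> lvl x = n"
proof -
  assume "1 \<le> d" and x: "x \<in> nc_level d n"
  hence "x ! 0 \<in> set x" by (intro nth_mem) (simp add: nc_level_def)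
  thus ?thesis using x by (auto simp: nc_level_def lvl_def)
qed

lemma finite_indices: "finite F \<Longrightarrow> finite (indices F)"
  by (simp add: indices_def)

lemma psd_restrict:
  fixes K :: "'a \<Rightarrow> 'a \<Rightarrow> complex"
  assumes "psd K"
  shows "psd (\<lambda>a b. if a \<in> A \<and> b \<in> A then K a b else 0)"
proof (rule psdI)
  show "(if b \<in> A \<and> a \<in> A then K b a else 0) = cnj (if a \<in> A \<and> b \<in> A then K a b else 0)" for a b
    using psd_herm[OF assms, of b a] by simp
  fix B :: "'a set" and c assume B: "finite B"
  have "qform B (\<lambda>a b. if a \<in> A \<and> b \<in> A then K a b else 0) c = qform B K (\<lambda>a. if a \<in> A then c a else 0)"
    unfolding qform_def by (intro sum.cong refl) auto
  thus "0 \<le> Re (qform B (\<lambda>a b. if a \<in> A \<and> b \<in> A then K a b else 0) c)"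
    using psd_nonneg[OF assms B] by simp
qed

context
  fixes d I J :: nat and \<delta> :: "nc_poly mat"
  assumes d: "1 \<le> d" and J: "1 \<le> J" and \<delta>: "\<delta> \<in> carrier_mat I J"
begin

lemma dcoef_contraction:
  assumes n: "n = lvl x"
  shows "(\<Sum>i<I. \<Sum>b<n. (cmod (\<Sum>j<J. \<Sum>c<n. dcoef \<delta> i ((x, a), b) j c * \<alpha> j c))\<^sup>2)
    \<le> (op_norm (delta_eval n x \<delta>))\<^sup>2 * (\<Sum>j<J. \<Sum>c<n. (cmod (\<alpha> j c))\<^sup>2)"
  using delta_eval_contraction[OF \<delta>, of n x \<alpha>] by (simp add: dcoef_def n Let_def)

text \<open>\<open>\<delta>(x)\<close> acts on the index \<open>b\<close> only, so
  \<open>\<Gamma>\<close> is block diagonal over the pairs \<open>s = (x, a)\<close>. The hypothesis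
  of \<open>solvable\<close> is verified on the direct sum in which \<open>x\<close> is repeated
  once for every \<open>a < lvl x\<close>: \<open>unit_at\<close> puts the basis vector with number
  \<open>a\<close> into the copy \<open>(x, a)\<close>, and the copies of \<open>\<phi>(x)\<close>
  turn it into \<open>value_at \<phi>\<close>.\<close>

lemma finite_model:
  assumes polys: "elements_mat \<delta> \<subseteq> nc_polys d" and \<phi>: "\<phi> \<in> H_inf_1 d \<delta>"
    and F: "finite F" "F \<subseteq> nc_polyhedron d \<delta>"
  shows "\<exists>K. psd K \<and> (\<forall>\<omega>\<in>indices F. \<forall>\<omega>'\<in>indices F. model_equation \<delta> \<phi> K \<omega> \<omega>')"
proof -
  define T where "T = Sigma F (\<lambda>x. {..<lvl x})"
  define \<Omega> where "\<Omega> = indices F"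
  have \<Omega>: "\<Omega> = Sigma T (\<lambda>s. {..<lvl (fst s)})" by (simp add: \<Omega>_def T_def indices_def)
  have fin: "finite \<Omega>" "finite T" using F(1) by (auto simp: \<Omega>_def T_def finite_indices)
  note finT = fin(2)
  \<comment> \<open>Squared norms, since the contraction hypothesis of
    \<open>kernel_equation\<close> compares squares; the 0 covers an empty \<open>F\<close>.\<close>
  define \<rho> where "\<rho> = Max (insert 0 ((\<lambda>x. (op_norm (delta_eval (lvl x) x \<delta>))\<^sup>2) ` F))"
  have \<rho>: "0 \<le> \<rho>" and \<rho>F: "(op_norm (delta_eval (lvl x) x \<delta>))\<^sup>2 \<le> \<rho>" if "x \<in> F" for x
    using F(1) that by (auto simp: \<rho>_def)
  have \<rho>0: "0 \<le> \<rho>" using F(1) by (auto simp: \<rho>_def)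
  have "(op_norm (delta_eval (lvl x) x \<delta>))\<^sup>2 < 1" if "x \<in> F" for x
    using nc_polyhedron_lvl(3)[OF d, of x \<delta>] F(2) that op_norm_nonneg
    by (auto simp: power2_less_1_iff abs_less_iff intro: less_le_trans[OF _ op_norm_nonneg])
  hence \<rho>1: "\<rho> < 1" using F(1) by (auto simp: \<rho>_def)
  define \<Gamma> where "\<Gamma> i \<omega> z = (if fst \<omega> = fst (fst z) then dcoef \<delta> i \<omega> (snd z) (snd (fst z)) else 0)"
    for i :: nat and \<omega> :: nc_index and z :: "nc_index \<times> nat"
  have \<Gamma>sum: "(\<Sum>z\<in>\<Omega> \<times> {..<J}. \<Gamma> i \<omega> z * f z) = (\<Sum>j<J. \<Sum>c<lvl (fst (fst \<omega>)). dcoef \<delta> i \<omega> j c * f ((fst \<omega>, c), j))"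
    if "fst \<omega> \<in> T" for i \<omega> f
  proof -
    have "(\<Sum>z\<in>\<Omega> \<times> {..<J}. \<Gamma> i \<omega> z * f z) = (\<Sum>\<tau>\<in>\<Omega>. \<Sum>j<J. \<Gamma> i \<omega> (\<tau>, j) * f (\<tau>, j))"
      by (simp add: sum.cartesian_product')
    also have "\<dots> = (\<Sum>s\<in>T. \<Sum>c<lvl (fst s). \<Sum>j<J. \<Gamma> i \<omega> ((s, c), j) * f ((s, c), j))"
      unfolding \<Omega> using fin by (subst sum.Sigma) (auto simp: case_prod_beta)
    also have "\<dots> = (\<Sum>s\<in>T. if s = fst \<omega> then \<Sum>c<lvl (fst s). \<Sum>j<J. dcoef \<delta> i \<omega> j c * f ((s, c), j) else 0)"
      by (intro sum.cong refl) (auto simp: \<Gamma>_def)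
    also have "\<dots> = (\<Sum>c<lvl (fst (fst \<omega>)). \<Sum>j<J. dcoef \<delta> i \<omega> j c * f ((fst \<omega>, c), j))"
      using fin that by simp
    finally show ?thesis by (simp add: sum.swap[of _ "{..<J}"])
  qed
  have sum\<Omega>: "(\<Sum>\<omega>\<in>\<Omega>. f \<omega>) = (\<Sum>s\<in>T. \<Sum>c<lvl (fst s). f (s, c))" for f :: "nc_index \<Rightarrow> real"
    unfolding \<Omega> using fin by (subst sum.Sigma) (auto simp: case_prod_beta)
  have \<Omega>T: "fst \<omega> \<in> T" if "\<omega> \<in> \<Omega>" for \<omega> using that by (auto simp: \<Omega>)
  interpret kernel_equation \<Omega> I J \<Gamma> unit_at "value_at \<phi>" \<rho>
  proof
    fix \<alpha> :: "nc_index \<times> nat \<Rightarrow> complex"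
    have "(\<Sum>i<I. \<Sum>\<omega>\<in>\<Omega>. (cmod (\<Sum>z\<in>\<Omega> \<times> {..<J}. \<Gamma> i \<omega> z * \<alpha> z))\<^sup>2)
        = (\<Sum>i<I. \<Sum>s\<in>T. \<Sum>b<lvl (fst s). (cmod (\<Sum>j<J. \<Sum>c<lvl (fst s). dcoef \<delta> i (s, b) j c * \<alpha> ((s, c), j)))\<^sup>2)"
      using fin by (simp add: \<Gamma>sum \<Omega>T cong: sum.cong) (simp add: \<Omega> sum.Sigma case_prod_beta)
    also have "\<dots> = (\<Sum>s\<in>T. \<Sum>i<I. \<Sum>b<lvl (fst s). (cmod (\<Sum>j<J. \<Sum>c<lvl (fst s). dcoef \<delta> i (s, b) j c * \<alpha> ((s, c), j)))\<^sup>2)"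
      by (rule sum.swap)
    also have "\<dots> \<le> (\<Sum>s\<in>T. \<rho> * (\<Sum>j<J. \<Sum>c<lvl (fst s). (cmod (\<alpha> ((s, c), j)))\<^sup>2))"
    proof (rule sum_mono)
      fix s assume "s \<in> T"
      then obtain x a where s: "s = (x, a)" "x \<in> F" by (auto simp: T_def)
      have "(\<Sum>i<I. \<Sum>b<lvl x. (cmod (\<Sum>j<J. \<Sum>c<lvl x. dcoef \<delta> i ((x, a), b) j c * \<alpha> (((x, a), c), j)))\<^sup>2)
         \<le> (op_norm (delta_eval (lvl x) x \<delta>))\<^sup>2 * (\<Sum>j<J. \<Sum>c<lvl x. (cmod (\<alpha> (((x, a), c), j)))\<^sup>2)"
        by (rule dcoef_contraction[OF refl])
      also have "\<dots> \<le> \<rho> * (\<Sum>j<J. \<Sum>c<lvl x. (cmod (\<alpha> (((x, a), c), j)))\<^sup>2)"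
        by (intro mult_right_mono \<rho>F s sum_nonneg) auto
      finally show "(\<Sum>i<I. \<Sum>b<lvl (fst s). (cmod (\<Sum>j<J. \<Sum>c<lvl (fst s). dcoef \<delta> i (s, b) j c * \<alpha> ((s, c), j)))\<^sup>2)
        \<le> \<rho> * (\<Sum>j<J. \<Sum>c<lvl (fst s). (cmod (\<alpha> ((s, c), j)))\<^sup>2)" by (simp add: s)
    qed
    also have "\<dots> = \<rho> * (\<Sum>s\<in>T. \<Sum>c<lvl (fst s). \<Sum>j<J. (cmod (\<alpha> ((s, c), j)))\<^sup>2)"
      by (simp add: sum_distrib_left sum.swap[of _ "{..<J}"])
    also have "\<dots> = \<rho> * (\<Sum>\<omega>\<in>\<Omega>. \<Sum>j<J. (cmod (\<alpha> (\<omega>, j)))\<^sup>2)"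
      by (simp add: sum\<Omega>)
    also have "\<dots> = \<rho> * (\<Sum>z\<in>\<Omega> \<times> {..<J}. (cmod (\<alpha> z))\<^sup>2)"
      by (simp add: sum.cartesian_product')
    finally show "(\<Sum>i<I. \<Sum>\<omega>\<in>\<Omega>. (cmod (\<Sum>z\<in>\<Omega> \<times> {..<J}. \<Gamma> i \<omega> z * \<alpha> z))\<^sup>2)
        \<le> \<rho> * (\<Sum>z\<in>\<Omega> \<times> {..<J}. (cmod (\<alpha> z))\<^sup>2)" .
  qed (use fin J \<rho>0 \<rho>1 in auto)
  have "\<exists>K. psd K \<and> (\<forall>\<omega>\<in>\<Omega>. \<forall>\<omega>'\<in>\<Omega>. \<Psi> K \<omega> \<omega>' = target \<omega> \<omega>')"
  proof (rule solvable)
    fix L \<rho>' \<epsilon> assume L: "psd L" "0 < \<epsilon>" "\<rho>' < 1"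
      and pos: "\<And>\<alpha>. \<epsilon> * (\<Sum>\<omega>\<in>\<Omega>. (cmod (\<alpha> \<omega>))\<^sup>2) \<le> Re (qform \<Omega> L \<alpha>)"
      and contr: "\<And>\<alpha>. (\<Sum>i<I. Re (qform \<Omega> L (\<lambda>\<omega>. \<Sum>z\<in>\<Omega> \<times> {..<J}. \<Gamma> i \<omega> z * \<alpha> z)))
         \<le> \<rho>' * (\<Sum>j<J. Re (qform \<Omega> L (\<lambda>\<omega>. \<alpha> (\<omega>, j))))"
    have "Re (qform \<Omega> L (\<lambda>(s, b). \<Sum>c<lvl (fst s). \<phi> (fst s) $$ (b, c) * unit_at (s, c))) \<le> Re (qform \<Omega> L unit_at)"
      unfolding \<Omega>
    proof (rule nc_function_contractive_for_form[OF d \<delta> polys \<phi> finT _ L pos[unfolded \<Omega>]])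
      show "fst s \<in> nc_polyhedron d \<delta> \<inter> nc_level d (lvl (fst s))" if "s \<in> T" for s
        using nc_polyhedron_lvl(1)[OF d] F(2) that by (auto simp: T_def)
      fix \<alpha> :: "nc_index \<times> nat \<Rightarrow> complex"
      have "qform \<Omega> L (\<lambda>(s, b). \<Sum>j<J. \<Sum>c<lvl (fst s).
              delta_eval (lvl (fst s)) (fst s) \<delta> $$ (i * lvl (fst s) + b, j * lvl (fst s) + c) * \<alpha> ((s, c), j))
          = qform \<Omega> L (\<lambda>\<omega>. \<Sum>z\<in>\<Omega> \<times> {..<J}. \<Gamma> i \<omega> z * \<alpha> z)" for i
        by (rule qform_cong) (auto simp: \<Gamma>sum \<Omega>T dcoef_def Let_def)
      thus "(\<Sum>i<I. Re (qform (Sigma T (\<lambda>s. {..<lvl (fst s)})) L (\<lambda>(s, b). \<Sum>j<J. \<Sum>c<lvl (fst s).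
              delta_eval (lvl (fst s)) (fst s) \<delta> $$ (i * lvl (fst s) + b, j * lvl (fst s) + c) * \<alpha> ((s, c), j))))
         \<le> \<rho>' * (\<Sum>j<J. Re (qform (Sigma T (\<lambda>s. {..<lvl (fst s)})) L (\<lambda>\<omega>. \<alpha> (\<omega>, j))))"
        using contr[of \<alpha>] by (simp add: \<Omega>)
    qed
    also have "qform \<Omega> L (\<lambda>(s, b). \<Sum>c<lvl (fst s). \<phi> (fst s) $$ (b, c) * unit_at (s, c)) = qform \<Omega> L (value_at \<phi>)"
    proof (rule qform_cong)
      fix \<omega> assume "\<omega> \<in> \<Omega>"
      then obtain x a b where \<omega>: "\<omega> = ((x, a), b)" "a < lvl x" "b < lvl x" by (auto simp: \<Omega> T_def)
      have "(\<Sum>c<lvl x. \<phi> x $$ (b, c) * unit_at ((x, a), c)) = (\<Sum>c<lvl x. if c = a then \<phi> x $$ (b, c) else 0)"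
        by (intro sum.cong refl) (auto simp: unit_at_def)
      thus "(case \<omega> of (s, b) \<Rightarrow> \<Sum>c<lvl (fst s). \<phi> (fst s) $$ (b, c) * unit_at (s, c)) = value_at \<phi> \<omega>"
        using \<omega> by (simp add: value_at_def)
    qed simp
    finally show "Re (qform \<Omega> L (value_at \<phi>)) \<le> Re (qform \<Omega> L unit_at)" .
  qed
  then obtain K where K: "psd K" "\<And>\<omega> \<omega>'. \<omega> \<in> \<Omega> \<Longrightarrow> \<omega>' \<in> \<Omega> \<Longrightarrow> \<Psi> K \<omega> \<omega>' = target \<omega> \<omega>'" by blast
  have "model_equation \<delta> \<phi> K \<omega> \<omega>'" if \<omega>: "\<omega> \<in> \<Omega>" "\<omega>' \<in> \<Omega>" for \<omega> \<omega>'
  proof -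
    have cnj\<Gamma>: "(\<Sum>z\<in>\<Omega> \<times> {..<J}. cnj (\<Gamma> i \<omega>' z) * f z)
        = (\<Sum>j<J. \<Sum>c<lvl (fst (fst \<omega>')). cnj (dcoef \<delta> i \<omega>' j c) * f ((fst \<omega>', c), j))" for i f
      using arg_cong[OF \<Gamma>sum[OF \<Omega>T[OF \<omega>(2)], of i "\<lambda>z. cnj (f z)"], of cnj] by (simp add: cnj_sum)
    have "(\<Sum>z\<in>\<Omega> \<times> {..<J}. \<Sum>z'\<in>\<Omega> \<times> {..<J}. \<Gamma> i \<omega> z * cnj (\<Gamma> i \<omega>' z') * K z z')
        = (\<Sum>z\<in>\<Omega> \<times> {..<J}. \<Gamma> i \<omega> z * (\<Sum>z'\<in>\<Omega> \<times> {..<J}. cnj (\<Gamma> i \<omega>' z') * K z z'))" for i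
      by (simp add: sum_distrib_left mult.assoc)
    hence e: "(\<Sum>z\<in>\<Omega> \<times> {..<J}. \<Sum>z'\<in>\<Omega> \<times> {..<J}. \<Gamma> i \<omega> z * cnj (\<Gamma> i \<omega>' z') * K z z')
        = (\<Sum>j<J. \<Sum>c<lvl (fst (fst \<omega>)). \<Sum>j'<J. \<Sum>c'<lvl (fst (fst \<omega>')).
         dcoef \<delta> i \<omega> j c * cnj (dcoef \<delta> i \<omega>' j' c') * K ((fst \<omega>, c), j) ((fst \<omega>', c'), j'))" for i
      by (simp only: cnj\<Gamma> \<Gamma>sum[OF \<Omega>T[OF \<omega>(1)]]) (simp add: sum_distrib_left mult.assoc)
    have "u - v = w - t \<Longrightarrow> w + v = t + u" for u v w t :: complex
      by (simp add: algebra_simps)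
    from this[OF K(2)[OF \<omega>, unfolded \<Psi>_def target_def e]] show ?thesis
      using \<delta> by (simp add: model_equation_def)
  qed
  thus ?thesis using K(1) unfolding \<Omega>_def by blast
qed

text \<open>Summing the diagonal equations over \<open>b\<close> gives
  \<open>tr \<le> 1 + r * tr\<close>. The resulting bound depends on \<open>x\<close> alone and not
  on the finite set of points in which \<open>x\<close> occurs, as the passage to all points
  requires.\<close>

lemma model_bound:
  assumes K: "psd K" and x: "x \<in> nc_polyhedron d \<delta>"
    and eq: "\<And>\<omega> \<omega>'. \<omega> \<in> indices {x} \<Longrightarrow> \<omega>' \<in> indices {x} \<Longrightarrow> model_equation \<delta> \<phi> K \<omega> \<omega>'"
    and a: "a < lvl x" and b: "b < lvl x" and j: "j < J"
  shows "Re (K (((x, a), b), j) (((x, a), b), j)) \<le> 1 / (1 - (op_norm (delta_eval (lvl x) x \<delta>))\<^sup>2)"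
proof -
  define n where "n = lvl x"
  define r where "r = (op_norm (delta_eval n x \<delta>))\<^sup>2"
  have r: "r < 1"
    using nc_polyhedron_lvl(3)[OF d x] op_norm_nonneg[of "delta_eval n x \<delta>"]
    by (simp add: r_def n_def power2_less_1_iff abs_less_iff)
  define Y where "Y = {..<n} \<times> {..<J}"
  define k where "k z z' = K (((x, a), fst z), snd z) (((x, a), fst z'), snd z')" for z z'
  have k: "psd k" unfolding k_def[abs_def] by (rule psd_pullback[OF K])
  define G where "G q z = dcoef \<delta> (fst q) ((x, a), snd q) (snd z) (fst z)" for q z
  define tr where "tr = (\<Sum>z\<in>Y. Re (k z z))"
  have sumY: "(\<Sum>z\<in>Y. f z) = (\<Sum>j<J. \<Sum>c<n. f (c, j))" for f :: "nat \<times> nat \<Rightarrow> 'z::comm_monoid_add"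
    unfolding Y_def by (simp add: sum.cartesian_product' sum.swap[of _ "{..<J}"])
  have "(\<Sum>q\<in>{..<I} \<times> {..<n}. Re (qform Y k (G q))) \<le> r * tr"
    unfolding tr_def
  proof (rule psd_contraction[OF k])
    fix \<alpha> :: "nat \<times> nat \<Rightarrow> complex"
    show "(\<Sum>q\<in>{..<I} \<times> {..<n}. (cmod (\<Sum>c\<in>Y. G q c * \<alpha> c))\<^sup>2) \<le> r * (\<Sum>c\<in>Y. (cmod (\<alpha> c))\<^sup>2)"
      using dcoef_contraction[OF n_def, of a "\<lambda>j c. \<alpha> (c, j)"]
      by (simp add: sumY sum.cartesian_product' G_def r_def)
  qed (simp add: Y_def)
  hence 1: "(\<Sum>b<n. \<Sum>i<I. Re (qform Y k (G (i, b)))) \<le> r * tr"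
    by (simp add: sum.cartesian_product' sum.swap[of _ "{..<n}"])
  have "(if a = b then 1 else 0) + (\<Sum>i<I. Re (qform Y k (G (i, b))))
      = (cmod (\<phi> x $$ (b, a)))\<^sup>2 + (\<Sum>j<J. Re (k (b, j) (b, j)))" if b: "b < n" for b
  proof -
    have \<omega>: "((x, a), b) \<in> indices {x}" using a b by (auto simp: indices_def n_def)
    have q: "qform Y k (G (i, b)) = (\<Sum>j<J. \<Sum>c<n. \<Sum>j'<J. \<Sum>c'<n. dcoef \<delta> i ((x, a), b) j c
        * cnj (dcoef \<delta> i ((x, a), b) j' c') * K (((x, a), c), j) (((x, a), c'), j'))" for i
      by (simp add: qform_def sumY G_def k_def)
    have "unit_at ((x, a), b) * cnj (unit_at ((x, a), b)) + (\<Sum>i<I. qform Y k (G (i, b)))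
      = of_real ((cmod (\<phi> x $$ (b, a)))\<^sup>2) + (\<Sum>j<J. k (b, j) (b, j))"
      using eq[OF \<omega> \<omega>] \<delta> unfolding model_equation_def complex_norm_square
      by (simp add: q n_def k_def value_at_def)
    from arg_cong[OF this, of Re] show ?thesis by (cases "a = b") (simp_all add: unit_at_def)
  qed
  hence "(\<Sum>b<n. (if a = b then 1 else 0) + (\<Sum>i<I. Re (qform Y k (G (i, b)))))
      = (\<Sum>b<n. (cmod (\<phi> x $$ (b, a)))\<^sup>2 + (\<Sum>j<J. Re (k (b, j) (b, j))))"
    by (intro sum.cong refl) auto
  hence "1 + (\<Sum>b<n. \<Sum>i<I. Re (qform Y k (G (i, b)))) = (\<Sum>b<n. (cmod (\<phi> x $$ (b, a)))\<^sup>2) + tr"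
    using a by (simp add: sum.distrib tr_def sumY n_def sum.swap[of _ "{..<J}"])
  moreover have "0 \<le> (\<Sum>b<n. (cmod (\<phi> x $$ (b, a)))\<^sup>2)" by (intro sum_nonneg) auto
  ultimately have "tr \<le> 1 + r * tr" using 1 by linarith
  hence "tr \<le> 1 / (1 - r)" using r by (simp add: field_simps)
  moreover have "Re (k (b, j) (b, j)) \<le> tr"
    unfolding tr_def
    by (rule member_le_sum[where f = "\<lambda>z. Re (k z z)"]) (use b j psd_diag[OF k] in \<open>auto simp: Y_def n_def\<close>)
  ultimately show ?thesis by (simp add: k_def r_def n_def)
qed

theorem exists_model:
  assumes polys: "elements_mat \<delta> \<subseteq> nc_polys d" and \<phi>: "\<phi> \<in> H_inf_1 d \<delta>"
  shows "\<exists>K. psd K \<and> (\<forall>\<omega>\<in>indices (nc_polyhedron d \<delta>). \<forall>\<omega>'\<in>indices (nc_polyhedron d \<delta>).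
      model_equation \<delta> \<phi> K \<omega> \<omega>')"
proof -
  define B where "B = nc_polyhedron d \<delta>"
  define M where "M z = (if fst (fst (fst z)) \<in> B then
      1 / (1 - (op_norm (delta_eval (lvl (fst (fst (fst z)))) (fst (fst (fst z))) \<delta>))\<^sup>2) else 0)" for z :: "nc_index \<times> nat"
  have M1: "1 \<le> M z" if "fst (fst (fst z)) \<in> B" for z
  proof -
    let ?r = "op_norm (delta_eval (lvl (fst (fst (fst z)))) (fst (fst (fst z))) \<delta>)"
    have "?r\<^sup>2 < 1"
      using nc_polyhedron_lvl(3)[OF d that[unfolded B_def]] op_norm_nonneg
      by (simp add: power2_less_1_iff abs_less_iff less_le_trans[of "-1" 0])
    thus ?thesis using that by (simp add: M_def)
  qed
  have M0: "0 \<le> M z" for z using order_trans[OF zero_le_one M1[of z]] by (cases "fst (fst (fst z)) \<in> B") (auto simp: M_def)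
  \<comment> \<open>The diagonal bounds control the square of an entry by \<open>M z * M z'\<close>.
    Over \<open>B\<close> both factors are at least 1, so the product also bounds the entry itself
    and no square root is taken.\<close>
  define S where "S = {\<kappa>. \<forall>p. cmod (\<kappa> p) \<le> M (fst p) * M (snd p)}"
  define C where "C F = {\<kappa>. psd (\<lambda>z z'. \<kappa> (z, z'))} \<inter>
    (\<Inter>\<omega>\<in>indices F. \<Inter>\<omega>'\<in>indices F. {\<kappa>. model_equation \<delta> \<phi> (\<lambda>z z'. \<kappa> (z, z')) \<omega> \<omega>'})" for F
  have "S \<inter> \<Inter> (C ` {F. finite F \<and> F \<subseteq> B}) \<noteq> {}"
  proof (rule compact_imp_fip_image)
    show "compact S" unfolding S_def by (rule compact_bounded_functions)
    have "closed {\<kappa>. model_equation \<delta> \<phi> (\<lambda>z z'. \<kappa> (z, z')) \<omega> \<omega>'}" for \<omega> \<omega>'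
      unfolding model_equation_def
      by (intro closed_Collect_eq continuous_intros continuous_on_product_coordinates)
    thus "closed (C F)" for F unfolding C_def by (intro closed_Int closed_psd closed_INT ballI)
    fix \<F> assume \<F>: "finite \<F>" "\<F> \<subseteq> {F. finite F \<and> F \<subseteq> B}"
    define F where "F = \<Union> \<F>"
    have F: "finite F" "F \<subseteq> nc_polyhedron d \<delta>" using \<F> by (auto simp: F_def B_def)
    obtain K where K: "psd K" "\<And>\<omega> \<omega>'. \<omega> \<in> indices F \<Longrightarrow> \<omega>' \<in> indices F \<Longrightarrow> model_equation \<delta> \<phi> K \<omega> \<omega>'"
      using finite_model[OF polys \<phi> F] by blast
    define Z where "Z = indices F \<times> {..<J}"
    \<comment> \<open>Outside \<open>Z\<close> the finite model is not controlled; cutting it off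
      leaves the equations over \<open>F\<close> intact and places it in \<open>S\<close>.\<close>
    define K' where "K' z z' = (if z \<in> Z \<and> z' \<in> Z then K z z' else 0)" for z z'
    have K': "psd K'" unfolding K'_def[abs_def] by (rule psd_restrict[OF K(1)])
    have mono: "indices E \<subseteq> indices F" if "E \<subseteq> F" for E
      using that by (auto simp: indices_def)
    have eq: "model_equation \<delta> \<phi> K' \<omega> \<omega>'" if \<omega>: "\<omega> \<in> indices F" "\<omega>' \<in> indices F" for \<omega> \<omega>'
    proof -
      have z: "((fst \<omega>, c), j) \<in> Z" if "\<omega> \<in> indices F" "c < lvl (fst (fst \<omega>))" "j < J" for \<omega> c j
        using that by (auto simp: Z_def indices_def)
      have z': "(\<omega>, j) \<in> Z" if "\<omega> \<in> indices F" "j < J" for \<omega> j using that by (simp add: Z_def)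
      show ?thesis
        using K(2)[OF \<omega>] \<delta> z[OF \<omega>(1)] z[OF \<omega>(2)] z'[OF \<omega>(1)] z'[OF \<omega>(2)]
        by (simp add: model_equation_def K'_def cong: sum.cong_simp)
    qed
    have diag: "Re (K' z z) \<le> M z" if z: "z \<in> Z" for z
    proof -
      obtain x a b j where zz: "z = (((x, a), b), j)" "x \<in> F" "a < lvl x" "b < lvl x" "j < J"
        using z by (auto simp: Z_def indices_def)
      have x: "x \<in> nc_polyhedron d \<delta>" using F(2) zz by blast
      have "Re (K' (((x, a), b), j) (((x, a), b), j)) \<le> 1 / (1 - (op_norm (delta_eval (lvl x) x \<delta>))\<^sup>2)"
        by (rule model_bound[OF K' x eq zz(3-5)]) (use mono[of "{x}"] zz(2) in auto)
      thus ?thesis using x by (simp add: zz(1) M_def B_def)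
    qed
    have ZB: "fst (fst (fst z)) \<in> B" if "z \<in> Z" for z
      using that F(2) by (auto simp: Z_def indices_def B_def)
    have "cmod (K' z z') \<le> M z * M z'" for z z'
    proof (cases "z \<in> Z \<and> z' \<in> Z")
      case True
      have MM: "1 \<le> M z * M z'" using True M1 ZB mult_mono[of 1 "M z" 1 "M z'"] by fastforce
      have "(cmod (K' z z'))\<^sup>2 \<le> Re (K' z z) * Re (K' z' z')" by (rule psd_cauchy_schwarz[OF K'])
      also have "\<dots> \<le> M z * M z'" using True by (intro mult_mono diag M0 psd_diag[OF K']) auto
      also have "\<dots> \<le> (M z * M z')\<^sup>2" using self_le_power[OF MM, of 2] by simp
      finally show ?thesis using M0 by (simp add: power2_le_iff_abs_le)
    next
      case False
      thus ?thesis using M0 by (auto simp: K'_def)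
    qed
    hence "(\<lambda>p. K' (fst p) (snd p)) \<in> S" by (simp add: S_def)
    moreover have "(\<lambda>p. K' (fst p) (snd p)) \<in> C E" if "E \<in> \<F>" for E
    proof -
      have "indices E \<subseteq> indices F" using that by (intro mono) (auto simp: F_def)
      hence "model_equation \<delta> \<phi> K' \<omega> \<omega>'" if "\<omega> \<in> indices E" "\<omega>' \<in> indices E" for \<omega> \<omega>'
        using that eq by blast
      thus ?thesis using K' by (simp add: C_def)
    qed
    ultimately show "S \<inter> \<Inter> (C ` \<F>) \<noteq> {}" by blast
  qed
  then obtain \<kappa> where \<kappa>: "\<And>F. finite F \<Longrightarrow> F \<subseteq> B \<Longrightarrow> \<kappa> \<in> C F" by blast
  define K where "K z z' = \<kappa> (z, z')" for z z'
  have "psd K" using \<kappa>[of "{}"] by (simp add: C_def K_def[abs_def])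
  moreover have "model_equation \<delta> \<phi> K \<omega> \<omega>'" if "\<omega> \<in> indices B" "\<omega>' \<in> indices B" for \<omega> \<omega>'
  proof -
    \<comment> \<open>An equation involves at most two points, so a single finite set decides
      it.\<close>
    let ?F = "{fst (fst \<omega>), fst (fst \<omega>')}"
    have "\<kappa> \<in> C ?F" by (rule \<kappa>) (use that in \<open>auto simp: indices_def\<close>)
    moreover have "\<omega> \<in> indices ?F" "\<omega>' \<in> indices ?F" using that by (auto simp: indices_def)
    ultimately show ?thesis unfolding C_def K_def[abs_def] by blast
  qed
  ultimately show ?thesis unfolding B_def by blast
qed

end

section \<open>Extending a Gram isometry\<close>

definition l2 :: "('a \<Rightarrow> complex) \<Rightarrow> bool" where
  "l2 f \<longleftrightarrow> (\<lambda>s. (cmod (f s))\<^sup>2) summable_on UNIV"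

lemma l2_bounded:
  assumes "\<And>S. finite S \<Longrightarrow> (\<Sum>s\<in>S. (cmod (f s))\<^sup>2) \<le> b"
  shows "l2 f" "(\<Sum>\<^sub>\<infinity>s. (cmod (f s))\<^sup>2) \<le> b"
proof -
  show "l2 f" unfolding l2_def
    by (rule nonneg_bdd_above_summable_on) (use assms in \<open>auto intro!: bdd_aboveI2\<close>)
  thus "(\<Sum>\<^sub>\<infinity>s. (cmod (f s))\<^sup>2) \<le> b"
    unfolding l2_def using assms by (intro infsum_le_finite_sums) auto
qed

lemma l2_finite_sum_le: "l2 f \<Longrightarrow> finite S \<Longrightarrow> (\<Sum>s\<in>S. (cmod (f s))\<^sup>2) \<le> (\<Sum>\<^sub>\<infinity>s. (cmod (f s))\<^sup>2)"
  unfolding l2_def by (rule finite_sum_le_infsum) auto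

lemma prod_le_sum_squares:
  fixes x y :: real
  assumes "0 \<le> x" "0 \<le> y"
  shows "x * y \<le> x\<^sup>2 + y\<^sup>2"
  using sum_squares_bound[of x y] mult_nonneg_nonneg[OF assms] by linarith

lemma l2_product_abs_summable:
  assumes "l2 f" "l2 g"
  shows "(\<lambda>s. cmod (f s * cnj (g s))) summable_on UNIV"
proof (rule summable_on_comparison_test)
  show "(\<lambda>s. (cmod (f s))\<^sup>2 + (cmod (g s))\<^sup>2) summable_on UNIV"
    using assms unfolding l2_def by (rule summable_on_add)
  show "cmod (f s * cnj (g s)) \<le> (cmod (f s))\<^sup>2 + (cmod (g s))\<^sup>2" for s
    by (simp add: norm_mult prod_le_sum_squares)
qed auto

lemma l2_product_summable: "l2 f \<Longrightarrow> l2 g \<Longrightarrow> (\<lambda>s. f s * cnj (g s)) summable_on UNIV"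
  by (rule abs_summable_summable) (rule l2_product_abs_summable)

lemma l2_scale: "l2 f \<Longrightarrow> l2 (\<lambda>s. c * f s)"
  unfolding l2_def by (simp add: norm_mult power_mult_distrib summable_on_cmult_right)

lemma l2_add:
  assumes "l2 f" "l2 g"
  shows "l2 (\<lambda>s. f s + g s)"
  unfolding l2_def
proof (rule summable_on_comparison_test)
  show "(\<lambda>s. 2 * (cmod (f s))\<^sup>2 + 2 * (cmod (g s))\<^sup>2) summable_on UNIV"
    using assms unfolding l2_def by (intro summable_on_add summable_on_cmult_right)
  show "(cmod (f s + g s))\<^sup>2 \<le> 2 * (cmod (f s))\<^sup>2 + 2 * (cmod (g s))\<^sup>2" for s
  proof -
    have "(cmod (f s + g s))\<^sup>2 \<le> (cmod (f s) + cmod (g s))\<^sup>2"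
      by (intro power_mono norm_triangle_ineq) auto
    also have "\<dots> \<le> 2 * (cmod (f s))\<^sup>2 + 2 * (cmod (g s))\<^sup>2"
      using sum_squares_bound[of "cmod (f s)" "cmod (g s)"] by (simp add: power2_sum)
    finally show ?thesis .
  qed
qed auto

lemma l2_zero: "l2 (\<lambda>_. 0)"
  by (simp add: l2_def)

lemma l2_sum: "(\<And>i. i \<in> I \<Longrightarrow> l2 (f i)) \<Longrightarrow> l2 (\<lambda>s. \<Sum>i\<in>I. f i s)"
  by (induction I rule: infinite_finite_induct) (auto simp: l2_zero intro: l2_add)

lemma has_sum_finite_sum:
  fixes f :: "'i \<Rightarrow> 'a \<Rightarrow> 'b::topological_comm_monoid_add"
  shows "(\<And>i. i \<in> I \<Longrightarrow> (f i has_sum a i) A) \<Longrightarrow> ((\<lambda>x. \<Sum>i\<in>I. f i x) has_sum (\<Sum>i\<in>I. a i)) A"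
  by (induction I rule: infinite_finite_induct) (auto intro: has_sum_add)

lemma psd_limit:
  fixes K' :: "'a \<Rightarrow> 'a \<Rightarrow> complex"
  assumes "\<And>L. psd (K L)" and lim: "\<And>a b. (\<lambda>L. K L a b) \<longlonglongrightarrow> K' a b"
  shows "psd K'"
proof (rule psdI)
  show "K' b a = cnj (K' a b)" for a b
  proof (rule LIMSEQ_unique[OF lim])
    have "K L b a = cnj (K L a b)" for L using psd_herm[OF assms(1)] .
    thus "(\<lambda>L. K L b a) \<longlonglongrightarrow> cnj (K' a b)" using lim[of a b] by (simp add: tendsto_cnj)
  qed
  fix A :: "'a set" and c assume A: "finite A"
  have "(\<lambda>L. Re (qform A (K L) c)) \<longlonglongrightarrow> Re (qform A K' c)"
    unfolding qform_def by (intro tendsto_intros lim)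
  thus "0 \<le> Re (qform A K' c)"
    by (rule LIMSEQ_le_const) (use psd_nonneg[OF assms(1) A] in auto)
qed

lemma gram_psd:
  fixes x :: "'a \<Rightarrow> 't \<Rightarrow> complex"
  assumes fin: "\<And>a. finite (X a)" and sup: "\<And>a t. t \<notin> X a \<Longrightarrow> x a t = 0"
  shows "psd (\<lambda>a b. \<Sum>t\<in>X a. x a t * cnj (x b t))"
proof (rule psdI)
  have sum: "(\<Sum>t\<in>X a. x a t * cnj (x b t)) = (\<Sum>t\<in>Y. x a t * cnj (x b t))" if "finite Y" "X a \<subseteq> Y" for a b Y
    by (rule sum.mono_neutral_left) (use that sup in auto)
  show "(\<Sum>t\<in>X b. x b t * cnj (x a t)) = cnj (\<Sum>t\<in>X a. x a t * cnj (x b t))" for a b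
    using fin by (simp add: sum[of "X a \<union> X b"] mult.commute)
  fix A :: "'a set" and c assume A: "finite A"
  define Y where "Y = (\<Union>a\<in>A. X a)"
  have Y: "finite Y" using A fin by (simp add: Y_def)
  have "qform A (\<lambda>a b. \<Sum>t\<in>X a. x a t * cnj (x b t)) c = qform A (\<lambda>a b. \<Sum>t\<in>Y. x a t * cnj (x b t)) c"
    by (rule qform_cong[OF refl sum[OF Y]]) (auto simp: Y_def)
  thus "0 \<le> Re (qform A (\<lambda>a b. \<Sum>t\<in>X a. x a t * cnj (x b t)) c)"
    by (simp add: qform_sum qform_rank_one sum_nonneg)
qed

lemma psd_block_diag:
  assumes "psd K1" "psd K2"
  shows "psd (\<lambda>a b. case (a, b) of (Inl t, Inl t') \<Rightarrow> K1 t t' | (Inr s, Inr s') \<Rightarrow> K2 s s' | _ \<Rightarrow> 0)"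
proof (rule psdI)
  show "(case (b, a) of (Inl t, Inl t') \<Rightarrow> K1 t t' | (Inr s, Inr s') \<Rightarrow> K2 s s' | _ \<Rightarrow> 0)
      = cnj (case (a, b) of (Inl t, Inl t') \<Rightarrow> K1 t t' | (Inr s, Inr s') \<Rightarrow> K2 s s' | _ \<Rightarrow> 0)" for a b
    by (auto simp: psd_herm[OF assms(1), symmetric] psd_herm[OF assms(2), symmetric] split: sum.splits)
  fix A :: "('a + 'b) set" and c assume A: "finite A"
  define A1 A2 where "A1 = Inl -` A" and "A2 = Inr -` A"
  have AA: "A = Inl ` A1 \<union> Inr ` A2"
    unfolding A1_def A2_def by (auto simp: image_iff) (metis sum.exhaust)
  have f: "finite A1" "finite A2"
    unfolding A1_def A2_def using A by (auto intro!: finite_vimageI)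
  have split: "(\<Sum>a\<in>A. f a) = (\<Sum>t\<in>A1. f (Inl t)) + (\<Sum>s\<in>A2. f (Inr s))" for f :: "'a + 'b \<Rightarrow> complex"
    unfolding AA using f by (subst sum.union_disjoint) (auto simp: sum.reindex)
  have "qform A (\<lambda>a b. case (a, b) of (Inl t, Inl t') \<Rightarrow> K1 t t' | (Inr s, Inr s') \<Rightarrow> K2 s s' | _ \<Rightarrow> 0) c
      = qform A1 K1 (\<lambda>t. c (Inl t)) + qform A2 K2 (\<lambda>s. c (Inr s))"
    by (simp add: qform_def split)
  thus "0 \<le> Re (qform A (\<lambda>a b. case (a, b) of (Inl t, Inl t') \<Rightarrow> K1 t t' | (Inr s, Inr s') \<Rightarrow> K2 s s' | _ \<Rightarrow> 0) c)"
    using psd_nonneg[OF assms(1) f(1)] psd_nonneg[OF assms(2) f(2)] by simp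
qed

text \<open>Eliminating the vectors of a family \<open>p\<close> from the Gram kernel of \<open>p\<close> and the standard basis amounts to
  orthonormalising \<open>p\<close>; doing the same for \<open>q\<close> gives a contraction \<open>v\<close> with \<open>v p = q\<close>, which \<open>w\<close> completes to an
  isometry.\<close>

locale gram_pair =
  fixes p :: "'k::countable \<Rightarrow> 't::countable \<Rightarrow> complex" and q :: "'k \<Rightarrow> 's \<Rightarrow> complex"
    and P :: "'k \<Rightarrow> 't set" and Q :: "'k \<Rightarrow> 's set"
  assumes finP: "\<And>k. finite (P k)" and supP: "\<And>k t. t \<notin> P k \<Longrightarrow> p k t = 0"
    and finQ: "\<And>k. finite (Q k)" and supQ: "\<And>k s. s \<notin> Q k \<Longrightarrow> q k s = 0"
    and gram: "\<And>k k'. (\<Sum>t\<in>P k. p k t * cnj (p k' t)) = (\<Sum>s\<in>Q k. q k s * cnj (q k' s))"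
begin

definition N1 :: "'k + 't \<Rightarrow> 'k + 't \<Rightarrow> complex" where
  "N1 a b = (\<Sum>t\<in>case_sum P (\<lambda>t. {t}) a. case_sum p (\<lambda>t t'. if t' = t then 1 else 0) a t
     * cnj (case_sum p (\<lambda>t t'. if t' = t then 1 else 0) b t))"

definition N2 :: "'k + 's \<Rightarrow> 'k + 's \<Rightarrow> complex" where
  "N2 a b = (\<Sum>s\<in>case_sum Q (\<lambda>s. {s}) a. case_sum q (\<lambda>s s'. if s' = s then 1 else 0) a s
     * cnj (case_sum q (\<lambda>s s'. if s' = s then 1 else 0) b s))"

text \<open>Only the members of \<open>p\<close> serve as pivots. \<open>R1 l (Inl k)\<close> and
  \<open>R1 l (Inr t)\<close> are the coefficients of \<open>p k\<close> and of the basis vector at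
  \<open>t\<close> along the \<open>l\<close>-th vector of the orthonormalised family.\<close>

definition R1 :: "nat \<Rightarrow> 'k + 't \<Rightarrow> complex" where "R1 = elim_coeff N1 (\<lambda>l. Inl (from_nat l))"
definition R2 :: "nat \<Rightarrow> 'k + 's \<Rightarrow> complex" where "R2 = elim_coeff N2 (\<lambda>l. Inl (from_nat l))"

lemma psd_N1: "psd N1"
  unfolding N1_def[abs_def] by (rule gram_psd) (auto simp: finP supP split: sum.splits)

lemma psd_N2: "psd N2"
  unfolding N2_def[abs_def] by (rule gram_psd) (auto simp: finQ supQ split: sum.splits)

lemma N1_simps: "N1 (Inr t) (Inr t') = (if t = t' then 1 else 0)"
  "N1 (Inl k) b = (\<Sum>t\<in>P k. p k t * N1 (Inr t) b)"
  by (simp_all add: N1_def)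

lemma N2_simps: "N2 (Inr s) (Inr s') = (if s = s' then 1 else 0)" "N2 (Inl k) (Inr s) = q k s"
  by (auto simp: N2_def finQ supQ if_distrib[of cnj] if_distrib[of "(*) _"] cong: if_cong)

text \<open>Elimination with pivots in the family, watched on the family, sees nothing but the Gram
  matrix, and \<open>p\<close> and \<open>q\<close> share it.\<close>

lemma elim_eq:
  "elim_seq N1 (\<lambda>l. Inl (from_nat l)) l (Inl k) (Inl k') = elim_seq N2 (\<lambda>l. Inl (from_nat l)) l (Inl k) (Inl k')"
  by (induction l arbitrary: k k') (simp_all add: eliminate_def, simp add: N1_def N2_def gram)

lemma R1_eq_R2: "R1 l (Inl k) = R2 l (Inl k)"
  by (simp add: R1_def R2_def elim_coeff_def elim_eq)

text \<open>With the second index fixed, elimination is linear in the row it acts on, so the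
  expansion of \<open>p k\<close> in the standard basis survives every step.\<close>

lemma elim_linear:
  "elim_seq N1 (\<lambda>l. Inl (from_nat l)) l (Inl k) b
    = (\<Sum>t\<in>P k. p k t * elim_seq N1 (\<lambda>l. Inl (from_nat l)) l (Inr t) b)"
proof (induction l arbitrary: b)
  case 0
  show ?case by (simp add: N1_simps(2))
next
  case (Suc l)
  show ?case
    by (simp only: elim_seq.simps eliminate_def Suc[of b] Suc[of "Inl (from_nat l)"] right_diff_distrib
        sum_subtractf sum_distrib_right sum_divide_distrib times_divide_eq_right mult.assoc)
qed

lemma R1_linear: "(\<Sum>t\<in>P k. p k t * R1 l (Inr t)) = R1 l (Inl k)"
  by (simp add: R1_def elim_coeff_def elim_linear[of l k] sum_divide_distrib)

text \<open>Matrix of the partial isometry that sends the \<open>l\<close>-th orthonormalised vector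
  of \<open>p\<close> to that of \<open>q\<close> and vanishes on the orthogonal complement;
  \<open>t\<close> is the input and \<open>s\<close> the output coordinate.\<close>

definition v :: "'t \<Rightarrow> 's \<Rightarrow> complex" where
  "v t s = suminf (\<lambda>l. R1 l (Inr t) * cnj (R2 l (Inr s)))"

lemma R1_bound: "(\<Sum>l<L. (cmod (R1 l (Inr t)))\<^sup>2) \<le> 1"
  using psd_bessel[OF psd_N1, of _ "Inr t" L] by (simp add: R1_def N1_simps)

lemma R2_bound: "(\<Sum>l<L. (cmod (R2 l (Inr s)))\<^sup>2) \<le> 1"
  using psd_bessel[OF psd_N2, of _ "Inr s" L] by (simp add: R2_def N2_simps)

lemma v_sums: "(\<lambda>l. R1 l (Inr t) * cnj (R2 l (Inr s))) sums v t s"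
proof -
  have "summable (\<lambda>l. (cmod (R1 l (Inr t)))\<^sup>2 + (cmod (R2 l (Inr s)))\<^sup>2)"
    by (intro summable_add summableI_nonneg_bounded[of _ 1] R1_bound R2_bound) auto
  hence "summable (\<lambda>l. R1 l (Inr t) * cnj (R2 l (Inr s)))"
  proof (rule summable_comparison_test'[where N = 0])
    show "cmod (R1 l (Inr t) * cnj (R2 l (Inr s))) \<le> (cmod (R1 l (Inr t)))\<^sup>2 + (cmod (R2 l (Inr s)))\<^sup>2" for l
      by (simp add: norm_mult prod_le_sum_squares)
  qed
  thus ?thesis unfolding v_def by (rule summable_sums)
qed

text \<open>Linearity collapses the sum over \<open>t\<close> to the coefficients of
  \<open>p k\<close>, which are those of \<open>q k\<close>. They vanish after step
  \<open>to_nat k\<close>, when the row of \<open>q k\<close> in \<open>N2\<close> is exhausted and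
  the sum is the entry \<open>q k s\<close>.\<close>

lemma v_p: "(\<Sum>t\<in>P k. p k t * v t s) = q k s"
proof (rule sums_unique2)
  show "(\<lambda>l. \<Sum>t\<in>P k. p k t * (R1 l (Inr t) * cnj (R2 l (Inr s)))) sums (\<Sum>t\<in>P k. p k t * v t s)"
    by (intro sums_sum sums_mult v_sums)
  have "(\<Sum>t\<in>P k. p k t * (R1 l (Inr t) * cnj (R2 l (Inr s)))) = R2 l (Inl k) * cnj (R2 l (Inr s))" for l
    unfolding R1_eq_R2[symmetric] R1_linear[symmetric] by (simp add: sum_distrib_right mult.assoc)
  moreover have "(\<lambda>l. R2 l (Inl k) * cnj (R2 l (Inr s))) sums (\<Sum>l<Suc (to_nat k). R2 l (Inl k) * cnj (R2 l (Inr s)))"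
    by (rule sums_finite) (use elim_coeff_pivot[OF psd_N2, of "to_nat k" _ "\<lambda>l. Inl (from_nat l)"] in \<open>auto simp: R2_def not_less\<close>)
  moreover have "(\<Sum>l<Suc (to_nat k). R2 l (Inl k) * cnj (R2 l (Inr s))) = N2 (Inl k) (Inr s)"
    by (subst elim_seq_decomp[OF psd_N2, of _ _ "\<lambda>l. Inl (from_nat l)" "Suc (to_nat k)"])
       (use elim_seq_pivot(1)[OF psd_N2, of "to_nat k" "Suc (to_nat k)" "\<lambda>l. Inl (from_nat l)"] in \<open>simp add: R2_def\<close>)
  ultimately show "(\<lambda>l. \<Sum>t\<in>P k. p k t * (R1 l (Inr t) * cnj (R2 l (Inr s)))) sums q k s"
    by (simp add: N2_simps)
qed

text \<open>The block kernel with identities on the diagonal and \<open>v\<close> off the diagonal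
  is positive, being the limit of sums of rank-one kernels \<open>r l\<close> plus the remainders of
  the two eliminations. Its form at \<open>c\<close> together with minus the image \<open>w\<close>
  of \<open>c\<close> is the squared norm of \<open>c\<close> minus that of
  \<open>w\<close>.\<close>

lemma v_contraction:
  assumes A: "finite A" and S: "finite S"
  shows "(\<Sum>s\<in>S. (cmod (\<Sum>t\<in>A. c t * v t s))\<^sup>2) \<le> (\<Sum>t\<in>A. (cmod (c t))\<^sup>2)"
proof -
  define Zk where "Zk a b = (case (a, b) of (Inl t, Inl t') \<Rightarrow> if t = t' then 1 else 0 | (Inl t, Inr s) \<Rightarrow> v t s
      | (Inr s, Inl t) \<Rightarrow> cnj (v t s) | (Inr s, Inr s') \<Rightarrow> if s = s' then 1 else (0 :: complex))" for a b :: "'t + 's"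
  define r where "r l = case_sum (\<lambda>t. R1 l (Inr t)) (\<lambda>s. R2 l (Inr s))" for l
  define E where "E L a b = (case (a, b) of (Inl t, Inl t') \<Rightarrow> elim_seq N1 (\<lambda>l. Inl (from_nat l)) L (Inr t) (Inr t')
      | (Inr s, Inr s') \<Rightarrow> elim_seq N2 (\<lambda>l. Inl (from_nat l)) L (Inr s) (Inr s') | _ \<Rightarrow> 0)" for L and a b :: "'t + 's"
  have E: "psd (E L)" for L
    unfolding E_def[abs_def]
    by (intro psd_block_diag psd_pullback[where f = Inr] psd_elim_seq psd_N1 psd_N2)
  have "psd Zk"
  proof (rule psd_limit)
    show "psd (\<lambda>a b. (\<Sum>l<L. r l a * cnj (r l b)) + E L a b)" for L
      by (intro psd_add psd_sum psd_rank_one E)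
    fix a b :: "'t + 's"
    show "(\<lambda>L. (\<Sum>l<L. r l a * cnj (r l b)) + E L a b) \<longlonglongrightarrow> Zk a b"
    proof (cases a; cases b)
      fix t t' assume "a = Inl t" "b = Inl t'"
      thus ?thesis using elim_seq_decomp[OF psd_N1, of "Inr t" "Inr t'" "\<lambda>l. Inl (from_nat l)", symmetric]
        by (simp add: r_def E_def Zk_def R1_def N1_simps)
    next
      fix s s' assume "a = Inr s" "b = Inr s'"
      thus ?thesis using elim_seq_decomp[OF psd_N2, of "Inr s" "Inr s'" "\<lambda>l. Inl (from_nat l)", symmetric]
        by (simp add: r_def E_def Zk_def R2_def N2_simps)
    next
      fix t s assume "a = Inl t" "b = Inr s"
      thus ?thesis using v_sums[of t s] by (simp add: r_def E_def Zk_def sums_def)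
    next
      fix s t assume "a = Inr s" "b = Inl t"
      thus ?thesis using tendsto_cnj[OF v_sums[of t s, unfolded sums_def]]
        by (simp add: r_def E_def Zk_def cnj_sum mult.commute)
    qed
  qed
  define w where "w s = (\<Sum>t\<in>A. c t * v t s)" for s
  define dd where "dd = case_sum c (\<lambda>s. - w s)"
  have w1: "(\<Sum>t\<in>A. c t * x * v t s) = w s * x" for x s
    unfolding w_def sum_distrib_right by (intro sum.cong refl) (simp add: mult_ac)
  have w2: "(\<Sum>t\<in>A. x * cnj (c t) * cnj (v t s)) = x * cnj (w s)" for x s
    by (simp add: w_def cnj_sum sum_distrib_left mult.assoc)
  let ?U = "Inl ` A \<union> Inr ` S"
  have split: "(\<Sum>a\<in>?U. f a) = (\<Sum>t\<in>A. f (Inl t)) + (\<Sum>s\<in>S. f (Inr s))" for f :: "'t + 's \<Rightarrow> complex"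
    using A S by (subst sum.union_disjoint) (auto simp: sum.reindex)
  have "0 \<le> Re (qform ?U Zk dd)" using A S by (intro psd_nonneg \<open>psd Zk\<close>) auto
  also have "qform ?U Zk dd = (\<Sum>t\<in>A. \<Sum>t'\<in>A. c t * cnj (c t') * (if t = t' then 1 else 0))
     - (\<Sum>t\<in>A. \<Sum>s\<in>S. c t * cnj (w s) * v t s) - (\<Sum>s\<in>S. \<Sum>t\<in>A. w s * cnj (c t) * cnj (v t s))
     + (\<Sum>s\<in>S. \<Sum>s'\<in>S. w s * cnj (w s') * (if s = s' then 1 else 0))"
    unfolding qform_def split sum.distrib dd_def by (simp add: Zk_def sum_negf algebra_simps)
  also have "(\<Sum>t\<in>A. \<Sum>t'\<in>A. c t * cnj (c t') * (if t = t' then 1 else 0)) = of_real (\<Sum>t\<in>A. (cmod (c t))\<^sup>2)"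
    using A by (simp add: complex_norm_square if_distrib[of "(*) _"] cong: if_cong del: of_real_power)
  also have "(\<Sum>s\<in>S. \<Sum>s'\<in>S. w s * cnj (w s') * (if s = s' then 1 else 0)) = of_real (\<Sum>s\<in>S. (cmod (w s))\<^sup>2)"
    using S by (simp add: complex_norm_square if_distrib[of "(*) _"] cong: if_cong del: of_real_power)
  also have "(\<Sum>t\<in>A. \<Sum>s\<in>S. c t * cnj (w s) * v t s) = of_real (\<Sum>s\<in>S. (cmod (w s))\<^sup>2)"
    by (subst sum.swap) (simp add: complex_norm_square w1 del: of_real_power)
  also have "(\<Sum>s\<in>S. \<Sum>t\<in>A. w s * cnj (c t) * cnj (v t s)) = of_real (\<Sum>s\<in>S. (cmod (w s))\<^sup>2)"
    by (simp add: complex_norm_square w2 del: of_real_power)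
  finally show ?thesis by (simp add: w_def)
qed

lemma v_l2: "l2 (v t)"
  by (rule l2_bounded(1)[of _ 1]) (use v_contraction[of "{t}" _ "\<lambda>_. 1"] in simp)

text \<open>The Gram matrix by which the images \<open>v t\<close> of the basis vectors fall short
  of orthonormality, to be supplied by additional coordinates.\<close>

definition defect :: "'t \<Rightarrow> 't \<Rightarrow> complex" where
  "defect t t' = (if t = t' then 1 else 0) - (\<Sum>\<^sub>\<infinity>s. v t s * cnj (v t' s))"

lemma qform_defect:
  assumes A: "finite A"
  shows "qform A defect c = of_real ((\<Sum>t\<in>A. (cmod (c t))\<^sup>2) - (\<Sum>\<^sub>\<infinity>s. (cmod (\<Sum>t\<in>A. c t * v t s))\<^sup>2))"
proof -
  have l2w: "l2 (\<lambda>s. \<Sum>t\<in>A. c t * v t s)" by (intro l2_sum l2_scale v_l2)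
  have "((\<lambda>s. \<Sum>t\<in>A. \<Sum>t'\<in>A. c t * cnj (c t') * (v t s * cnj (v t' s))) has_sum
      qform A (\<lambda>t t'. \<Sum>\<^sub>\<infinity>s. v t s * cnj (v t' s)) c) UNIV"
    unfolding qform_def
    by (intro has_sum_finite_sum has_sum_cmult_right has_sum_infsum l2_product_summable v_l2)
  hence "qform A (\<lambda>t t'. \<Sum>\<^sub>\<infinity>s. v t s * cnj (v t' s)) c
      = (\<Sum>\<^sub>\<infinity>s. \<Sum>t\<in>A. \<Sum>t'\<in>A. c t * cnj (c t') * (v t s * cnj (v t' s)))"
    by (rule infsumI[symmetric])
  also have "\<dots> = (\<Sum>\<^sub>\<infinity>s. of_real ((cmod (\<Sum>t\<in>A. c t * v t s))\<^sup>2))"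
    by (intro infsum_cong) (simp add: qform_rank_one[symmetric] qform_def del: of_real_power)
  also have "\<dots> = of_real (\<Sum>\<^sub>\<infinity>s. (cmod (\<Sum>t\<in>A. c t * v t s))\<^sup>2)"
    by (rule infsumI, rule has_sum_bounded_linear[OF bounded_linear_of_real]) (use l2w in \<open>simp add: l2_def\<close>)
  finally have "qform A (\<lambda>t t'. \<Sum>\<^sub>\<infinity>s. v t s * cnj (v t' s)) c = \<dots>" .
  moreover have "qform A (\<lambda>t t'. if t = t' then 1 else 0) c = of_real (\<Sum>t\<in>A. (cmod (c t))\<^sup>2)"
    using A unfolding qform_def
    by (simp add: complex_norm_square if_distrib[of "(*) _"] cong: if_cong del: of_real_power)
  ultimately show ?thesis unfolding defect_def[abs_def] qform_diff by simp
qed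

lemma psd_defect: "psd defect"
proof (rule psdI)
  show "defect t' t = cnj (defect t t')" for t t'
    by (simp add: defect_def infsum_cnj[symmetric] mult.commute)
  fix A :: "'t set" and c assume A: "finite A"
  have "(\<Sum>\<^sub>\<infinity>s. (cmod (\<Sum>t\<in>A. c t * v t s))\<^sup>2) \<le> (\<Sum>t\<in>A. (cmod (c t))\<^sup>2)"
    by (rule l2_bounded(2)) (rule v_contraction[OF A])
  thus "0 \<le> Re (qform A defect c)" by (simp add: qform_defect[OF A])
qed

text \<open>\<open>w\<close> is a triangular factor of the defect. At \<open>p k\<close> the defect
  form is the squared norm of \<open>p k\<close> minus that of \<open>q k\<close>, hence 0; so
  \<open>w\<close> annihilates the family, and adding it to \<open>v\<close> in other coordinates
  does not disturb the images of the family.\<close>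

theorem isometric_extension:
  obtains w :: "'t \<Rightarrow> nat \<Rightarrow> complex" where
    "\<And>t l. to_nat t < l \<Longrightarrow> w t l = 0"
    "\<And>t t'. ((\<lambda>s. v t s * cnj (v t' s)) has_sum
        ((if t = t' then 1 else 0) - (\<Sum>l<Suc (to_nat t). w t l * cnj (w t' l)))) UNIV"
    "\<And>k l. (\<Sum>t\<in>P k. p k t * w t l) = 0"
proof -
  have "\<exists>w :: 't \<Rightarrow> nat \<Rightarrow> complex. (\<forall>t l. to_nat t < l \<longrightarrow> w t l = 0)
      \<and> (\<forall>t t' L. to_nat t < L \<longrightarrow> defect t t' = (\<Sum>l<L. w t l * cnj (w t' l)))"
  proof (rule psd_countable_decomp[OF psd_defect])
    fix U :: "'t \<Rightarrow> nat \<Rightarrow> complex"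
    assume "\<And>a l. to_nat a < l \<Longrightarrow> U a l = 0"
      and "\<And>a b L. to_nat a < L \<Longrightarrow> defect a b = (\<Sum>l<L. U a l * cnj (U b l))"
    thus ?thesis by (intro exI[of _ U]) simp
  qed
  then obtain w :: "'t \<Rightarrow> nat \<Rightarrow> complex" where w: "\<And>t l. to_nat t < l \<Longrightarrow> w t l = 0"
    "\<And>t t' L. to_nat t < L \<Longrightarrow> defect t t' = (\<Sum>l<L. w t l * cnj (w t' l))" by blast
  show ?thesis
  proof (rule that[OF w(1)])
    fix t t'
    have "(if t = t' then 1 else 0) - (\<Sum>l<Suc (to_nat t). w t l * cnj (w t' l)) = (\<Sum>\<^sub>\<infinity>s. v t s * cnj (v t' s))"
      by (simp add: w(2)[of t "Suc (to_nat t)", symmetric] defect_def del: sum.lessThan_Suc)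
    thus "((\<lambda>s. v t s * cnj (v t' s)) has_sum
        ((if t = t' then 1 else 0) - (\<Sum>l<Suc (to_nat t). w t l * cnj (w t' l)))) UNIV"
      using has_sum_infsum[OF l2_product_summable[OF v_l2 v_l2]] by simp
  next
    fix k l
    \<comment> \<open>Large enough to exhaust the rows of all \<open>t\<close> in \<open>P k\<close>
      and to include the coordinate \<open>l\<close>.\<close>
    define L where "L = Suc (max l (Max (insert 0 (to_nat ` P k))))"
    have L: "to_nat t < L" if "t \<in> P k" for t
      using that finP[of k] by (auto simp: L_def less_Suc_eq_le intro!: max.coboundedI2)
    have "qform (P k) defect (p k) = qform (P k) (\<lambda>t t'. \<Sum>l<L. w t l * cnj (w t' l)) (p k)"
      by (rule qform_cong) (auto intro!: w(2) L)
    hence "of_real (\<Sum>l<L. (cmod (\<Sum>t\<in>P k. p k t * w t l))\<^sup>2) = qform (P k) defect (p k)"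
      by (simp add: qform_sum qform_rank_one)
    also have "\<dots> = of_real ((\<Sum>t\<in>P k. (cmod (p k t))\<^sup>2) - (\<Sum>\<^sub>\<infinity>s. (cmod (q k s))\<^sup>2))"
      unfolding qform_defect[OF finP] v_p ..
    also have "(\<Sum>\<^sub>\<infinity>s. (cmod (q k s))\<^sup>2) = (\<Sum>s\<in>Q k. (cmod (q k s))\<^sup>2)"
    proof -
      have "(\<Sum>\<^sub>\<infinity>s. (cmod (q k s))\<^sup>2) = (\<Sum>\<^sub>\<infinity>s\<in>Q k. (cmod (q k s))\<^sup>2)"
        by (rule infsum_cong_neutral) (use supQ in auto)
      thus ?thesis using finQ by simp
    qed
    also have "\<dots> = (\<Sum>t\<in>P k. (cmod (p k t))\<^sup>2)"
      unfolding cmod_power2 using arg_cong[OF gram[of k k], of Re] by (simp add: power2_eq_square sum.distrib)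
    finally have "(\<Sum>l<L. (cmod (\<Sum>t\<in>P k. p k t * w t l))\<^sup>2) = 0"
      by (simp del: of_real_sum)
    hence "(cmod (\<Sum>t\<in>P k. p k t * w t l))\<^sup>2 = 0"
      by (simp add: sum_nonneg_eq_0_iff L_def del: sum.lessThan_Suc)
    thus "(\<Sum>t\<in>P k. p k t * w t l) = 0" by simp
  qed
qed

end

section \<open>Hilbert spaces with explicit carriers\<close>

context hilbert_space
begin

lemma smult_closed': "u \<in> carrier H \<Longrightarrow> (c :: complex) \<odot>\<^bsub>H\<^esub> u \<in> carrier H"
  by (rule smult_closed) simp_all

lemma minus_eq_smult: "u \<in> carrier H \<Longrightarrow> v \<in> carrier H \<Longrightarrow> u \<ominus> v = u \<oplus> (- 1 :: complex) \<odot>\<^bsub>H\<^esub> v"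
  using smult_minus_1[of v] by (simp add: a_minus_def class_ring_simps)

lemma inner_add_right: "\<lbrakk>u \<in> carrier H; v \<in> carrier H; w \<in> carrier H\<rbrakk> \<Longrightarrow>
    hinner H u (v \<oplus> w) = hinner H u v + hinner H u w"
  by (subst inner_commute) (simp_all add: inner_add inner_commute[of u v] inner_commute[of u w])

lemma inner_smult_right: "\<lbrakk>u \<in> carrier H; v \<in> carrier H\<rbrakk> \<Longrightarrow> hinner H u (c \<odot>\<^bsub>H\<^esub> v) = cnj c * hinner H u v"
  by (subst inner_commute) (simp_all add: inner_smult smult_closed' inner_commute[of u v])

lemma inner_zero_left: "u \<in> carrier H \<Longrightarrow> hinner H \<zero> u = 0"
  using inner_add[of \<zero> \<zero> u] by simp

lemma inner_zero_right: "u \<in> carrier H \<Longrightarrow> hinner H u \<zero> = 0"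
  using inner_add_right[of u \<zero> \<zero>] by simp

lemma hnorm_sq: "u \<in> carrier H \<Longrightarrow> (hnorm H u)\<^sup>2 = Re (hinner H u u)"
  by (simp add: hnorm_def inner_nonneg)

lemma inner_self: "u \<in> carrier H \<Longrightarrow> hinner H u u = of_real ((hnorm H u)\<^sup>2)"
proof -
  assume u: "u \<in> carrier H"
  have "Im (hinner H u u) = 0"
    using arg_cong[OF inner_commute[OF u u], of Im] unfolding cnj.sel equal_neg_zero .
  thus ?thesis by (simp add: hnorm_sq[OF u] complex_eq_iff)
qed

lemma hnorm_nonneg: "u \<in> carrier H \<Longrightarrow> 0 \<le> hnorm H u"
  by (simp add: hnorm_def inner_nonneg)

lemma hnorm_zero: "hnorm H \<zero> = 0"
  by (simp add: hnorm_def inner_zero_left)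

lemma hnorm_eq_zero:
  assumes "u \<in> carrier H" "hnorm H u = 0"
  shows "u = \<zero>"
  by (rule inner_definite[OF assms(1)]) (simp add: inner_self[OF assms(1)] assms(2))

lemma hnorm_le_zero: "u \<in> carrier H \<Longrightarrow> hnorm H u \<le> 0 \<Longrightarrow> u = \<zero>"
  by (rule hnorm_eq_zero) (auto intro: antisym hnorm_nonneg)

lemma inner_finsum_left:
  "finite A \<Longrightarrow> f \<in> A \<rightarrow> carrier H \<Longrightarrow> w \<in> carrier H \<Longrightarrow> hinner H (\<Oplus>i\<in>A. f i) w = (\<Sum>i\<in>A. hinner H (f i) w)"
  by (induction A rule: finite_induct) (auto simp: inner_zero_left inner_add Pi_def)

lemma inner_finsum_right:
  "finite A \<Longrightarrow> f \<in> A \<rightarrow> carrier H \<Longrightarrow> w \<in> carrier H \<Longrightarrow> hinner H w (\<Oplus>i\<in>A. f i) = (\<Sum>i\<in>A. hinner H w (f i))"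
  by (induction A rule: finite_induct) (auto simp: inner_zero_right inner_add_right Pi_def)

lemma qform_inner:
  assumes "finite A" and f: "f \<in> A \<rightarrow> carrier H"
  shows "qform A (\<lambda>a b. hinner H (f a) (f b)) c = of_real ((hnorm H (\<Oplus>a\<in>A. c a \<odot>\<^bsub>H\<^esub> f a))\<^sup>2)"
proof -
  have cf: "(\<lambda>a. c a \<odot>\<^bsub>H\<^esub> f a) \<in> A \<rightarrow> carrier H" using f by (auto intro: smult_closed')
  have "hinner H (\<Oplus>a\<in>A. c a \<odot>\<^bsub>H\<^esub> f a) (\<Oplus>a\<in>A. c a \<odot>\<^bsub>H\<^esub> f a)
      = (\<Sum>a\<in>A. \<Sum>b\<in>A. hinner H (c a \<odot>\<^bsub>H\<^esub> f a) (c b \<odot>\<^bsub>H\<^esub> f b))"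
    using assms cf by (subst inner_finsum_left) (auto intro!: sum.cong inner_finsum_right)
  also have "\<dots> = qform A (\<lambda>a b. hinner H (f a) (f b)) c"
    unfolding qform_def
    by (intro sum.cong refl) (use f in \<open>auto simp: inner_smult inner_smult_right smult_closed' Pi_def\<close>)
  finally show ?thesis using inner_self[of "\<Oplus>a\<in>A. c a \<odot>\<^bsub>H\<^esub> f a"] cf by (simp add: finsum_closed)
qed

lemma psd_inner:
  fixes f :: "'i \<Rightarrow> _"
  assumes f: "\<And>a. f a \<in> carrier H"
  shows "psd (\<lambda>a b. hinner H (f a) (f b))"
proof (rule psdI)
  show "hinner H (f b) (f a) = cnj (hinner H (f a) (f b))" for a b
    by (rule inner_commute) (use f in auto)
  fix A :: "'i set" and c assume "finite A"
  thus "0 \<le> Re (qform A (\<lambda>a b. hinner H (f a) (f b)) c)"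
    using f by (simp add: qform_inner)
qed

lemma cauchy_schwarz:
  assumes u: "u \<in> carrier H" and v: "v \<in> carrier H"
  shows "cmod (hinner H u v) \<le> hnorm H u * hnorm H v"
proof (rule power2_le_imp_le)
  define f where "f b = (if b then u else v)" for b
  have "psd (\<lambda>a b. hinner H (f a) (f b))" by (rule psd_inner) (simp add: f_def u v)
  from psd_cauchy_schwarz[OF this, of True False]
  show "(cmod (hinner H u v))\<^sup>2 \<le> (hnorm H u * hnorm H v)\<^sup>2"
    by (simp add: f_def power_mult_distrib hnorm_sq[OF u] hnorm_sq[OF v])
  show "0 \<le> hnorm H u * hnorm H v" using u v by (simp add: hnorm_nonneg)
qed

lemma hnorm_add: "u \<in> carrier H \<Longrightarrow> v \<in> carrier H \<Longrightarrow> hnorm H (u \<oplus> v) \<le> hnorm H u + hnorm H v"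
proof (rule power2_le_imp_le)
  assume u: "u \<in> carrier H" and v: "v \<in> carrier H"
  have "(hnorm H (u \<oplus> v))\<^sup>2 = (hnorm H u)\<^sup>2 + (hnorm H v)\<^sup>2 + 2 * Re (hinner H u v)"
    using u v inner_commute[of v u] by (simp add: hnorm_sq inner_add inner_add_right)
  also have "Re (hinner H u v) \<le> hnorm H u * hnorm H v"
    using cauchy_schwarz[OF u v] complex_Re_le_cmod order_trans by blast
  finally show "(hnorm H (u \<oplus> v))\<^sup>2 \<le> (hnorm H u + hnorm H v)\<^sup>2"
    by (simp add: power2_sum algebra_simps)
  show "0 \<le> hnorm H u + hnorm H v" using u v by (simp add: hnorm_nonneg)
qed

lemma hnorm_smult: "u \<in> carrier H \<Longrightarrow> hnorm H (c \<odot>\<^bsub>H\<^esub> u) = cmod c * hnorm H u"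
proof -
  assume u: "u \<in> carrier H"
  have cu: "c \<odot>\<^bsub>H\<^esub> u \<in> carrier H" using u by (rule smult_closed')
  have "hinner H (c \<odot>\<^bsub>H\<^esub> u) (c \<odot>\<^bsub>H\<^esub> u) = (c * cnj c) * hinner H u u"
    using u cu by (simp add: inner_smult inner_smult_right)
  also have "\<dots> = of_real ((cmod c)\<^sup>2 * (hnorm H u)\<^sup>2)"
    by (simp only: inner_self[OF u] complex_norm_square[symmetric] of_real_mult)
  finally have "(hnorm H (c \<odot>\<^bsub>H\<^esub> u))\<^sup>2 = (cmod c * hnorm H u)\<^sup>2"
    by (simp only: hnorm_sq[OF cu] Re_complex_of_real power_mult_distrib)
  thus ?thesis using u by (simp add: power2_eq_iff_nonneg hnorm_nonneg smult_closed')
qed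

lemma hnorm_minus_commute: "u \<in> carrier H \<Longrightarrow> v \<in> carrier H \<Longrightarrow> hnorm H (u \<ominus> v) = hnorm H (v \<ominus> u)"
proof -
  assume u: "u \<in> carrier H" and v: "v \<in> carrier H"
  have "(- 1 :: complex) \<odot>\<^bsub>H\<^esub> (u \<ominus> v) = v \<ominus> u"
    using u v smult_minus_1[of "u \<ominus> v"]
    by (simp add: class_ring_simps a_minus_def minus_add a_comm)
  thus ?thesis using hnorm_smult[of "u \<ominus> v" "- 1"] u v by simp
qed

lemma minus_plus_minus: "u \<in> carrier H \<Longrightarrow> v \<in> carrier H \<Longrightarrow> w \<in> carrier H \<Longrightarrow> (u \<ominus> v) \<oplus> (v \<ominus> w) = u \<ominus> w"
  by (simp add: a_minus_def a_assoc r_neg1)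

lemma add_minus_add:
  assumes "k \<in> carrier H" "x \<in> carrier H" "y \<in> carrier H"
  shows "(k \<oplus> x) \<ominus> (k \<oplus> y) = x \<ominus> y"
proof -
  have "(k \<oplus> x) \<ominus> (k \<oplus> y) = (x \<oplus> k) \<oplus> (\<ominus> k \<oplus> \<ominus> y)"
    using assms by (simp add: a_minus_def minus_add a_comm[of k x])
  also have "\<dots> = x \<oplus> (k \<oplus> (\<ominus> k \<oplus> \<ominus> y))" using assms by (intro a_assoc) auto
  also have "\<dots> = x \<ominus> y" using assms by (simp add: r_neg2 a_minus_def)
  finally show ?thesis .
qed

lemma minus_eq_swap:
  assumes "a \<in> carrier H" "b \<in> carrier H" "c \<in> carrier H" "e \<in> carrier H" and eq: "a \<ominus> b = c \<ominus> e"
  shows "a \<ominus> c = b \<ominus> e"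
proof -
  have "a \<ominus> c = (c \<ominus> e) \<oplus> (b \<ominus> c)"
    using minus_plus_minus[of a b c] assms by simp
  also have "\<dots> = (b \<ominus> c) \<oplus> (c \<ominus> e)" using assms by (intro a_comm) auto
  also have "\<dots> = b \<ominus> e" using assms by (intro minus_plus_minus)
  finally show ?thesis .
qed

lemma hnorm_triangle:
  "u \<in> carrier H \<Longrightarrow> v \<in> carrier H \<Longrightarrow> w \<in> carrier H \<Longrightarrow> hnorm H (u \<ominus> w) \<le> hnorm H (u \<ominus> v) + hnorm H (v \<ominus> w)"
proof -
  assume *: "u \<in> carrier H" "v \<in> carrier H" "w \<in> carrier H"
  thus ?thesis using hnorm_add[of "u \<ominus> v" "v \<ominus> w"] by (simp add: minus_plus_minus)
qed

text \<open>The equation \<open>u \<ominus> T u = k\<close> says that \<open>u\<close> is a fixed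
  point of \<open>\<lambda>u. k \<oplus> T u\<close>. Surjectivity is Banach's iteration from the
  zero vector, whose limit exists by completeness.\<close>

theorem contraction_bij_betw:
  assumes T: "T \<in> carrier H \<rightarrow> carrier H"
    and Tdiff: "\<And>u v. u \<in> carrier H \<Longrightarrow> v \<in> carrier H \<Longrightarrow> T (u \<ominus> v) = T u \<ominus> T v"
    and r: "0 \<le> r" "r < 1" and contr: "\<And>u. u \<in> carrier H \<Longrightarrow> hnorm H (T u) \<le> r * hnorm H u"
  shows "bij_betw (\<lambda>u. u \<ominus> T u) (carrier H) (carrier H)"
proof -
  have Tc: "T u \<in> carrier H" if "u \<in> carrier H" for u using T that by auto
  have contr2: "hnorm H (T u \<ominus> T v) \<le> r * hnorm H (u \<ominus> v)" if "u \<in> carrier H" "v \<in> carrier H" for u v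
    using contr[of "u \<ominus> v"] Tdiff[OF that] that by simp
  have inj: "u = v" if u: "u \<in> carrier H" and v: "v \<in> carrier H" and e: "u \<ominus> T u = v \<ominus> T v" for u v
  proof -
    have "u \<ominus> v = T u \<ominus> T v" by (rule minus_eq_swap[OF u Tc[OF u] v Tc[OF v] e])
    hence "hnorm H (u \<ominus> v) \<le> r * hnorm H (u \<ominus> v)" using contr2[OF u v] by simp
    hence "(1 - r) * hnorm H (u \<ominus> v) \<le> 0" by (simp add: algebra_simps)
    hence "hnorm H (u \<ominus> v) \<le> 0" using r by (simp add: mult_le_0_iff)
    hence "u \<ominus> v = \<zero>" by (rule hnorm_le_zero[rotated]) (use u v in auto)
    thus "u = v" using u v by simp
  qed
  have surj: "\<exists>h\<in>carrier H. h \<ominus> T h = k" if k: "k \<in> carrier H" for k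
  proof -
    define s where "s m = ((\<lambda>u. k \<oplus> T u) ^^ m) \<zero>" for m
    have s0: "s 0 = \<zero>" and sS: "s (Suc m) = k \<oplus> T (s m)" for m by (simp_all add: s_def)
    have s: "s m \<in> carrier H" for m by (induction m) (use s0 sS k Tc in auto)
    have kd: "(k \<oplus> T u) \<ominus> (k \<oplus> T v) = T u \<ominus> T v" if "u \<in> carrier H" "v \<in> carrier H" for u v
      using k Tc that by (intro add_minus_add) auto
    have step: "hnorm H (s (Suc m) \<ominus> s m) \<le> r ^ m * hnorm H k" for m
    proof (induction m)
      case 0
      have "T \<zero> = \<zero>" by (rule hnorm_le_zero) (use contr[of \<zero>] Tc in \<open>auto simp: hnorm_zero\<close>)
      moreover have "\<ominus> \<zero> = \<zero>" by (rule minus_equality) simp_all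
      hence "k \<ominus> \<zero> = k" unfolding a_minus_def by (simp only: r_zero[OF k])
      ultimately show ?case using k by (simp add: s0 sS)
    next
      case (Suc m)
      have "(k \<oplus> T (s (Suc m))) \<ominus> (k \<oplus> T (s m)) = T (s (Suc m)) \<ominus> T (s m)"
        by (rule kd[OF s s])
      hence "hnorm H (s (Suc (Suc m)) \<ominus> s (Suc m)) = hnorm H (T (s (Suc m)) \<ominus> T (s m))"
        by (simp only: sS[symmetric])
      also have "\<dots> \<le> r * hnorm H (s (Suc m) \<ominus> s m)" by (rule contr2[OF s s])
      also have "\<dots> \<le> r * (r ^ m * hnorm H k)" using Suc r by (intro mult_left_mono)
      finally show ?case by (simp add: mult.assoc)
    qed
    \<comment> \<open>Sum of a geometric series: everything that happens after step
      \<open>m\<close>.\<close>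
    have dist: "hnorm H (s (m + p) \<ominus> s m) \<le> r ^ m * hnorm H k / (1 - r)" for m p
    proof -
      have "hnorm H (s (m + p) \<ominus> s m) \<le> (\<Sum>i<p. r ^ (m + i) * hnorm H k)"
      proof (induction p)
        case 0
        show ?case using s[of m] by (simp add: a_minus_def r_neg hnorm_zero)
      next
        case (Suc p)
        have "hnorm H (s (m + Suc p) \<ominus> s m) \<le> hnorm H (s (Suc (m + p)) \<ominus> s (m + p)) + hnorm H (s (m + p) \<ominus> s m)"
          using hnorm_triangle[OF s s s] by simp
        thus ?case using step[of "m + p"] Suc by simp
      qed
      also have "\<dots> = r ^ m * hnorm H k * (\<Sum>i<p. r ^ i)"
        by (simp add: power_add sum_distrib_left mult_ac)
      also have "(\<Sum>i<p. r ^ i) \<le> 1 / (1 - r)"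
        using r by (simp add: sum_gp_strict divide_right_mono)
      finally show ?thesis using r k by (simp add: mult_left_mono hnorm_nonneg)
    qed
    have "(\<lambda>m. r ^ m * hnorm H k / (1 - r)) \<longlonglongrightarrow> 0 * hnorm H k / (1 - r)"
      using r by (intro tendsto_intros LIMSEQ_realpow_zero) auto
    hence lim: "(\<lambda>m. r ^ m * hnorm H k / (1 - r)) \<longlonglongrightarrow> 0" by simp
    have "\<exists>u \<in> carrier H. (\<lambda>m. hnorm H (s m \<ominus> u)) \<longlonglongrightarrow> 0"
    proof (rule complete[OF s])
      fix e :: real assume e: "0 < e"
      then obtain N where N: "r ^ N * hnorm H k / (1 - r) < e / 2"
        using order_tendstoD(2)[OF lim, of "e / 2"] by (auto simp: eventually_sequentially)
      have "hnorm H (s m \<ominus> s l) < e" if "m \<ge> N" "l \<ge> N" for m l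
      proof -
        have "hnorm H (s m \<ominus> s N) < e / 2" "hnorm H (s l \<ominus> s N) < e / 2"
          using le_less_trans[OF dist N, of "m - N"] le_less_trans[OF dist N, of "l - N"] that by auto
        thus ?thesis
          using hnorm_triangle[OF s[of m] s[of N] s[of l]] hnorm_minus_commute[OF s[of N] s[of l]] by linarith
      qed
      thus "\<exists>N. \<forall>k\<ge>N. \<forall>l\<ge>N. hnorm H (s k \<ominus> s l) < e" by blast
    qed
    then obtain h where h: "h \<in> carrier H" and lim: "(\<lambda>m. hnorm H (s m \<ominus> h)) \<longlonglongrightarrow> 0" by blast
    have b: "hnorm H (h \<ominus> (k \<oplus> T h)) \<le> hnorm H (s (Suc m) \<ominus> h) + r * hnorm H (s m \<ominus> h)" for m
      using hnorm_triangle[OF h s[of "Suc m"], of "k \<oplus> T h"] hnorm_minus_commute[OF h s[of "Suc m"]]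
        contr2[OF s[of m] h] kd[OF s[of m] h] k Tc[OF h] by (simp add: sS)
    have "(\<lambda>m. hnorm H (s (Suc m) \<ominus> h) + r * hnorm H (s m \<ominus> h)) \<longlonglongrightarrow> 0 + r * 0"
      by (intro tendsto_intros lim LIMSEQ_Suc[OF lim])
    hence "hnorm H (h \<ominus> (k \<oplus> T h)) \<le> 0 + r * 0"
      by (rule LIMSEQ_le_const) (use b in auto)
    hence z: "h \<ominus> (k \<oplus> T h) = \<zero>" using h k Tc by (intro hnorm_le_zero) auto
    have "h = k \<oplus> T h" by (rule iffD1[OF minus_other_side z]) (use h k Tc in auto)
    hence "h \<ominus> T h = (k \<oplus> T h) \<ominus> T h" by (rule arg_cong[where f = "\<lambda>x. x \<ominus> T h"])
    also have "\<dots> = k" using h k Tc by (simp add: a_minus_def a_assoc r_neg)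
    finally have "h \<ominus> T h = k" .
    thus ?thesis using h by blast
  qed
  have "carrier H \<subseteq> (\<lambda>u. u \<ominus> T u) ` carrier H"
  proof
    fix k assume "k \<in> carrier H"
    then obtain h where "h \<in> carrier H" "h \<ominus> T h = k" using surj by blast
    thus "k \<in> (\<lambda>u. u \<ominus> T u) ` carrier H" by (intro image_eqI[of _ _ h]) (rule sym)
  qed
  moreover have "(\<lambda>u. u \<ominus> T u) ` carrier H \<subseteq> carrier H" using Tc by auto
  moreover have "inj_on (\<lambda>u. u \<ominus> T u) (carrier H)" by (rule inj_onI) (rule inj)
  ultimately show ?thesis unfolding bij_betw_def by blast
qed

end

section \<open>Tensor products of a Hilbert space with finite-dimensional spaces\<close>

lemma tensor_simps:
  "carrier (tensor H k) = (\<Pi>\<^sub>E i\<in>{..<k}. carrier H)"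
  "zero (tensor H k) = (\<lambda>i\<in>{..<k}. \<zero>\<^bsub>H\<^esub>)"
  "add (tensor H k) f g = (\<lambda>i\<in>{..<k}. f i \<oplus>\<^bsub>H\<^esub> g i)"
  "smult (tensor H k) c f = (\<lambda>i\<in>{..<k}. c \<odot>\<^bsub>H\<^esub> f i)"
  "hinner (tensor H k) f g = (\<Sum>i<k. hinner H (f i) (g i))"
  by (simp_all add: tensor_def)

context hilbert_space
begin

lemma tensor_abelian_group: "abelian_group (tensor H k)"
proof (rule abelian_groupI)
  fix f assume f: "f \<in> carrier (tensor H k)"
  show "\<exists>g\<in>carrier (tensor H k). g \<oplus>\<^bsub>tensor H k\<^esub> f = \<zero>\<^bsub>tensor H k\<^esub>"
    by (rule bexI[of _ "\<lambda>i\<in>{..<k}. \<ominus> f i"]) (use f in \<open>auto simp: tensor_simps l_neg PiE_def Pi_def cong: restrict_cong\<close>)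
  show "\<zero>\<^bsub>tensor H k\<^esub> \<oplus>\<^bsub>tensor H k\<^esub> f = f"
    using f by (auto simp: tensor_simps PiE_def Pi_def extensional_def fun_eq_iff)
qed (auto simp: tensor_simps PiE_def Pi_def a_ac cong: restrict_cong)

lemma tensor_vectorspace: "vectorspace scalar_field (tensor H k)"
proof -
  have "module_axioms scalar_field (tensor H k)"
    by unfold_locales (auto simp: tensor_simps PiE_def Pi_def smult_closed' smult_l_distr[simplified]
        smult_r_distr[simplified] smult_assoc1[simplified] extensional_def fun_eq_iff smult_one[simplified])
  thus ?thesis
    by (intro vectorspace.intro module.intro class_field tensor_abelian_group)
       (use class_field in \<open>auto simp: field_def domain_def\<close>)
qed

lemma tensor_minus:
  assumes f: "f \<in> carrier (tensor H k)" and g: "g \<in> carrier (tensor H k)"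
  shows "f \<ominus>\<^bsub>tensor H k\<^esub> g = (\<lambda>i\<in>{..<k}. f i \<ominus> g i)"
proof -
  interpret T: abelian_group "tensor H k" by (rule tensor_abelian_group)
  define n where "n = (\<lambda>i\<in>{..<k}. \<ominus> g i)"
  have n: "n \<in> carrier (tensor H k)" using g by (auto simp: tensor_simps n_def)
  have "n \<oplus>\<^bsub>tensor H k\<^esub> g = \<zero>\<^bsub>tensor H k\<^esub>"
    using g by (auto simp: tensor_simps n_def l_neg PiE_def Pi_def cong: restrict_cong)
  hence "\<ominus>\<^bsub>tensor H k\<^esub> g = n" using g n by (intro T.minus_equality)
  thus ?thesis unfolding a_minus_def by (auto simp: tensor_simps n_def a_minus_def cong: restrict_cong)
qed

lemma tensor_hnorm_sq:
  assumes "f \<in> carrier (tensor H k)"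
  shows "0 \<le> Re (hinner (tensor H k) f f)" "(hnorm (tensor H k) f)\<^sup>2 = (\<Sum>i<k. (hnorm H (f i))\<^sup>2)"
proof -
  have f: "f i \<in> carrier H" if "i < k" for i using assms that by (auto simp: tensor_simps)
  show *: "0 \<le> Re (hinner (tensor H k) f f)"
    using f by (auto simp: tensor_simps intro!: sum_nonneg inner_nonneg)
  show "(hnorm (tensor H k) f)\<^sup>2 = (\<Sum>i<k. (hnorm H (f i))\<^sup>2)"
    using * f by (simp add: hnorm_def[of "tensor H k"] tensor_simps hnorm_sq)
qed

lemma tensor_hilbert: "hilbert_space (tensor H k)"
proof (intro hilbert_space.intro tensor_vectorspace hilbert_space_axioms.intro)
  fix u v w c
  assume *: "u \<in> carrier (tensor H k)" "v \<in> carrier (tensor H k)"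
  have c: "u i \<in> carrier H" "v i \<in> carrier H" if "i < k" for i using * that by (auto simp: tensor_simps)
  show "hinner (tensor H k) (c \<odot>\<^bsub>tensor H k\<^esub> u) v = c * hinner (tensor H k) u v"
    using c by (simp add: tensor_simps inner_smult sum_distrib_left)
  show "hinner (tensor H k) u v = cnj (hinner (tensor H k) v u)"
    using c by (auto simp: tensor_simps cnj_sum intro!: sum.cong inner_commute)
  assume "w \<in> carrier (tensor H k)"
  hence "w i \<in> carrier H" if "i < k" for i using that by (auto simp: tensor_simps)
  thus "hinner (tensor H k) (u \<oplus>\<^bsub>tensor H k\<^esub> v) w = hinner (tensor H k) u w + hinner (tensor H k) v w"
    using c by (simp add: tensor_simps inner_add sum.distrib)
next
  fix u assume u: "u \<in> carrier (tensor H k)"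
  show "0 \<le> Re (hinner (tensor H k) u u)" by (rule tensor_hnorm_sq[OF u])
  assume z: "hinner (tensor H k) u u = 0"
  have uc: "u i \<in> carrier H" if "i < k" for i using u that by (auto simp: tensor_simps)
  have "(\<Sum>i<k. (hnorm H (u i))\<^sup>2) = 0"
    using tensor_hnorm_sq(2)[OF u] z by (simp add: hnorm_def)
  hence "hnorm H (u i) = 0" if "i < k" for i using that by (simp add: sum_nonneg_eq_0_iff)
  hence "u i = \<zero>" if "i < k" for i using that uc hnorm_eq_zero by blast
  thus "u = \<zero>\<^bsub>tensor H k\<^esub>" using u by (auto simp: tensor_simps PiE_def extensional_def fun_eq_iff)
next
  fix s :: "nat \<Rightarrow> nat \<Rightarrow> 'h"
  assume s: "\<And>m. s m \<in> carrier (tensor H k)"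
    and cauchy: "\<And>e. 0 < e \<Longrightarrow> \<exists>N. \<forall>m\<ge>N. \<forall>l\<ge>N. hnorm (tensor H k) (s m \<ominus>\<^bsub>tensor H k\<^esub> s l) < e"
  interpret T: abelian_group "tensor H k" by (rule tensor_abelian_group)
  have sc: "s m i \<in> carrier H" if "i < k" for m i using s[of m] that by (auto simp: tensor_simps)
  have le: "hnorm H (f i) \<le> hnorm (tensor H k) f" if "f \<in> carrier (tensor H k)" "i < k" for f i
  proof (rule power2_le_imp_le)
    show "(hnorm H (f i))\<^sup>2 \<le> (hnorm (tensor H k) f)\<^sup>2"
      unfolding tensor_hnorm_sq(2)[OF that(1)] using that by (intro member_le_sum) auto
    show "0 \<le> hnorm (tensor H k) f" using tensor_hnorm_sq(1)[OF that(1)] by (simp add: hnorm_def)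
  qed
  have "\<exists>u\<in>carrier H. (\<lambda>m. hnorm H (s m i \<ominus> u)) \<longlonglongrightarrow> 0" if i: "i < k" for i
  proof (rule complete)
    show "s m i \<in> carrier H" for m by (rule sc[OF i])
    fix e :: real assume "0 < e"
    then obtain N where N: "\<And>m l. m \<ge> N \<Longrightarrow> l \<ge> N \<Longrightarrow> hnorm (tensor H k) (s m \<ominus>\<^bsub>tensor H k\<^esub> s l) < e"
      using cauchy by blast
    have "hnorm H (s m i \<ominus> s l i) < e" if "m \<ge> N" "l \<ge> N" for m l
      using le[OF T.minus_closed[OF s[of m] s[of l]] i] N[OF that] i by (simp add: tensor_minus[OF s s])
    thus "\<exists>N. \<forall>m\<ge>N. \<forall>l\<ge>N. hnorm H (s m i \<ominus> s l i) < e" by blast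
  qed
  then obtain u where u: "\<And>i. i < k \<Longrightarrow> u i \<in> carrier H" "\<And>i. i < k \<Longrightarrow> (\<lambda>m. hnorm H (s m i \<ominus> u i)) \<longlonglongrightarrow> 0"
    by metis
  define U where "U = (\<lambda>i\<in>{..<k}. u i)"
  have U: "U \<in> carrier (tensor H k)" using u by (auto simp: U_def tensor_simps)
  have "(\<lambda>m. sqrt (\<Sum>i<k. (hnorm H (s m i \<ominus> u i))\<^sup>2)) \<longlonglongrightarrow> sqrt (\<Sum>i<k. 0\<^sup>2)"
    by (intro tendsto_intros u) auto
  moreover have "hnorm (tensor H k) (s m \<ominus>\<^bsub>tensor H k\<^esub> U) = sqrt (\<Sum>i<k. (hnorm H (s m i \<ominus> u i))\<^sup>2)" for m
  proof -
    have "(hnorm (tensor H k) (s m \<ominus>\<^bsub>tensor H k\<^esub> U))\<^sup>2 = (\<Sum>i<k. (hnorm H (s m i \<ominus> u i))\<^sup>2)"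
      by (subst tensor_hnorm_sq(2)[OF T.minus_closed[OF s U]], subst tensor_minus[OF s U])
        (simp add: U_def cong: sum.cong_simp)
    moreover have "0 \<le> hnorm (tensor H k) (s m \<ominus>\<^bsub>tensor H k\<^esub> U)"
      using tensor_hnorm_sq(1)[OF T.minus_closed[OF s U]] by (simp add: hnorm_def)
    ultimately show ?thesis by (metis real_sqrt_unique)
  qed
  ultimately show "\<exists>u\<in>carrier (tensor H k). (\<lambda>m. hnorm (tensor H k) (s m \<ominus>\<^bsub>tensor H k\<^esub> u)) \<longlonglongrightarrow> 0"
    using U by (intro bexI[of _ U]) simp_all
qed

end

section \<open>Functions given by a free realization\<close>

context hilbert_space
begin

text \<open>For comparing vectors given by nested finite sums in the carrier: after pairing with
  \<open>w\<close> they become sums of complex numbers, which can be reordered freely.\<close>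

lemma eq_if_inner_eq:
  assumes u: "u \<in> carrier H" and v: "v \<in> carrier H"
    and eq: "\<And>w. w \<in> carrier H \<Longrightarrow> hinner H u w = hinner H v w"
  shows "u = v"
proof -
  have uv: "u \<ominus> v \<in> carrier H" using u v by simp
  have m: "(- 1 :: complex) \<odot>\<^bsub>H\<^esub> v \<in> carrier H" using v by (rule smult_closed')
  have "hinner H (u \<ominus> v) (u \<ominus> v) = hinner H u (u \<ominus> v) + - 1 * hinner H v (u \<ominus> v)"
    by (subst (1) minus_eq_smult[OF u v]) (simp only: inner_add[OF u m uv] inner_smult[OF v uv])
  also have "\<dots> = 0" by (simp add: eq[OF uv])
  finally have "u \<ominus> v = \<zero>" by (rule inner_definite[OF uv])
  thus ?thesis by (rule iffD1[OF minus_other_side[OF u v]])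
qed

lemma comb_closed: "f \<in> A \<rightarrow> carrier H \<Longrightarrow> (\<Oplus>a\<in>A. (c a :: complex) \<odot>\<^bsub>H\<^esub> f a) \<in> carrier H"
  by (intro finsum_closed) (auto intro: smult_closed')

lemma inner_comb: "finite A \<Longrightarrow> f \<in> A \<rightarrow> carrier H \<Longrightarrow> w \<in> carrier H \<Longrightarrow>
    hinner H (\<Oplus>a\<in>A. c a \<odot>\<^bsub>H\<^esub> f a) w = (\<Sum>a\<in>A. c a * hinner H (f a) w)"
  by (subst inner_finsum_left) (auto intro!: smult_closed' sum.cong inner_smult)

lemma tensor_finsum:
  assumes "finite A" "f \<in> A \<rightarrow> carrier (tensor H k)" "i < k"
  shows "(\<Oplus>\<^bsub>tensor H k\<^esub>a\<in>A. f a) i = (\<Oplus>a\<in>A. f a i)"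
proof -
  interpret T: hilbert_space "tensor H k" by (rule tensor_hilbert)
  have c: "f a i \<in> carrier H" if "f a \<in> carrier (tensor H k)" for a
    using that assms(3) by (auto simp: tensor_simps)
  show ?thesis
    using assms(1,2)
  proof (induction A rule: finite_induct)
    case empty
    show ?case using assms(3) by (simp add: tensor_simps)
  next
    case (insert a A)
    have "(\<Oplus>\<^bsub>tensor H k\<^esub>a\<in>insert a A. f a) = f a \<oplus>\<^bsub>tensor H k\<^esub> (\<Oplus>\<^bsub>tensor H k\<^esub>a\<in>A. f a)"
      using insert by (intro T.finsum_insert) auto
    moreover have "(\<Oplus>a\<in>insert a A. f a i) = f a i \<oplus> (\<Oplus>a\<in>A. f a i)"
      using insert c by (intro finsum_insert) auto
    ultimately show ?case using insert assms(3) by (simp add: tensor_simps)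
  qed
qed

lemma tensor_comb:
  assumes "finite A" "f \<in> A \<rightarrow> carrier (tensor H k)" "i < k"
  shows "(\<Oplus>\<^bsub>tensor H k\<^esub>a\<in>A. c a \<odot>\<^bsub>tensor H k\<^esub> f a) i = (\<Oplus>a\<in>A. c a \<odot>\<^bsub>H\<^esub> f a i)"
proof -
  interpret T: hilbert_space "tensor H k" by (rule tensor_hilbert)
  have "(\<Oplus>\<^bsub>tensor H k\<^esub>a\<in>A. c a \<odot>\<^bsub>tensor H k\<^esub> f a) i = (\<Oplus>a\<in>A. (c a \<odot>\<^bsub>tensor H k\<^esub> f a) i)"
    by (rule tensor_finsum[OF assms(1) _ assms(3)]) (use assms(2) in \<open>auto intro: T.smult_closed'\<close>)
  thus ?thesis using assms(3) by (simp add: tensor_simps)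
qed

lemma module_hom_comb:
  assumes L: "L \<in> module_hom scalar_field H K" and K: "hilbert_space K"
    and A: "finite A" and f: "f \<in> A \<rightarrow> carrier H"
  shows "L (\<Oplus>a\<in>A. c a \<odot>\<^bsub>H\<^esub> f a) = (\<Oplus>\<^bsub>K\<^esub>a\<in>A. c a \<odot>\<^bsub>K\<^esub> L (f a))"
  using A f
proof (induction A rule: finite_induct)
  interpret K: hilbert_space K by (rule K)
  case empty
  have "L (0 \<odot>\<^bsub>H\<^esub> \<zero>) = 0 \<odot>\<^bsub>K\<^esub> L \<zero>" using module_hom_smult[OF L, of 0 \<zero>] by simp
  moreover have "L \<zero> \<in> carrier K" using module_hom_closed[OF L] by auto
  ultimately show ?case using lmult_0[of \<zero>] K.lmult_0[of "L \<zero>"] by simp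
next
  interpret K: hilbert_space K by (rule K)
  case (insert a A)
  have Lc: "L u \<in> carrier K" if "u \<in> carrier H" for u using module_hom_closed[OF L] that by auto
  have "(\<Oplus>a\<in>insert a A. c a \<odot>\<^bsub>H\<^esub> f a) = c a \<odot>\<^bsub>H\<^esub> f a \<oplus> (\<Oplus>a\<in>A. c a \<odot>\<^bsub>H\<^esub> f a)"
    using insert by (intro finsum_insert) (auto intro: smult_closed')
  moreover have "(\<Oplus>\<^bsub>K\<^esub>a\<in>insert a A. c a \<odot>\<^bsub>K\<^esub> L (f a)) = c a \<odot>\<^bsub>K\<^esub> L (f a) \<oplus>\<^bsub>K\<^esub> (\<Oplus>\<^bsub>K\<^esub>a\<in>A. c a \<odot>\<^bsub>K\<^esub> L (f a))"
    using insert by (intro K.finsum_insert) (auto intro!: K.smult_closed' Lc)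
  moreover have "L (c a \<odot>\<^bsub>H\<^esub> f a \<oplus> (\<Oplus>a\<in>A. c a \<odot>\<^bsub>H\<^esub> f a)) = L (c a \<odot>\<^bsub>H\<^esub> f a) \<oplus>\<^bsub>K\<^esub> L (\<Oplus>a\<in>A. c a \<odot>\<^bsub>H\<^esub> f a)"
    using insert by (intro module_hom_add[OF L] smult_closed' comb_closed) auto
  moreover have "L (c a \<odot>\<^bsub>H\<^esub> f a) = c a \<odot>\<^bsub>K\<^esub> L (f a)"
    using insert by (intro module_hom_smult[OF L]) auto
  ultimately show ?case using insert by simp
qed

end

lemma scalars_simps:
  "carrier scalars = UNIV" "add scalars = (+)" "smult scalars = (*)" "zero scalars = 0"
  "hinner scalars z w = z * cnj w"
  by (simp_all add: scalars_def)

lemma scalars_hilbert: "hilbert_space scalars"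
proof -
  have "abelian_group scalars"
    by (rule abelian_groupI) (auto simp: scalars_simps algebra_simps intro: exI[of _ "- _"])
  moreover have "module_axioms scalar_field scalars"
    by unfold_locales (auto simp: scalars_simps algebra_simps)
  ultimately have "vectorspace scalar_field scalars"
    by (intro vectorspace.intro module.intro class_field) (use class_field in \<open>auto simp: field_def domain_def\<close>)
  moreover have n: "hnorm scalars z = cmod z" for z
    by (simp add: hnorm_def scalars_simps complex_norm_square[symmetric] del: of_real_power)
  moreover have m: "z \<ominus>\<^bsub>scalars\<^esub> w = z - w" for z w
  proof -
    interpret abelian_group scalars by fact
    have "\<ominus>\<^bsub>scalars\<^esub> w = - w" by (rule minus_equality) (simp_all add: scalars_simps)
    thus ?thesis by (simp add: a_minus_def scalars_simps)
  qed
  have "\<exists>u\<in>carrier scalars. (\<lambda>k. hnorm scalars (s k \<ominus>\<^bsub>scalars\<^esub> u)) \<longlonglongrightarrow> 0"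
    if "\<And>e. 0 < e \<Longrightarrow> \<exists>N. \<forall>k\<ge>N. \<forall>l\<ge>N. hnorm scalars (s k \<ominus>\<^bsub>scalars\<^esub> s l) < e" for s :: "nat \<Rightarrow> complex"
  proof -
    have "Cauchy s" using that by (intro CauchyI) (simp add: n m)
    then obtain u where "s \<longlonglongrightarrow> u" using Cauchy_convergent convergent_def by blast
    hence "(\<lambda>k. cmod (s k - u)) \<longlonglongrightarrow> 0" by (simp add: LIM_zero tendsto_norm_zero)
    thus ?thesis by (intro bexI[of _ u]) (simp_all add: n m scalars_simps)
  qed
  ultimately show ?thesis
    by (intro hilbert_space.intro hilbert_space_axioms.intro)
       (auto simp: scalars_simps algebra_simps)
qed

lemma scalars_finsum: "finite A \<Longrightarrow> (\<Oplus>\<^bsub>scalars\<^esub>a\<in>A. f a) = (\<Sum>a\<in>A. f a)"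
proof (induction A rule: finite_induct)
  interpret hilbert_space scalars by (rule scalars_hilbert)
  case empty
  show ?case by (simp add: scalars_simps)
next
  interpret hilbert_space scalars by (rule scalars_hilbert)
  case (insert a A)
  thus ?case by (subst finsum_insert) (auto simp: scalars_simps)
qed

lemma hsum_simps:
  "carrier (hsum H K) = carrier H \<times> carrier K"
  "hinner (hsum H K) u v = hinner H (fst u) (fst v) + hinner K (snd u) (snd v)"
  "add (hsum H K) u v = (fst u \<oplus>\<^bsub>H\<^esub> fst v, snd u \<oplus>\<^bsub>K\<^esub> snd v)"
  "smult (hsum H K) c u = (c \<odot>\<^bsub>H\<^esub> fst u, c \<odot>\<^bsub>K\<^esub> snd u)"
  by (simp_all add: hsum_def module.defs hspace.defs direct_sum_def)

lemma (in hilbert_space) hnorm_hsum: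
  assumes v: "v \<in> carrier H"
  shows "(hnorm (hsum scalars H) (z, v))\<^sup>2 = (cmod z)\<^sup>2 + (hnorm H v)\<^sup>2"
proof -
  have "0 \<le> Re (z * cnj z + hinner H v v)"
    using inner_nonneg[OF v] by (simp add: complex_norm_square[symmetric] del: of_real_power)
  thus ?thesis
    using hnorm_sq[OF v]
    by (simp add: hnorm_def[of "hsum scalars H"] hsum_simps scalars_simps complex_norm_square[symmetric] del: of_real_power)
qed

section \<open>Colligations: the isometric block operators behind a realization\<close>

locale colligation = M?: hilbert_space M for M :: "'m hspace" (structure) +
  fixes I J :: nat and A :: complex and B C D
  assumes B: "B \<in> module_hom scalar_field (tensor M I) scalars"
    and C: "C \<in> module_hom scalar_field scalars (tensor M J)"
    and D: "D \<in> module_hom scalar_field (tensor M I) (tensor M J)"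
    and iso: "isometry (hsum scalars (tensor M I)) (hsum scalars (tensor M J)) (block_op A B C D (tensor M J))"
begin

sublocale MI: hilbert_space "tensor M I" by (rule tensor_hilbert)
sublocale MJ: hilbert_space "tensor M J" by (rule tensor_hilbert)

lemma C_closed: "C z \<in> carrier (tensor M J)"
  using module_hom_closed[OF C] by (auto simp: scalars_simps)

lemma D_closed: "u \<in> carrier (tensor M I) \<Longrightarrow> D u \<in> carrier (tensor M J)"
  using module_hom_closed[OF D] by auto

lemma isometry_sq:
  assumes u: "u \<in> carrier (tensor M I)"
  shows "(cmod (A * z + B u))\<^sup>2 + (hnorm (tensor M J) (C z \<oplus>\<^bsub>tensor M J\<^esub> D u))\<^sup>2
    = (cmod z)\<^sup>2 + (hnorm (tensor M I) u)\<^sup>2"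
proof -
  have "(z, u) \<in> carrier (hsum scalars (tensor M I))"
    using u by (simp add: hsum_simps scalars_simps)
  hence "hnorm (hsum scalars (tensor M J)) (block_op A B C D (tensor M J) (z, u)) = hnorm (hsum scalars (tensor M I)) (z, u)"
    using iso unfolding isometry_def by blast
  hence e: "hnorm (hsum scalars (tensor M J)) (A * z + B u, C z \<oplus>\<^bsub>tensor M J\<^esub> D u) = hnorm (hsum scalars (tensor M I)) (z, u)"
    unfolding block_op_def prod.case .
  have c: "C z \<oplus>\<^bsub>tensor M J\<^esub> D u \<in> carrier (tensor M J)"
    by (rule MJ.a_closed[OF C_closed D_closed[OF u]])
  show ?thesis
    unfolding MJ.hnorm_hsum[OF c, symmetric] MI.hnorm_hsum[OF u, symmetric] e ..
qed

lemma id_tensor_apply: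
  "a < n \<Longrightarrow> i < I \<Longrightarrow> id_tensor M I J n G h a i
    = (\<Oplus>b\<in>{..<n}. \<Oplus>j\<in>{..<J}. G $$ (i * n + a, j * n + b) \<odot>\<^bsub>M\<^esub> h b j)"
  by (simp add: id_tensor_def)

lemma component_closed:
  assumes "h \<in> carrier (tensor (tensor M k) n)" "b < n" "j < k"
  shows "h b j \<in> carrier M"
proof -
  have "h b \<in> carrier (tensor M k)"
    using assms(1,2) unfolding tensor_simps(1)[of "tensor M k"] by (blast dest: PiE_mem)
  thus ?thesis using assms(3) unfolding tensor_simps(1) by (blast dest: PiE_mem)
qed

lemma id_tensor_inner_closed:
  assumes "h \<in> carrier (tensor (tensor M J) n)" "b < n"
  shows "(\<Oplus>j\<in>{..<J}. (c j :: complex) \<odot>\<^bsub>M\<^esub> h b j) \<in> carrier M"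
  by (rule comb_closed, rule Pi_I, rule component_closed[OF assms]) simp

lemma id_tensor_closed:
  assumes h: "h \<in> carrier (tensor (tensor M J) n)"
  shows "id_tensor M I J n G h \<in> carrier (tensor (tensor M I) n)"
  unfolding tensor_simps
proof (intro PiE_I)
  fix a i assume a: "a \<in> {..<n}" and i: "i \<in> {..<I}"
  have "(\<Oplus>b\<in>{..<n}. \<Oplus>j\<in>{..<J}. G $$ (i * n + a, j * n + b) \<odot>\<^bsub>M\<^esub> h b j) \<in> carrier M"
    by (rule finsum_closed, rule Pi_I, rule id_tensor_inner_closed[OF h]) simp
  thus "id_tensor M I J n G h a i \<in> carrier M" using a i by (simp add: id_tensor_apply)
qed (simp_all add: id_tensor_def)

lemma inner_id_tensor:
  assumes h: "h \<in> carrier (tensor (tensor M J) n)" and "a < n" "i < I" and w: "w \<in> carrier M"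
  shows "hinner M (id_tensor M I J n G h a i) w
    = (\<Sum>b<n. \<Sum>j<J. G $$ (i * n + a, j * n + b) * hinner M (h b j) w)"
proof -
  have "hinner M (id_tensor M I J n G h a i) w
      = (\<Sum>b<n. hinner M (\<Oplus>j\<in>{..<J}. G $$ (i * n + a, j * n + b) \<odot>\<^bsub>M\<^esub> h b j) w)"
    unfolding id_tensor_apply[OF assms(2,3)]
    by (rule inner_finsum_left) (use id_tensor_inner_closed[OF h] w in auto)
  also have "\<dots> = (\<Sum>b<n. \<Sum>j<J. G $$ (i * n + a, j * n + b) * hinner M (h b j) w)"
    by (intro sum.cong refl inner_comb) (use component_closed[OF h] w in auto)
  finally show ?thesis .
qed

lemma hnorm_tensor2:
  assumes "h \<in> carrier (tensor (tensor M k) n)"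
  shows "(hnorm (tensor (tensor M k) n) h)\<^sup>2 = (\<Sum>b<n. \<Sum>j<k. (hnorm M (h b j))\<^sup>2)"
proof -
  interpret T: hilbert_space "tensor M k" by (rule tensor_hilbert)
  have "h b \<in> carrier (tensor M k)" if "b < n" for b using assms that by (auto simp: tensor_simps)
  thus ?thesis by (simp add: T.tensor_hnorm_sq(2)[OF assms] tensor_hnorm_sq(2))
qed

text \<open>The squared norm of a component of the image is the form of the Gram kernel of the
  components of \<open>h\<close>, taken at a row of \<open>G\<close>; so
  \<open>psd_contraction\<close> transfers the bound from scalars to the Hilbert space.\<close>

lemma id_tensor_contraction:
  assumes h: "h \<in> carrier (tensor (tensor M J) n)"
    and G: "\<And>\<alpha>. (\<Sum>i<I. \<Sum>a<n. (cmod (\<Sum>j<J. \<Sum>b<n. G $$ (i * n + a, j * n + b) * \<alpha> j b))\<^sup>2)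
        \<le> r\<^sup>2 * (\<Sum>j<J. \<Sum>b<n. (cmod (\<alpha> j b))\<^sup>2)" and r: "0 \<le> r"
  shows "hnorm (tensor (tensor M I) n) (id_tensor M I J n G h) \<le> r * hnorm (tensor (tensor M J) n) h"
proof (rule power2_le_imp_le)
  interpret TI: hilbert_space "tensor (tensor M I) n" by (rule MI.tensor_hilbert)
  interpret TJ: hilbert_space "tensor (tensor M J) n" by (rule MJ.tensor_hilbert)
  \<comment> \<open>Extended by the zero vector, because \<open>psd_inner\<close> speaks of a family
    over a whole index type.\<close>
  define f where "f z = (if z \<in> {..<n} \<times> {..<J} then h (fst z) (snd z) else \<zero>)" for z :: "nat \<times> nat"
  have f: "f z \<in> carrier M" for z using component_closed[OF h] by (auto simp: f_def)
  define K where "K z z' = hinner M (f z) (f z')" for z z'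
  have K: "psd K" unfolding K_def[abs_def] by (rule psd_inner) (rule f)
  define g where "g q z = G $$ (fst q * n + snd q, snd z * n + fst z)" for q z :: "nat \<times> nat"
  define \<Delta> where "\<Delta> = id_tensor M I J n G h"
  have \<Delta>: "\<Delta> \<in> carrier (tensor (tensor M I) n)" unfolding \<Delta>_def by (rule id_tensor_closed[OF h])
  have q: "(hnorm M (\<Delta> a i))\<^sup>2 = Re (qform ({..<n} \<times> {..<J}) K (g (i, a)))" if "a < n" "i < I" for a i
  proof -
    have \<Delta>c: "\<Delta> a i \<in> carrier M" using component_closed[OF \<Delta> that] .
    have r: "hinner M (h b j) (\<Delta> a i) = (\<Sum>b'<n. \<Sum>j'<J. cnj (g (i, a) (b', j')) * K (b, j) (b', j'))"
      if bj: "b < n" "j < J" for b j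
    proof -
      note hb = component_closed[OF h bj]
      have "hinner M (h b j) (\<Delta> a i) = cnj (hinner M (\<Delta> a i) (h b j))" by (rule inner_commute[OF hb \<Delta>c])
      also have "\<dots> = (\<Sum>b'<n. \<Sum>j'<J. cnj (g (i, a) (b', j')) * cnj (hinner M (h b' j') (h b j)))"
        unfolding \<Delta>_def by (subst inner_id_tensor[OF h \<open>a < n\<close> \<open>i < I\<close> hb]) (simp add: cnj_sum g_def)
      also have "\<dots> = (\<Sum>b'<n. \<Sum>j'<J. cnj (g (i, a) (b', j')) * K (b, j) (b', j'))"
      proof (intro sum.cong refl)
        fix b' j' assume "b' \<in> {..<n}" "j' \<in> {..<J}"
        hence b': "b' < n" "j' < J" by auto
        have "cnj (hinner M (h b' j') (h b j)) = K (b, j) (b', j')"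
          using bj b' inner_commute[OF hb component_closed[OF h b'], symmetric] by (simp add: K_def f_def)
        thus "cnj (g (i, a) (b', j')) * cnj (hinner M (h b' j') (h b j)) = cnj (g (i, a) (b', j')) * K (b, j) (b', j')"
          by simp
      qed
      finally show ?thesis .
    qed
    have "hinner M (\<Delta> a i) (\<Delta> a i) = (\<Sum>b<n. \<Sum>j<J. g (i, a) (b, j) * hinner M (h b j) (\<Delta> a i))"
      unfolding \<Delta>_def[THEN arg_cong, of "\<lambda>x. hinner M (x a i)"]
      by (subst inner_id_tensor[OF h that \<Delta>c]) (simp add: g_def)
    also have "\<dots> = qform ({..<n} \<times> {..<J}) K (g (i, a))"
      unfolding qform_def sum.cartesian_product'
      by (intro sum.cong refl) (simp add: r sum_distrib_left mult.assoc)
    finally show ?thesis by (simp add: hnorm_sq[OF \<Delta>c])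
  qed
  have "(hnorm (tensor (tensor M I) n) \<Delta>)\<^sup>2 = (\<Sum>p\<in>{..<I} \<times> {..<n}. Re (qform ({..<n} \<times> {..<J}) K (g p)))"
    by (simp add: hnorm_tensor2[OF \<Delta>] q sum.cartesian_product' sum.swap[of _ "{..<I}"])
  also have "\<dots> \<le> r\<^sup>2 * (\<Sum>z\<in>{..<n} \<times> {..<J}. Re (K z z))"
  proof (rule psd_contraction[OF K])
    fix \<alpha> :: "nat \<times> nat \<Rightarrow> complex"
    show "(\<Sum>p\<in>{..<I} \<times> {..<n}. (cmod (\<Sum>z\<in>{..<n} \<times> {..<J}. g p z * \<alpha> z))\<^sup>2) \<le> r\<^sup>2 * (\<Sum>z\<in>{..<n} \<times> {..<J}. (cmod (\<alpha> z))\<^sup>2)"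
      using G[of "\<lambda>j b. \<alpha> (b, j)"] by (simp add: sum.cartesian_product' g_def sum.swap[of _ "{..<J}"])
  qed simp
  also have "(\<Sum>z\<in>{..<n} \<times> {..<J}. Re (K z z)) = (hnorm (tensor (tensor M J) n) h)\<^sup>2"
    by (simp add: hnorm_tensor2[OF h] sum.cartesian_product' K_def f_def hnorm_sq component_closed[OF h])
  finally show "(hnorm (tensor (tensor M I) n) (id_tensor M I J n G h))\<^sup>2 \<le> (r * hnorm (tensor (tensor M J) n) h)\<^sup>2"
    by (simp add: \<Delta>_def power_mult_distrib)
  show "0 \<le> r * hnorm (tensor (tensor M J) n) h" using r TJ.hnorm_nonneg[OF h] by simp
qed

end

lemma (in hilbert_space) module_hom_zero:
  assumes L: "L \<in> module_hom scalar_field H K" and K: "hilbert_space K"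
  shows "L \<zero> = \<zero>\<^bsub>K\<^esub>"
proof -
  interpret K: hilbert_space K by (rule K)
  show ?thesis using module_hom_comb[OF L K, of "{}" "\<lambda>_. undefined"] by simp
qed

lemma (in hilbert_space) module_hom_diff:
  assumes L: "L \<in> module_hom scalar_field H K" and K: "hilbert_space K"
    and u: "u \<in> carrier H" and v: "v \<in> carrier H"
  shows "L (u \<ominus> v) = L u \<ominus>\<^bsub>K\<^esub> L v"
proof -
  interpret K: hilbert_space K by (rule K)
  have Lc: "L u \<in> carrier K" "L v \<in> carrier K" using module_hom_closed[OF L] u v by auto
  show ?thesis
    unfolding minus_eq_smult[OF u v] K.minus_eq_smult[OF Lc]
    using module_hom_add[OF L u smult_closed'[OF v]] module_hom_smult[OF L _ v, of "- 1"] by simp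
qed

lemma tensor_id_hom:
  assumes L: "L \<in> module_hom scalar_field H K"
  shows "tensor_id n L \<in> module_hom scalar_field (tensor H n) (tensor K n)"
proof -
  have Lc: "L u \<in> carrier K" if "u \<in> carrier H" for u using module_hom_closed[OF L] that by auto
  have "tensor_id n L f \<in> carrier (tensor K n)" if "f \<in> carrier (tensor H n)" for f
    using that Lc by (auto simp: tensor_simps tensor_id_def)
  moreover have "tensor_id n L (f \<oplus>\<^bsub>tensor H n\<^esub> g) = tensor_id n L f \<oplus>\<^bsub>tensor K n\<^esub> tensor_id n L g"
    if "f \<in> carrier (tensor H n)" "g \<in> carrier (tensor H n)" for f g
    using that by (auto simp: tensor_simps tensor_id_def fun_eq_iff intro!: module_hom_add[OF L])
  moreover have "tensor_id n L (c \<odot>\<^bsub>tensor H n\<^esub> f) = c \<odot>\<^bsub>tensor K n\<^esub> tensor_id n L f"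
    if "f \<in> carrier (tensor H n)" for c f
  proof
    fix i
    show "tensor_id n L (c \<odot>\<^bsub>tensor H n\<^esub> f) i = (c \<odot>\<^bsub>tensor K n\<^esub> tensor_id n L f) i"
      using that module_hom_smult[OF L, of c "f i"] by (auto simp: tensor_simps tensor_id_def)
  qed
  ultimately show ?thesis by (simp add: module_hom_def)
qed

section \<open>The state equation of a colligation\<close>

context colligation
begin

abbreviation "state_space n \<equiv> tensor (tensor M J) n"

text \<open>Take scalar part 0 in the isometry and drop the contribution of
  \<open>B u\<close>.\<close>

lemma D_norm_le: "u \<in> carrier (tensor M I) \<Longrightarrow> hnorm (tensor M J) (D u) \<le> hnorm (tensor M I) u"
proof (rule power2_le_imp_le)
  assume u: "u \<in> carrier (tensor M I)"
  interpret S: hilbert_space scalars by (rule scalars_hilbert)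
  have "C 0 = \<zero>\<^bsub>tensor M J\<^esub>"
    using S.module_hom_zero[OF C MJ.hilbert_space_axioms] by (simp add: scalars_simps)
  hence "C 0 \<oplus>\<^bsub>tensor M J\<^esub> D u = D u" using D_closed[OF u] by simp
  thus "(hnorm (tensor M J) (D u))\<^sup>2 \<le> (hnorm (tensor M I) u)\<^sup>2"
    using isometry_sq[OF u, of 0] by simp (metis zero_le_power2 add.commute le_add_same_cancel2 order_refl)
  show "0 \<le> hnorm (tensor M I) u" by (rule MI.hnorm_nonneg[OF u])
qed

lemma id_tensor_hom:
  "id_tensor M I J n G \<in> module_hom scalar_field (state_space n) (tensor (tensor M I) n)"
proof -
  interpret T: hilbert_space "state_space n" by (rule MJ.tensor_hilbert)
  interpret TI: hilbert_space "tensor (tensor M I) n" by (rule MI.tensor_hilbert)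
  have ext: "f = g" if f: "f \<in> carrier (tensor (tensor M I) n)" and g: "g \<in> carrier (tensor (tensor M I) n)"
    and eq: "\<And>a i w. a < n \<Longrightarrow> i < I \<Longrightarrow> w \<in> carrier M \<Longrightarrow> hinner M (f a i) w = hinner M (g a i) w" for f g
  proof (rule PiE_ext[OF f[unfolded tensor_simps(1)] g[unfolded tensor_simps(1)]])
    fix a assume a: "a \<in> {..<n}"
    have fa: "f a \<in> (\<Pi>\<^sub>E i\<in>{..<I}. carrier M)" "g a \<in> (\<Pi>\<^sub>E i\<in>{..<I}. carrier M)"
      using f g a unfolding tensor_simps(1) by (blast dest: PiE_mem)+
    show "f a = g a"
      using a by (intro PiE_ext[OF fa] eq_if_inner_eq component_closed[OF f] component_closed[OF g] eq) auto
  qed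
  have "id_tensor M I J n G (u \<oplus>\<^bsub>state_space n\<^esub> v)
      = id_tensor M I J n G u \<oplus>\<^bsub>tensor (tensor M I) n\<^esub> id_tensor M I J n G v"
    if u: "u \<in> carrier (state_space n)" and v: "v \<in> carrier (state_space n)" for u v
  proof (rule ext)
    note uv = T.a_closed[OF u v] and cu = id_tensor_closed[OF u, of G] and cv = id_tensor_closed[OF v, of G]
    show "id_tensor M I J n G (u \<oplus>\<^bsub>state_space n\<^esub> v) \<in> carrier (tensor (tensor M I) n)"
      by (rule id_tensor_closed[OF uv])
    show "id_tensor M I J n G u \<oplus>\<^bsub>tensor (tensor M I) n\<^esub> id_tensor M I J n G v \<in> carrier (tensor (tensor M I) n)"
      by (rule TI.a_closed[OF cu cv])
    fix a i w assume a: "a < n" "i < I" and w: "w \<in> carrier M"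
    have "hinner M (id_tensor M I J n G (u \<oplus>\<^bsub>state_space n\<^esub> v) a i) w
      = (\<Sum>b<n. \<Sum>j<J. G $$ (i * n + a, j * n + b) * (hinner M (u b j) w + hinner M (v b j) w))"
      unfolding inner_id_tensor[OF uv a w]
      by (intro sum.cong refl)
         (use component_closed[OF u] component_closed[OF v] w in \<open>simp add: tensor_simps(3) inner_add\<close>)
    thus "hinner M (id_tensor M I J n G (u \<oplus>\<^bsub>state_space n\<^esub> v) a i) w
      = hinner M ((id_tensor M I J n G u \<oplus>\<^bsub>tensor (tensor M I) n\<^esub> id_tensor M I J n G v) a i) w"
      using a w by (simp add: tensor_simps(3) inner_add component_closed[OF cu] component_closed[OF cv]
          inner_id_tensor[OF u] inner_id_tensor[OF v] distrib_left sum.distrib)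
  qed
  moreover have "id_tensor M I J n G (c \<odot>\<^bsub>state_space n\<^esub> u)
      = c \<odot>\<^bsub>tensor (tensor M I) n\<^esub> id_tensor M I J n G u"
    if u: "u \<in> carrier (state_space n)" for u c
  proof (rule ext)
    note cu' = T.smult_closed'[OF u, of c] and cu = id_tensor_closed[OF u, of G]
    show "id_tensor M I J n G (c \<odot>\<^bsub>state_space n\<^esub> u) \<in> carrier (tensor (tensor M I) n)"
      by (rule id_tensor_closed[OF cu'])
    show "c \<odot>\<^bsub>tensor (tensor M I) n\<^esub> id_tensor M I J n G u \<in> carrier (tensor (tensor M I) n)"
      by (rule TI.smult_closed'[OF cu])
    fix a i w assume a: "a < n" "i < I" and w: "w \<in> carrier M"
    have "hinner M (id_tensor M I J n G (c \<odot>\<^bsub>state_space n\<^esub> u) a i) w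
      = (\<Sum>b<n. \<Sum>j<J. G $$ (i * n + a, j * n + b) * (c * hinner M (u b j) w))"
      unfolding inner_id_tensor[OF cu' a w]
      by (intro sum.cong refl)
         (use component_closed[OF u] w in \<open>simp add: tensor_simps(4) inner_smult\<close>)
    thus "hinner M (id_tensor M I J n G (c \<odot>\<^bsub>state_space n\<^esub> u) a i) w
      = hinner M ((c \<odot>\<^bsub>tensor (tensor M I) n\<^esub> id_tensor M I J n G u) a i) w"
      using a w by (simp add: tensor_simps(4) inner_smult component_closed[OF cu]
          inner_id_tensor[OF u] sum_distrib_left mult.left_commute)
  qed
  ultimately show ?thesis
    using id_tensor_closed by (simp add: module_hom_def)
qed

text \<open>The resolvent applied to \<open>tensor_id n C w\<close>, described by the equation it
  solves and split into rows; \<open>w\<close> is the input. In this form it can be transported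
  along intertwiners and compared between points without inverses.\<close>

definition is_state :: "nat \<Rightarrow> complex mat \<Rightarrow> (nat \<Rightarrow> complex) \<Rightarrow> (nat \<Rightarrow> nat \<Rightarrow> 'm) \<Rightarrow> bool" where
  "is_state n G w h \<longleftrightarrow> h \<in> carrier (state_space n) \<and>
     (\<forall>a<n. h a = C (w a) \<oplus>\<^bsub>tensor M J\<^esub> D (id_tensor M I J n G h a))"

definition resolve :: "nat \<Rightarrow> complex mat \<Rightarrow> (nat \<Rightarrow> nat \<Rightarrow> 'm) \<Rightarrow> nat \<Rightarrow> nat \<Rightarrow> 'm" where
  "resolve n G h = h \<ominus>\<^bsub>state_space n\<^esub> tensor_id n D (id_tensor M I J n G h)"

lemma state_row_closed: "h \<in> carrier (tensor (tensor M k) n) \<Longrightarrow> a < n \<Longrightarrow> h a \<in> carrier (tensor M k)"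
  unfolding tensor_simps(1)[of "tensor M k"] by (blast dest: PiE_mem)

lemma is_state_iff:
  assumes h: "h \<in> carrier (state_space n)"
  shows "is_state n G w h \<longleftrightarrow> resolve n G h = tensor_id n C w"
proof -
  interpret T: hilbert_space "state_space n" by (rule MJ.tensor_hilbert)
  let ?D = "tensor_id n D (id_tensor M I J n G h)"
  have \<Delta>: "id_tensor M I J n G h \<in> carrier (tensor (tensor M I) n)" by (rule id_tensor_closed[OF h])
  have Dc: "?D \<in> carrier (state_space n)"
    using module_hom_closed[OF tensor_id_hom[OF D]] \<Delta> by auto
  have res: "resolve n G h = (\<lambda>a\<in>{..<n}. h a \<ominus>\<^bsub>tensor M J\<^esub> ?D a)"
    unfolding resolve_def by (rule MJ.tensor_minus[OF h Dc])
  have e: "h a = C (w a) \<oplus>\<^bsub>tensor M J\<^esub> D (id_tensor M I J n G h a)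
      \<longleftrightarrow> h a \<ominus>\<^bsub>tensor M J\<^esub> ?D a = C (w a)" if "a < n" for a
  proof -
    note ha = state_row_closed[OF h that] and da = D_closed[OF state_row_closed[OF \<Delta> that]]
    have "?D a = D (id_tensor M I J n G h a)" using that by (simp add: tensor_id_def)
    moreover have "h a = C (w a) \<oplus>\<^bsub>tensor M J\<^esub> d \<longleftrightarrow> h a \<ominus>\<^bsub>tensor M J\<^esub> d = C (w a)"
      if d: "d \<in> carrier (tensor M J)" for d
    proof
      assume "h a = C (w a) \<oplus>\<^bsub>tensor M J\<^esub> d"
      hence "h a \<ominus>\<^bsub>tensor M J\<^esub> d = (C (w a) \<oplus>\<^bsub>tensor M J\<^esub> d) \<ominus>\<^bsub>tensor M J\<^esub> d" by (rule arg_cong)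
      thus "h a \<ominus>\<^bsub>tensor M J\<^esub> d = C (w a)" using d C_closed by (simp add: a_minus_def MJ.a_assoc MJ.r_neg)
    next
      assume "h a \<ominus>\<^bsub>tensor M J\<^esub> d = C (w a)"
      hence "C (w a) \<oplus>\<^bsub>tensor M J\<^esub> d = (h a \<ominus>\<^bsub>tensor M J\<^esub> d) \<oplus>\<^bsub>tensor M J\<^esub> d" by (rule arg_cong[OF sym])
      thus "h a = C (w a) \<oplus>\<^bsub>tensor M J\<^esub> d" using d ha by (simp add: a_minus_def MJ.a_assoc MJ.l_neg)
    qed
    ultimately show ?thesis using da by simp
  qed
  show ?thesis
    using h e unfolding is_state_def res by (auto simp: tensor_id_def fun_eq_iff)
qed

text \<open>\<open>D\<close> is a contraction and \<open>id_tensor\<close> has norm at most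
  \<open>op_norm G < 1\<close>, so \<open>contraction_bij_betw\<close> applies to their
  composite.\<close>

lemma resolve_bij:
  assumes "op_norm G < 1"
    and G: "\<And>\<alpha>. (\<Sum>i<I. \<Sum>a<n. (cmod (\<Sum>j<J. \<Sum>b<n. G $$ (i * n + a, j * n + b) * \<alpha> j b))\<^sup>2)
        \<le> (op_norm G)\<^sup>2 * (\<Sum>j<J. \<Sum>b<n. (cmod (\<alpha> j b))\<^sup>2)"
  shows "bij_betw (resolve n G) (carrier (state_space n)) (carrier (state_space n))"
proof -
  interpret T: hilbert_space "state_space n" by (rule MJ.tensor_hilbert)
  interpret TI: hilbert_space "tensor (tensor M I) n" by (rule MI.tensor_hilbert)
  let ?\<Delta> = "id_tensor M I J n G"
  let ?T = "\<lambda>h. tensor_id n D (?\<Delta> h)"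
  have Tc: "?T h \<in> carrier (state_space n)" if "h \<in> carrier (state_space n)" for h
    using module_hom_closed[OF tensor_id_hom[OF D]] id_tensor_closed[OF that] by auto
  show ?thesis
    unfolding resolve_def[abs_def]
  proof (rule T.contraction_bij_betw[where r = "op_norm G"])
    show "?T \<in> carrier (state_space n) \<rightarrow> carrier (state_space n)" using Tc by blast
    show "?T (u \<ominus>\<^bsub>state_space n\<^esub> v) = ?T u \<ominus>\<^bsub>state_space n\<^esub> ?T v"
      if "u \<in> carrier (state_space n)" "v \<in> carrier (state_space n)" for u v
      using T.module_hom_diff[OF id_tensor_hom TI.hilbert_space_axioms that, of G]
        TI.module_hom_diff[OF tensor_id_hom[OF D] T.hilbert_space_axioms
          id_tensor_closed[OF that(1), of G] id_tensor_closed[OF that(2), of G]] by simp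
    fix h assume h: "h \<in> carrier (state_space n)"
    note \<Delta> = id_tensor_closed[OF h, of G]
    have "hnorm (state_space n) (?T h) \<le> hnorm (tensor (tensor M I) n) (?\<Delta> h)"
    proof (rule power2_le_imp_le)
      show "(hnorm (state_space n) (?T h))\<^sup>2 \<le> (hnorm (tensor (tensor M I) n) (?\<Delta> h))\<^sup>2"
        unfolding MJ.tensor_hnorm_sq(2)[OF Tc[OF h]] MI.tensor_hnorm_sq(2)[OF \<Delta>]
        by (intro sum_mono power_mono)
           (auto simp: tensor_id_def intro!: D_norm_le MJ.hnorm_nonneg D_closed state_row_closed[OF \<Delta>])
      show "0 \<le> hnorm (tensor (tensor M I) n) (?\<Delta> h)" by (rule TI.hnorm_nonneg[OF \<Delta>])
    qed
    also have "\<dots> \<le> op_norm G * hnorm (state_space n) h"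
      by (rule id_tensor_contraction[OF h G op_norm_nonneg])
    finally show "hnorm (state_space n) (?T h) \<le> op_norm G * hnorm (state_space n) h" .
  qed (use assms(1) op_norm_nonneg in auto)
qed

lemma state_exists:
  assumes "bij_betw (resolve n G) (carrier (state_space n)) (carrier (state_space n))"
  shows "is_state n G w (inv_into (carrier (state_space n)) (resolve n G) (tensor_id n C w))"
proof -
  have c: "tensor_id n C w \<in> carrier (state_space n)"
    using C_closed by (auto simp: tensor_id_def tensor_simps(1)[of "tensor M J"])
  let ?h = "inv_into (carrier (state_space n)) (resolve n G) (tensor_id n C w)"
  have img: "tensor_id n C w \<in> resolve n G ` carrier (state_space n)"
    using assms c by (simp add: bij_betw_def)
  show ?thesis
    using is_state_iff[OF inv_into_into[OF img]] f_inv_into_f[OF img] by blast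
qed

lemma state_unique:
  assumes "bij_betw (resolve n G) (carrier (state_space n)) (carrier (state_space n))"
    and h: "is_state n G w h"
  shows "inv_into (carrier (state_space n)) (resolve n G) (tensor_id n C w) = h"
proof -
  have "h \<in> carrier (state_space n)" using h by (simp add: is_state_def)
  thus ?thesis using assms is_state_iff[of h n G w] by (metis bij_betw_def inv_into_f_f)
qed

lemma state_isometry:
  assumes h: "is_state n G w h"
  shows "(\<Sum>a<n. (cmod (A * w a + B (id_tensor M I J n G h a)))\<^sup>2) + (hnorm (state_space n) h)\<^sup>2
    = (\<Sum>a<n. (cmod (w a))\<^sup>2) + (hnorm (tensor (tensor M I) n) (id_tensor M I J n G h))\<^sup>2"
proof -
  have hc: "h \<in> carrier (state_space n)" and eq: "\<And>a. a < n \<Longrightarrow> h a = C (w a) \<oplus>\<^bsub>tensor M J\<^esub> D (id_tensor M I J n G h a)"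
    using h unfolding is_state_def by blast+
  note \<Delta> = id_tensor_closed[OF hc, of G]
  have "(cmod (A * w a + B (id_tensor M I J n G h a)))\<^sup>2 + (hnorm (tensor M J) (h a))\<^sup>2
      = (cmod (w a))\<^sup>2 + (hnorm (tensor M I) (id_tensor M I J n G h a))\<^sup>2" if a: "a < n" for a
    by (subst eq[OF a]) (rule isometry_sq[OF state_row_closed[OF \<Delta> a]])
  thus ?thesis
    unfolding MJ.tensor_hnorm_sq(2)[OF hc] MI.tensor_hnorm_sq(2)[OF \<Delta>] sum.distrib[symmetric]
    by (intro sum.cong refl) simp
qed

end

context colligation
begin

lemma is_state_cong: "(\<And>a. a < n \<Longrightarrow> w a = w' a) \<Longrightarrow> is_state n G w h = is_state n G w' h"
  by (auto simp: is_state_def)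

lemma polyhedron_resolve_bij:
  assumes "1 \<le> d" "\<delta> \<in> carrier_mat I J" "x \<in> nc_polyhedron d \<delta>" "x \<in> nc_level d n"
  shows "bij_betw (resolve n (delta_eval n x \<delta>)) (carrier (state_space n)) (carrier (state_space n))"
  by (rule resolve_bij[OF nc_polyhedron_level(2)[OF assms(1,3,4)] delta_eval_contraction[OF assms(2)]])

text \<open>On the polyhedron the resolvent exists by \<open>resolve_bij\<close> and its value is
  the unique state, so the formula for \<open>\<phi>\<close> becomes a statement about all solutions
  of the state equation.\<close>

lemma free_realization_iff:
  assumes d: "1 \<le> d" and \<delta>: "\<delta> \<in> carrier_mat I J"
  shows "free_realization d \<delta> \<phi> M A B C D \<longleftrightarrow> (\<forall>n\<ge>1. \<forall>x\<in>nc_polyhedron d \<delta> \<inter> nc_level d n.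
     \<phi> x \<in> carrier_mat n n \<and> (\<forall>v\<in>carrier_vec n. \<forall>h. is_state n (delta_eval n x \<delta>) (\<lambda>a. v $ a) h \<longrightarrow>
       \<phi> x *\<^sub>v v = vec n (\<lambda>a. A * v $ a + B (id_tensor M I J n (delta_eval n x \<delta>) h a))))"
proof -
  have dims: "dim_row \<delta> = I" "dim_col \<delta> = J" using \<delta> by auto
  have "(bij_betw (resolve n (delta_eval n x \<delta>)) (carrier (state_space n)) (carrier (state_space n)) \<and>
       \<phi> x \<in> carrier_mat n n \<and> (\<forall>v\<in>carrier (tensor scalars n). \<phi> x *\<^sub>v vec n v =
         vec n (tensor_id n (\<lambda>z. A * z) v \<oplus>\<^bsub>tensor scalars n\<^esub> tensor_id n B (id_tensor M I J n (delta_eval n x \<delta>)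
           (inv_into (carrier (state_space n)) (resolve n (delta_eval n x \<delta>)) (tensor_id n C v))))))
    \<longleftrightarrow> \<phi> x \<in> carrier_mat n n \<and> (\<forall>v\<in>carrier_vec n. \<forall>h. is_state n (delta_eval n x \<delta>) (\<lambda>a. v $ a) h \<longrightarrow>
       \<phi> x *\<^sub>v v = vec n (\<lambda>a. A * v $ a + B (id_tensor M I J n (delta_eval n x \<delta>) h a)))"
    (is "?bij \<and> ?c \<and> ?f \<longleftrightarrow> ?c \<and> ?g")
    if x: "x \<in> nc_polyhedron d \<delta> \<inter> nc_level d n" for n x
  proof -
    let ?G = "delta_eval n x \<delta>"
    have bij: ?bij using polyhedron_resolve_bij[OF d \<delta>] x by blast
    have e: "vec n (tensor_id n (\<lambda>z. A * z) v \<oplus>\<^bsub>tensor scalars n\<^esub> tensor_id n B f) = vec n (\<lambda>a. A * v a + B (f a))" for v f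
      by (rule eq_vecI) (simp_all add: tensor_simps scalars_simps tensor_id_def)
    have ?g if ?f
    proof (intro ballI allI impI)
      fix v h assume v: "v \<in> carrier_vec n" and h: "is_state n ?G (\<lambda>a. v $ a) h"
      define w where "w = (\<lambda>a\<in>{..<n}. v $ a)"
      have w: "w \<in> carrier (tensor scalars n)" "vec n w = v" "is_state n ?G w h"
        using v h is_state_cong[of n w "\<lambda>a. v $ a"] by (auto simp: w_def tensor_simps scalars_simps)
      show "\<phi> x *\<^sub>v v = vec n (\<lambda>a. A * v $ a + B (id_tensor M I J n ?G h a))"
        using bspec[OF that w(1)] w(2) unfolding e state_unique[OF bij w(3)] by (auto simp: w_def intro!: eq_vecI)
    qed
    moreover have ?f if ?g
    proof
      fix w assume w: "w \<in> carrier (tensor scalars n)"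
      let ?h = "inv_into (carrier (state_space n)) (resolve n ?G) (tensor_id n C w)"
      have "is_state n ?G w ?h" by (rule state_exists[OF bij])
      hence "is_state n ?G (\<lambda>a. vec n w $ a) ?h" using is_state_cong[of n w "\<lambda>a. vec n w $ a"] by simp
      hence "\<phi> x *\<^sub>v vec n w = vec n (\<lambda>a. A * vec n w $ a + B (id_tensor M I J n ?G ?h a))"
        using that by simp
      thus "\<phi> x *\<^sub>v vec n w = vec n (tensor_id n (\<lambda>z. A * z) w \<oplus>\<^bsub>tensor scalars n\<^esub> tensor_id n B (id_tensor M I J n ?G ?h))"
        unfolding e by (auto intro!: eq_vecI)
    qed
    ultimately show ?thesis using bij by blast
  qed
  thus ?thesis
    unfolding free_realization_def Let_def dims resolve_def[abs_def]
    using hilbert_space_axioms B C D iso by simp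
qed

lemma realization_contractive:
  assumes d: "1 \<le> d" and \<delta>: "\<delta> \<in> carrier_mat I J" and real: "free_realization d \<delta> \<phi> M A B C D"
    and x: "x \<in> nc_polyhedron d \<delta>"
  shows "op_norm (\<phi> x) \<le> 1"
proof (rule op_norm_le)
  define n where "n = lvl x"
  note x' = nc_polyhedron_lvl[OF d x, folded n_def]
  note r = real[unfolded free_realization_iff[OF d \<delta>], rule_format, OF x'(2) IntI[OF x x'(1)]]
  let ?G = "delta_eval n x \<delta>"
  fix v :: "complex vec" assume "v \<in> carrier_vec (dim_col (\<phi> x))"
  hence v: "v \<in> carrier_vec n" using r by auto
  obtain h where h: "is_state n ?G (\<lambda>a. v $ a) h"
    using state_exists[OF polyhedron_resolve_bij[OF d \<delta> x x'(1)]] by blast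
  hence hc: "h \<in> carrier (state_space n)" by (simp add: is_state_def)
  interpret T: hilbert_space "state_space n" by (rule MJ.tensor_hilbert)
  interpret TI: hilbert_space "tensor (tensor M I) n" by (rule MI.tensor_hilbert)
  have "hnorm (tensor (tensor M I) n) (id_tensor M I J n ?G h) \<le> op_norm ?G * hnorm (state_space n) h"
    by (rule id_tensor_contraction[OF hc delta_eval_contraction[OF \<delta>] op_norm_nonneg])
  also have "\<dots> \<le> 1 * hnorm (state_space n) h"
    using x'(3) by (intro mult_right_mono T.hnorm_nonneg[OF hc]) simp
  finally have "(hnorm (tensor (tensor M I) n) (id_tensor M I J n ?G h))\<^sup>2 \<le> (hnorm (state_space n) h)\<^sup>2"
    by (intro power_mono TI.hnorm_nonneg id_tensor_closed[OF hc]) simp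
  hence "(\<Sum>a<n. (cmod (A * v $ a + B (id_tensor M I J n ?G h a)))\<^sup>2) \<le> (\<Sum>a<n. (cmod (v $ a))\<^sup>2)"
    using state_isometry[OF h] by linarith
  moreover have "\<phi> x *\<^sub>v v = vec n (\<lambda>a. A * v $ a + B (id_tensor M I J n ?G h a))"
    using r v h by blast
  ultimately have "(vnorm (\<phi> x *\<^sub>v v))\<^sup>2 \<le> 1 * (vnorm v)\<^sup>2" using v by (simp add: vnorm_sq)
  thus "vnorm (\<phi> x *\<^sub>v v) \<le> 1 * vnorm v" using vnorm_sq_le_imp by fastforce
qed simp

text \<open>\<open>S\<close> acts on the factor indexed by \<open>b < n\<close> and commutes with
  \<open>C\<close> and \<open>D\<close>, which act on the other factors; its passage through
  \<open>\<delta>\<close> is \<open>poly_eval_intertwine\<close>, entry by entry. Hence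
  \<open>S\<close> carries a state at \<open>x\<close> to a state at \<open>y\<close> whose input is
  the image of \<open>w\<close> under \<open>S\<close>.\<close>

lemma state_intertwine:
  assumes x: "x \<in> nc_level d n" and y: "y \<in> nc_level d m" and S: "S \<in> carrier_mat m n"
    and int: "\<And>r. r < d \<Longrightarrow> S * (x ! r) = (y ! r) * S"
    and \<delta>: "\<delta> \<in> carrier_mat I J" and polys: "elements_mat \<delta> \<subseteq> nc_polys d"
    and h: "is_state n (delta_eval n x \<delta>) w h"
  defines "h' \<equiv> \<lambda>a\<in>{..<m}. \<Oplus>\<^bsub>tensor M J\<^esub>b\<in>{..<n}. S $$ (a, b) \<odot>\<^bsub>tensor M J\<^esub> h b"
  shows "is_state m (delta_eval m y \<delta>) (\<lambda>a. \<Sum>b<n. S $$ (a, b) * w b) h'"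
    and "a < m \<Longrightarrow> id_tensor M I J m (delta_eval m y \<delta>) h' a
      = (\<Oplus>\<^bsub>tensor M I\<^esub>b\<in>{..<n}. S $$ (a, b) \<odot>\<^bsub>tensor M I\<^esub> id_tensor M I J n (delta_eval n x \<delta>) h b)"
proof -
  let ?G = "delta_eval n x \<delta>" and ?G' = "delta_eval m y \<delta>"
  have hc: "h \<in> carrier (state_space n)"
    and eq: "\<And>a. a < n \<Longrightarrow> h a = C (w a) \<oplus>\<^bsub>tensor M J\<^esub> D (id_tensor M I J n ?G h a)"
    using h unfolding is_state_def by blast+
  note \<Delta> = id_tensor_closed[OF hc, of ?G]
  have hrow: "h \<in> {..<n} \<rightarrow> carrier (tensor M J)" using state_row_closed[OF hc] by auto
  have \<Delta>row: "id_tensor M I J n ?G h \<in> {..<n} \<rightarrow> carrier (tensor M I)" using state_row_closed[OF \<Delta>] by auto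
  have h'c: "h' \<in> carrier (state_space m)"
    unfolding h'_def tensor_simps(1)[of "tensor M J"] using MJ.comb_closed[OF hrow] by auto
  have h'i: "h' a j = (\<Oplus>b\<in>{..<n}. S $$ (a, b) \<odot>\<^bsub>M\<^esub> h b j)" if "a < m" "j < J" for a j
    using tensor_comb[OF _ hrow that(2), of "\<lambda>b. S $$ (a, b)"] that by (simp add: h'_def)
  show 1: "id_tensor M I J m ?G' h' a
      = (\<Oplus>\<^bsub>tensor M I\<^esub>b\<in>{..<n}. S $$ (a, b) \<odot>\<^bsub>tensor M I\<^esub> id_tensor M I J n ?G h b)" if a: "a < m" for a
  proof (rule PiE_ext)
    note L = state_row_closed[OF id_tensor_closed[OF h'c, of ?G'] a]
    have R: "(\<Oplus>\<^bsub>tensor M I\<^esub>b\<in>{..<n}. S $$ (a, b) \<odot>\<^bsub>tensor M I\<^esub> id_tensor M I J n ?G h b) \<in> carrier (tensor M I)"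
      by (rule MI.comb_closed[OF \<Delta>row])
    show "id_tensor M I J m ?G' h' a \<in> (\<Pi>\<^sub>E i\<in>{..<I}. carrier M)"
      "(\<Oplus>\<^bsub>tensor M I\<^esub>b\<in>{..<n}. S $$ (a, b) \<odot>\<^bsub>tensor M I\<^esub> id_tensor M I J n ?G h b) \<in> (\<Pi>\<^sub>E i\<in>{..<I}. carrier M)"
      using L R by (simp_all only: tensor_simps(1))
    fix i assume "i \<in> {..<I}"
    hence i: "i < I" by simp
    have c: "(\<Oplus>\<^bsub>tensor M I\<^esub>b\<in>{..<n}. S $$ (a, b) \<odot>\<^bsub>tensor M I\<^esub> id_tensor M I J n ?G h b) i
        = (\<Oplus>b\<in>{..<n}. S $$ (a, b) \<odot>\<^bsub>M\<^esub> id_tensor M I J n ?G h b i)"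
      by (rule tensor_comb[OF _ \<Delta>row i]) simp
    have \<Delta>i: "(\<lambda>b. id_tensor M I J n ?G h b i) \<in> {..<n} \<rightarrow> carrier M"
      using component_closed[OF \<Delta> _ i] by auto
    show "id_tensor M I J m ?G' h' a i = (\<Oplus>\<^bsub>tensor M I\<^esub>b\<in>{..<n}. S $$ (a, b) \<odot>\<^bsub>tensor M I\<^esub> id_tensor M I J n ?G h b) i"
      unfolding c
    proof (rule eq_if_inner_eq)
      show "id_tensor M I J m ?G' h' a i \<in> carrier M" by (rule component_closed[OF id_tensor_closed[OF h'c] a i])
      show "(\<Oplus>b\<in>{..<n}. S $$ (a, b) \<odot>\<^bsub>M\<^esub> id_tensor M I J n ?G h b i) \<in> carrier M" by (rule comb_closed[OF \<Delta>i])
      fix w assume w: "w \<in> carrier M"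
      have "hinner M (id_tensor M I J m ?G' h' a i) w
          = (\<Sum>b'<m. \<Sum>j<J. ?G' $$ (i * m + a, j * m + b') * (\<Sum>b<n. S $$ (b', b) * hinner M (h b j) w))"
        unfolding inner_id_tensor[OF h'c a i w]
      proof (intro sum.cong refl arg_cong2[where f = "(*)"])
        fix b' j assume bj: "b' \<in> {..<m}" "j \<in> {..<J}"
        have "(\<lambda>b. h b j) \<in> {..<n} \<rightarrow> carrier M" using component_closed[OF hc] bj by auto
        thus "hinner M (h' b' j) w = (\<Sum>b<n. S $$ (b', b) * hinner M (h b j) w)"
          using bj h'i[of b' j] inner_comb[of "{..<n}" "\<lambda>b. h b j" w "\<lambda>b. S $$ (b', b)"] w by simp
      qed
      also have "\<dots> = (\<Sum>j<J. \<Sum>b<n. (\<Sum>b'<m. ?G' $$ (i * m + a, j * m + b') * S $$ (b', b)) * hinner M (h b j) w)"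
        by (simp add: sum_distrib_left sum_distrib_right mult.assoc sum.swap[of _ "{..<m}"])
      also have "\<dots> = (\<Sum>j<J. \<Sum>b<n. (\<Sum>b'<n. S $$ (a, b') * ?G $$ (i * n + b', j * n + b)) * hinner M (h b j) w)"
      proof (rule sum.cong[OF refl], rule sum.cong[OF refl])
        fix j b assume "j \<in> {..<J}" "b \<in> {..<n}"
        hence j: "j < J" and b: "b < n" by auto
        have p: "\<delta> $$ (i, j) \<in> nc_polys d" using polys elements_matI[OF \<delta> i j refl] by blast
        have "(\<Sum>b'<m. poly_eval m y (\<delta> $$ (i, j)) $$ (a, b') * S $$ (b', b))
            = (\<Sum>b'<n. S $$ (a, b') * poly_eval n x (\<delta> $$ (i, j)) $$ (b', b))"
          using poly_eval_intertwine[OF x y S int p] mult_mat_index[OF S poly_eval_carrier a b, of x "\<delta> $$ (i, j)"]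
            mult_mat_index[OF poly_eval_carrier S a b, of y "\<delta> $$ (i, j)"] by simp
        hence "(\<Sum>b'<m. ?G' $$ (i * m + a, j * m + b') * S $$ (b', b)) = (\<Sum>b'<n. S $$ (a, b') * ?G $$ (i * n + b', j * n + b))"
          using a b by (simp add: delta_eval_index[OF \<delta> i j])
        thus "(\<Sum>b'<m. ?G' $$ (i * m + a, j * m + b') * S $$ (b', b)) * hinner M (h b j) w
          = (\<Sum>b'<n. S $$ (a, b') * ?G $$ (i * n + b', j * n + b)) * hinner M (h b j) w" by simp
      qed
      also have "\<dots> = (\<Sum>j<J. \<Sum>b<n. \<Sum>b'<n. S $$ (a, b') * (?G $$ (i * n + b', j * n + b) * hinner M (h b j) w))"
        by (simp add: sum_distrib_right mult.assoc)
      also have "\<dots> = (\<Sum>j<J. \<Sum>b'<n. \<Sum>b<n. S $$ (a, b') * (?G $$ (i * n + b', j * n + b) * hinner M (h b j) w))"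
        by (rule sum.cong[OF refl], rule sum.swap)
      also have "\<dots> = (\<Sum>b'<n. \<Sum>j<J. \<Sum>b<n. S $$ (a, b') * (?G $$ (i * n + b', j * n + b) * hinner M (h b j) w))"
        by (rule sum.swap)
      also have "\<dots> = (\<Sum>b'<n. \<Sum>b<n. \<Sum>j<J. S $$ (a, b') * (?G $$ (i * n + b', j * n + b) * hinner M (h b j) w))"
        by (rule sum.cong[OF refl], rule sum.swap)
      also have "\<dots> = (\<Sum>b'<n. S $$ (a, b') * (\<Sum>b<n. \<Sum>j<J. ?G $$ (i * n + b', j * n + b) * hinner M (h b j) w))"
        by (simp add: sum_distrib_left)
      also have "\<dots> = hinner M (\<Oplus>b\<in>{..<n}. S $$ (a, b) \<odot>\<^bsub>M\<^esub> id_tensor M I J n ?G h b i) w"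
        by (subst inner_comb[OF _ \<Delta>i w]) (simp_all add: inner_id_tensor[OF hc _ i w])
      finally show "hinner M (id_tensor M I J m ?G' h' a i) w
        = hinner M (\<Oplus>b\<in>{..<n}. S $$ (a, b) \<odot>\<^bsub>M\<^esub> id_tensor M I J n ?G h b i) w" .
    qed
  qed
  interpret S: hilbert_space scalars by (rule scalars_hilbert)
  have "h' a = C (\<Sum>b<n. S $$ (a, b) * w b) \<oplus>\<^bsub>tensor M J\<^esub> D (id_tensor M I J m ?G' h' a)" if a: "a < m" for a
  proof -
    have cC: "(\<lambda>b. C (w b)) \<in> {..<n} \<rightarrow> carrier (tensor M J)" using C_closed by auto
    have cD: "(\<lambda>b. D (id_tensor M I J n ?G h b)) \<in> {..<n} \<rightarrow> carrier (tensor M J)" using D_closed \<Delta>row by auto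
    have "h' a = (\<Oplus>\<^bsub>tensor M J\<^esub>b\<in>{..<n}. S $$ (a, b) \<odot>\<^bsub>tensor M J\<^esub> C (w b) \<oplus>\<^bsub>tensor M J\<^esub>
        S $$ (a, b) \<odot>\<^bsub>tensor M J\<^esub> D (id_tensor M I J n ?G h b))"
      unfolding h'_def using a
    proof (simp, intro MJ.finsum_cong' refl)
      fix b assume "b \<in> {..<n}"
      hence b: "b < n" by simp
      have c: "C (w b) \<in> carrier (tensor M J)" "D (id_tensor M I J n ?G h b) \<in> carrier (tensor M J)"
        using cC cD b by auto
      show "S $$ (a, b) \<odot>\<^bsub>tensor M J\<^esub> h b = S $$ (a, b) \<odot>\<^bsub>tensor M J\<^esub> C (w b) \<oplus>\<^bsub>tensor M J\<^esub>
          S $$ (a, b) \<odot>\<^bsub>tensor M J\<^esub> D (id_tensor M I J n ?G h b)"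
        unfolding eq[OF b] by (rule MJ.smult_r_distr) (use c in auto)
    qed (use cC cD in \<open>auto intro!: MJ.a_closed MJ.smult_closed'\<close>)
    also have "\<dots> = (\<Oplus>\<^bsub>tensor M J\<^esub>b\<in>{..<n}. S $$ (a, b) \<odot>\<^bsub>tensor M J\<^esub> C (w b)) \<oplus>\<^bsub>tensor M J\<^esub>
        (\<Oplus>\<^bsub>tensor M J\<^esub>b\<in>{..<n}. S $$ (a, b) \<odot>\<^bsub>tensor M J\<^esub> D (id_tensor M I J n ?G h b))"
      by (rule MJ.finsum_addf) (use cC cD in \<open>auto intro!: MJ.smult_closed'\<close>)
    also have "(\<Oplus>\<^bsub>tensor M J\<^esub>b\<in>{..<n}. S $$ (a, b) \<odot>\<^bsub>tensor M J\<^esub> C (w b)) = C (\<Sum>b<n. S $$ (a, b) * w b)"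
      using S.module_hom_comb[OF C MJ.hilbert_space_axioms, of "{..<n}" w "\<lambda>b. S $$ (a, b)"]
      by (simp add: scalars_finsum scalars_simps)
    also have "(\<Oplus>\<^bsub>tensor M J\<^esub>b\<in>{..<n}. S $$ (a, b) \<odot>\<^bsub>tensor M J\<^esub> D (id_tensor M I J n ?G h b))
        = D (id_tensor M I J m ?G' h' a)"
      unfolding 1[OF a] by (rule MI.module_hom_comb[OF D MJ.hilbert_space_axioms _ \<Delta>row, symmetric]) simp
    finally show ?thesis .
  qed
  thus "is_state m ?G' (\<lambda>a. \<Sum>b<n. S $$ (a, b) * w b) h'"
    using h'c by (simp add: is_state_def)
qed

theorem realization_in_H_inf:
  assumes d: "1 \<le> d" and \<delta>: "\<delta> \<in> carrier_mat I J" and polys: "elements_mat \<delta> \<subseteq> nc_polys d"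
    and real: "free_realization d \<delta> \<phi> M A B C D"
  shows "\<phi> \<in> H_inf_1 d \<delta>"
proof -
  note r = real[unfolded free_realization_iff[OF d \<delta>], rule_format]
  have "S * \<phi> x = \<phi> y * S"
    if n: "1 \<le> n" and m: "1 \<le> m" and x: "x \<in> nc_polyhedron d \<delta> \<inter> nc_level d n"
      and y: "y \<in> nc_polyhedron d \<delta> \<inter> nc_level d m" and S: "S \<in> carrier_mat m n"
      and int: "\<forall>r<d. S * (x ! r) = (y ! r) * S" for n m x y S
  proof -
    have \<phi>x: "\<phi> x \<in> carrier_mat n n" and \<phi>y: "\<phi> y \<in> carrier_mat m m" using r[OF n x] r[OF m y] by auto
    have xl: "x \<in> nc_level d n" "x \<in> nc_polyhedron d \<delta>" and yl: "y \<in> nc_level d m" "y \<in> nc_polyhedron d \<delta>"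
      using x y by auto
    let ?G = "delta_eval n x \<delta>" and ?G' = "delta_eval m y \<delta>"
    have vec: "(S * \<phi> x) *\<^sub>v v = (\<phi> y * S) *\<^sub>v v" if v: "v \<in> carrier_vec n" for v
    proof -
      obtain h where h: "is_state n ?G (\<lambda>a. v $ a) h"
        using state_exists[OF polyhedron_resolve_bij[OF d \<delta> xl(2,1)]] by blast
      define h' where "h' = (\<lambda>a\<in>{..<m}. \<Oplus>\<^bsub>tensor M J\<^esub>b\<in>{..<n}. S $$ (a, b) \<odot>\<^bsub>tensor M J\<^esub> h b)"
      have si1: "is_state m ?G' (\<lambda>a. \<Sum>b<n. S $$ (a, b) * v $ b) h'"
        unfolding h'_def by (rule state_intertwine(1)[OF xl(1) yl(1) S _ \<delta> polys h]) (use int in blast)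
      have si2: "id_tensor M I J m ?G' h' a
          = (\<Oplus>\<^bsub>tensor M I\<^esub>b\<in>{..<n}. S $$ (a, b) \<odot>\<^bsub>tensor M I\<^esub> id_tensor M I J n ?G h b)" if "a < m" for a
        unfolding h'_def by (rule state_intertwine(2)[OF xl(1) yl(1) S _ \<delta> polys h that]) (use int in blast)
      have Sv: "S *\<^sub>v v \<in> carrier_vec m" using S v by simp
      have Svi: "(S *\<^sub>v v) $ a = (\<Sum>b<n. S $$ (a, b) * v $ b)" if "a < m" for a
        by (rule mult_mat_vec_index[OF S v that])
      have h': "is_state m ?G' (\<lambda>a. (S *\<^sub>v v) $ a) h'"
        by (rule iffD1[OF is_state_cong si1]) (rule Svi[symmetric])
      have hc: "h \<in> carrier (state_space n)" using h by (simp add: is_state_def)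
      have \<Delta>row: "id_tensor M I J n ?G h \<in> {..<n} \<rightarrow> carrier (tensor M I)"
        using state_row_closed[OF id_tensor_closed[OF hc]] by auto
      have ex: "\<phi> x *\<^sub>v v = vec n (\<lambda>a. A * v $ a + B (id_tensor M I J n ?G h a))" using r[OF n x] v h by blast
      have ey: "\<phi> y *\<^sub>v (S *\<^sub>v v) = vec m (\<lambda>a. A * (S *\<^sub>v v) $ a + B (id_tensor M I J m ?G' h' a))"
        using r[OF m y] Sv h' by blast
      have "(S *\<^sub>v (\<phi> x *\<^sub>v v)) $ a = (\<phi> y *\<^sub>v (S *\<^sub>v v)) $ a" if a: "a < m" for a
      proof -
        have "B (id_tensor M I J m ?G' h' a) = (\<Sum>b<n. S $$ (a, b) * B (id_tensor M I J n ?G h b))"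
          unfolding si2[OF a]
          using MI.module_hom_comb[OF B scalars_hilbert _ \<Delta>row, of "\<lambda>b. S $$ (a, b)"]
          by (simp add: scalars_finsum scalars_simps)
        moreover have "(S *\<^sub>v (\<phi> x *\<^sub>v v)) $ a = (\<Sum>b<n. S $$ (a, b) * (A * v $ b + B (id_tensor M I J n ?G h b)))"
          unfolding ex by (subst mult_mat_vec_index[OF S _ a]) auto
        ultimately show ?thesis
          unfolding ey using a Svi[OF a]
          by (simp add: sum.distrib distrib_left sum_distrib_left mult.left_commute del: index_mult_mat_vec)
      qed
      hence "S *\<^sub>v (\<phi> x *\<^sub>v v) = \<phi> y *\<^sub>v (S *\<^sub>v v)"
        using S \<phi>y by (intro eq_vecI) (auto simp del: index_mult_mat_vec)
      thus ?thesis using assoc_mult_mat_vec[OF S \<phi>x v] assoc_mult_mat_vec[OF \<phi>y S v] by simp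
    qed
    have SS: "S * \<phi> x \<in> carrier_mat m n" "\<phi> y * S \<in> carrier_mat m n" using S \<phi>x \<phi>y by auto
    show ?thesis
    proof (rule eq_matI)
      fix a b assume "a < dim_row (\<phi> y * S)" "b < dim_col (\<phi> y * S)"
      hence ab: "a < m" "b < n" using SS by auto
      have u: "(X *\<^sub>v unit_vec n b) $ a = X $$ (a, b)" if "X \<in> carrier_mat m n" for X :: "complex mat"
        using that ab by (simp add: scalar_prod_right_unit)
      show "(S * \<phi> x) $$ (a, b) = (\<phi> y * S) $$ (a, b)"
        using u[OF SS(1)] u[OF SS(2)] vec[of "unit_vec n b"] by simp
    qed (use S \<phi>x \<phi>y in auto)
  qed
  thus ?thesis
    unfolding H_inf_1_def nc_function_def
    using r realization_contractive[OF d \<delta> real] by blast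
qed

end

section \<open>The Hilbert space of square-summable families\<close>

definition ell2 :: "('s \<Rightarrow> complex) hspace" where
  "ell2 = \<lparr>carrier = {f. l2 f}, monoid.mult = undefined, one = undefined, zero = (\<lambda>_. 0),
     add = (\<lambda>f g s. f s + g s), smult = (\<lambda>c f s. c * f s),
     hinner = (\<lambda>f g. \<Sum>\<^sub>\<infinity>s. f s * cnj (g s))\<rparr>"

lemma ell2_simps:
  "carrier ell2 = {f. l2 f}" "zero ell2 = (\<lambda>_. 0)" "add ell2 f g = (\<lambda>s. f s + g s)"
  "smult ell2 c f = (\<lambda>s. c * f s)" "hinner ell2 f g = (\<Sum>\<^sub>\<infinity>s. f s * cnj (g s))"
  by (simp_all add: ell2_def)

lemma l2_uminus: "l2 f \<Longrightarrow> l2 (\<lambda>s. - f s)"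
  by (simp add: l2_def)

lemma l2_diff: "l2 f \<Longrightarrow> l2 g \<Longrightarrow> l2 (\<lambda>s. f s - g s)"
  using l2_add[of f "\<lambda>s. - g s"] by (simp add: l2_uminus)

lemma ell2_abelian_group: "abelian_group (ell2 :: ('s \<Rightarrow> complex) hspace)"
proof (rule abelian_groupI)
  fix f :: "'s \<Rightarrow> complex" assume "f \<in> carrier ell2"
  thus "\<exists>g\<in>carrier ell2. g \<oplus>\<^bsub>ell2\<^esub> f = \<zero>\<^bsub>ell2\<^esub>"
    by (intro bexI[of _ "\<lambda>s. - f s"]) (simp_all add: ell2_simps l2_uminus)
qed (simp_all add: ell2_simps l2_add l2_zero algebra_simps)

lemma ell2_minus: "l2 f \<Longrightarrow> l2 g \<Longrightarrow> f \<ominus>\<^bsub>ell2\<^esub> g = (\<lambda>s. f s - g s)"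
proof -
  assume f: "l2 f" and g: "l2 g"
  interpret abelian_group ell2 by (rule ell2_abelian_group)
  have "\<ominus>\<^bsub>ell2\<^esub> g = (\<lambda>s. - g s)"
    using g by (intro minus_equality) (simp_all add: ell2_simps l2_uminus)
  thus ?thesis by (simp add: a_minus_def ell2_simps)
qed

lemma ell2_inner_self: "l2 f \<Longrightarrow> hinner ell2 f f = of_real (\<Sum>\<^sub>\<infinity>s. (cmod (f s))\<^sup>2)"
proof -
  assume f: "l2 f"
  have "((\<lambda>s. complex_of_real ((cmod (f s))\<^sup>2)) has_sum of_real (\<Sum>\<^sub>\<infinity>s. (cmod (f s))\<^sup>2)) UNIV"
    by (rule has_sum_bounded_linear[OF bounded_linear_of_real has_sum_infsum]) (use f in \<open>simp add: l2_def\<close>)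
  thus ?thesis unfolding ell2_simps complex_norm_square by (rule infsumI)
qed

lemma ell2_hnorm_sq: "l2 f \<Longrightarrow> (hnorm ell2 f)\<^sup>2 = (\<Sum>\<^sub>\<infinity>s. (cmod (f s))\<^sup>2)"
  by (simp add: hnorm_def ell2_inner_self infsum_nonneg)

lemma ell2_hnorm_nonneg: "l2 f \<Longrightarrow> 0 \<le> hnorm ell2 f"
  by (simp add: hnorm_def ell2_inner_self infsum_nonneg)

lemma ell2_coord_le: "l2 f \<Longrightarrow> cmod (f s) \<le> hnorm ell2 f"
  using l2_finite_sum_le[of f "{s}"]
  by - (rule power2_le_imp_le, auto simp: ell2_hnorm_sq ell2_hnorm_nonneg)

lemma ell2_complete:
  fixes s :: "nat \<Rightarrow> 's \<Rightarrow> complex"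
  assumes s: "\<And>k. l2 (s k)"
    and cauchy: "\<And>e. 0 < e \<Longrightarrow> \<exists>N. \<forall>k\<ge>N. \<forall>l\<ge>N. hnorm ell2 (s k \<ominus>\<^bsub>ell2\<^esub> s l) < e"
  shows "\<exists>u\<in>carrier ell2. (\<lambda>k. hnorm ell2 (s k \<ominus>\<^bsub>ell2\<^esub> u)) \<longlonglongrightarrow> 0"
proof -
  have d: "s k \<ominus>\<^bsub>ell2\<^esub> s l = (\<lambda>x. s k x - s l x)" "l2 (\<lambda>x. s k x - s l x)" for k l
    by (simp_all add: ell2_minus s l2_diff)
  have "convergent (\<lambda>k. s k x)" for x
  proof (rule Cauchy_convergent, rule CauchyI)
    fix e :: real assume "0 < e"
    then obtain N where N: "\<And>k l. k \<ge> N \<Longrightarrow> l \<ge> N \<Longrightarrow> hnorm ell2 (s k \<ominus>\<^bsub>ell2\<^esub> s l) < e" using cauchy by blast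
    have "cmod (s k x - s l x) < e" if "k \<ge> N" "l \<ge> N" for k l
      using ell2_coord_le[OF d(2)[of k l], of x] N[OF that] by (simp add: d(1))
    thus "\<exists>M. \<forall>m\<ge>M. \<forall>n\<ge>M. cmod (s m x - s n x) < e" by blast
  qed
  then obtain u where u: "\<And>x. (\<lambda>k. s k x) \<longlonglongrightarrow> u x" unfolding convergent_def by metis
  have close: "\<exists>N. \<forall>k\<ge>N. l2 (\<lambda>x. s k x - u x) \<and> hnorm ell2 (\<lambda>x. s k x - u x) \<le> e" if e: "0 < e" for e
  proof -
    obtain N where N: "\<And>k l. k \<ge> N \<Longrightarrow> l \<ge> N \<Longrightarrow> hnorm ell2 (s k \<ominus>\<^bsub>ell2\<^esub> s l) < e" using cauchy e by blast
    have "l2 (\<lambda>x. s k x - u x) \<and> hnorm ell2 (\<lambda>x. s k x - u x) \<le> e" if k: "k \<ge> N" for k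
    proof -
      have b: "(\<Sum>x\<in>S. (cmod (s k x - u x))\<^sup>2) \<le> e\<^sup>2" if S: "finite S" for S
      proof (rule LIMSEQ_le_const2)
        show "(\<lambda>l. \<Sum>x\<in>S. (cmod (s k x - s l x))\<^sup>2) \<longlonglongrightarrow> (\<Sum>x\<in>S. (cmod (s k x - u x))\<^sup>2)"
          by (intro tendsto_intros u)
        have "(\<Sum>x\<in>S. (cmod (s k x - s l x))\<^sup>2) \<le> e\<^sup>2" if "l \<ge> N" for l
        proof -
          have "(\<Sum>x\<in>S. (cmod (s k x - s l x))\<^sup>2) \<le> (hnorm ell2 (s k \<ominus>\<^bsub>ell2\<^esub> s l))\<^sup>2"
            using l2_finite_sum_le[OF d(2) S] by (simp add: d(1) ell2_hnorm_sq[OF d(2)])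
          also have "\<dots> \<le> e\<^sup>2" using N[OF k that] ell2_hnorm_nonneg[OF d(2)] by (intro power_mono) (auto simp: d(1))
          finally show ?thesis .
        qed
        thus "\<exists>N. \<forall>l\<ge>N. (\<Sum>x\<in>S. (cmod (s k x - s l x))\<^sup>2) \<le> e\<^sup>2" by blast
      qed
      have l: "l2 (\<lambda>x. s k x - u x)" "(\<Sum>\<^sub>\<infinity>x. (cmod (s k x - u x))\<^sup>2) \<le> e\<^sup>2"
        by (rule l2_bounded, erule b)+
      have "hnorm ell2 (\<lambda>x. s k x - u x) \<le> e"
        using l(2) e by - (rule power2_le_imp_le, simp_all add: ell2_hnorm_sq[OF l(1)])
      thus ?thesis using l(1) by simp
    qed
    thus ?thesis by blast
  qed
  obtain N where "l2 (\<lambda>x. s N x - u x)" using close[of 1] by auto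
  hence lu: "l2 u" using l2_diff[OF s[of N], of "\<lambda>x. s N x - u x"] by simp
  have "(\<lambda>k. hnorm ell2 (s k \<ominus>\<^bsub>ell2\<^esub> u)) \<longlonglongrightarrow> 0"
  proof (rule LIMSEQ_I)
    fix r :: real assume "0 < r"
    then obtain N where N: "\<And>k. k \<ge> N \<Longrightarrow> l2 (\<lambda>x. s k x - u x) \<and> hnorm ell2 (\<lambda>x. s k x - u x) \<le> r / 2"
      using close[of "r / 2"] by auto
    have "norm (hnorm ell2 (s k \<ominus>\<^bsub>ell2\<^esub> u) - 0) < r" if "k \<ge> N" for k
      using N[OF that] ell2_hnorm_nonneg[of "\<lambda>x. s k x - u x"] \<open>0 < r\<close> by (simp add: ell2_minus[OF s lu])
    thus "\<exists>no. \<forall>k\<ge>no. norm (hnorm ell2 (s k \<ominus>\<^bsub>ell2\<^esub> u) - 0) < r" by blast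
  qed
  thus ?thesis using lu by (intro bexI[of _ u]) (simp_all add: ell2_simps)
qed

lemma ell2_hilbert: "hilbert_space (ell2 :: ('s \<Rightarrow> complex) hspace)"
proof (intro hilbert_space.intro hilbert_space_axioms.intro)
  have "module_axioms scalar_field (ell2 :: ('s \<Rightarrow> complex) hspace)"
    by unfold_locales (auto simp: ell2_simps l2_scale algebra_simps)
  thus "vectorspace scalar_field (ell2 :: ('s \<Rightarrow> complex) hspace)"
    by (intro vectorspace.intro module.intro class_field ell2_abelian_group)
       (use class_field in \<open>auto simp: field_def domain_def\<close>)
next
  fix u v w :: "'s \<Rightarrow> complex" and c
  assume u: "u \<in> carrier ell2" and v: "v \<in> carrier ell2"
  show "hinner ell2 (c \<odot>\<^bsub>ell2\<^esub> u) v = c * hinner ell2 u v"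
    using u v l2_product_summable[of u v] by (simp add: ell2_simps infsum_cmult_right mult.assoc)
  show "hinner ell2 u v = cnj (hinner ell2 v u)"
    by (simp add: ell2_simps infsum_cnj[symmetric] mult.commute del: infsum_cnj)
  assume w: "w \<in> carrier ell2"
  show "hinner ell2 (u \<oplus>\<^bsub>ell2\<^esub> v) w = hinner ell2 u w + hinner ell2 v w"
    using u v w by (simp add: ell2_simps distrib_right infsum_add l2_product_summable)
next
  fix u :: "'s \<Rightarrow> complex" assume u: "u \<in> carrier ell2"
  hence l: "l2 u" by (simp add: ell2_simps)
  show "0 \<le> Re (hinner ell2 u u)" by (simp add: ell2_inner_self[OF l] infsum_nonneg)
  assume "hinner ell2 u u = 0"
  hence "hnorm ell2 u = 0" by (simp add: hnorm_def)
  hence "u s = 0" for s using ell2_coord_le[OF l, of s] by simp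
  thus "u = \<zero>\<^bsub>ell2\<^esub>" by (simp add: ell2_simps fun_eq_iff)
next
  fix s :: "nat \<Rightarrow> 's \<Rightarrow> complex"
  assume "\<And>k. s k \<in> carrier ell2" and "\<And>e. 0 < e \<Longrightarrow> \<exists>N. \<forall>k\<ge>N. \<forall>l\<ge>N. hnorm ell2 (s k \<ominus>\<^bsub>ell2\<^esub> s l) < e"
  thus "\<exists>u\<in>carrier ell2. (\<lambda>k. hnorm ell2 (s k \<ominus>\<^bsub>ell2\<^esub> u)) \<longlonglongrightarrow> 0"
    by (intro ell2_complete) (auto simp: ell2_simps)
qed

lemma ell2_finsum:
  assumes "finite A" "\<And>a. a \<in> A \<Longrightarrow> l2 (f a)"
  shows "(\<Oplus>\<^bsub>ell2\<^esub>a\<in>A. f a) = (\<lambda>s. \<Sum>a\<in>A. f a s)"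
proof -
  interpret hilbert_space ell2 by (rule ell2_hilbert)
  show ?thesis
    using assms
  proof (induction A rule: finite_induct)
    case empty
    show ?case by (simp add: ell2_simps)
  next
    case (insert a A)
    have "(\<Oplus>\<^bsub>ell2\<^esub>a\<in>insert a A. f a) = f a \<oplus>\<^bsub>ell2\<^esub> (\<Oplus>\<^bsub>ell2\<^esub>a\<in>A. f a)"
      using insert by (intro finsum_insert) (auto simp: ell2_simps)
    thus ?case using insert by (simp add: ell2_simps)
  qed
qed

lemma l2_inj: "l2 f \<Longrightarrow> inj g \<Longrightarrow> l2 (\<lambda>x. f (g x))"
  unfolding l2_def
  using summable_on_reindex[of g UNIV "\<lambda>s. (cmod (f s))\<^sup>2"] summable_on_subset_banach[of "\<lambda>s. (cmod (f s))\<^sup>2" UNIV "range g"]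
  by (simp add: o_def)

section \<open>Isometries given by infinite matrices with orthonormal columns\<close>

locale orthonormal_columns =
  fixes W :: "'t \<Rightarrow> 's \<Rightarrow> complex"
  assumes ortho: "\<And>t t'. ((\<lambda>s. W t s * cnj (W t' s)) has_sum (if t = t' then 1 else 0)) UNIV"
begin

definition app :: "('t \<Rightarrow> complex) \<Rightarrow> 's \<Rightarrow> complex" where
  "app h s = (\<Sum>\<^sub>\<infinity>t. h t * W t s)"

lemma finite_isometry:
  assumes T: "finite T"
  shows "((\<lambda>s. (cmod (\<Sum>t\<in>T. h t * W t s))\<^sup>2) has_sum (\<Sum>t\<in>T. (cmod (h t))\<^sup>2)) UNIV"
proof -
  have "((\<lambda>s. \<Sum>t\<in>T. \<Sum>t'\<in>T. (h t * cnj (h t')) * (W t s * cnj (W t' s))) has_sum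
      (\<Sum>t\<in>T. \<Sum>t'\<in>T. (h t * cnj (h t')) * (if t = t' then 1 else 0))) UNIV"
    by (intro has_sum_finite_sum has_sum_cmult_right ortho)
  moreover have "(\<Sum>t\<in>T. \<Sum>t'\<in>T. (h t * cnj (h t')) * (W t s * cnj (W t' s))) = of_real ((cmod (\<Sum>t\<in>T. h t * W t s))\<^sup>2)" for s
    using qform_rank_one[of T "\<lambda>t. W t s" h] by (simp add: qform_def del: of_real_power)
  moreover have "(\<Sum>t\<in>T. \<Sum>t'\<in>T. (h t * cnj (h t')) * (if t = t' then 1 else 0)) = of_real (\<Sum>t\<in>T. (cmod (h t))\<^sup>2)"
    using T by (simp add: complex_norm_square if_distrib[of "(*) _"] cong: if_cong del: of_real_power)
  ultimately have "((\<lambda>s. complex_of_real ((cmod (\<Sum>t\<in>T. h t * W t s))\<^sup>2)) has_sum of_real (\<Sum>t\<in>T. (cmod (h t))\<^sup>2)) UNIV"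
    by (simp del: of_real_power of_real_sum)
  from has_sum_Re[OF this] show ?thesis by (simp del: of_real_power)
qed

text \<open>Apply \<open>finite_isometry\<close> to the conjugate of a finite part of the row: the
  coordinate \<open>s\<close> of the image is \<open>\<beta>\<close>, and its total squared norm is
  \<open>\<beta>\<close> as well, so \<open>\<beta>\<^sup>2 \<le> \<beta>\<close>. It follows that
  the series defining \<open>app\<close> converges at every coordinate.\<close>

lemma row_l2: "l2 (\<lambda>t. cnj (W t s))"
proof (rule l2_bounded(1)[of _ 1])
  fix T :: "'t set" assume T: "finite T"
  define \<beta> where "\<beta> = (\<Sum>t\<in>T. (cmod (W t s))\<^sup>2)"
  have "0 \<le> \<beta>" unfolding \<beta>_def by (intro sum_nonneg) auto
  note F = finite_isometry[OF T, of "\<lambda>t. cnj (W t s)"]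
  have "(\<Sum>t\<in>T. cnj (W t s) * W t s) = of_real \<beta>"
    by (simp add: \<beta>_def complex_norm_square mult.commute del: of_real_power)
  hence "\<beta>\<^sup>2 = (cmod (\<Sum>t\<in>T. cnj (W t s) * W t s))\<^sup>2" using \<open>0 \<le> \<beta>\<close> by simp
  also have "\<dots> \<le> (\<Sum>\<^sub>\<infinity>s'. (cmod (\<Sum>t\<in>T. cnj (W t s) * W t s'))\<^sup>2)"
    using finite_sum_le_infsum[OF has_sum_imp_summable[OF F], of "{s}"] by simp
  also have "\<dots> = \<beta>" using infsumI[OF F] by (simp add: \<beta>_def)
  finally have "\<beta> * \<beta> \<le> \<beta> * 1" by (simp add: power2_eq_square)
  hence "\<beta> \<le> 1" using \<open>0 \<le> \<beta>\<close> by (cases "\<beta> = 0") auto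
  thus "(\<Sum>t\<in>T. (cmod (cnj (W t s)))\<^sup>2) \<le> 1" by (simp add: \<beta>_def)
qed

lemma app_summable: "l2 h \<Longrightarrow> (\<lambda>t. h t * W t s) summable_on UNIV"
  using l2_product_summable[OF _ row_l2] by simp

lemma app_add: "l2 h \<Longrightarrow> l2 g \<Longrightarrow> app (\<lambda>t. h t + g t) s = app h s + app g s"
  unfolding app_def by (simp add: distrib_right infsum_add app_summable)

lemma app_scale: "l2 h \<Longrightarrow> app (\<lambda>t. c * h t) s = c * app h s"
  unfolding app_def by (simp add: mult.assoc infsum_cmult_right app_summable)

lemma app_finite:
  assumes "finite T" "\<And>t. t \<notin> T \<Longrightarrow> h t = 0"
  shows "app h s = (\<Sum>t\<in>T. h t * W t s)"
proof -
  have "app h s = (\<Sum>\<^sub>\<infinity>t\<in>T. h t * W t s)"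
    unfolding app_def by (rule infsum_cong_neutral) (use assms in auto)
  thus ?thesis using assms by simp
qed

text \<open>Finitely supported inputs are mapped isometrically; on finitely many output coordinates
  the estimate passes to the limit over finite input sets.\<close>

lemma app_contractive:
  assumes h: "l2 h"
  shows "l2 (app h)" "(\<Sum>\<^sub>\<infinity>s. (cmod (app h s))\<^sup>2) \<le> (\<Sum>\<^sub>\<infinity>t. (cmod (h t))\<^sup>2)"
proof -
  have "(\<Sum>s\<in>S. (cmod (app h s))\<^sup>2) \<le> (\<Sum>\<^sub>\<infinity>t. (cmod (h t))\<^sup>2)" if S: "finite S" for S
  proof (rule tendsto_upperbound)
    have "((\<lambda>T. \<Sum>t\<in>T. h t * W t s) \<longlongrightarrow> app h s) (finite_subsets_at_top UNIV)" for s
      using has_sum_infsum[OF app_summable[OF h]] unfolding app_def has_sum_def .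
    thus "((\<lambda>T. \<Sum>s\<in>S. (cmod (\<Sum>t\<in>T. h t * W t s))\<^sup>2) \<longlongrightarrow> (\<Sum>s\<in>S. (cmod (app h s))\<^sup>2)) (finite_subsets_at_top UNIV)"
      by (intro tendsto_intros)
    have "(\<Sum>s\<in>S. (cmod (\<Sum>t\<in>T. h t * W t s))\<^sup>2) \<le> (\<Sum>\<^sub>\<infinity>t. (cmod (h t))\<^sup>2)" if T: "finite T" for T
    proof -
      have "(\<Sum>s\<in>S. (cmod (\<Sum>t\<in>T. h t * W t s))\<^sup>2) \<le> (\<Sum>\<^sub>\<infinity>s. (cmod (\<Sum>t\<in>T. h t * W t s))\<^sup>2)"
        using finite_sum_le_infsum[OF has_sum_imp_summable[OF finite_isometry[OF T]] S] by simp
      also have "\<dots> = (\<Sum>t\<in>T. (cmod (h t))\<^sup>2)" by (rule infsumI[OF finite_isometry[OF T]])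
      also have "\<dots> \<le> (\<Sum>\<^sub>\<infinity>t. (cmod (h t))\<^sup>2)" by (rule l2_finite_sum_le[OF h T])
      finally show ?thesis .
    qed
    thus "\<forall>\<^sub>F T in finite_subsets_at_top UNIV. (\<Sum>s\<in>S. (cmod (\<Sum>t\<in>T. h t * W t s))\<^sup>2) \<le> (\<Sum>\<^sub>\<infinity>t. (cmod (h t))\<^sup>2)"
      by (intro eventually_finite_subsets_at_top_weakI) auto
  qed simp
  hence b: "\<And>S. finite S \<Longrightarrow> (\<Sum>s\<in>S. (cmod (app h s))\<^sup>2) \<le> (\<Sum>\<^sub>\<infinity>t. (cmod (h t))\<^sup>2)" by blast
  show "l2 (app h)" "(\<Sum>\<^sub>\<infinity>s. (cmod (app h s))\<^sup>2) \<le> (\<Sum>\<^sub>\<infinity>t. (cmod (h t))\<^sup>2)"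
    by (rule l2_bounded, erule b)+
qed

text \<open>For the lower bound \<open>h\<close> is cut into a finite part, on which
  \<open>app\<close> is isometric, and a tail, on which it is contractive; the triangle inequality
  leaves an error that vanishes as the finite part grows.\<close>

theorem app_isometry:
  assumes h: "l2 h"
  shows "hnorm ell2 (app h) = hnorm ell2 h"
proof (rule antisym)
  interpret T: hilbert_space "ell2 :: ('t \<Rightarrow> complex) hspace" by (rule ell2_hilbert)
  interpret S: hilbert_space "ell2 :: ('s \<Rightarrow> complex) hspace" by (rule ell2_hilbert)
  have le: "hnorm ell2 (app g) \<le> hnorm ell2 g" if "l2 g" for g
    using app_contractive[OF that] that
    by - (rule power2_le_imp_le, simp_all add: ell2_hnorm_sq ell2_hnorm_nonneg)
  show "hnorm ell2 (app h) \<le> hnorm ell2 h" by (rule le[OF h])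
  have "sqrt (\<Sum>t\<in>F. (cmod (h t))\<^sup>2) - sqrt ((\<Sum>\<^sub>\<infinity>t. (cmod (h t))\<^sup>2) - (\<Sum>t\<in>F. (cmod (h t))\<^sup>2)) \<le> hnorm ell2 (app h)"
    if F: "finite F" for F
  proof -
    define h1 where "h1 t = (if t \<in> F then h t else 0)" for t
    define h2 where "h2 t = (if t \<in> F then 0 else h t)" for t
    have s1: "((\<lambda>t. (cmod (h1 t))\<^sup>2) has_sum (\<Sum>t\<in>F. (cmod (h t))\<^sup>2)) UNIV"
      by (rule has_sum_cong_neutral[THEN iffD1, OF _ _ _ has_sum_finite[OF F]]) (auto simp: h1_def)
    hence l1: "l2 h1" unfolding l2_def by (rule has_sum_imp_summable)
    have n1: "(hnorm ell2 h1)\<^sup>2 = (\<Sum>t\<in>F. (cmod (h t))\<^sup>2)" using infsumI[OF s1] by (simp add: ell2_hnorm_sq[OF l1])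
    have h12: "h2 t = h t - h1 t" "h t = h1 t + h2 t" for t by (simp_all add: h1_def h2_def)
    have l2': "l2 h2" unfolding h12(1)[abs_def] by (rule l2_diff[OF h l1])
    have "(\<lambda>t. (cmod (h t))\<^sup>2) = (\<lambda>t. (cmod (h1 t))\<^sup>2 + (cmod (h2 t))\<^sup>2)"
      by (auto simp: h1_def h2_def)
    hence "(\<Sum>\<^sub>\<infinity>t. (cmod (h t))\<^sup>2) = (\<Sum>\<^sub>\<infinity>t. (cmod (h1 t))\<^sup>2) + (\<Sum>\<^sub>\<infinity>t. (cmod (h2 t))\<^sup>2)"
      using infsum_add[OF l1[unfolded l2_def] l2'[unfolded l2_def]] by simp
    hence n2: "(hnorm ell2 h2)\<^sup>2 = (\<Sum>\<^sub>\<infinity>t. (cmod (h t))\<^sup>2) - (\<Sum>t\<in>F. (cmod (h t))\<^sup>2)"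
      using n1 by (simp add: ell2_hnorm_sq[OF l1] ell2_hnorm_sq[OF l2'])
    have a1: "app h1 s = (\<Sum>t\<in>F. h t * W t s)" for s
      using app_finite[OF F, of h1 s] by (simp add: h1_def)
    have "(hnorm ell2 (app h1))\<^sup>2 = (hnorm ell2 h1)\<^sup>2"
      unfolding n1 ell2_hnorm_sq[OF app_contractive(1)[OF l1]] a1 by (rule infsumI[OF finite_isometry[OF F]])
    hence e1: "hnorm ell2 (app h1) = sqrt (\<Sum>t\<in>F. (cmod (h t))\<^sup>2)"
      unfolding n1 using ell2_hnorm_nonneg[OF app_contractive(1)[OF l1]] by (metis real_sqrt_unique)
    have e2: "hnorm ell2 h2 = sqrt ((\<Sum>\<^sub>\<infinity>t. (cmod (h t))\<^sup>2) - (\<Sum>t\<in>F. (cmod (h t))\<^sup>2))"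
      unfolding n2[symmetric] using ell2_hnorm_nonneg[OF l2'] by simp
    have "app h1 = app h \<oplus>\<^bsub>ell2\<^esub> (- 1) \<odot>\<^bsub>ell2\<^esub> app h2"
      using app_add[OF l1 l2'] by (simp add: ell2_simps h12(2)[symmetric] fun_eq_iff)
    moreover have "hnorm ell2 (app h \<oplus>\<^bsub>ell2\<^esub> (- 1) \<odot>\<^bsub>ell2\<^esub> app h2)
        \<le> hnorm ell2 (app h) + hnorm ell2 ((- 1) \<odot>\<^bsub>ell2\<^esub> app h2)"
      by (rule S.hnorm_add) (simp_all add: ell2_simps app_contractive(1) h l2' l2_uminus)
    moreover have "hnorm ell2 ((- 1) \<odot>\<^bsub>ell2\<^esub> app h2) = hnorm ell2 (app h2)"
      using S.hnorm_smult[of "app h2" "- 1"] app_contractive(1)[OF l2'] by (simp add: ell2_simps)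
    ultimately show ?thesis using le[OF l2'] e1 e2 by simp
  qed
  hence ev: "\<forall>\<^sub>F F in finite_subsets_at_top UNIV. sqrt (\<Sum>t\<in>F. (cmod (h t))\<^sup>2)
      - sqrt ((\<Sum>\<^sub>\<infinity>t. (cmod (h t))\<^sup>2) - (\<Sum>t\<in>F. (cmod (h t))\<^sup>2)) \<le> hnorm ell2 (app h)"
    by (intro eventually_finite_subsets_at_top_weakI) auto
  have lim: "((\<lambda>F. \<Sum>t\<in>F. (cmod (h t))\<^sup>2) \<longlongrightarrow> (\<Sum>\<^sub>\<infinity>t. (cmod (h t))\<^sup>2)) (finite_subsets_at_top UNIV)"
    using h has_sum_infsum unfolding l2_def has_sum_def by blast
  have "((\<lambda>F. sqrt (\<Sum>t\<in>F. (cmod (h t))\<^sup>2) - sqrt ((\<Sum>\<^sub>\<infinity>t. (cmod (h t))\<^sup>2) - (\<Sum>t\<in>F. (cmod (h t))\<^sup>2))) \<longlongrightarrow>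
      sqrt (\<Sum>\<^sub>\<infinity>t. (cmod (h t))\<^sup>2) - sqrt ((\<Sum>\<^sub>\<infinity>t. (cmod (h t))\<^sup>2) - (\<Sum>\<^sub>\<infinity>t. (cmod (h t))\<^sup>2))) (finite_subsets_at_top UNIV)"
    by (intro tendsto_intros lim)
  from tendsto_upperbound[OF this ev] have "sqrt (\<Sum>\<^sub>\<infinity>t. (cmod (h t))\<^sup>2) \<le> hnorm ell2 (app h)" by simp
  thus "hnorm ell2 h \<le> hnorm ell2 (app h)"
    using ell2_hnorm_nonneg[OF h] by (simp add: ell2_hnorm_sq[OF h, symmetric])
qed

end

context gram_pair
begin

text \<open>The basis vector at such an \<open>s\<close> is orthogonal to every \<open>q k\<close>,
  so elimination never gives it a coefficient.\<close>

lemma v_zero: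
  assumes "\<And>k. q k s = 0"
  shows "v t s = 0"
proof -
  have "elim_seq N2 (\<lambda>l. Inl (from_nat l)) l (Inr s) (Inl k) = 0" for l k
  proof (induction l arbitrary: k)
    case 0
    show ?case using assms by (simp add: N2_def)
  next
    case (Suc l)
    show ?case by (simp add: eliminate_def Suc)
  qed
  hence "R2 l (Inr s) = 0" for l by (simp add: R2_def elim_coeff_def)
  thus ?thesis by (simp add: v_def)
qed

text \<open>The completion \<open>w\<close> is placed in coordinates \<open>\<sigma> l\<close> that \<open>q\<close> leaves free.\<close>

theorem orthonormal_extension:
  fixes \<sigma> :: "nat \<Rightarrow> 's"
  assumes \<sigma>: "inj \<sigma>" and free: "\<And>k l. q k (\<sigma> l) = 0"
  obtains W where "orthonormal_columns W" "\<And>k s. (\<Sum>t\<in>P k. p k t * W t s) = q k s"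
    "\<And>t s. s \<notin> range \<sigma> \<Longrightarrow> (\<And>k. q k s = 0) \<Longrightarrow> W t s = 0"
proof -
  obtain w :: "'t \<Rightarrow> nat \<Rightarrow> complex" where w1: "\<And>t l. to_nat t < l \<Longrightarrow> w t l = 0"
    and w2: "\<And>t t'. ((\<lambda>s. v t s * cnj (v t' s)) has_sum
        ((if t = t' then 1 else 0) - (\<Sum>l<Suc (to_nat t). w t l * cnj (w t' l)))) UNIV"
    and w3: "\<And>k l. (\<Sum>t\<in>P k. p k t * w t l) = 0"
    using isometric_extension by blast
  define x where "x t s = (if s \<in> range \<sigma> then w t (inv_into UNIV \<sigma> s) else 0)" for t s
  define W where "W t s = v t s + x t s" for t s
  have x\<sigma>: "x t (\<sigma> l) = w t l" for t l using \<sigma> by (simp add: x_def)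
  \<comment> \<open>Thus \<open>v\<close> and \<open>x\<close> live on disjoint sets of coordinates:
    cross terms vanish and their Gram matrices add up to the identity.\<close>
  have v\<sigma>: "v t s = 0" if "s \<in> range \<sigma>" for t s using that free by (auto intro: v_zero)
  show ?thesis
  proof (rule that)
    show "orthonormal_columns W"
    proof
      fix t t'
      have "((\<lambda>l. w t l * cnj (w t' l)) has_sum (\<Sum>l<Suc (to_nat t). w t l * cnj (w t' l))) UNIV"
        by (rule has_sum_cong_neutral[THEN iffD1, OF _ _ _ has_sum_finite[of "{..<Suc (to_nat t)}"]]) (auto simp: w1)
      hence "((\<lambda>s. x t s * cnj (x t' s)) has_sum (\<Sum>l<Suc (to_nat t). w t l * cnj (w t' l))) (range \<sigma>)"
        using \<sigma> by (subst has_sum_reindex) (simp_all add: o_def x\<sigma>)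
      hence "((\<lambda>s. x t s * cnj (x t' s)) has_sum (\<Sum>l<Suc (to_nat t). w t l * cnj (w t' l))) UNIV"
        by (rule has_sum_cong_neutral[THEN iffD1, rotated 3]) (auto simp: x_def)
      from has_sum_add[OF w2[of t t'] this]
      have "((\<lambda>s. v t s * cnj (v t' s) + x t s * cnj (x t' s)) has_sum (if t = t' then 1 else 0)) UNIV" by simp
      moreover have "v t s * cnj (v t' s) + x t s * cnj (x t' s) = W t s * cnj (W t' s)" for s
        by (cases "s \<in> range \<sigma>") (simp_all add: W_def v\<sigma> x_def)
      ultimately show "((\<lambda>s. W t s * cnj (W t' s)) has_sum (if t = t' then 1 else 0)) UNIV" by simp
    qed
    fix k s
    have "(\<Sum>t\<in>P k. p k t * x t s) = 0"
      by (cases "s \<in> range \<sigma>") (auto simp: x\<sigma> w3 x_def)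
    thus "(\<Sum>t\<in>P k. p k t * W t s) = q k s" by (simp add: W_def distrib_left sum.distrib v_p)
  next
    fix t s assume "s \<notin> range \<sigma>" "\<And>k. q k s = 0"
    thus "W t s = 0" by (simp add: W_def x_def v_zero)
  qed
qed

end

section \<open>Colligations on square-summable sequences\<close>

lemma has_sum_supported: "finite F \<Longrightarrow> (\<And>t. t \<notin> F \<Longrightarrow> f t = 0) \<Longrightarrow> (f has_sum sum f F) UNIV"
  by (rule has_sum_cong_neutral[THEN iffD1, OF _ _ _ has_sum_finite[of F f]]) auto

text \<open>The space \<open>\<complex> \<oplus> (\<ell>\<^sup>2 \<otimes> \<complex>\<^sup>k)\<close> inside the square-summable families indexed by \<open>(nat \<times> nat) option\<close>:
  the scalar sits at \<open>None\<close>, and \<open>Some (l, i)\<close> is the coordinate \<open>l\<close> of the component \<open>i\<close>.\<close>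

definition pack :: "nat \<Rightarrow> complex \<times> (nat \<Rightarrow> nat \<Rightarrow> complex) \<Rightarrow> (nat \<times> nat) option \<Rightarrow> complex" where
  "pack k zu t = (case t of None \<Rightarrow> fst zu | Some (l, i) \<Rightarrow> if i < k then snd zu i l else 0)"

definition unpack :: "nat \<Rightarrow> ((nat \<times> nat) option \<Rightarrow> complex) \<Rightarrow> nat \<Rightarrow> nat \<Rightarrow> complex" where
  "unpack k f = (\<lambda>i\<in>{..<k}. \<lambda>l. f (Some (l, i)))"

lemma pack_has_sum:
  assumes u: "u \<in> carrier (tensor ell2 k)"
  shows "((\<lambda>t. (cmod (pack k (z, u) t))\<^sup>2) has_sum ((cmod z)\<^sup>2 + (hnorm (tensor ell2 k) u)\<^sup>2)) UNIV"
proof -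
  interpret E: hilbert_space "ell2 :: (nat \<Rightarrow> complex) hspace" by (rule ell2_hilbert)
  have l: "l2 (u i)" if "i < k" for i using u that by (auto simp: tensor_simps ell2_simps)
  have none: "((\<lambda>t. if t = None then (cmod z)\<^sup>2 else 0) has_sum (cmod z)\<^sup>2) (UNIV :: (nat \<times> nat) option set)"
    by (rule has_sum_supported[of "{None}" "\<lambda>t. if t = None then (cmod z)\<^sup>2 else 0", simplified]) auto
  have comp: "((\<lambda>t. case t of None \<Rightarrow> 0 | Some (l, j) \<Rightarrow> if j = i then (cmod (u i l))\<^sup>2 else 0) has_sum (hnorm ell2 (u i))\<^sup>2) UNIV"
    if i: "i \<in> {..<k}" for i
  proof -
    have li: "l2 (u i)" using l i by simp
    have "((\<lambda>l. (cmod (u i l))\<^sup>2) has_sum (hnorm ell2 (u i))\<^sup>2) UNIV"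
      unfolding ell2_hnorm_sq[OF li] using li unfolding l2_def by (rule has_sum_infsum)
    hence "((\<lambda>t. case t of None \<Rightarrow> 0 | Some (l, j) \<Rightarrow> if j = i then (cmod (u i l))\<^sup>2 else 0) has_sum (hnorm ell2 (u i))\<^sup>2)
        (range (\<lambda>l. Some (l, i)))"
      by (subst has_sum_reindex) (auto simp: o_def inj_on_def)
    thus ?thesis by (rule has_sum_cong_neutral[THEN iffD1, rotated 3]) (auto split: option.splits)
  qed
  have "((\<lambda>t. \<Sum>i<k. case t of None \<Rightarrow> 0 | Some (l, j) \<Rightarrow> if j = i then (cmod (u i l))\<^sup>2 else 0) has_sum
      (\<Sum>i<k. (hnorm ell2 (u i))\<^sup>2)) UNIV"
    by (rule has_sum_finite_sum, rule comp)
  hence "((\<lambda>t. (if t = None then (cmod z)\<^sup>2 else 0)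
      + (\<Sum>i<k. case t of None \<Rightarrow> 0 | Some (l, j) \<Rightarrow> if j = i then (cmod (u i l))\<^sup>2 else 0)) has_sum
      (cmod z)\<^sup>2 + (\<Sum>i<k. (hnorm ell2 (u i))\<^sup>2)) UNIV"
    by (rule has_sum_add[OF none])
  moreover have "(\<lambda>t. (if t = None then (cmod z)\<^sup>2 else 0)
      + (\<Sum>i<k. case t of None \<Rightarrow> 0 | Some (l, j) \<Rightarrow> if j = i then (cmod (u i l))\<^sup>2 else 0)) = (\<lambda>t. (cmod (pack k (z, u) t))\<^sup>2)"
  proof (rule ext)
    fix t
    show "(if t = None then (cmod z)\<^sup>2 else 0)
      + (\<Sum>i<k. case t of None \<Rightarrow> 0 | Some (l, j) \<Rightarrow> if j = i then (cmod (u i l))\<^sup>2 else 0) = (cmod (pack k (z, u) t))\<^sup>2"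
    proof (cases t)
      case (Some p)
      thus ?thesis by (cases p) (simp add: pack_def)
    qed (simp add: pack_def)
  qed
  ultimately show ?thesis by (simp only: E.tensor_hnorm_sq(2)[OF u])
qed

lemma pack_l2: "u \<in> carrier (tensor ell2 k) \<Longrightarrow> l2 (pack k (z, u))"
  unfolding l2_def by (rule has_sum_imp_summable[OF pack_has_sum])

lemma unpack_closed: "l2 f \<Longrightarrow> unpack k f \<in> carrier (tensor ell2 k)"
  using l2_inj[of f "\<lambda>l. Some (l, _)"] by (auto simp: unpack_def tensor_simps ell2_simps inj_on_def)

lemma pack_add: "pack k (z + w, u \<oplus>\<^bsub>tensor ell2 k\<^esub> v) = (\<lambda>t. pack k (z, u) t + pack k (w, v) t)"
  by (auto simp: pack_def fun_eq_iff tensor_simps ell2_simps split: option.splits)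

lemma pack_scale: "pack k (c * z, c \<odot>\<^bsub>tensor ell2 k\<^esub> u) = (\<lambda>t. c * pack k (z, u) t)"
  by (auto simp: pack_def fun_eq_iff tensor_simps ell2_simps split: option.splits)

lemma block_op_hom:
  assumes H: "hilbert_space H" and K: "hilbert_space K"
    and B: "B \<in> module_hom scalar_field H scalars" and C: "C \<in> module_hom scalar_field scalars K"
    and D: "D \<in> module_hom scalar_field H K"
  shows "block_op A B C D K \<in> module_hom scalar_field (hsum scalars H) (hsum scalars K)"
proof -
  interpret H: hilbert_space H by (rule H)
  interpret K: hilbert_space K by (rule K)
  have Cc: "C z \<in> carrier K" for z using module_hom_closed[OF C] by (auto simp: scalars_simps)
  have Dc: "D u \<in> carrier K" if "u \<in> carrier H" for u using module_hom_closed[OF D] that by auto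
  have C': "C (z + w) = C z \<oplus>\<^bsub>K\<^esub> C w" "C (c * z) = c \<odot>\<^bsub>K\<^esub> C z" for z w c
    using module_hom_add[OF C, of z w] module_hom_smult[OF C, of c z] by (simp_all add: scalars_simps)
  have B': "B (u \<oplus>\<^bsub>H\<^esub> v) = B u + B v" "B (c \<odot>\<^bsub>H\<^esub> u) = c * B u"
    if "u \<in> carrier H" "v \<in> carrier H" for u v c
    using module_hom_add[OF B, of u v] module_hom_smult[OF B, of c u] that by (simp_all add: scalars_simps)
  have D': "D (u \<oplus>\<^bsub>H\<^esub> v) = D u \<oplus>\<^bsub>K\<^esub> D v" "D (c \<odot>\<^bsub>H\<^esub> u) = c \<odot>\<^bsub>K\<^esub> D u"
    if "u \<in> carrier H" "v \<in> carrier H" for u v c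
    using module_hom_add[OF D, of u v] module_hom_smult[OF D, of c u] that by simp_all
  have "(C z \<oplus>\<^bsub>K\<^esub> C w) \<oplus>\<^bsub>K\<^esub> (D u \<oplus>\<^bsub>K\<^esub> D v) = (C z \<oplus>\<^bsub>K\<^esub> D u) \<oplus>\<^bsub>K\<^esub> (C w \<oplus>\<^bsub>K\<^esub> D v)"
    if "u \<in> carrier H" "v \<in> carrier H" for z w u v
    using that by (simp add: K.a_ac Cc Dc)
  moreover have "c \<odot>\<^bsub>K\<^esub> C z \<oplus>\<^bsub>K\<^esub> c \<odot>\<^bsub>K\<^esub> D u = c \<odot>\<^bsub>K\<^esub> (C z \<oplus>\<^bsub>K\<^esub> D u)" if "u \<in> carrier H" for c z u
    using K.smult_r_distr[of c "C z" "D u"] that Cc Dc by simp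
  ultimately show ?thesis
    unfolding module_hom_def
    by (auto simp: block_op_def hsum_simps scalars_simps B' C' D' algebra_simps Cc Dc intro!: K.a_closed)
qed

text \<open>The index type has room for infinitely many components. \<open>W_zero\<close> confines
  the outputs to the first \<open>J\<close> of them, while \<open>pack I\<close> feeds inputs into
  the first \<open>I\<close>.\<close>

locale colligation_columns = orthonormal_columns W for W :: "(nat \<times> nat) option \<Rightarrow> (nat \<times> nat) option \<Rightarrow> complex" +
  fixes I J :: nat
  assumes W_zero: "\<And>t l j. J \<le> j \<Longrightarrow> W t (Some (l, j)) = 0"
begin

definition A where "A = W None None"
definition B where "B u = app (pack I (0, u)) None"
definition C where "C z = unpack J (\<lambda>s. z * W None s)"
definition D where "D u = unpack J (app (pack I (0, u)))"

lemma W_l2: "l2 (W t)"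
  using has_sum_imp_summable[OF has_sum_Re[OF ortho[of t t]]] unfolding l2_def
  by (simp add: complex_norm_square[symmetric] del: of_real_power)

lemma app_pack:
  assumes u: "u \<in> carrier (tensor ell2 I)"
  shows "app (pack I (z, u)) = pack J (block_op A B C D (tensor ell2 J) (z, u))"
proof -
  define e where "e t = (if t = None then z else 0)" for t :: "(nat \<times> nat) option"
  have e: "app e s = z * W None s" for s by (subst app_finite[of "{None}"]) (auto simp: e_def)
  have le: "l2 e" unfolding l2_def
    by (rule has_sum_imp_summable[OF has_sum_supported[of "{None}"]]) (auto simp: e_def)
  have "pack I (z, u) = (\<lambda>t. e t + pack I (0, u) t)"
    by (auto simp: pack_def e_def fun_eq_iff split: option.splits)
  hence "app (pack I (z, u)) s = z * W None s + app (pack I (0, u)) s" for s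
    using app_add[OF le pack_l2[OF u]] e by simp
  moreover have "app f (Some (l, j)) = 0" if "J \<le> j" for f l j
    using W_zero[OF that] by (simp add: app_def)
  ultimately show ?thesis
    using W_zero
    by (auto simp: pack_def block_op_def A_def B_def C_def D_def unpack_def tensor_simps ell2_simps fun_eq_iff
        split: option.splits)
qed

text \<open>\<open>pack\<close> preserves norms and \<open>app_pack\<close> identifies the block
  operator with \<open>app\<close>, so isometry is inherited from
  \<open>app_isometry\<close>.\<close>

theorem colligation: "colligation ell2 I J A B C D"
proof (intro colligation.intro colligation_axioms.intro ell2_hilbert)
  interpret E: hilbert_space "ell2 :: (nat \<Rightarrow> complex) hspace" by (rule ell2_hilbert)
  interpret EI: hilbert_space "tensor (ell2 :: (nat \<Rightarrow> complex) hspace) I" by (rule E.tensor_hilbert)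
  interpret EJ: hilbert_space "tensor (ell2 :: (nat \<Rightarrow> complex) hspace) J" by (rule E.tensor_hilbert)
  have add: "app (pack I (0, u \<oplus>\<^bsub>tensor ell2 I\<^esub> v)) = (\<lambda>s. app (pack I (0, u)) s + app (pack I (0, v)) s)"
    if "u \<in> carrier (tensor ell2 I)" "v \<in> carrier (tensor ell2 I)" for u v
    using app_add[OF pack_l2[OF that(1)] pack_l2[OF that(2)], of 0 0] pack_add[of I 0 0, symmetric] by auto
  have scale: "app (pack I (0, c \<odot>\<^bsub>tensor ell2 I\<^esub> u)) = (\<lambda>s. c * app (pack I (0, u)) s)"
    if "u \<in> carrier (tensor ell2 I)" for c u
    using app_scale[OF pack_l2[OF that], of c 0] pack_scale[of I c 0, symmetric] by auto
  show B: "B \<in> module_hom scalar_field (tensor ell2 I) scalars"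
    by (simp add: module_hom_def B_def scalars_simps add scale)
  show C: "C \<in> module_hom scalar_field scalars (tensor ell2 J)"
    using unpack_closed[OF l2_scale[OF W_l2]]
    by (auto simp: module_hom_def C_def scalars_simps unpack_def tensor_simps(3,4) ell2_simps distrib_right mult.assoc)
  show D: "D \<in> module_hom scalar_field (tensor ell2 I) (tensor ell2 J)"
    unfolding module_hom_def
  proof (intro CollectI conjI allI impI)
    show "D \<in> carrier (tensor ell2 I) \<rightarrow> carrier (tensor ell2 J)"
      using unpack_closed[OF app_contractive(1)[OF pack_l2]] by (auto simp: D_def)
  qed (simp_all add: D_def add scale, auto simp: unpack_def tensor_simps(3,4) ell2_simps)
  note hom = block_op_hom[OF EI.hilbert_space_axioms EJ.hilbert_space_axioms B C D, of A]
  have "hnorm (hsum scalars (tensor ell2 J)) (block_op A B C D (tensor ell2 J) (z, u)) = hnorm (hsum scalars (tensor ell2 I)) (z, u)"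
    if u: "u \<in> carrier (tensor ell2 I)" for z u
  proof -
    have sq: "hnorm (hsum scalars (tensor ell2 k)) (y, v) = hnorm ell2 (pack k (y, v))"
      if v: "v \<in> carrier (tensor ell2 k)" for y v and k
    proof -
      interpret Ek: hilbert_space "tensor (ell2 :: (nat \<Rightarrow> complex) hspace) k" by (rule E.tensor_hilbert)
      have "(hnorm (hsum scalars (tensor ell2 k)) (y, v))\<^sup>2 = (hnorm ell2 (pack k (y, v)))\<^sup>2"
        unfolding Ek.hnorm_hsum[OF v] ell2_hnorm_sq[OF pack_l2[OF v]] by (rule infsumI[OF pack_has_sum[OF v], symmetric])
      moreover have "0 \<le> hnorm (hsum scalars (tensor ell2 k)) (y, v)"
        using Ek.inner_nonneg[OF v]
        by (simp add: hnorm_def hsum_simps scalars_simps complex_norm_square[symmetric] del: of_real_power)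
      ultimately show ?thesis using ell2_hnorm_nonneg[OF pack_l2[OF v], of y] by (simp add: power2_eq_iff_nonneg)
    qed
    obtain y v where yv: "block_op A B C D (tensor ell2 J) (z, u) = (y, v)" by (cases "block_op A B C D (tensor ell2 J) (z, u)")
    have v: "v \<in> carrier (tensor ell2 J)"
      using funcset_mem[OF module_hom_closed[OF hom], of "(z, u)"] u unfolding yv by (simp add: hsum_simps scalars_simps)
    have "hnorm ell2 (app (pack I (z, u))) = hnorm ell2 (pack I (z, u))" by (rule app_isometry[OF pack_l2[OF u]])
    thus ?thesis unfolding app_pack[OF u] yv sq[OF u] sq[OF v] .
  qed
  thus "isometry (hsum scalars (tensor ell2 I)) (hsum scalars (tensor ell2 J)) (block_op A B C D (tensor ell2 J))"
    using hom by (auto simp: isometry_def hsum_simps)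
qed

end

section \<open>Continuity of a realization in the evaluated polynomials\<close>

context colligation
begin

text \<open>A Hilbert-Schmidt bound: by Cauchy-Schwarz each of the \<open>I * n\<close> rows
  contributes at most \<open>e\<^sup>2 * real (J * n)\<close> times the squared norm of
  \<open>\<alpha>\<close>, hence the root of the number of entries.\<close>

lemma small_entries_contraction:
  fixes E :: "complex mat"
  assumes "\<And>r s. r < I * n \<Longrightarrow> s < J * n \<Longrightarrow> cmod (E $$ (r, s)) \<le> e" and e: "0 \<le> e"
  shows "(\<Sum>i<I. \<Sum>a<n. (cmod (\<Sum>j<J. \<Sum>b<n. E $$ (i * n + a, j * n + b) * \<alpha> j b))\<^sup>2)
    \<le> (e * sqrt (real (I * n * (J * n))))\<^sup>2 * (\<Sum>j<J. \<Sum>b<n. (cmod (\<alpha> j b))\<^sup>2)"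
proof -
  define s where "s = (\<Sum>j<J. \<Sum>b<n. (cmod (\<alpha> j b))\<^sup>2)"
  have "(cmod (\<Sum>j<J. \<Sum>b<n. E $$ (i * n + a, j * n + b) * \<alpha> j b))\<^sup>2 \<le> e\<^sup>2 * (s * real (J * n))"
    if i: "i < I" and a: "a < n" for i a
  proof -
    have "cmod (\<Sum>j<J. \<Sum>b<n. E $$ (i * n + a, j * n + b) * \<alpha> j b) \<le> (\<Sum>j<J. \<Sum>b<n. e * cmod (\<alpha> j b))"
    proof (intro order.trans[OF norm_sum] sum_mono)
      fix j b assume jb: "j \<in> {..<J}" "b \<in> {..<n}"
      hence "cmod (E $$ (i * n + a, j * n + b)) \<le> e"
        using assms(1)[OF block_index_less[OF i a] block_index_less[of j J b n]] by simp
      thus "cmod (E $$ (i * n + a, j * n + b) * \<alpha> j b) \<le> e * cmod (\<alpha> j b)"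
        unfolding norm_mult by (rule mult_right_mono) simp
    qed
    also have "\<dots> = e * (\<Sum>(j, b)\<in>{..<J} \<times> {..<n}. cmod (\<alpha> j b))"
      by (simp add: sum_distrib_left sum.cartesian_product case_prod_unfold)
    finally have "(cmod (\<Sum>j<J. \<Sum>b<n. E $$ (i * n + a, j * n + b) * \<alpha> j b))\<^sup>2
        \<le> (e * (\<Sum>(j, b)\<in>{..<J} \<times> {..<n}. cmod (\<alpha> j b)))\<^sup>2"
      by (rule power_mono) simp
    also have "\<dots> \<le> e\<^sup>2 * (s * real (J * n))"
      unfolding power_mult_distrib
    proof (rule mult_left_mono)
      have "(\<Sum>(j, b)\<in>{..<J} \<times> {..<n}. cmod (\<alpha> j b))
          \<le> L2_set (\<lambda>(j, b). cmod (\<alpha> j b)) ({..<J} \<times> {..<n}) * L2_set (\<lambda>_. 1) ({..<J} \<times> {..<n})"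
        using L2_set_mult_ineq[of "\<lambda>(j, b). cmod (\<alpha> j b)" "\<lambda>_. 1" "{..<J} \<times> {..<n}"]
        by (simp add: case_prod_unfold)
      also have "\<dots> = sqrt (s * real (J * n))"
        by (simp add: L2_set_def s_def sum.cartesian_product case_prod_unfold real_sqrt_mult)
      finally have "(\<Sum>(j, b)\<in>{..<J} \<times> {..<n}. cmod (\<alpha> j b))\<^sup>2 \<le> (sqrt (s * real (J * n)))\<^sup>2"
        by (rule power_mono) (auto intro!: sum_nonneg)
      moreover have "0 \<le> s" by (auto simp: s_def intro!: sum_nonneg)
      ultimately show "(\<Sum>(j, b)\<in>{..<J} \<times> {..<n}. cmod (\<alpha> j b))\<^sup>2 \<le> s * real (J * n)" by simp
    qed simp
    finally show ?thesis .
  qed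
  hence "(\<Sum>i<I. \<Sum>a<n. (cmod (\<Sum>j<J. \<Sum>b<n. E $$ (i * n + a, j * n + b) * \<alpha> j b))\<^sup>2)
      \<le> (\<Sum>i<I. \<Sum>a<n. e\<^sup>2 * (s * real (J * n)))"
    by (intro sum_mono) auto
  also have "\<dots> = (e * sqrt (real (I * n * (J * n))))\<^sup>2 * s"
    by (simp add: power_mult_distrib)
  finally show ?thesis by (simp add: s_def)
qed

lemma id_tensor_matrix_diff:
  assumes G: "G \<in> carrier_mat (I * n) (J * n)" "G' \<in> carrier_mat (I * n) (J * n)"
    and h: "h \<in> carrier (state_space n)"
  shows "id_tensor M I J n (G - G') h = id_tensor M I J n G h \<ominus>\<^bsub>tensor (tensor M I) n\<^esub> id_tensor M I J n G' h"
proof (rule ext)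
  interpret TI: hilbert_space "tensor (tensor M I) n" by (rule MI.tensor_hilbert)
  note c = id_tensor_closed[OF h]
  fix a
  show "id_tensor M I J n (G - G') h a = (id_tensor M I J n G h \<ominus>\<^bsub>tensor (tensor M I) n\<^esub> id_tensor M I J n G' h) a"
  proof (cases "a < n")
    case False
    thus ?thesis by (simp add: MI.tensor_minus[OF c c]) (simp add: id_tensor_def)
  next
    case a: True
    note r = state_row_closed[OF c a]
    have "id_tensor M I J n (G - G') h a i = (id_tensor M I J n G h a \<ominus>\<^bsub>tensor M I\<^esub> id_tensor M I J n G' h a) i" for i
    proof (cases "i < I")
      case False
      thus ?thesis using a by (simp add: tensor_minus[OF r r]) (simp add: id_tensor_def)
    next
      case i: True
      note ci = component_closed[OF c a i]
      have "id_tensor M I J n (G - G') h a i = id_tensor M I J n G h a i \<ominus> id_tensor M I J n G' h a i"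
      proof (rule eq_if_inner_eq[OF ci])
        show "id_tensor M I J n G h a i \<ominus> id_tensor M I J n G' h a i \<in> carrier M"
          using ci by simp
        fix w assume w: "w \<in> carrier M"
        have "(G - G') $$ (i * n + a, j * n + b) = G $$ (i * n + a, j * n + b) - G' $$ (i * n + a, j * n + b)"
          if "j < J" "b < n" for j b
          using G block_index_less[OF i a] block_index_less[OF that] by simp
        hence "hinner M (id_tensor M I J n (G - G') h a i) w
            = hinner M (id_tensor M I J n G h a i) w - hinner M (id_tensor M I J n G' h a i) w"
          by (simp add: inner_id_tensor[OF h a i w] left_diff_distrib sum_subtractf)
        also have "\<dots> = hinner M (id_tensor M I J n G h a i \<ominus> id_tensor M I J n G' h a i) w"
          using inner_add[OF ci[of G] smult_closed'[OF ci[of G'], of "- 1"] w] inner_smult[OF ci[of G'] w, of "- 1"]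
          by (simp add: minus_eq_smult[OF ci ci])
        finally show "hinner M (id_tensor M I J n (G - G') h a i) w
            = hinner M (id_tensor M I J n G h a i \<ominus> id_tensor M I J n G' h a i) w" .
      qed
      thus ?thesis using i by (simp add: tensor_minus[OF r r])
    qed
    thus ?thesis using a by (simp add: MI.tensor_minus[OF c c] fun_eq_iff)
  qed
qed

text \<open>For the difference \<open>u\<close> of the two inputs to \<open>B\<close> and
  \<open>D\<close> the terms with \<open>C\<close> cancel, so the difference of the states is
  \<open>D\<close> applied to the rows of \<open>u\<close>, and the isometry bounds both its norm
  \<open>X\<close> and the difference of the outputs by the norm of \<open>u\<close>. Conversely
  \<open>u\<close> is at most \<open>(r + \<epsilon>) * X\<close> plus \<open>\<epsilon>\<close>
  times the norm of \<open>h\<close>; as \<open>r + \<epsilon> \<le> (1 + r) / 2 < 1\<close>, the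
  first term can be absorbed. The bound refers to \<open>h\<close> and not to \<open>h'\<close>, so
  it stays fixed while \<open>G'\<close> varies.\<close>

lemma state_perturbation:
  assumes G: "G \<in> carrier_mat (I * n) (J * n)" and G': "G' \<in> carrier_mat (I * n) (J * n)"
    and contr: "\<And>\<alpha>. (\<Sum>i<I. \<Sum>a<n. (cmod (\<Sum>j<J. \<Sum>b<n. G $$ (i * n + a, j * n + b) * \<alpha> j b))\<^sup>2)
        \<le> r\<^sup>2 * (\<Sum>j<J. \<Sum>b<n. (cmod (\<alpha> j b))\<^sup>2)"
    and r: "0 \<le> r" "r < 1"
    and close: "\<And>k s. k < I * n \<Longrightarrow> s < J * n \<Longrightarrow> cmod (G $$ (k, s) - G' $$ (k, s)) \<le> e" and e: "0 \<le> e"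
    and small: "e * sqrt (real (I * n * (J * n))) \<le> (1 - r) / 2"
    and h: "is_state n G w h" and h': "is_state n G' w h'" and a: "a < n"
  shows "cmod (B (id_tensor M I J n G h a) - B (id_tensor M I J n G' h' a))
    \<le> 2 * (e * sqrt (real (I * n * (J * n)))) * hnorm (state_space n) h / (1 - r)"
proof -
  interpret S: hilbert_space scalars by (rule scalars_hilbert)
  interpret T: hilbert_space "state_space n" by (rule MJ.tensor_hilbert)
  interpret TI: hilbert_space "tensor (tensor M I) n" by (rule MI.tensor_hilbert)
  let ?\<Delta> = "id_tensor M I J n"
  define \<epsilon> where "\<epsilon> = e * sqrt (real (I * n * (J * n)))"
  have \<epsilon>: "0 \<le> \<epsilon>" "\<epsilon> \<le> (1 - r) / 2" using e small by (simp_all add: \<epsilon>_def)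
  have hc: "h \<in> carrier (state_space n)" and h'c: "h' \<in> carrier (state_space n)"
    using h h' by (simp_all add: is_state_def)
  note c = id_tensor_closed[OF hc, of G] id_tensor_closed[OF h'c, of G'] id_tensor_closed[OF h'c, of G]
  define u where "u = ?\<Delta> G h \<ominus>\<^bsub>tensor (tensor M I) n\<^esub> ?\<Delta> G' h'"
  have uc: "u \<in> carrier (tensor (tensor M I) n)" using c by (simp add: u_def)
  note ur = state_row_closed[OF uc]
  define X where "X = hnorm (state_space n) (h \<ominus>\<^bsub>state_space n\<^esub> h')"
  have hh: "h \<ominus>\<^bsub>state_space n\<^esub> h' \<in> carrier (state_space n)" using hc h'c by simp
  have Bu: "B (u b) = B (?\<Delta> G h b) - B (?\<Delta> G' h' b)"
    and Du: "(h \<ominus>\<^bsub>state_space n\<^esub> h') b = D (u b)" if b: "b < n" for b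
  proof -
    note cb = state_row_closed[OF c(1) b] state_row_closed[OF c(2) b]
    have ub: "u b = ?\<Delta> G h b \<ominus>\<^bsub>tensor M I\<^esub> ?\<Delta> G' h' b"
      using b by (simp add: u_def MI.tensor_minus[OF c(1,2)])
    show "B (u b) = B (?\<Delta> G h b) - B (?\<Delta> G' h' b)"
      using MI.module_hom_diff[OF B scalars_hilbert cb] by (simp add: ub S.minus_eq_smult scalars_simps)
    note d = D_closed[OF cb(1)] D_closed[OF cb(2)]
    have "h b = C (w b) \<oplus>\<^bsub>tensor M J\<^esub> D (?\<Delta> G h b)" "h' b = C (w b) \<oplus>\<^bsub>tensor M J\<^esub> D (?\<Delta> G' h' b)"
      using h h' b unfolding is_state_def by blast+
    hence "(h \<ominus>\<^bsub>state_space n\<^esub> h') b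
        = (C (w b) \<oplus>\<^bsub>tensor M J\<^esub> D (?\<Delta> G h b)) \<ominus>\<^bsub>tensor M J\<^esub> (C (w b) \<oplus>\<^bsub>tensor M J\<^esub> D (?\<Delta> G' h' b))"
      using b by (simp add: MJ.tensor_minus[OF hc h'c])
    also have "\<dots> = D (?\<Delta> G h b) \<ominus>\<^bsub>tensor M J\<^esub> D (?\<Delta> G' h' b)"
      by (rule MJ.add_minus_add[OF C_closed d])
    also have "\<dots> = D (u b)" by (simp add: ub MI.module_hom_diff[OF D MJ.hilbert_space_axioms cb])
    finally show "(h \<ominus>\<^bsub>state_space n\<^esub> h') b = D (u b)" .
  qed
  have iso0: "(cmod (B v))\<^sup>2 + (hnorm (tensor M J) (D v))\<^sup>2 = (hnorm (tensor M I) v)\<^sup>2" if "v \<in> carrier (tensor M I)" for v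
    using isometry_sq[OF that, of 0] S.module_hom_zero[OF C MJ.hilbert_space_axioms] D_closed[OF that]
    by (simp add: scalars_simps)
  have "(\<Sum>b<n. (cmod (B (u b)))\<^sup>2) + X\<^sup>2 = (hnorm (tensor (tensor M I) n) u)\<^sup>2"
    unfolding X_def MJ.tensor_hnorm_sq(2)[OF hh] MI.tensor_hnorm_sq(2)[OF uc]
    by (simp add: Du iso0[OF ur, symmetric] sum.distrib)
  moreover have "(cmod (B (u a)))\<^sup>2 \<le> (\<Sum>b<n. (cmod (B (u b)))\<^sup>2)"
    using a by (intro member_le_sum) auto
  moreover have "0 \<le> (\<Sum>b<n. (cmod (B (u b)))\<^sup>2)" by (intro sum_nonneg) simp
  ultimately have "(cmod (B (u a)))\<^sup>2 \<le> (hnorm (tensor (tensor M I) n) u)\<^sup>2 \<and> X\<^sup>2 \<le> (hnorm (tensor (tensor M I) n) u)\<^sup>2"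
    using zero_le_power2[of X] by (intro conjI) linarith+
  hence 1: "cmod (B (u a)) \<le> hnorm (tensor (tensor M I) n) u" and 2: "X \<le> hnorm (tensor (tensor M I) n) u"
    using power2_le_imp_le[OF _ TI.hnorm_nonneg[OF uc]] by blast+
  have "hnorm (tensor (tensor M I) n) u
      \<le> hnorm (tensor (tensor M I) n) (?\<Delta> G h \<ominus>\<^bsub>tensor (tensor M I) n\<^esub> ?\<Delta> G h')
       + hnorm (tensor (tensor M I) n) (?\<Delta> G h' \<ominus>\<^bsub>tensor (tensor M I) n\<^esub> ?\<Delta> G' h')"
    unfolding u_def by (rule TI.hnorm_triangle[OF c(1,3,2)])
  also have "?\<Delta> G h \<ominus>\<^bsub>tensor (tensor M I) n\<^esub> ?\<Delta> G h' = ?\<Delta> G (h \<ominus>\<^bsub>state_space n\<^esub> h')"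
    by (rule T.module_hom_diff[OF id_tensor_hom TI.hilbert_space_axioms hc h'c, symmetric])
  also have "?\<Delta> G h' \<ominus>\<^bsub>tensor (tensor M I) n\<^esub> ?\<Delta> G' h' = ?\<Delta> (G - G') h'"
    by (rule id_tensor_matrix_diff[OF G G' h'c, symmetric])
  also have "hnorm (tensor (tensor M I) n) (?\<Delta> G (h \<ominus>\<^bsub>state_space n\<^esub> h')) \<le> r * X"
    unfolding X_def by (rule id_tensor_contraction[OF hh contr r(1)])
  also have "hnorm (tensor (tensor M I) n) (?\<Delta> (G - G') h') \<le> \<epsilon> * hnorm (state_space n) h'"
    unfolding \<epsilon>_def
    by (rule id_tensor_contraction[OF h'c small_entries_contraction]) (use close e G G' in auto)
  finally have 3: "hnorm (tensor (tensor M I) n) u \<le> r * X + \<epsilon> * hnorm (state_space n) h'" by simp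
  have z: "g \<ominus>\<^bsub>state_space n\<^esub> \<zero>\<^bsub>state_space n\<^esub> = g" if "g \<in> carrier (state_space n)" for g
    using T.minus_eq_smult[OF that T.zero_closed] that by (simp add: T.smult_r_null)
  have "hnorm (state_space n) h' \<le> hnorm (state_space n) h + X"
    using T.hnorm_triangle[OF h'c hc T.zero_closed] T.hnorm_minus_commute[OF hc h'c] hc h'c
    by (simp add: X_def z)
  hence "\<epsilon> * hnorm (state_space n) h' \<le> \<epsilon> * (hnorm (state_space n) h + X)" by (rule mult_left_mono[OF _ \<epsilon>(1)])
  hence 4: "hnorm (tensor (tensor M I) n) u \<le> (r + \<epsilon>) * X + \<epsilon> * hnorm (state_space n) h"
    using 3 by (simp add: algebra_simps)
  have "(r + \<epsilon>) * X \<le> (1 + r) / 2 * hnorm (tensor (tensor M I) n) u"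
    using 2 \<epsilon> r T.hnorm_nonneg[OF hh, folded X_def] by (intro mult_mono) auto
  hence "(1 - r) / 2 * hnorm (tensor (tensor M I) n) u \<le> \<epsilon> * hnorm (state_space n) h"
    using 4 by (simp add: field_simps)
  hence "hnorm (tensor (tensor M I) n) u \<le> 2 * \<epsilon> * hnorm (state_space n) h / (1 - r)"
    using r by (simp add: field_simps)
  thus ?thesis using 1 unfolding Bu[OF a] \<epsilon>_def by linarith
qed

definition realized_at :: "nc_poly mat \<Rightarrow> (complex mat list \<Rightarrow> complex mat) \<Rightarrow> complex mat list \<Rightarrow> bool" where
  "realized_at \<delta> \<phi> x \<longleftrightarrow> (let n = lvl x in \<forall>v\<in>carrier_vec n. \<forall>h.
     is_state n (delta_eval n x \<delta>) (\<lambda>a. v $ a) h \<longrightarrow>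
       \<phi> x *\<^sub>v v = vec n (\<lambda>a. A * v $ a + B (id_tensor M I J n (delta_eval n x \<delta>) h a)))"

text \<open>With a sample within \<open>e\<close>, the formula at \<open>x\<close> fails by at most
  \<open>e * K\<close>, where \<open>K\<close> involves the state at \<open>x\<close> but not the
  one at the sample; so the error tends to 0 with \<open>e\<close>.\<close>

theorem realization_from_dense:
  assumes d: "1 \<le> d" and \<delta>: "\<delta> \<in> carrier_mat I J"
    and \<phi>: "\<And>x. x \<in> nc_polyhedron d \<delta> \<Longrightarrow> \<phi> x \<in> carrier_mat (lvl x) (lvl x)"
    and dense: "\<And>x e. x \<in> nc_polyhedron d \<delta> \<Longrightarrow> 0 < e \<Longrightarrow> \<exists>y\<in>nc_polyhedron d \<delta>. lvl y = lvl x \<and> realized_at \<delta> \<phi> y \<and>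
      (\<forall>k<I * lvl x. \<forall>s<J * lvl x. cmod (delta_eval (lvl x) x \<delta> $$ (k, s) - delta_eval (lvl x) y \<delta> $$ (k, s)) \<le> e) \<and>
      (\<forall>a<lvl x. \<forall>b<lvl x. cmod (\<phi> x $$ (a, b) - \<phi> y $$ (a, b)) \<le> e)"
  shows "free_realization d \<delta> \<phi> M A B C D"
proof -
  have "(\<phi> x *\<^sub>v v) $ a = A * v $ a + B (id_tensor M I J n (delta_eval n x \<delta>) h a)"
    if x: "x \<in> nc_polyhedron d \<delta>" and n: "n = lvl x" and v: "v \<in> carrier_vec n"
      and h: "is_state n (delta_eval n x \<delta>) (\<lambda>a. v $ a) h" and a: "a < n" for x n v h a
  proof -
    let ?G = "delta_eval n x \<delta>"
    define r where "r = op_norm ?G"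
    define c where "c = sqrt (real (I * n * (J * n)))"
    have r: "0 \<le> r" "r < 1" using nc_polyhedron_lvl(3)[OF d x] op_norm_nonneg by (simp_all add: r_def n)
    have c: "0 \<le> c" by (simp add: c_def)
    define K where "K = (\<Sum>b<n. cmod (v $ b)) + 2 * c * hnorm (state_space n) h / (1 - r)"
    define z where "z = A * v $ a + B (id_tensor M I J n ?G h a)"
    have bound: "cmod ((\<phi> x *\<^sub>v v) $ a - z) \<le> e * K" if e: "0 < e" "e * c \<le> (1 - r) / 2" for e
    proof -
      obtain y where y: "y \<in> nc_polyhedron d \<delta>" "lvl y = n" "realized_at \<delta> \<phi> y"
        and cl\<delta>: "\<And>k s. k < I * n \<Longrightarrow> s < J * n \<Longrightarrow> cmod (?G $$ (k, s) - delta_eval n y \<delta> $$ (k, s)) \<le> e"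
        and cl\<phi>: "\<And>b. b < n \<Longrightarrow> cmod (\<phi> x $$ (a, b) - \<phi> y $$ (a, b)) \<le> e"
        using dense[OF x e(1)] a unfolding n by blast
      obtain h' where h': "is_state n (delta_eval n y \<delta>) (\<lambda>a. v $ a) h'"
        using state_exists[OF polyhedron_resolve_bij[OF d \<delta> y(1) nc_polyhedron_lvl(1)[OF d y(1)]]] unfolding y(2) by blast
      have "\<phi> y *\<^sub>v v = vec n (\<lambda>a. A * v $ a + B (id_tensor M I J n (delta_eval n y \<delta>) h' a))"
        using y(3) v h' unfolding realized_at_def Let_def y(2) by blast
      hence fy: "(\<phi> y *\<^sub>v v) $ a = A * v $ a + B (id_tensor M I J n (delta_eval n y \<delta>) h' a)" using a by simp
      have "(\<phi> x *\<^sub>v v) $ a - (\<phi> y *\<^sub>v v) $ a = (\<Sum>b<n. (\<phi> x $$ (a, b) - \<phi> y $$ (a, b)) * v $ b)"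
        using mult_mat_vec_index[OF \<phi>[OF x, folded n] v a] mult_mat_vec_index[OF \<phi>[OF y(1), unfolded y(2)] v a]
        by (simp add: left_diff_distrib sum_subtractf del: index_mult_mat_vec)
      also have "cmod \<dots> \<le> (\<Sum>b<n. e * cmod (v $ b))"
        by (intro order.trans[OF norm_sum] sum_mono) (auto simp: norm_mult intro!: mult_right_mono cl\<phi>)
      finally have 1: "cmod ((\<phi> x *\<^sub>v v) $ a - (\<phi> y *\<^sub>v v) $ a) \<le> e * (\<Sum>b<n. cmod (v $ b))"
        by (simp add: sum_distrib_left)
      have "cmod (B (id_tensor M I J n ?G h a) - B (id_tensor M I J n (delta_eval n y \<delta>) h' a))
          \<le> 2 * (e * c) * hnorm (state_space n) h / (1 - r)"
        unfolding c_def
        by (rule state_perturbation[OF delta_eval_carrier[OF \<delta>] delta_eval_carrier[OF \<delta>] _ r _ _ _ h h' a])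
           (use delta_eval_contraction[OF \<delta>] e cl\<delta> in \<open>auto simp: r_def c_def\<close>)
      hence 2: "cmod ((\<phi> y *\<^sub>v v) $ a - z) \<le> 2 * (e * c) * hnorm (state_space n) h / (1 - r)"
        unfolding fy z_def by (simp add: norm_minus_commute)
      have "cmod ((\<phi> x *\<^sub>v v) $ a - z) \<le> cmod ((\<phi> x *\<^sub>v v) $ a - (\<phi> y *\<^sub>v v) $ a) + cmod ((\<phi> y *\<^sub>v v) $ a - z)"
        using norm_triangle_ineq[of "(\<phi> x *\<^sub>v v) $ a - (\<phi> y *\<^sub>v v) $ a" "(\<phi> y *\<^sub>v v) $ a - z"]
        by (simp del: index_mult_mat_vec)
      also have "\<dots> \<le> e * K" using 1 2 by (simp add: K_def distrib_left mult_ac del: index_mult_mat_vec)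
      finally show ?thesis .
    qed
    \<comment> \<open>Tends to 0 within the smallness condition of
      \<open>state_perturbation\<close>; \<open>c + 1\<close> keeps the denominator
      positive.\<close>
    define \<epsilon> where "\<epsilon> m = (1 - r) / (2 * (c + 1) * real (Suc m))" for m
    have "\<epsilon> m * c \<le> (1 - r) / 2" "0 < \<epsilon> m" for m
    proof -
      define p where "p = (c + 1) * real (Suc m)"
      have "c \<le> p" using c mult_mono[of "c" "c + 1" 1 "real (Suc m)"] by (simp add: p_def)
      moreover have "0 < p" using c by (simp add: p_def)
      ultimately have "(1 - r) / 2 * (c / p) \<le> (1 - r) / 2 * 1"
        using r by (intro mult_left_mono) auto
      moreover have "\<epsilon> m * c = (1 - r) / 2 * (c / p)"
        by (simp add: \<epsilon>_def p_def mult.assoc del: of_nat_Suc)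
      ultimately show "\<epsilon> m * c \<le> (1 - r) / 2" by simp
      show "0 < \<epsilon> m" using r c by (simp add: \<epsilon>_def)
    qed
    hence "cmod ((\<phi> x *\<^sub>v v) $ a - z) \<le> \<epsilon> m * K" for m by (intro bound)
    moreover have "(\<lambda>m. \<epsilon> m * K) \<longlonglongrightarrow> 0"
    proof -
      have "(\<lambda>m. (1 - r) / (2 * (c + 1)) * inverse (real (Suc m)) * K) \<longlonglongrightarrow> (1 - r) / (2 * (c + 1)) * 0 * K"
        by (intro tendsto_intros LIMSEQ_inverse_real_of_nat)
      thus ?thesis by (simp add: \<epsilon>_def divide_inverse mult_ac)
    qed
    ultimately have "cmod ((\<phi> x *\<^sub>v v) $ a - z) \<le> 0" by (intro LIMSEQ_le_const) auto
    thus ?thesis by (simp add: z_def del: index_mult_mat_vec)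
  qed
  note value_eq = this
  show ?thesis
    unfolding free_realization_iff[OF d \<delta>]
  proof (intro allI impI ballI conjI)
    fix n x assume x: "x \<in> nc_polyhedron d \<delta> \<inter> nc_level d n"
    hence n: "n = lvl x" using nc_level_lvl[OF d] by blast
    show \<phi>x: "\<phi> x \<in> carrier_mat n n" using \<phi> x n by blast
    fix v h assume v: "v \<in> carrier_vec n" and h: "is_state n (delta_eval n x \<delta>) (\<lambda>a. v $ a) h"
    show "\<phi> x *\<^sub>v v = vec n (\<lambda>a. A * v $ a + B (id_tensor M I J n (delta_eval n x \<delta>) h a))"
      using value_eq[OF _ n v h] x \<phi>x by (intro eq_vecI) (simp_all del: index_mult_mat_vec)
  qed
qed

end

section \<open>Sampling the model on a dense sequence of points\<close>

text \<open>Rounding the listed coordinates to multiples of \<open>1 / m\<close> leaves countably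
  many codes, and one representative for every \<open>m\<close> and every code that occurs is
  enough. Closeness is measured by \<open>g\<close>, later the entries of \<open>\<delta>(x)\<close>
  and \<open>\<phi>(x)\<close>, and not by the points themselves.\<close>

lemma exists_dense_sequence:
  fixes B :: "'p set" and n :: "'p \<Rightarrow> nat" and es :: "nat \<Rightarrow> 'i list" and g :: "'p \<Rightarrow> 'i \<Rightarrow> complex"
  shows "\<exists>X :: nat \<Rightarrow> 'p. \<forall>x\<in>B. \<forall>e>0. \<exists>k. X k \<in> B \<and> n (X k) = n x \<and> (\<forall>i\<in>set (es (n x)). cmod (g x i - g (X k) i) \<le> e)"
proof -
  define code where "code m x = (n x, map (\<lambda>i. (\<lfloor>real m * Re (g x i)\<rfloor>, \<lfloor>real m * Im (g x i)\<rfloor>)) (es (n x)))" for m x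
  \<comment> \<open>For a code that no point of \<open>B\<close> has, the choice is arbitrary and
    \<open>X k\<close> may lie outside \<open>B\<close>.\<close>
  define X where "X k = (case from_nat k of (m, c) \<Rightarrow> SOME x. x \<in> B \<and> code m x = c)" for k
  have "\<exists>k. X k \<in> B \<and> n (X k) = n x \<and> (\<forall>i\<in>set (es (n x)). cmod (g x i - g (X k) i) \<le> e)"
    if x: "x \<in> B" and e: "0 < e" for x e
  proof -
    define m where "m = Suc (nat \<lceil>2 / e\<rceil>)"
    have m0: "0 < real m" by (simp add: m_def)
    have "2 / e \<le> real m" unfolding m_def by linarith
    hence m: "2 / real m \<le> e" using e m0 by (simp add: pos_divide_le_eq mult.commute)
    define k where "k = to_nat (m, code m x)"
    have "X k = (SOME y. y \<in> B \<and> code m y = code m x)" by (simp add: X_def k_def)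
    hence k: "X k \<in> B" "code m (X k) = code m x" using someI_ex[of "\<lambda>y. y \<in> B \<and> code m y = code m x"] x by auto
    hence n: "n (X k) = n x" by (simp add: code_def)
    have fl: "\<bar>s - t\<bar> \<le> 1 / real m" if "\<lfloor>real m * s\<rfloor> = \<lfloor>real m * t\<rfloor>" for s t :: real
    proof -
      have "\<bar>real m * s - real m * t\<bar> \<le> 1" using that by linarith
      hence "real m * \<bar>s - t\<bar> \<le> 1" using m0 by (simp add: abs_mult right_diff_distrib[symmetric])
      thus ?thesis using m0 by (simp add: field_simps)
    qed
    have "cmod (g x i - g (X k) i) \<le> e" if "i \<in> set (es (n x))" for i
    proof -
      have "\<lfloor>real m * Re (g x i)\<rfloor> = \<lfloor>real m * Re (g (X k) i)\<rfloor>" "\<lfloor>real m * Im (g x i)\<rfloor> = \<lfloor>real m * Im (g (X k) i)\<rfloor>"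
        using k(2) that unfolding code_def n by auto
      from this[THEN fl] have "cmod (g x i - g (X k) i) \<le> 1 / real m + 1 / real m"
        using cmod_le[of "g x i - g (X k) i"] by simp
      thus ?thesis using m by simp
    qed
    thus ?thesis using k(1) n by blast
  qed
  thus ?thesis by blast
qed

lemma (in orthonormal_columns) app_sum:
  assumes "finite S" "\<And>a. a \<in> S \<Longrightarrow> l2 (f a)"
  shows "app (\<lambda>t. \<Sum>a\<in>S. c a * f a t) s = (\<Sum>a\<in>S. c a * app (f a) s)"
  using assms
proof (induction S rule: finite_induct)
  case empty
  show ?case by (simp add: app_def)
next
  case (insert a S)
  have "l2 (\<lambda>t. \<Sum>a\<in>S. c a * f a t)" using insert by (intro l2_sum l2_scale) auto
  thus ?case using insert app_add[of "\<lambda>t. c a * f a t" "\<lambda>t. \<Sum>a\<in>S. c a * f a t"]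
    by (simp add: l2_scale app_scale)
qed

lemma gram_expand:
  fixes A A' :: "'j \<Rightarrow> 'c \<Rightarrow> complex"
  shows "(\<Sum>l\<in>L. (\<Sum>j\<in>S. \<Sum>c\<in>T. A j c * u j c l) * cnj (\<Sum>j\<in>S'. \<Sum>c\<in>T'. A' j c * u' j c l))
    = (\<Sum>j\<in>S. \<Sum>c\<in>T. \<Sum>j'\<in>S'. \<Sum>c'\<in>T'. A j c * cnj (A' j' c') * (\<Sum>l\<in>L. u j c l * cnj (u' j' c' l)))"
proof -
  let ?f = "\<lambda>l j c j' c'. A j c * cnj (A' j' c') * (u j c l * cnj (u' j' c' l))"
  have "(\<Sum>l\<in>L. (\<Sum>j\<in>S. \<Sum>c\<in>T. A j c * u j c l) * cnj (\<Sum>j\<in>S'. \<Sum>c\<in>T'. A' j c * u' j c l))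
      = (\<Sum>l\<in>L. \<Sum>j\<in>S. \<Sum>c\<in>T. \<Sum>j'\<in>S'. \<Sum>c'\<in>T'. ?f l j c j' c')"
    by (simp only: cnj_sum sum_distrib_right) (simp only: sum_distrib_left complex_cnj_mult mult_ac)
  also have "\<dots> = (\<Sum>j\<in>S. \<Sum>l\<in>L. \<Sum>c\<in>T. \<Sum>j'\<in>S'. \<Sum>c'\<in>T'. ?f l j c j' c')" by (rule sum.swap)
  also have "\<dots> = (\<Sum>j\<in>S. \<Sum>c\<in>T. \<Sum>l\<in>L. \<Sum>j'\<in>S'. \<Sum>c'\<in>T'. ?f l j c j' c')"
    by (rule sum.cong[OF refl], rule sum.swap)
  also have "\<dots> = (\<Sum>j\<in>S. \<Sum>c\<in>T. \<Sum>j'\<in>S'. \<Sum>l\<in>L. \<Sum>c'\<in>T'. ?f l j c j' c')"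
    by (rule sum.cong[OF refl], rule sum.cong[OF refl], rule sum.swap)
  also have "\<dots> = (\<Sum>j\<in>S. \<Sum>c\<in>T. \<Sum>j'\<in>S'. \<Sum>c'\<in>T'. \<Sum>l\<in>L. ?f l j c j' c')"
    by (rule sum.cong[OF refl], rule sum.cong[OF refl], rule sum.cong[OF refl], rule sum.swap)
  finally show ?thesis by (simp add: sum_distrib_left)
qed

lemma sum_even:
  fixes f :: "nat \<Rightarrow> 'a::comm_monoid_add"
  shows "(\<Sum>l<2 * L. if even l then f (l div 2) else 0) = (\<Sum>l<L. f l)"
  by (induction L) (simp_all add: algebra_simps)

text \<open>Points are replaced by their numbers in the sequence, so that the kernel pulled back
  along \<open>sample\<close> has a countable index type and \<open>psd_countable_decomp\<close>
  applies.\<close>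

definition sample :: "(nat \<Rightarrow> complex mat list) \<Rightarrow> (nat \<times> nat) \<times> nat \<Rightarrow> nc_index" where
  "sample X k = ((X (fst (fst k)), snd (fst k)), snd k)"

locale sampled_model =
  fixes d I J :: nat and \<delta> :: "nc_poly mat" and \<phi> :: "complex mat list \<Rightarrow> complex mat"
    and K :: "nc_index \<times> nat \<Rightarrow> nc_index \<times> nat \<Rightarrow> complex"
    and X :: "nat \<Rightarrow> complex mat list" and U :: "((nat \<times> nat) \<times> nat) \<times> nat \<Rightarrow> nat \<Rightarrow> complex"
  assumes d: "1 \<le> d" and J: "1 \<le> J" and \<delta>: "\<delta> \<in> carrier_mat I J"
    and \<phi>: "\<And>x. x \<in> nc_polyhedron d \<delta> \<Longrightarrow> \<phi> x \<in> carrier_mat (lvl x) (lvl x)"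
    and model: "\<And>\<omega> \<omega>'. \<omega> \<in> indices (nc_polyhedron d \<delta>) \<Longrightarrow> \<omega>' \<in> indices (nc_polyhedron d \<delta>) \<Longrightarrow> model_equation \<delta> \<phi> K \<omega> \<omega>'"
    and U_zero: "\<And>z l. to_nat z < l \<Longrightarrow> U z l = 0"
    and decomp: "\<And>z z' L. to_nat z < L \<Longrightarrow>
      K (sample X (fst z), snd z) (sample X (fst z'), snd z') = (\<Sum>l<L. U z l * cnj (U z' l))"
begin

text \<open>Half of the coordinates of \<open>\<ell>\<^sup>2\<close> are kept free for the completion to an isometry.\<close>

definition V :: "((nat \<times> nat) \<times> nat) \<times> nat \<Rightarrow> nat \<Rightarrow> complex" where
  "V z l = (if even l then U z (l div 2) else 0)"

definition valid :: "(nat \<times> nat) \<times> nat \<Rightarrow> bool" where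
  "valid k \<longleftrightarrow> sample X k \<in> indices (nc_polyhedron d \<delta>)"

definition level :: "(nat \<times> nat) \<times> nat \<Rightarrow> nat" where
  "level k = lvl (X (fst (fst k)))"

text \<open>A sum instead of a maximum, as any common strict upper bound for the codes of the
  indices belonging to \<open>k\<close> will do; it limits the supports of their Gram
  vectors.\<close>

definition bound :: "(nat \<times> nat) \<times> nat \<Rightarrow> nat" where
  "bound k = Suc (\<Sum>c<level k. \<Sum>j<J. to_nat ((fst k, c), j))"

text \<open>Input of the isometry to be built, laid out as in \<open>pack\<close>: the unit
  component and \<open>\<delta>\<close> applied to the Gram vectors. The matching output
  \<open>q\<close> has the value of \<open>\<phi>\<close> and the Gram vectors themselves. Labels of
  indices outside the polyhedron give 0 in both families, so the Gram identity holds for all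
  labels.\<close>

definition p :: "(nat \<times> nat) \<times> nat \<Rightarrow> (nat \<times> nat) option \<Rightarrow> complex" where
  "p k t = (if valid k then (case t of None \<Rightarrow> unit_at (sample X k)
     | Some (l, i) \<Rightarrow> if i < I then \<Sum>j<J. \<Sum>c<level k. dcoef \<delta> i (sample X k) j c * V ((fst k, c), j) l else 0) else 0)"

definition q :: "(nat \<times> nat) \<times> nat \<Rightarrow> (nat \<times> nat) option \<Rightarrow> complex" where
  "q k t = (if valid k then (case t of None \<Rightarrow> value_at \<phi> (sample X k)
     | Some (l, j) \<Rightarrow> if j < J then V (k, j) l else 0) else 0)"

definition support :: "nat \<Rightarrow> (nat \<times> nat) \<times> nat \<Rightarrow> (nat \<times> nat) option set" where
  "support m k = insert None (Some ` ({..<2 * bound k} \<times> {..<m}))"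

lemma to_nat_less_bound: "c < level k \<Longrightarrow> j < J \<Longrightarrow> to_nat ((fst k, c), j) < bound k"
proof -
  assume c: "c < level k" and j: "j < J"
  have "to_nat ((fst k, c), j) \<le> (\<Sum>j<J. to_nat ((fst k, c), j))"
    using j by (intro member_le_sum[of j "{..<J}" "\<lambda>j. to_nat ((fst k, c), j)"]) auto
  also have "\<dots> \<le> (\<Sum>c<level k. \<Sum>j<J. to_nat ((fst k, c), j))"
    using c by (intro member_le_sum[of c "{..<level k}" "\<lambda>c. \<Sum>j<J. to_nat ((fst k, c), j)"]) auto
  finally show ?thesis by (simp add: bound_def)
qed

lemma V_zero: "c < level k \<Longrightarrow> j < J \<Longrightarrow> 2 * bound k \<le> l \<Longrightarrow> V ((fst k, c), j) l = 0"
  using to_nat_less_bound[of c k j] U_zero[of "((fst k, c), j)" "l div 2"] by (simp add: V_def)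

lemma V_gram:
  "c < level k \<Longrightarrow> j < J \<Longrightarrow> (\<Sum>l<2 * bound k. V ((fst k, c), j) l * cnj (V z' l))
    = K (sample X (fst k, c), j) (sample X (fst z'), snd z')"
proof -
  assume "c < level k" "j < J"
  hence t: "to_nat ((fst k, c), j) < bound k" by (rule to_nat_less_bound)
  have "(\<Sum>l<2 * bound k. V ((fst k, c), j) l * cnj (V z' l))
      = (\<Sum>l<2 * bound k. if even l then (\<lambda>l. U ((fst k, c), j) l * cnj (U z' l)) (l div 2) else 0)"
    by (intro sum.cong refl) (simp add: V_def)
  also have "\<dots> = (\<Sum>l<bound k. U ((fst k, c), j) l * cnj (U z' l))" by (rule sum_even)
  finally show ?thesis using decomp[OF t, of z'] by simp
qed

lemma valid_iff: "valid k \<longleftrightarrow> X (fst (fst k)) \<in> nc_polyhedron d \<delta> \<and> snd (fst k) < level k \<and> snd k < level k"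
  by (auto simp: valid_def indices_def sample_def level_def)

lemma support_sum: "(\<Sum>t\<in>support m k. f t) = f None + (\<Sum>i<m. \<Sum>l<2 * bound k. f (Some (l, i)))"
proof -
  have "(\<Sum>t\<in>support m k. f t) = f None + (\<Sum>t\<in>{..<2 * bound k} \<times> {..<m}. f (Some t))"
    unfolding support_def by (subst sum.insert) (auto simp: sum.reindex)
  also have "(\<Sum>t\<in>{..<2 * bound k} \<times> {..<m}. f (Some t)) = (\<Sum>l<2 * bound k. \<Sum>i<m. f (Some (l, i)))"
    by (simp add: sum.cartesian_product case_prod_unfold)
  also have "\<dots> = (\<Sum>i<m. \<Sum>l<2 * bound k. f (Some (l, i)))" by (rule sum.swap)
  finally show ?thesis .
qed

lemma gram_eq: "(\<Sum>t\<in>support I k. p k t * cnj (p k' t)) = (\<Sum>s\<in>support J k. q k s * cnj (q k' s))"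
proof (cases "valid k \<and> valid k'")
  case True
  hence v: "valid k" "valid k'" and k: "snd k < level k" by (auto simp: valid_iff)
  let ?\<omega> = "sample X k" and ?\<omega>' = "sample X k'"
  have lv: "lvl (fst (fst ?\<omega>)) = level k" "lvl (fst (fst ?\<omega>')) = level k'" by (simp_all add: sample_def level_def)
  have s: "sample X (fst k, c) = (fst ?\<omega>, c)" "sample X (fst k', c) = (fst ?\<omega>', c)" for c
    by (simp_all add: sample_def)
  have "(\<Sum>t\<in>support I k. p k t * cnj (p k' t)) = unit_at ?\<omega> * cnj (unit_at ?\<omega>')
      + (\<Sum>i<I. \<Sum>l<2 * bound k. (\<Sum>j<J. \<Sum>c<level k. dcoef \<delta> i ?\<omega> j c * V ((fst k, c), j) l)
          * cnj (\<Sum>j<J. \<Sum>c<level k'. dcoef \<delta> i ?\<omega>' j c * V ((fst k', c), j) l))"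
    unfolding support_sum using v by (simp add: p_def)
  also have "\<dots> = unit_at ?\<omega> * cnj (unit_at ?\<omega>') + (\<Sum>i<I. \<Sum>j<J. \<Sum>c<level k. \<Sum>j'<J. \<Sum>c'<level k'.
         dcoef \<delta> i ?\<omega> j c * cnj (dcoef \<delta> i ?\<omega>' j' c') * K ((fst ?\<omega>, c), j) ((fst ?\<omega>', c'), j'))"
    unfolding gram_expand by (simp add: V_gram s cong: sum.cong_simp)
  also have "\<dots> = value_at \<phi> ?\<omega> * cnj (value_at \<phi> ?\<omega>') + (\<Sum>j<J. K (?\<omega>, j) (?\<omega>', j))"
    using model[of ?\<omega> ?\<omega>'] v \<delta> unfolding valid_def model_equation_def lv by auto
  also have "(\<Sum>j<J. K (?\<omega>, j) (?\<omega>', j)) = (\<Sum>j<J. \<Sum>l<2 * bound k. V (k, j) l * cnj (V (k', j) l))"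
    using V_gram[OF k] by (intro sum.cong refl) simp
  also have "value_at \<phi> ?\<omega> * cnj (value_at \<phi> ?\<omega>') + \<dots> = (\<Sum>s\<in>support J k. q k s * cnj (q k' s))"
    unfolding support_sum using v by (simp add: q_def)
  finally show ?thesis .
qed (auto simp: p_def q_def)

sublocale gram_pair p q "support I" "support J"
proof
  fix k t
  show "finite (support I k)" "finite (support J k)" by (simp_all add: support_def)
  show "p k t = 0" if "t \<notin> support I k"
  proof (cases t)
    case (Some li)
    obtain l i where li: "li = (l, i)" by (cases li)
    hence "i < I \<Longrightarrow> 2 * bound k \<le> l" using that Some by (auto simp: support_def not_less)
    thus ?thesis using Some li by (simp add: p_def V_zero)
  qed (use that in \<open>simp add: support_def\<close>)
  show "q k t = 0" if "t \<notin> support J k"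
  proof (cases t)
    case (Some lj)
    obtain l j where lj: "lj = (l, j)" by (cases lj)
    hence "j < J \<Longrightarrow> 2 * bound k \<le> l" using that Some by (auto simp: support_def not_less)
    thus ?thesis using Some lj V_zero[of "snd k" k j l] by (simp add: q_def valid_iff)
  qed (use that in \<open>simp add: support_def\<close>)
qed (rule gram_eq)

lemma exists_columns:
  obtains W where "colligation_columns W J" "\<And>k s. orthonormal_columns.app W (p k) s = q k s"
proof -
  \<comment> \<open>The odd coordinates of component 0, where every \<open>V\<close> vanishes. As
    \<open>1 \<le> J\<close>, component 0 is among the first \<open>J\<close>, so the completion
    does not leave the output space.\<close>
  define \<sigma> :: "nat \<Rightarrow> (nat \<times> nat) option" where "\<sigma> l = Some (2 * l + 1, 0)" for l
  have "inj \<sigma>" by (auto simp: inj_on_def \<sigma>_def)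
  moreover have "q k (\<sigma> l) = 0" for k l by (simp add: q_def \<sigma>_def V_def)
  ultimately obtain W where W: "orthonormal_columns W" "\<And>k s. (\<Sum>t\<in>support I k. p k t * W t s) = q k s"
    "\<And>t s. s \<notin> range \<sigma> \<Longrightarrow> (\<And>k. q k s = 0) \<Longrightarrow> W t s = 0"
    using orthonormal_extension by blast
  interpret orthonormal_columns W by (rule W(1))
  show ?thesis
  proof (rule that[of W])
    have "W t (Some (l, j)) = 0" if "J \<le> j" for t l j
      by (rule W(3)) (use that J in \<open>auto simp: \<sigma>_def q_def\<close>)
    thus "colligation_columns W J" by unfold_locales
    show "app (p k) s = q k s" for k s
      using app_finite[OF finP supP] W(2) by simp
  qed
qed

lemma realized_at_sample:
  assumes W: "colligation_columns W J" and pq: "\<And>k s. orthonormal_columns.app W (p k) s = q k s"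
    and x: "X \<kappa> \<in> nc_polyhedron d \<delta>"
  shows "colligation.realized_at ell2 I J (colligation_columns.A W) (colligation_columns.B W I)
    (colligation_columns.C W J) (colligation_columns.D W I J) \<delta> \<phi> (X \<kappa>)"
proof -
  interpret W: colligation_columns W I J by (rule W)
  interpret S: colligation ell2 I J W.A W.B W.C W.D by (rule W.colligation)
  define n where "n = lvl (X \<kappa>)"
  let ?G = "delta_eval n (X \<kappa>) \<delta>"
  have pos: "X \<kappa> \<in> nc_level d n" using nc_polyhedron_lvl(1)[OF d x] by (simp add: n_def)
  have val: "valid ((\<kappa>, a), b)" if "a < n" "b < n" for a b
    using that x by (simp add: valid_iff level_def n_def)
  have Vl2: "l2 (V z)" for z
    unfolding l2_def
    by (rule has_sum_imp_summable[OF has_sum_supported[of "{..2 * to_nat z + 1}"]]) (use U_zero[of z] in \<open>auto simp: V_def\<close>)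
  have pl2: "l2 (p k)" for k
    unfolding l2_def by (rule has_sum_imp_summable[OF has_sum_supported[OF finP[of k]]]) (simp add: supP)
  have "\<phi> (X \<kappa>) *\<^sub>v v = vec n (\<lambda>a. W.A * v $ a + W.B (id_tensor ell2 I J n ?G h a))"
    if v: "v \<in> carrier_vec n" and h: "S.is_state n ?G (\<lambda>a. v $ a) h" for v h
  proof -
    \<comment> \<open>The state at a sample point as the model predicts it: the Gram vectors,
      combined linearly in the input \<open>v\<close>.\<close>
    define g where "g = (\<lambda>b\<in>{..<n}. \<lambda>j\<in>{..<J}. \<lambda>l. \<Sum>a<n. v $ a * V (((\<kappa>, a), b), j) l)"
    have gl2: "l2 (g b j)" if "b < n" "j < J" for b j
      using that by (simp add: g_def) (intro l2_sum l2_scale Vl2)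
    have g: "g \<in> carrier (tensor (tensor ell2 J) n)"
      using gl2 by (auto simp: tensor_simps ell2_simps g_def)
    let ?\<Delta> = "id_tensor ell2 I J n ?G g"
    have \<Delta>: "?\<Delta> b \<in> carrier (tensor ell2 I)" if "b < n" for b
      by (rule S.state_row_closed[OF S.id_tensor_closed[OF g] that])
    \<comment> \<open>The scalar input together with \<open>?\<Delta> b\<close> is a combination of
      the vectors \<open>p\<close>. \<open>W\<close> maps it to the same combination of the vectors
      \<open>q\<close>, whose scalar part is the output and whose remaining part is
      \<open>g b\<close>; so \<open>g\<close> solves the state equation.\<close>
    have pk: "pack I (v $ b, ?\<Delta> b) = (\<lambda>t. \<Sum>a<n. v $ a * p ((\<kappa>, a), b) t)" if b: "b < n" for b
    proof
      fix t
      show "pack I (v $ b, ?\<Delta> b) t = (\<Sum>a<n. v $ a * p ((\<kappa>, a), b) t)"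
      proof (cases t)
        case None
        have "(\<Sum>a<n. v $ a * p ((\<kappa>, a), b) t) = (\<Sum>a<n. if a = b then v $ a else 0)"
          using None val b by (intro sum.cong refl) (simp add: p_def unit_at_def sample_def)
        thus ?thesis using None b by (simp add: pack_def)
      next
        case (Some li)
        obtain l i where t: "t = Some (l, i)" using Some by (cases li) auto
        show ?thesis
        proof (cases "i < I")
          case True
          have in2: "l2 (\<lambda>l. \<Sum>j<J. ?G $$ (i * n + b, j * n + c) * g c j l)" if "c < n" for c
            using that gl2 by (intro l2_sum l2_scale) auto
          have in1: "(\<Oplus>\<^bsub>ell2\<^esub>j\<in>{..<J}. ?G $$ (i * n + b, j * n + c) \<odot>\<^bsub>ell2\<^esub> g c j)
              = (\<lambda>l. \<Sum>j<J. ?G $$ (i * n + b, j * n + c) * g c j l)" if c: "c < n" for c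
            using ell2_finsum[of "{..<J}" "\<lambda>j. ?G $$ (i * n + b, j * n + c) \<odot>\<^bsub>ell2\<^esub> g c j"] gl2[OF c]
            by (simp add: ell2_simps l2_scale)
          have "?\<Delta> b i = (\<Oplus>\<^bsub>ell2\<^esub>c\<in>{..<n}. (\<lambda>l. \<Sum>j<J. ?G $$ (i * n + b, j * n + c) * g c j l))"
            unfolding S.id_tensor_apply[OF b True]
            by (rule S.finsum_cong') (use in1 in2 in \<open>auto simp: ell2_simps\<close>)
          also have "\<dots> = (\<lambda>l. \<Sum>c<n. \<Sum>j<J. ?G $$ (i * n + b, j * n + c) * g c j l)"
            by (rule ell2_finsum) (use in2 in auto)
          finally have "?\<Delta> b i l = (\<Sum>c<n. \<Sum>j<J. ?G $$ (i * n + b, j * n + c) * g c j l)" by simp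
          also have "\<dots> = (\<Sum>c<n. \<Sum>j<J. \<Sum>a<n. v $ a * (?G $$ (i * n + b, j * n + c) * V (((\<kappa>, a), c), j) l))"
            by (intro sum.cong refl) (simp add: g_def sum_distrib_left mult.left_commute)
          also have "\<dots> = (\<Sum>j<J. \<Sum>c<n. \<Sum>a<n. v $ a * (?G $$ (i * n + b, j * n + c) * V (((\<kappa>, a), c), j) l))"
            by (rule sum.swap)
          also have "\<dots> = (\<Sum>j<J. \<Sum>a<n. \<Sum>c<n. v $ a * (?G $$ (i * n + b, j * n + c) * V (((\<kappa>, a), c), j) l))"
            by (rule sum.cong[OF refl], rule sum.swap)
          also have "\<dots> = (\<Sum>a<n. \<Sum>j<J. \<Sum>c<n. v $ a * (?G $$ (i * n + b, j * n + c) * V (((\<kappa>, a), c), j) l))"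
            by (rule sum.swap)
          also have "\<dots> = (\<Sum>a<n. v $ a * p ((\<kappa>, a), b) t)"
            using True val b t
            by (intro sum.cong refl)
               (simp add: p_def sum_distrib_left dcoef_def sample_def level_def n_def[symmetric] Let_def)
          finally show ?thesis using True t by (simp add: pack_def)
        qed (simp add: t pack_def p_def)
      qed
    qed
    have blk: "pack J (block_op W.A W.B W.C W.D (tensor ell2 J) (v $ b, ?\<Delta> b)) s = (\<Sum>a<n. v $ a * q ((\<kappa>, a), b) s)"
      if b: "b < n" for b s
      unfolding W.app_pack[OF \<Delta>[OF b], symmetric] pk[OF b] by (subst W.app_sum) (simp_all add: pl2 pq)
    have out: "W.A * v $ b + W.B (?\<Delta> b) = (\<phi> (X \<kappa>) *\<^sub>v v) $ b" if b: "b < n" for b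
      using blk[OF b, of None] mult_mat_vec_index[OF \<phi>[OF x, folded n_def] v b] val b
      by (simp add: pack_def block_op_def q_def value_at_def sample_def mult.commute del: index_mult_mat_vec cong: sum.cong_simp)
    have st: "g b = W.C (v $ b) \<oplus>\<^bsub>tensor ell2 J\<^esub> W.D (?\<Delta> b)" if b: "b < n" for b
    proof -
      have "g b \<in> carrier (tensor ell2 J)" by (rule S.state_row_closed[OF g b])
      moreover have "W.C (v $ b) \<oplus>\<^bsub>tensor ell2 J\<^esub> W.D (?\<Delta> b) \<in> carrier (tensor ell2 J)"
        by (rule S.MJ.a_closed[OF S.C_closed S.D_closed[OF \<Delta>[OF b]]])
      moreover have "g b j = (W.C (v $ b) \<oplus>\<^bsub>tensor ell2 J\<^esub> W.D (?\<Delta> b)) j" if j: "j < J" for j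
      proof
        fix l
        show "g b j l = (W.C (v $ b) \<oplus>\<^bsub>tensor ell2 J\<^esub> W.D (?\<Delta> b)) j l"
          using blk[OF b, of "Some (l, j)"] val b j
          by (simp add: pack_def block_op_def q_def g_def cong: sum.cong_simp)
      qed
      ultimately show ?thesis unfolding tensor_simps(1) by (intro PiE_ext) auto
    qed
    have "S.is_state n ?G (\<lambda>a. v $ a) g" using g st by (simp add: S.is_state_def)
    \<comment> \<open>The formula is claimed for every state, and the bijectivity of the resolvent
      leaves only this one.\<close>
    hence "h = g"
      using S.state_unique[OF S.polyhedron_resolve_bij[OF d \<delta> x pos]] h by metis
    thus ?thesis using out \<phi>[OF x, folded n_def] by (intro eq_vecI) (simp_all del: index_mult_mat_vec)
  qed
  thus ?thesis unfolding S.realized_at_def Let_def n_def by blast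
qed

end

theorem H_inf_realization:
  assumes d: "1 \<le> d" and J: "1 \<le> J" and \<delta>: "\<delta> \<in> carrier_mat I J"
    and polys: "elements_mat \<delta> \<subseteq> nc_polys d" and \<phi>: "\<phi> \<in> H_inf_1 d \<delta>"
  shows "has_free_realization TYPE(nat \<Rightarrow> complex) d \<delta> \<phi>"
proof -
  define B where "B = nc_polyhedron d \<delta>"
  have \<phi>c: "\<phi> x \<in> carrier_mat (lvl x) (lvl x)" if "x \<in> nc_polyhedron d \<delta>" for x
    using \<phi> nc_polyhedron_lvl(1,2)[OF d that] that by (auto simp: H_inf_1_def nc_function_def)
  obtain K where K: "psd K" and model: "\<And>\<omega> \<omega>'. \<omega> \<in> indices (nc_polyhedron d \<delta>) \<Longrightarrow> \<omega>' \<in> indices (nc_polyhedron d \<delta>)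
      \<Longrightarrow> model_equation \<delta> \<phi> K \<omega> \<omega>'"
    using exists_model[OF d J \<delta> polys \<phi>] by blast
  \<comment> \<open>The entries to be approximated at level \<open>n\<close>: those of
    \<open>\<delta>(x)\<close> are tagged \<open>True\<close>, those of \<open>\<phi>(x)\<close> are
    tagged \<open>False\<close>.\<close>
  define es where "es n = map (\<lambda>(k, s). (True, k, s)) (List.product [0..<I * n] [0..<J * n])
      @ map (\<lambda>(k, s). (False, k, s)) (List.product [0..<n] [0..<n])" for n
  define g where "g x = (\<lambda>(b, ks). if b then delta_eval (lvl x) x \<delta> $$ ks else \<phi> x $$ ks)" for x
  obtain X :: "nat \<Rightarrow> complex mat list" where X: "\<forall>x\<in>B. \<forall>e>0. \<exists>k. X k \<in> B \<and> lvl (X k) = lvl x \<and>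
      (\<forall>i\<in>set (es (lvl x)). cmod (g x i - g (X k) i) \<le> e)"
    using exists_dense_sequence[of B lvl es g] by blast
  obtain U :: "((nat \<times> nat) \<times> nat) \<times> nat \<Rightarrow> nat \<Rightarrow> complex" where U: "\<And>z l. to_nat z < l \<Longrightarrow> U z l = 0"
    "\<And>z z' L. to_nat z < L \<Longrightarrow> K (sample X (fst z), snd z) (sample X (fst z'), snd z') = (\<Sum>l<L. U z l * cnj (U z' l))"
  proof (rule psd_countable_decomp[OF psd_pullback[OF K, of "\<lambda>z. (sample X (fst z), snd z)"]])
    fix U :: "((nat \<times> nat) \<times> nat) \<times> nat \<Rightarrow> nat \<Rightarrow> complex"
    assume 1: "\<And>z l. to_nat z < l \<Longrightarrow> U z l = 0" and 2: "\<And>z z' L. to_nat z < L \<Longrightarrow>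
      K (sample X (fst z), snd z) (sample X (fst z'), snd z') = (\<Sum>l<L. U z l * cnj (U z' l))"
    show thesis by (rule that[OF 1 2])
  qed
  interpret sampled_model d I J \<delta> \<phi> K X U
    by unfold_locales (fact d J \<delta> \<phi>c model U)+
  obtain W where W: "colligation_columns W J" "\<And>k s. orthonormal_columns.app W (p k) s = q k s"
    using exists_columns by blast
  interpret W: colligation_columns W I J by (rule W(1))
  interpret S: colligation ell2 I J W.A W.B W.C W.D by (rule W.colligation)
  have "free_realization d \<delta> \<phi> ell2 W.A W.B W.C W.D"
  proof (rule S.realization_from_dense[OF d \<delta> \<phi>c])
    fix x and e :: real assume x: "x \<in> nc_polyhedron d \<delta>" and e: "0 < e"
    obtain k where k: "X k \<in> B" "lvl (X k) = lvl x" "\<And>i. i \<in> set (es (lvl x)) \<Longrightarrow> cmod (g x i - g (X k) i) \<le> e"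
      using X[rule_format, OF x[folded B_def] e] by blast
    have "(True, r, s) \<in> set (es (lvl x))" if "r < I * lvl x" "s < J * lvl x" for r s
      using that by (force simp: es_def)
    hence 1: "cmod (delta_eval (lvl x) x \<delta> $$ (r, s) - delta_eval (lvl x) (X k) \<delta> $$ (r, s)) \<le> e"
      if "r < I * lvl x" "s < J * lvl x" for r s
      using k(2) k(3)[of "(True, r, s)"] that by (simp add: g_def)
    have "(False, a, b) \<in> set (es (lvl x))" if "a < lvl x" "b < lvl x" for a b
      using that by (force simp: es_def)
    hence 2: "cmod (\<phi> x $$ (a, b) - \<phi> (X k) $$ (a, b)) \<le> e" if "a < lvl x" "b < lvl x" for a b
      using k(3)[of "(False, a, b)"] that by (simp add: g_def)
    show "\<exists>y\<in>nc_polyhedron d \<delta>. lvl y = lvl x \<and> S.realized_at \<delta> \<phi> y \<and>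
      (\<forall>k<I * lvl x. \<forall>s<J * lvl x. cmod (delta_eval (lvl x) x \<delta> $$ (k, s) - delta_eval (lvl x) y \<delta> $$ (k, s)) \<le> e) \<and>
      (\<forall>a<lvl x. \<forall>b<lvl x. cmod (\<phi> x $$ (a, b) - \<phi> y $$ (a, b)) \<le> e)"
      using realized_at_sample[OF W k(1)[unfolded B_def]] k(1,2) 1 2 unfolding B_def by blast
  qed
  thus ?thesis unfolding has_free_realization_def by blast
qed

lemma H_inf_if_has_free_realization:
  assumes d: "1 \<le> d" and \<delta>: "\<delta> \<in> carrier_mat I J" and polys: "elements_mat \<delta> \<subseteq> nc_polys d"
    and real: "has_free_realization TYPE('m) d \<delta> \<phi>"
  shows "\<phi> \<in> H_inf_1 d \<delta>"
proof -
  obtain M :: "'m hspace" and A B C D where r: "free_realization d \<delta> \<phi> M A B C D"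
    using real unfolding has_free_realization_def by blast
  have "dim_row \<delta> = I" "dim_col \<delta> = J" using \<delta> by auto
  hence "colligation M I J A B C D"
    using r unfolding free_realization_def Let_def by (intro colligation.intro colligation_axioms.intro) auto
  from colligation.realization_in_H_inf[OF this d \<delta> polys r] show ?thesis .
qed

text \<open>The second conjunct admits carriers inside an arbitrary type, so Hilbert spaces too
  large for \<open>nat \<Rightarrow> complex\<close> realize no further functions.\<close>

theorem theorem1p5:
  fixes d I J :: nat
    and \<delta> :: "nc_poly mat"
    and \<phi> :: "complex mat list \<Rightarrow> complex mat"
  assumes "1 \<le> d" and "1 \<le> I" and "1 \<le> J"
    and "\<delta> \<in> carrier_mat I J" and "elements_mat \<delta> \<subseteq> nc_polys d"
    and "\<phi> \<in> nc_polyhedron d \<delta> \<rightarrow> nc_matrices"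
  shows "(\<phi> \<in> H_inf_1 d \<delta> \<longleftrightarrow> has_free_realization TYPE(nat \<Rightarrow> complex) d \<delta> \<phi>) \<and>
    (has_free_realization TYPE('m) d \<delta> \<phi> \<longrightarrow> \<phi> \<in> H_inf_1 d \<delta>)"
proof (intro conjI iffI impI)
  assume "\<phi> \<in> H_inf_1 d \<delta>"
  thus "has_free_realization TYPE(nat \<Rightarrow> complex) d \<delta> \<phi>"
    by (rule H_inf_realization[OF assms(1,3,4,5)])
qed (rule H_inf_if_has_free_realization[OF assms(1,4,5)], assumption)+

end
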